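(* A finitely complete (locally small) category is $\Phi_{\mathrm{coh}}$-exact if and only if it is a coherent category.
   Context: All categories are ordinary locally small categories ($\mathcal V=\mathbf{Set}$); lex means finite-limit-preserving between finitely complete categories. A class of lex-weights $\Phi$ is a collection of functors $\phi:\mathcal K^{op}\to\mathbf{Set}$ with each $\mathcal K$ small and finitely complete. A $\Phi$-lex-colimit is a weighted colimit $\phi\star D$ with $\phi:\mathcal K^{op}\to\mathbf{Set}$ in $\Phi$ and $D$ a lex functor with domain $\mathcal K$. $\mathcal P\mathcal C$ is the category of small presheaves on $\mathcal C$ (presheaves that are left Kan extensions of their restriction to some small full subcategory); it is finitely complete if $\mathcal C$ is. For finitely complete $\mathcal C$, $\Phi_l\mathcal C$ is the smallest full replete subcategory of $\mathcal P\mathcal C$ containing the representables and closed under finite limits and $\Phi$-lex-colimits, and $W:\mathcal C\to\Phi_l\mathcal C$ is the restricted Yoneda embedding. $\mathcal C$ is $\Phi$-exact if it is finitely complete and $W$ has a finite-limit-preserving left adjoint. $\Phi_{\mathrm{coh}}=\Phi_{\mathrm{reg}}\cup\Phi_\vee$, where: $\Phi_{\mathrm{reg}}$ consists of the single functor $\phi:\mathcal K^{op}\to\mathbf{Set}$ with $\mathcal K$ the free category with finite limits generated by an arrow $f:X\to Y$ and $\phi$ the coequaliser in $[\mathcal K^{op},\mathbf{Set}]$ of the kernel-pair of $\mathcal K(-,f)$; and $\Phi_\vee$ consists of $\phi_0:\mathcal K_0^{op}\to\mathbf{Set}$, with $\mathcal K_0$ the terminal category and $\phi_0$ the initial object of $[\mathcal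 K_0^{op},\mathbf{Set}]$, and $\phi_2:\mathcal K_2^{op}\to\mathbf{Set}$, with $\mathcal K_2$ the free category with finite limits generated by a pair of monomorphisms $A\rightarrowtail C\leftarrowtail B$ and $\phi_2$ the union in $[\mathcal K_2^{op},\mathbf{Set}]$ of the subobjects $\mathcal K_2(-,A)$ and $\mathcal K_2(-,B)$ of $\mathcal K_2(-,C)$. A coherent category is a regular category (finite limits, coequalisers of kernel-pairs, regular epimorphisms stable under pullback) with finite unions of subobjects stable under pullback. *)

theory Defs
  imports Main "HOL-Library.FuncSet"
begin

unbundle cardinal_syntax

text \<open>
  Size. The type \<open>'u\<close> plays the role of the universe of sets: a collection (over any type) is
  small iff it has fewer elements than \<open>'u\<close>, and arbitrary subsets of \<open>'u\<close> are the classes. A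
  category whose arrows form a class has type \<open>('o, 'u) cat\<close>. If the cardinality
  of \<open>'u\<close> is inaccessible, the small subsets of \<open>'u\<close> form, up to equivalence, the category of sets
  of a Grothendieck universe. Only regularity and uncountability are demanded (not that the
  cardinal is a strong limit), so inaccessible cardinals are among the instances, but the
  assumption can also be met by types that HOL proves to exist.
\<close>

definition small :: "'u itself \<Rightarrow> 'x set \<Rightarrow> bool" where
  "small U A \<longleftrightarrow> |A| <o |UNIV :: 'u set|"

definition universe :: "'u itself \<Rightarrow> bool" where
  "universe U \<longleftrightarrow> regularCard |UNIV :: 'u set| \<and> natLeq <o |UNIV :: 'u set|"


section \<open>Categories, functors, natural transformations\<close>

record ('o, 'a) cat =
  Ob :: "'o set"
  Arr :: "'a set"
  Dom :: "'a \<Rightarrow> 'o"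
  Cod :: "'a \<Rightarrow> 'o"
  Id :: "'o \<Rightarrow> 'a"
  Comp :: "'a \<Rightarrow> 'a \<Rightarrow> 'a"

definition hom :: "('o, 'a) cat \<Rightarrow> 'o \<Rightarrow> 'o \<Rightarrow> 'a set" where
  "hom C x y = {f \<in> Arr C. Dom C f = x \<and> Cod C f = y}"

text \<open>\<open>Comp C g f\<close> is \<open>g\<close> after \<open>f\<close>; its value is irrelevant when \<open>f\<close> and \<open>g\<close> are not composable.\<close>

definition category :: "('o, 'a) cat \<Rightarrow> bool" where
  "category C \<longleftrightarrow>
    (\<forall>f \<in> Arr C. Dom C f \<in> Ob C \<and> Cod C f \<in> Ob C) \<and>
    (\<forall>x \<in> Ob C. Id C x \<in> hom C x x) \<and>
    (\<forall>x y z. \<forall>f \<in> hom C x y. \<forall>g \<in> hom C y z. Comp C g f \<in> hom C x z) \<and>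
    (\<forall>x y. \<forall>f \<in> hom C x y. Comp C f (Id C x) = f \<and> Comp C (Id C y) f = f) \<and>
    (\<forall>w x y z. \<forall>f \<in> hom C w x. \<forall>g \<in> hom C x y. \<forall>h \<in> hom C y z.
        Comp C h (Comp C g f) = Comp C (Comp C h g) f)"

definition locally_small :: "('o, 'u) cat \<Rightarrow> bool" where
  "locally_small C \<longleftrightarrow> (\<forall>x \<in> Ob C. \<forall>y \<in> Ob C. small TYPE('u) (hom C x y))"

definition small_category :: "('o, 'u) cat \<Rightarrow> bool" where
  "small_category C \<longleftrightarrow> category C \<and> small TYPE('u) (Ob C) \<and> small TYPE('u) (Arr C)"

definition op_cat :: "('o, 'a) cat \<Rightarrow> ('o, 'a) cat" where
  "op_cat C = \<lparr>Ob = Ob C, Arr = Arr C, Dom = Cod C, Cod = Dom C, Id = Id C,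
     Comp = (\<lambda>g f. Comp C f g)\<rparr>"

definition full_sub :: "('o, 'a) cat \<Rightarrow> 'o set \<Rightarrow> ('o, 'a) cat" where
  "full_sub C S = C\<lparr>Ob := Ob C \<inter> S, Arr := {f \<in> Arr C. Dom C f \<in> S \<and> Cod C f \<in> S}\<rparr>"

record ('o, 'a, 'p, 'b) func =
  ob_map :: "'o \<Rightarrow> 'p"
  ar_map :: "'a \<Rightarrow> 'b"

definition is_functor :: "('o, 'a) cat \<Rightarrow> ('p, 'b) cat \<Rightarrow> ('o, 'a, 'p, 'b) func \<Rightarrow> bool" where
  "is_functor A B F \<longleftrightarrow> category A \<and> category B \<and>
    (\<forall>x \<in> Ob A. ob_map F x \<in> Ob B \<and> ar_map F (Id A x) = Id B (ob_map F x)) \<and>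
    (\<forall>x y. \<forall>f \<in> hom A x y. ar_map F f \<in> hom B (ob_map F x) (ob_map F y)) \<and>
    (\<forall>x y z. \<forall>f \<in> hom A x y. \<forall>g \<in> hom A y z.
        ar_map F (Comp A g f) = Comp B (ar_map F g) (ar_map F f))"

definition id_func :: "('o, 'a, 'o, 'a) func" where
  "id_func = \<lparr>ob_map = (\<lambda>x. x), ar_map = (\<lambda>f. f)\<rparr>"

definition comp_func ::
  "('p, 'b, 'q, 'c) func \<Rightarrow> ('o, 'a, 'p, 'b) func \<Rightarrow> ('o, 'a, 'q, 'c) func" where
  "comp_func G F =
    \<lparr>ob_map = (\<lambda>x. ob_map G (ob_map F x)), ar_map = (\<lambda>f. ar_map G (ar_map F f))\<rparr>"

text \<open>Components are extensional so that equality of natural transformations is equality of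
  their components at the objects of the domain.\<close>

definition nat_trans :: "('o, 'a) cat \<Rightarrow> ('p, 'b) cat \<Rightarrow> ('o, 'a, 'p, 'b) func \<Rightarrow>
    ('o, 'a, 'p, 'b) func \<Rightarrow> ('o \<Rightarrow> 'b) \<Rightarrow> bool" where
  "nat_trans A B F G \<alpha> \<longleftrightarrow> \<alpha> \<in> extensional (Ob A) \<and>
    (\<forall>x \<in> Ob A. \<alpha> x \<in> hom B (ob_map F x) (ob_map G x)) \<and>
    (\<forall>x y. \<forall>f \<in> hom A x y. Comp B (\<alpha> y) (ar_map F f) = Comp B (ar_map G f) (\<alpha> x))"

definition functor_cat :: "('o, 'a) cat \<Rightarrow> ('p, 'b) cat \<Rightarrow>
    (('o, 'a, 'p, 'b) func,
     ('o, 'a, 'p, 'b) func \<times> ('o \<Rightarrow> 'b) \<times> ('o, 'a, 'p, 'b) func) cat" where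
  "functor_cat A B =
    (let Fs = {F. is_functor A B F \<and> ob_map F \<in> extensional (Ob A) \<and> ar_map F \<in> extensional (Arr A)}
     in \<lparr>Ob = Fs,
         Arr = {(F, \<alpha>, G). F \<in> Fs \<and> G \<in> Fs \<and> nat_trans A B F G \<alpha>},
         Dom = (\<lambda>(F, \<alpha>, G). F),
         Cod = (\<lambda>(F, \<alpha>, G). G),
         Id = (\<lambda>F. (F, \<lambda>x \<in> Ob A. Id B (ob_map F x), F)),
         Comp = (\<lambda>(G', \<beta>, H) (F, \<alpha>, G). (F, \<lambda>x \<in> Ob A. Comp B (\<beta> x) (\<alpha> x), H))\<rparr>)"

definition is_adjunction :: "('o, 'a) cat \<Rightarrow> ('p, 'b) cat \<Rightarrow> ('o, 'a, 'p, 'b) func \<Rightarrow>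
    ('p, 'b, 'o, 'a) func \<Rightarrow> ('o \<Rightarrow> 'p \<Rightarrow> 'b \<Rightarrow> 'a) \<Rightarrow> bool" where
  "is_adjunction A B L R \<theta> \<longleftrightarrow> is_functor A B L \<and> is_functor B A R \<and>
    (\<forall>x \<in> Ob A. \<forall>y \<in> Ob B. bij_betw (\<theta> x y) (hom B (ob_map L x) y) (hom A x (ob_map R y))) \<and>
    (\<forall>x x' y y'. \<forall>f \<in> hom A x' x. \<forall>g \<in> hom B y y'. \<forall>h \<in> hom B (ob_map L x) y.
        \<theta> x' y' (Comp B g (Comp B h (ar_map L f))) = Comp A (ar_map R g) (Comp A (\<theta> x y h) f))"

definition left_adjoint :: "('o, 'a) cat \<Rightarrow> ('p, 'b) cat \<Rightarrow> ('o, 'a, 'p, 'b) func \<Rightarrow>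
    ('p, 'b, 'o, 'a) func \<Rightarrow> bool" where
  "left_adjoint A B L R \<longleftrightarrow> (\<exists>\<theta>. is_adjunction A B L R \<theta>)"


section \<open>Limits, colimits and subobjects\<close>

definition is_iso :: "('o, 'a) cat \<Rightarrow> 'a \<Rightarrow> bool" where
  "is_iso C f \<longleftrightarrow> f \<in> Arr C \<and> (\<exists>g \<in> hom C (Cod C f) (Dom C f).
     Comp C g f = Id C (Dom C f) \<and> Comp C f g = Id C (Cod C f))"

definition isomorphic :: "('o, 'a) cat \<Rightarrow> 'o \<Rightarrow> 'o \<Rightarrow> bool" where
  "isomorphic C x y \<longleftrightarrow> (\<exists>f \<in> hom C x y. is_iso C f)"

definition is_cone :: "('j, 'i) cat \<Rightarrow> ('o, 'a) cat \<Rightarrow> ('j, 'i, 'o, 'a) func \<Rightarrow>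
    'o \<Rightarrow> ('j \<Rightarrow> 'a) \<Rightarrow> bool" where
  "is_cone J C D l \<pi> \<longleftrightarrow> l \<in> Ob C \<and> (\<forall>j \<in> Ob J. \<pi> j \<in> hom C l (ob_map D j)) \<and>
    (\<forall>j k. \<forall>u \<in> hom J j k. Comp C (ar_map D u) (\<pi> j) = \<pi> k)"

definition is_limit :: "('j, 'i) cat \<Rightarrow> ('o, 'a) cat \<Rightarrow> ('j, 'i, 'o, 'a) func \<Rightarrow>
    'o \<Rightarrow> ('j \<Rightarrow> 'a) \<Rightarrow> bool" where
  "is_limit J C D l \<pi> \<longleftrightarrow> is_cone J C D l \<pi> \<and>
    (\<forall>m \<rho>. is_cone J C D m \<rho> \<longrightarrow>
       (\<exists>!h. h \<in> hom C m l \<and> (\<forall>j \<in> Ob J. Comp C (\<pi> j) h = \<rho> j)))"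

text \<open>Every finite category is isomorphic to one with natural numbers as objects and arrows.\<close>

definition finite_category :: "(nat, nat) cat \<Rightarrow> bool" where
  "finite_category J \<longleftrightarrow> category J \<and> finite (Ob J) \<and> finite (Arr J)"

definition finitely_complete :: "('o, 'a) cat \<Rightarrow> bool" where
  "finitely_complete C \<longleftrightarrow> category C \<and>
    (\<forall>J D. finite_category J \<and> is_functor J C D \<longrightarrow> (\<exists>l \<pi>. is_limit J C D l \<pi>))"

definition preserves_finite_limits ::
  "('o, 'a) cat \<Rightarrow> ('p, 'b) cat \<Rightarrow> ('o, 'a, 'p, 'b) func \<Rightarrow> bool" where
  "preserves_finite_limits A B F \<longleftrightarrow>
    (\<forall>J D l \<pi>. finite_category J \<and> is_functor J A D \<and> is_limit J A D l \<pi> \<longrightarrow>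
       is_limit J B (comp_func F D) (ob_map F l) (\<lambda>j. ar_map F (\<pi> j)))"

text \<open>Finite completeness of the domain and codomain is imposed separately where it is not
  automatic.\<close>

definition lex_functor :: "('o, 'a) cat \<Rightarrow> ('p, 'b) cat \<Rightarrow> ('o, 'a, 'p, 'b) func \<Rightarrow> bool" where
  "lex_functor A B F \<longleftrightarrow> is_functor A B F \<and> preserves_finite_limits A B F"

definition is_initial :: "('o, 'a) cat \<Rightarrow> 'o \<Rightarrow> bool" where
  "is_initial C z \<longleftrightarrow> z \<in> Ob C \<and> (\<forall>x \<in> Ob C. \<exists>!f. f \<in> hom C z x)"

text \<open>In \<open>is_pullback C f g p q\<close>, the arrow \<open>p\<close> is the pullback of \<open>g\<close> along \<open>f\<close>, and \<open>q\<close> that of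
  \<open>f\<close> along \<open>g\<close>.\<close>

definition is_pullback :: "('o, 'a) cat \<Rightarrow> 'a \<Rightarrow> 'a \<Rightarrow> 'a \<Rightarrow> 'a \<Rightarrow> bool" where
  "is_pullback C f g p q \<longleftrightarrow> f \<in> Arr C \<and> g \<in> Arr C \<and> Cod C f = Cod C g \<and>
    p \<in> hom C (Dom C p) (Dom C f) \<and> q \<in> hom C (Dom C p) (Dom C g) \<and>
    Comp C f p = Comp C g q \<and>
    (\<forall>w. \<forall>r \<in> hom C w (Dom C f). \<forall>s \<in> hom C w (Dom C g). Comp C f r = Comp C g s \<longrightarrow>
       (\<exists>!h. h \<in> hom C w (Dom C p) \<and> Comp C p h = r \<and> Comp C q h = s))"

definition is_kernel_pair :: "('o, 'a) cat \<Rightarrow> 'a \<Rightarrow> 'a \<Rightarrow> 'a \<Rightarrow> bool" where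
  "is_kernel_pair C f p q \<longleftrightarrow> is_pullback C f f p q"

definition is_coequaliser :: "('o, 'a) cat \<Rightarrow> 'a \<Rightarrow> 'a \<Rightarrow> 'a \<Rightarrow> bool" where
  "is_coequaliser C p q e \<longleftrightarrow> p \<in> Arr C \<and> q \<in> hom C (Dom C p) (Cod C p) \<and>
    e \<in> hom C (Cod C p) (Cod C e) \<and> Comp C e p = Comp C e q \<and>
    (\<forall>w. \<forall>r \<in> hom C (Cod C p) w. Comp C r p = Comp C r q \<longrightarrow>
       (\<exists>!h. h \<in> hom C (Cod C e) w \<and> Comp C h e = r))"

definition is_regular_epi :: "('o, 'a) cat \<Rightarrow> 'a \<Rightarrow> bool" where
  "is_regular_epi C e \<longleftrightarrow> (\<exists>p q. is_coequaliser C p q e)"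

definition is_mono :: "('o, 'a) cat \<Rightarrow> 'a \<Rightarrow> bool" where
  "is_mono C m \<longleftrightarrow> m \<in> Arr C \<and>
    (\<forall>w. \<forall>r \<in> hom C w (Dom C m). \<forall>s \<in> hom C w (Dom C m). Comp C m r = Comp C m s \<longrightarrow> r = s)"

definition is_subobject :: "('o, 'a) cat \<Rightarrow> 'o \<Rightarrow> 'a \<Rightarrow> bool" where
  "is_subobject C x m \<longleftrightarrow> is_mono C m \<and> Cod C m = x"

definition sub_le :: "('o, 'a) cat \<Rightarrow> 'a \<Rightarrow> 'a \<Rightarrow> bool" where
  "sub_le C m n \<longleftrightarrow> (\<exists>h \<in> hom C (Dom C m) (Dom C n). Comp C n h = m)"

text \<open>\<open>m\<close> represents the join of the subobjects \<open>S\<close> in the preorder of subobjects of \<open>x\<close>; for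
  \<open>S = {}\<close> it represents the least subobject.\<close>

definition is_union :: "('o, 'a) cat \<Rightarrow> 'o \<Rightarrow> 'a set \<Rightarrow> 'a \<Rightarrow> bool" where
  "is_union C x S m \<longleftrightarrow> (\<forall>s \<in> S. is_subobject C x s) \<and> is_subobject C x m \<and>
    (\<forall>s \<in> S. sub_le C s m) \<and>
    (\<forall>n. is_subobject C x n \<and> (\<forall>s \<in> S. sub_le C s n) \<longrightarrow> sub_le C m n)"


section \<open>Regular and coherent categories\<close>

definition regular_category :: "('o, 'a) cat \<Rightarrow> bool" where
  "regular_category C \<longleftrightarrow> finitely_complete C \<and>
    (\<forall>f p q. is_kernel_pair C f p q \<longrightarrow> (\<exists>e. is_coequaliser C p q e)) \<and>
    (\<forall>f e p q. is_regular_epi C e \<and> is_pullback C f e p q \<longrightarrow> is_regular_epi C p)"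

definition coherent_category :: "('o, 'a) cat \<Rightarrow> bool" where
  "coherent_category C \<longleftrightarrow> regular_category C \<and>
    (\<forall>x \<in> Ob C. \<forall>S. finite S \<and> (\<forall>s \<in> S. is_subobject C x s) \<longrightarrow> (\<exists>m. is_union C x S m)) \<and>
    (\<forall>f \<in> Arr C. \<forall>(n :: nat) s m s' m'.
        is_union C (Cod C f) (s ` {..<n}) m \<and>
        (\<forall>i<n. \<exists>t. is_pullback C f (s i) (s' i) t) \<and> (\<exists>t. is_pullback C f m m' t) \<longrightarrow>
        is_union C (Dom C f) (s' ` {..<n}) m')"


section \<open>Presheaves\<close>

type_synonym 'u set_arr = "'u set \<times> ('u \<Rightarrow> 'u) \<times> 'u set"
type_synonym ('o, 'u) presheaf = "('o, 'u, 'u set, 'u set_arr) func"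
type_synonym ('o, 'u) presheaf_arr =
  "('o, 'u) presheaf \<times> ('o \<Rightarrow> 'u set_arr) \<times> ('o, 'u) presheaf"

definition set_cat :: "('u set, 'u set_arr) cat" where
  "set_cat =
    \<lparr>Ob = {A. small TYPE('u) A},
     Arr = {(A, f, B). small TYPE('u) A \<and> small TYPE('u) B \<and> f \<in> A \<rightarrow>\<^sub>E B},
     Dom = (\<lambda>(A, f, B). A),
     Cod = (\<lambda>(A, f, B). B),
     Id = (\<lambda>A. (A, \<lambda>x \<in> A. x, A)),
     Comp = (\<lambda>(B', g, C) (A, f, B). (A, compose A g f, C))\<rparr>"

definition set_app :: "'u set_arr \<Rightarrow> 'u \<Rightarrow> 'u" where
  "set_app h = fst (snd h)"

definition psh :: "('o, 'u) cat \<Rightarrow> (('o, 'u) presheaf, ('o, 'u) presheaf_arr) cat" where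
  "psh C = functor_cat (op_cat C) set_cat"

definition representable :: "('o, 'u) cat \<Rightarrow> 'o \<Rightarrow> ('o, 'u) presheaf" where
  "representable C c =
    \<lparr>ob_map = (\<lambda>x \<in> Ob C. hom C x c),
     ar_map = (\<lambda>f \<in> Arr C. (hom C (Cod C f) c, \<lambda>g \<in> hom C (Cod C f) c. Comp C g f,
                             hom C (Dom C f) c))\<rparr>"

definition yoneda :: "('o, 'u) cat \<Rightarrow> ('o, 'u, ('o, 'u) presheaf, ('o, 'u) presheaf_arr) func" where
  "yoneda C =
    \<lparr>ob_map = representable C,
     ar_map = (\<lambda>f. (representable C (Dom C f),
                     \<lambda>x \<in> Ob C. (hom C x (Dom C f), \<lambda>g \<in> hom C x (Dom C f). Comp C f g,
                                  hom C x (Cod C f)),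
                     representable C (Cod C f)))\<rparr>"

text \<open>\<open>L\<close> with unit \<open>\<eta>\<close> is a left Kan extension of \<open>F : A \<rightarrow> E\<close> along \<open>J : A \<rightarrow> B\<close>.\<close>

definition is_left_kan_extension :: "('o, 'a) cat \<Rightarrow> ('p, 'b) cat \<Rightarrow> ('q, 'c) cat \<Rightarrow>
    ('o, 'a, 'p, 'b) func \<Rightarrow> ('o, 'a, 'q, 'c) func \<Rightarrow> ('p, 'b, 'q, 'c) func \<Rightarrow> ('o \<Rightarrow> 'c) \<Rightarrow> bool" where
  "is_left_kan_extension A B E J F L \<eta> \<longleftrightarrow>
    is_functor A B J \<and> is_functor A E F \<and> is_functor B E L \<and>
    nat_trans A E F (comp_func L J) \<eta> \<and>
    (\<forall>G \<tau>. is_functor B E G \<and> nat_trans A E F (comp_func G J) \<tau> \<longrightarrow>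
       (\<exists>!\<sigma>. nat_trans B E L G \<sigma> \<and> (\<forall>a \<in> Ob A. Comp E (\<sigma> (ob_map J a)) (\<eta> a) = \<tau> a)))"

text \<open>The restriction of \<open>P\<close> to the full subcategory on \<open>S\<close> is \<open>P\<close> precomposed with the inclusion,
  which acts as the identity on objects and arrows.\<close>

definition small_presheaf :: "('o, 'u) cat \<Rightarrow> ('o, 'u) presheaf \<Rightarrow> bool" where
  "small_presheaf C P \<longleftrightarrow> P \<in> Ob (psh C) \<and>
    (\<exists>S \<subseteq> Ob C. small TYPE('u) S \<and>
       (\<exists>\<eta>. is_left_kan_extension (op_cat (full_sub C S)) (op_cat C) set_cat
              id_func (comp_func P id_func) P \<eta>))"

definition small_psh :: "('o, 'u) cat \<Rightarrow> (('o, 'u) presheaf, ('o, 'u) presheaf_arr) cat" where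
  "small_psh C = full_sub (psh C) {P. small_presheaf C P}"


section \<open>Weighted colimits and exactness\<close>

text \<open>A natural transformation \<open>\<phi> \<rightarrow> E(D-, c)\<close>, given by its components
  \<open>\<gamma> k : \<phi> k \<rightarrow> E(D k, c)\<close>. It is spelled out elementwise because \<open>E\<close> need not have its arrows
  in \<open>'u\<close>.\<close>

definition is_weighted_cocone :: "('k, 'u) cat \<Rightarrow> ('k, 'u) presheaf \<Rightarrow> ('e, 'b) cat \<Rightarrow>
    ('k, 'u, 'e, 'b) func \<Rightarrow> 'e \<Rightarrow> ('k \<Rightarrow> 'u \<Rightarrow> 'b) \<Rightarrow> bool" where
  "is_weighted_cocone K \<phi> E D c \<gamma> \<longleftrightarrow> c \<in> Ob E \<and>
    (\<forall>k \<in> Ob K. \<forall>x \<in> ob_map \<phi> k. \<gamma> k x \<in> hom E (ob_map D k) c) \<and>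
    (\<forall>j k. \<forall>u \<in> hom K j k. \<forall>x \<in> ob_map \<phi> k.
        \<gamma> j (set_app (ar_map \<phi> u) x) = Comp E (\<gamma> k x) (ar_map D u))"

text \<open>\<open>c\<close> with unit \<open>\<gamma>\<close> is the colimit of \<open>D\<close> weighted by \<open>\<phi>\<close>: composition with \<open>\<gamma>\<close> is a bijection
  \<open>E(c, d) \<cong> [K\<^sup>o\<^sup>p, Set](\<phi>, E(D-, d))\<close> for all \<open>d\<close>.\<close>

definition is_weighted_colimit :: "('k, 'u) cat \<Rightarrow> ('k, 'u) presheaf \<Rightarrow> ('e, 'b) cat \<Rightarrow>
    ('k, 'u, 'e, 'b) func \<Rightarrow> 'e \<Rightarrow> ('k \<Rightarrow> 'u \<Rightarrow> 'b) \<Rightarrow> bool" where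
  "is_weighted_colimit K \<phi> E D c \<gamma> \<longleftrightarrow> is_weighted_cocone K \<phi> E D c \<gamma> \<and>
    (\<forall>d \<delta>. is_weighted_cocone K \<phi> E D d \<delta> \<longrightarrow>
       (\<exists>!h. h \<in> hom E c d \<and>
          (\<forall>k \<in> Ob K. \<forall>x \<in> ob_map \<phi> k. Comp E h (\<gamma> k x) = \<delta> k x)))"

text \<open>A weight \<open>\<phi> : K\<^sup>o\<^sup>p \<rightarrow> Set\<close> is recorded together with \<open>K\<close>. Every small category is isomorphic
  to one with objects and arrows in \<open>'u\<close>.\<close>

type_synonym 'u weight = "('u, 'u) cat \<times> ('u, 'u) presheaf"

definition lex_weight :: "'u weight \<Rightarrow> bool" where
  "lex_weight = (\<lambda>(K, \<phi>). small_category K \<and> finitely_complete K \<and> \<phi> \<in> Ob (psh K))"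

text \<open>Objects of the smallest full replete subcategory of \<open>small_psh C\<close> that contains the
  representables and is closed under finite limits and \<open>\<Phi>\<close>-lex-colimits.\<close>

inductive_set Phi_l_obs :: "'u weight set \<Rightarrow> ('o, 'u) cat \<Rightarrow> ('o, 'u) presheaf set"
  for \<Phi> :: "'u weight set" and C :: "('o, 'u) cat" where
  repr: "c \<in> Ob C \<Longrightarrow> representable C c \<in> Phi_l_obs \<Phi> C"
| replete: "P \<in> Phi_l_obs \<Phi> C \<Longrightarrow> isomorphic (small_psh C) P Q \<Longrightarrow> Q \<in> Phi_l_obs \<Phi> C"
| finite_limit: "finite_category J \<Longrightarrow> is_functor J (small_psh C) D \<Longrightarrow>
    (\<And>j. j \<in> Ob J \<Longrightarrow> ob_map D j \<in> Phi_l_obs \<Phi> C) \<Longrightarrow>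
    is_limit J (small_psh C) D P \<pi> \<Longrightarrow> P \<in> Phi_l_obs \<Phi> C"
| lex_colimit: "(K, \<phi>) \<in> \<Phi> \<Longrightarrow> lex_functor K (small_psh C) D \<Longrightarrow>
    (\<And>k. k \<in> Ob K \<Longrightarrow> ob_map D k \<in> Phi_l_obs \<Phi> C) \<Longrightarrow>
    is_weighted_colimit K \<phi> (small_psh C) D P \<gamma> \<Longrightarrow> P \<in> Phi_l_obs \<Phi> C"

definition Phi_l :: "'u weight set \<Rightarrow> ('o, 'u) cat \<Rightarrow>
    (('o, 'u) presheaf, ('o, 'u) presheaf_arr) cat" where
  "Phi_l \<Phi> C = full_sub (small_psh C) (Phi_l_obs \<Phi> C)"

definition Phi_exact :: "'u weight set \<Rightarrow> ('o, 'u) cat \<Rightarrow> bool" where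
  "Phi_exact \<Phi> C \<longleftrightarrow> finitely_complete C \<and>
    (\<exists>L. left_adjoint (Phi_l \<Phi> C) C L (yoneda C) \<and> preserves_finite_limits (Phi_l \<Phi> C) C L)"


section \<open>The weights for coherent categories\<close>

text \<open>
  Free finitely complete categories are determined up to equivalence only, by a bicategorical
  universal property: for each finitely complete \<open>D\<close>, evaluation at the generator is an equivalence
  from the category of lex functors \<open>K \<rightarrow> D\<close> (and natural transformations) to the category of
  arrows (cospans of monomorphisms, respectively) in \<open>D\<close>. In the two definitions below,
  the first half of the property is essential surjectivity and the second half is full
  faithfulness. The test category \<open>D\<close> is a locally small category whose objects and arrows form
  classes, i.e. subsets of \<open>'u\<close>.
\<close>

definition free_lex_on_arrow :: "('u, 'u) cat \<Rightarrow> 'u \<Rightarrow> bool" where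
  "free_lex_on_arrow K f \<longleftrightarrow> finitely_complete K \<and> f \<in> Arr K \<and>
    (\<forall>D :: ('u, 'u) cat. finitely_complete D \<and> locally_small D \<longrightarrow>
      (\<forall>g \<in> Arr D. \<exists>F i j. lex_functor K D F \<and>
         i \<in> hom D (ob_map F (Dom K f)) (Dom D g) \<and> is_iso D i \<and>
         j \<in> hom D (ob_map F (Cod K f)) (Cod D g) \<and> is_iso D j \<and>
         Comp D j (ar_map F f) = Comp D g i) \<and>
      (\<forall>F G a b. lex_functor K D F \<and> lex_functor K D G \<and>
         a \<in> hom D (ob_map F (Dom K f)) (ob_map G (Dom K f)) \<and>
         b \<in> hom D (ob_map F (Cod K f)) (ob_map G (Cod K f)) \<and>
         Comp D b (ar_map F f) = Comp D (ar_map G f) a \<longrightarrow>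
         (\<exists>!\<alpha>. nat_trans K D F G \<alpha> \<and> \<alpha> (Dom K f) = a \<and> \<alpha> (Cod K f) = b)))"

definition mono_cospan :: "('o, 'a) cat \<Rightarrow> 'a \<Rightarrow> 'a \<Rightarrow> bool" where
  "mono_cospan C m n \<longleftrightarrow> is_mono C m \<and> is_mono C n \<and> Cod C m = Cod C n"

definition free_lex_on_mono_cospan :: "('u, 'u) cat \<Rightarrow> 'u \<Rightarrow> 'u \<Rightarrow> bool" where
  "free_lex_on_mono_cospan K m n \<longleftrightarrow> finitely_complete K \<and> mono_cospan K m n \<and>
    (\<forall>D :: ('u, 'u) cat. finitely_complete D \<and> locally_small D \<longrightarrow>
      (\<forall>m' n'. mono_cospan D m' n' \<longrightarrow> (\<exists>F i j k. lex_functor K D F \<and>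
         i \<in> hom D (ob_map F (Dom K m)) (Dom D m') \<and> is_iso D i \<and>
         j \<in> hom D (ob_map F (Dom K n)) (Dom D n') \<and> is_iso D j \<and>
         k \<in> hom D (ob_map F (Cod K m)) (Cod D m') \<and> is_iso D k \<and>
         Comp D k (ar_map F m) = Comp D m' i \<and> Comp D k (ar_map F n) = Comp D n' j)) \<and>
      (\<forall>F G a b c. lex_functor K D F \<and> lex_functor K D G \<and>
         a \<in> hom D (ob_map F (Dom K m)) (ob_map G (Dom K m)) \<and>
         b \<in> hom D (ob_map F (Dom K n)) (ob_map G (Dom K n)) \<and>
         c \<in> hom D (ob_map F (Cod K m)) (ob_map G (Cod K m)) \<and>
         Comp D c (ar_map F m) = Comp D (ar_map G m) a \<and>
         Comp D c (ar_map F n) = Comp D (ar_map G n) b \<longrightarrow>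
         (\<exists>!\<alpha>. nat_trans K D F G \<alpha> \<and>
            \<alpha> (Dom K m) = a \<and> \<alpha> (Dom K n) = b \<and> \<alpha> (Cod K m) = c)))"

definition terminal_category :: "('o, 'a) cat \<Rightarrow> bool" where
  "terminal_category K \<longleftrightarrow> category K \<and> (\<exists>x. Ob K = {x}) \<and> (\<exists>i. Arr K = {i})"

text \<open>Since \<open>K\<close> is determined up to equivalence and \<open>\<phi>\<close> up to isomorphism, each class contains all
  representatives of the weights in question.\<close>

definition weights_reg :: "'u weight set" where
  "weights_reg = {(K, \<phi>). small_category K \<and> (\<exists>f p q e. free_lex_on_arrow K f \<and>
     is_kernel_pair (psh K) (ar_map (yoneda K) f) p q \<and>
     is_coequaliser (psh K) p q e \<and> Cod (psh K) e = \<phi>)}"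

definition weights_or :: "'u weight set" where
  "weights_or =
    {(K, \<phi>). terminal_category K \<and> is_initial (psh K) \<phi>} \<union>
    {(K, \<phi>). small_category K \<and> (\<exists>m n v. free_lex_on_mono_cospan K m n \<and>
       is_union (psh K) (representable K (Cod K m))
         {ar_map (yoneda K) m, ar_map (yoneda K) n} v \<and> Dom (psh K) v = \<phi>)}"

definition weights_coh :: "'u weight set" where
  "weights_coh = weights_reg \<union> weights_or"


section \<open>Well-formedness\<close>

lemma category_op: "category C \<Longrightarrow> category (op_cat C)"
  unfolding category_def op_cat_def hom_def by auto

lemma category_full_sub: "category C \<Longrightarrow> category (full_sub C S)"
  unfolding category_def full_sub_def hom_def by auto

lemma category_set_cat: "category set_cat"
  unfolding category_def set_cat_def hom_def
  by (auto simp: compose_def restrict_def fun_eq_iff PiE_def Pi_def extensional_def)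

lemma category_functor_cat:
  assumes A: "category A" and B: "category B"
  shows "category (functor_cat A B)"
proof -
  have idn: "nat_trans A B F F (\<lambda>x\<in>Ob A. Id B (ob_map F x))" if F: "is_functor A B F" for F
    using F A B unfolding nat_trans_def is_functor_def
    by (auto simp: category_def hom_def)
  have cmp: "nat_trans A B F H (\<lambda>x\<in>Ob A. Comp B (\<beta> x) (\<alpha> x))"
    if FGH: "is_functor A B F" "is_functor A B G" "is_functor A B H"
      and a: "nat_trans A B F G \<alpha>" and b: "nat_trans A B G H \<beta>" for F G H \<alpha> \<beta>
  proof -
    have "Comp B (Comp B (\<beta> y) (\<alpha> y)) (ar_map F f) = Comp B (ar_map H f) (Comp B (\<beta> x) (\<alpha> x))"
      if f: "f \<in> hom A x y" for x y f
    proof -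
      have xy: "x \<in> Ob A" "y \<in> Ob A" using f A by (auto simp: category_def hom_def)
      have h: "\<alpha> x \<in> hom B (ob_map F x) (ob_map G x)" "\<alpha> y \<in> hom B (ob_map F y) (ob_map G y)"
        "\<beta> x \<in> hom B (ob_map G x) (ob_map H x)" "\<beta> y \<in> hom B (ob_map G y) (ob_map H y)"
        "ar_map F f \<in> hom B (ob_map F x) (ob_map F y)"
        "ar_map G f \<in> hom B (ob_map G x) (ob_map G y)"
        "ar_map H f \<in> hom B (ob_map H x) (ob_map H y)"
        using a b xy f FGH unfolding nat_trans_def is_functor_def by auto
      have assoc: "Comp B t (Comp B s r) = Comp B (Comp B t s) r"
        if "r \<in> hom B u v" "s \<in> hom B v w" "t \<in> hom B w z" for r s t u v w z
        using B that unfolding category_def by blast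
      have "Comp B (Comp B (\<beta> y) (\<alpha> y)) (ar_map F f) = Comp B (\<beta> y) (Comp B (\<alpha> y) (ar_map F f))"
        using assoc h by metis
      also have "\<dots> = Comp B (\<beta> y) (Comp B (ar_map G f) (\<alpha> x))"
        using a f unfolding nat_trans_def by auto
      also have "\<dots> = Comp B (Comp B (\<beta> y) (ar_map G f)) (\<alpha> x)"
        using assoc h by metis
      also have "\<dots> = Comp B (Comp B (ar_map H f) (\<beta> x)) (\<alpha> x)"
        using b f unfolding nat_trans_def by auto
      also have "\<dots> = Comp B (ar_map H f) (Comp B (\<beta> x) (\<alpha> x))"
        using assoc h by metis
      finally show ?thesis .
    qed
    moreover have "Comp B (\<beta> x) (\<alpha> x) \<in> hom B (ob_map F x) (ob_map H x)" if "x \<in> Ob A" for x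
    proof -
      have "\<alpha> x \<in> hom B (ob_map F x) (ob_map G x)" "\<beta> x \<in> hom B (ob_map G x) (ob_map H x)"
        using a b that unfolding nat_trans_def by auto
      then show ?thesis using B unfolding category_def by blast
    qed
    moreover have "x \<in> Ob A \<and> y \<in> Ob A" if "f \<in> hom A x y" for x y f
      using that A by (auto simp: category_def hom_def)
    ultimately show ?thesis unfolding nat_trans_def by auto
  qed
  have comps: "\<alpha> x \<in> hom B (ob_map F x) (ob_map G x)" if "nat_trans A B F G \<alpha>" "x \<in> Ob A" for F G \<alpha> x
    using that unfolding nat_trans_def by auto
  have unit: "(\<lambda>x\<in>Ob A. Comp B (\<alpha> x) ((\<lambda>x\<in>Ob A. Id B (ob_map F x)) x)) = \<alpha>"
     "(\<lambda>x\<in>Ob A. Comp B ((\<lambda>x\<in>Ob A. Id B (ob_map G x)) x) (\<alpha> x)) = \<alpha>"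
    if a: "nat_trans A B F G \<alpha>" for F G \<alpha>
  proof -
    have "Comp B (\<alpha> x) (Id B (ob_map F x)) = \<alpha> x \<and> Comp B (Id B (ob_map G x)) (\<alpha> x) = \<alpha> x"
      if "x \<in> Ob A" for x using comps[OF a that] B unfolding category_def by blast
    moreover have "\<alpha> \<in> extensional (Ob A)" using a unfolding nat_trans_def by auto
    ultimately show "(\<lambda>x\<in>Ob A. Comp B (\<alpha> x) ((\<lambda>x\<in>Ob A. Id B (ob_map F x)) x)) = \<alpha>"
      "(\<lambda>x\<in>Ob A. Comp B ((\<lambda>x\<in>Ob A. Id B (ob_map G x)) x) (\<alpha> x)) = \<alpha>"
      by (auto simp: restrict_def extensional_def fun_eq_iff)
  qed
  have assoc: "(\<lambda>x\<in>Ob A. Comp B (\<gamma> x) ((\<lambda>x\<in>Ob A. Comp B (\<beta> x) (\<alpha> x)) x)) =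
      (\<lambda>x\<in>Ob A. Comp B ((\<lambda>x\<in>Ob A. Comp B (\<gamma> x) (\<beta> x)) x) (\<alpha> x))"
    if "nat_trans A B F G \<alpha>" "nat_trans A B G H \<beta>" "nat_trans A B H I \<gamma>" for F G H I \<alpha> \<beta> \<gamma>
  proof -
    have "Comp B (\<gamma> x) (Comp B (\<beta> x) (\<alpha> x)) = Comp B (Comp B (\<gamma> x) (\<beta> x)) (\<alpha> x)" if x: "x \<in> Ob A" for x
      using comps[OF \<open>nat_trans A B F G \<alpha>\<close> x] comps[OF \<open>nat_trans A B G H \<beta>\<close> x]
        comps[OF \<open>nat_trans A B H I \<gamma>\<close> x] B unfolding category_def by blast
    then show ?thesis by (auto simp: restrict_def fun_eq_iff)
  qed
  show ?thesis
    unfolding category_def[of "functor_cat A B"]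
    by (auto simp: functor_cat_def Let_def hom_def[of "\<lparr>Ob = _, Arr = _, Dom = _, Cod = _, Id = _, Comp = _\<rparr>"]
        intro: idn cmp dest: unit assoc simp del: restrict_apply)
qed

lemma category_psh: "category C \<Longrightarrow> category (psh C)"
  unfolding psh_def by (intro category_functor_cat category_op category_set_cat)

lemma representable_psh:
  fixes C :: "('o, 'u) cat"
  assumes C: "category C" and ls: "locally_small C" and c: "c \<in> Ob C"
  shows "representable C c \<in> Ob (psh C)"
proof -
  have "is_functor (op_cat C) set_cat (representable C c)"
    unfolding is_functor_def
  proof (intro conjI allI ballI)
    fix x assume x: "x \<in> Ob (op_cat C)"
    show "ob_map (representable C c) x \<in> Ob set_cat"
      using x ls c by (auto simp: representable_def op_cat_def set_cat_def locally_small_def)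
    have "Id C x \<in> hom C x x" "\<And>g. g \<in> hom C x c \<Longrightarrow> Comp C g (Id C x) = g"
      using C x by (auto simp: category_def op_cat_def)
    then show "ar_map (representable C c) (Id (op_cat C) x) = Id set_cat (ob_map (representable C c) x)"
      using x by (auto simp: representable_def op_cat_def set_cat_def hom_def fun_eq_iff restrict_def)
  next
    fix x y f assume f: "f \<in> hom (op_cat C) x y"
    then have f': "f \<in> hom C y x" "x \<in> Ob C" "y \<in> Ob C" "f \<in> Arr C" "Dom C f = y" "Cod C f = x"
      using C by (auto simp: hom_def op_cat_def category_def)
    have "\<And>g. g \<in> hom C x c \<Longrightarrow> Comp C g f \<in> hom C y c"
      using C f' unfolding category_def by blast
    then show "ar_map (representable C c) f \<in>
        hom set_cat (ob_map (representable C c) x) (ob_map (representable C c) y)"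
      using f' ls c unfolding locally_small_def
      by (auto simp: representable_def set_cat_def hom_def[of "\<lparr>Ob = _, Arr = _, Dom = _, Cod = _, Id = _, Comp = _\<rparr>"])
  next
    fix x y z f g assume "f \<in> hom (op_cat C) x y" "g \<in> hom (op_cat C) y z"
    then have f: "f \<in> hom C y x" "f \<in> Arr C" "Dom C f = y" "Cod C f = x"
      and g: "g \<in> hom C z y" "g \<in> Arr C" "Dom C g = z" "Cod C g = y"
      by (auto simp: hom_def op_cat_def)
    have fg: "Comp C f g \<in> hom C z x" using C f g unfolding category_def by blast
    have "Comp C h f \<in> hom C y c \<and> Comp C h (Comp C f g) = Comp C (Comp C h f) g"
      if "h \<in> hom C x c" for h
      using C f g that unfolding category_def by blast
    then show "ar_map (representable C c) (Comp (op_cat C) g f) =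
        Comp set_cat (ar_map (representable C c) g) (ar_map (representable C c) f)"
      using f g fg by (auto simp: representable_def op_cat_def set_cat_def compose_def fun_eq_iff
          restrict_def hom_def[of C z x])
  qed (use C in \<open>auto intro: category_op category_set_cat\<close>)
  then show ?thesis
    by (auto simp: psh_def functor_cat_def Let_def representable_def op_cat_def)
qed

lemma yoneda_functor:
  fixes C :: "('o, 'u) cat"
  assumes C: "category C" and ls: "locally_small C"
  shows "is_functor C (psh C) (yoneda C)"
proof -
  have obs: "Dom C f \<in> Ob C \<and> Cod C f \<in> Ob C" if "f \<in> hom C x y" for f x y
    using C that by (auto simp: category_def hom_def)
  have hin: "Comp C g f \<in> hom C x z" if "f \<in> hom C x y" "g \<in> hom C y z" for f g x y z
    using C that unfolding category_def by blast
  have assoc: "Comp C h (Comp C g f) = Comp C (Comp C h g) f"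
    if "f \<in> hom C w x" "g \<in> hom C x y" "h \<in> hom C y z" for f g h w x y z
    using C that unfolding category_def by blast
  have idn: "Id C x \<in> hom C x x" if "x \<in> Ob C" for x using C that unfolding category_def by blast
  have idl: "Comp C (Id C y) f = f" if "f \<in> hom C x y" for f x y
    using C that unfolding category_def by blast
  have sm: "small TYPE('u) (hom C x y)" if "x \<in> Ob C" "y \<in> Ob C" for x y
    using ls that unfolding locally_small_def by blast
  have arr: "ar_map (yoneda C) f \<in> hom (psh C) (representable C x) (representable C y)"
    if f: "f \<in> hom C x y" for f x y
  proof -
    have xy: "x \<in> Ob C" "y \<in> Ob C" "Dom C f = x" "Cod C f = y"
      using obs[OF f] f by (auto simp: hom_def)
    have "nat_trans (op_cat C) set_cat (representable C x) (representable C y)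
        (\<lambda>w \<in> Ob C. (hom C w x, \<lambda>g \<in> hom C w x. Comp C f g, hom C w y))"
      unfolding nat_trans_def
    proof (intro conjI ballI allI)
      fix w assume "w \<in> Ob (op_cat C)"
      then have w: "w \<in> Ob C" by (simp add: op_cat_def)
      show "(\<lambda>w \<in> Ob C. (hom C w x, \<lambda>g \<in> hom C w x. Comp C f g, hom C w y)) w
         \<in> hom set_cat (ob_map (representable C x) w) (ob_map (representable C y) w)"
        using w xy f hin sm by (auto simp: representable_def set_cat_def
            hom_def[of "\<lparr>Ob = _, Arr = _, Dom = _, Cod = _, Id = _, Comp = _\<rparr>"])
    next
      fix v w u assume "u \<in> hom (op_cat C) v w"
      then have u: "u \<in> hom C w v" "u \<in> Arr C" "Dom C u = w" "Cod C u = v"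
        by (auto simp: hom_def op_cat_def)
      then have vw: "v \<in> Ob C" "w \<in> Ob C" using obs by auto
      have "Comp C g u \<in> hom C w x \<and> Comp C f g \<in> hom C v y \<and>
          Comp C f (Comp C g u) = Comp C (Comp C f g) u" if "g \<in> hom C v x" for g
        using assoc[OF u(1) that f] hin[OF u(1) that] hin[OF that f] by simp
      then show "Comp set_cat ((\<lambda>w \<in> Ob C. (hom C w x, \<lambda>g \<in> hom C w x. Comp C f g, hom C w y)) w)
          (ar_map (representable C x) u) =
        Comp set_cat (ar_map (representable C y) u)
          ((\<lambda>w \<in> Ob C. (hom C w x, \<lambda>g \<in> hom C w x. Comp C f g, hom C w y)) v)"
        using u vw by (auto simp: representable_def set_cat_def compose_def fun_eq_iff restrict_def)
    qed (simp add: op_cat_def)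
    then show ?thesis
      using representable_psh[OF C ls] xy
      unfolding psh_def hom_def[of "functor_cat A B" for A B]
      by (auto simp: yoneda_def functor_cat_def Let_def)
  qed
  show ?thesis
    unfolding is_functor_def
  proof (intro conjI ballI allI)
    fix x assume x: "x \<in> Ob C"
    show "ob_map (yoneda C) x \<in> Ob (psh C)"
      using representable_psh[OF C ls x] by (simp add: yoneda_def)
    have "Dom C (Id C x) = x" "Cod C (Id C x) = x" using idn[OF x] by (auto simp: hom_def)
    then show "ar_map (yoneda C) (Id C x) = Id (psh C) (ob_map (yoneda C) x)"
      using idl by (auto simp: yoneda_def psh_def functor_cat_def Let_def op_cat_def set_cat_def
          representable_def fun_eq_iff restrict_def)
  next
    fix x y f assume "f \<in> hom C x y"
    from arr[OF this] show "ar_map (yoneda C) f \<in> hom (psh C) (ob_map (yoneda C) x) (ob_map (yoneda C) y)"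
      by (simp add: yoneda_def)
  next
    fix x y z f g assume f: "f \<in> hom C x y" and g: "g \<in> hom C y z"
    have d: "Dom C f = x" "Cod C f = y" "Dom C g = y" "Cod C g = z"
      "Dom C (Comp C g f) = x" "Cod C (Comp C g f) = z"
      using f g hin[OF f g] by (auto simp: hom_def)
    have "Comp C f h \<in> hom C w y \<and> Comp C (Comp C g f) h = Comp C g (Comp C f h)"
      if "h \<in> hom C w x" for h w
      using assoc[OF that f g] hin[OF that f] by simp
    then show "ar_map (yoneda C) (Comp C g f) =
        Comp (psh C) (ar_map (yoneda C) g) (ar_map (yoneda C) f)"
      using d by (auto simp: yoneda_def psh_def functor_cat_def Let_def op_cat_def set_cat_def
          compose_def fun_eq_iff restrict_def)
  qed (use C in \<open>auto intro: category_psh\<close>)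
qed

lemma weights_coh_lex:
  fixes w :: "'u weight"
  assumes U: "universe TYPE('u)" and w: "w \<in> weights_coh"
  shows "lex_weight w"
proof -
  obtain K \<phi> where [simp]: "w = (K, \<phi>)" by (cases w)
  have fin: "small TYPE('u) A" if "finite A" for A :: "'u set"
    using that U infinite_iff_natLeq_ordLeq[of "UNIV :: 'u set"]
      finite_ordLess_infinite[of "|A|" "|UNIV :: 'u set|"]
    by (auto simp: small_def universe_def card_of_well_order_on Field_card_of dest: ordLess_imp_ordLeq)
  consider "(K, \<phi>) \<in> weights_reg" | "terminal_category K" "is_initial (psh K) \<phi>"
    | m n v where "small_category K" "free_lex_on_mono_cospan K m n"
       "is_union (psh K) (representable K (Cod K m))
         {ar_map (yoneda K) m, ar_map (yoneda K) n} v" "Dom (psh K) v = \<phi>"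
    using w by (auto simp: weights_coh_def weights_or_def)
  then show ?thesis
  proof cases
    case 1
    then obtain f p q e where *: "small_category K" "free_lex_on_arrow K f"
      "is_coequaliser (psh K) p q e" "Cod (psh K) e = \<phi>"
      by (auto simp: weights_reg_def)
    then have "category (psh K)" "e \<in> Arr (psh K)"
      by (auto simp: small_category_def category_psh is_coequaliser_def hom_def)
    then have "\<phi> \<in> Ob (psh K)" using *(4) by (auto simp: category_def)
    with * show ?thesis by (auto simp: lex_weight_def free_lex_on_arrow_def)
  next
    case 3
    then have "category (psh K)" "v \<in> Arr (psh K)"
      by (auto simp: small_category_def category_psh is_union_def is_subobject_def is_mono_def)
    then have "\<phi> \<in> Ob (psh K)" using 3 by (auto simp: category_def)
    with 3 show ?thesis by (auto simp: lex_weight_def free_lex_on_mono_cospan_def)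
  next
    case 2
    then obtain x i where K: "category K" "Ob K = {x}" "Arr K = {i}"
      by (auto simp: terminal_category_def)
    then have h: "Dom K i = x" "Cod K i = x" "Id K x = i" "Comp K i i = i"
      by (auto simp: category_def hom_def)
    have "is_limit J K D x (\<lambda>_. i)" if "is_functor J K D" for J :: "(nat, nat) cat" and D
    proof -
      have D: "ob_map D j = x" if "j \<in> Ob J" for j
        using that \<open>is_functor J K D\<close> K by (auto simp: is_functor_def)
      have D': "ar_map D u = i" if "u \<in> hom J j k" for u j k
        using that \<open>is_functor J K D\<close> K unfolding is_functor_def hom_def by blast
      show ?thesis
        using D D' h K by (auto simp: is_limit_def is_cone_def hom_def[of K])
    qed
    then have "finitely_complete K" using K by (auto simp: finitely_complete_def)
    moreover have "small_category K" using K fin by (auto simp: small_category_def)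
    ultimately show ?thesis using 2 by (auto simp: lex_weight_def is_initial_def)
  qed
qed

end

theory Submission
 imports Defs "HOL-Library.Countable_Set"
begin

text \<open>
  Each of the three weights is the sieve on an object \<open>y\<close> of \<open>K\<close> generated by a finite family \<open>T\<close> of
  arrows, so for lex \<open>D\<close> the colimit of \<open>D\<close> weighted by it is the union of the images of the \<open>D t\<close> in
  \<open>D y\<close>. As \<open>K\<close> is free, \<open>\<Phi>\<^sub>l C\<close> contains the sieve generated by any arrow, any pair of subobjects and
  the empty family in \<open>C\<close>. A lex reflection sends these sieves to subobjects that they cover
  effectively and stably, which are the required images and unions. Conversely, the finite covers of a
  coherent category are effective and stable, and the presheaves with a locally bijective map
  to a representable include the representables and are closed under finite limits and unions of
  images, hence include \<open>\<Phi>\<^sub>l C\<close>; the representing object is the value of a lex left adjoint.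
\<close>

section \<open>Categories and limits of bipartite graphs\<close>

abbreviation "ob \<equiv> ob_map"
abbreviation "ar \<equiv> ar_map"

lemma functorD:
 assumes "is_functor A B F"
 shows "category A" "category B" "x \<in> Ob A ==> ob F x \<in> Ob B"
  "f \<in> hom A x y ==> ar F f \<in> hom B (ob F x) (ob F y)"
 using assms by (simp_all add: is_functor_def)

locale cat =
 fixes C :: "('o, 'a) cat"
 assumes category: "category C"
begin

abbreviation cmp :: "'a => 'a => 'a" (infixr "**" 70) where
 "g ** f \<equiv> Comp C g f"

lemma dom_ob: "f \<in> Arr C ==> Dom C f \<in> Ob C"
 and cod_ob: "f \<in> Arr C ==> Cod C f \<in> Ob C"
 using category by (auto simp: category_def)

lemma hom_ob: "f \<in> hom C x y ==> x \<in> Ob C \<and> y \<in> Ob C"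
 by (auto simp: hom_def dom_ob cod_ob)

lemma hom_arr: "f \<in> Arr C ==> f \<in> hom C (Dom C f) (Cod C f)"
 by (auto simp: hom_def)

lemma id_hom: "x \<in> Ob C ==> Id C x \<in> hom C x x"
 using category by (auto simp: category_def)

lemma comp_hom: "g \<in> hom C y z ==> f \<in> hom C x y ==> g ** f \<in> hom C x z"
 using category unfolding category_def by blast

lemma id_right: "f \<in> hom C x y ==> f ** Id C x = f"
 and id_left: "f \<in> hom C x y ==> Id C y ** f = f"
 using category unfolding category_def by blast+

lemma assoc: "h \<in> hom C y z ==> g \<in> hom C x y ==> f \<in> hom C w x ==> (h ** g) ** f = h ** (g ** f)"
 using category unfolding category_def by (simp only: Ball_def)

lemma isoD:
 assumes "is_iso C f" "f \<in> hom C x y"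
 obtains g where "g \<in> hom C y x" "g ** f = Id C x" "f ** g = Id C y"
 using assms by (auto simp: is_iso_def hom_def)

lemma isoI: "f \<in> hom C x y ==> g \<in> hom C y x ==> g ** f = Id C x ==> f ** g = Id C y ==> is_iso C f"
 unfolding is_iso_def hom_def by auto

lemma monoD:
 "is_mono C m ==> m \<in> hom C x y ==> r \<in> hom C w x ==> s \<in> hom C w x ==> m ** r = m ** s ==> r = s"
 unfolding is_mono_def hom_def by blast

lemma monoI:
 "m \<in> hom C x y ==> (\<And>w r s. r \<in> hom C w x ==> s \<in> hom C w x ==> m ** r = m ** s ==> r = s) ==> is_mono C m"
 by (auto simp: is_mono_def hom_def)

lemma mono_hom: "is_mono C m ==> m \<in> hom C (Dom C m) (Cod C m)"
 by (auto simp: is_mono_def hom_def)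

lemma mono_comp_cancel:
 assumes "is_mono C m" "m \<in> hom C y z" "e \<in> hom C x y" "is_mono C (m ** e)"
 shows "is_mono C e"
proof (rule monoI[OF assms(3)])
 fix w r s assume rs: "r \<in> hom C w x" "s \<in> hom C w x" "e ** r = e ** s"
 hence "(m ** e) ** r = (m ** e) ** s" using assms assoc by metis
 thus "r = s" using monoD[OF assms(4) comp_hom[OF assms(2,3)]] rs by blast
qed

lemma iso_mono: assumes "is_iso C f" shows "is_mono C f"
proof -
 have f: "f \<in> hom C (Dom C f) (Cod C f)" using assms by (auto simp: is_iso_def hom_def)
 then obtain g where g: "g \<in> hom C (Cod C f) (Dom C f)" "g ** f = Id C (Dom C f)" using assms isoD by blast
 show ?thesis
 proof (rule monoI[OF f])
  fix w r s assume "r \<in> hom C w (Dom C f)" "s \<in> hom C w (Dom C f)" "f ** r = f ** s"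
  thus "r = s" using f g assoc id_left by metis
 qed
qed

lemma mono_split_iso:
 assumes m: "is_mono C n" "n \<in> hom C x y" and h: "h \<in> hom C y x" "n ** h = Id C y"
 shows "is_iso C n"
proof -
 have "n ** (h ** n) = n ** Id C x" using m h assoc id_left id_right by metis
 hence "h ** n = Id C x" using monoD[OF m(1,2)] comp_hom[OF h(1) m(2)] id_hom hom_ob[OF m(2)] by blast
 thus ?thesis using isoI m h by blast
qed

lemma comp_mono:
 assumes m: "is_mono C m" "m \<in> hom C y z" and n: "is_mono C n" "n \<in> hom C x y"
 shows "is_mono C (m ** n)"
proof (rule monoI[OF comp_hom[OF m(2) n(2)]])
 fix w r s assume rs: "r \<in> hom C w x" "s \<in> hom C w x" and e: "(m ** n) ** r = (m ** n) ** s"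
 hence "m ** (n ** r) = m ** (n ** s)" using m n assoc by metis
 thus "r = s" using monoD[OF m] monoD[OF n] rs comp_hom[OF n(2)] by metis
qed

lemma mono_Id: "x \<in> Ob C ==> is_mono C (Id C x)"
 by (rule monoI[OF id_hom]) (auto simp: id_left)

end

definition is_gcone :: "('o, 'a) cat => 'v set => 'e set => ('e => 'v) => ('e => 'v) =>
  ('v => 'o) => ('e => 'a) => 'o => ('v => 'a) => bool" where
 "is_gcone C V E s t X g l \<pi> \<longleftrightarrow> l \<in> Ob C \<and> (\<forall>v\<in>V. \<pi> v \<in> hom C l (X v)) \<and>
  (\<forall>e\<in>E. Comp C (g e) (\<pi> (s e)) = \<pi> (t e))"

definition is_glim :: "('o, 'a) cat => 'v set => 'e set => ('e => 'v) => ('e => 'v) =>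
  ('v => 'o) => ('e => 'a) => 'o => ('v => 'a) => bool" where
 "is_glim C V E s t X g l \<pi> \<longleftrightarrow> is_gcone C V E s t X g l \<pi> \<and>
  (\<forall>m \<rho>. is_gcone C V E s t X g m \<rho> --> (\<exists>!h. h \<in> hom C m l \<and> (\<forall>v\<in>V. Comp C (\<pi> v) h = \<rho> v)))"

text \<open>No two edges are composable, so the free category on the graph has only edges and identities.\<close>

definition bipartite :: "'v set => 'e set => ('e => 'v) => ('e => 'v) => bool" where
 "bipartite V E s t \<longleftrightarrow> finite V \<and> finite E \<and> (\<forall>e\<in>E. s e \<in> V \<and> t e \<in> V \<and> s e \<notin> t ` E)"

definition gdiag :: "('o, 'a) cat => 'v set => 'e set => ('e => 'v) => ('e => 'v) =>
  ('v => 'o) => ('e => 'a) => bool" where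
 "gdiag C V E s t X g \<longleftrightarrow> (\<forall>v\<in>V. X v \<in> Ob C) \<and> (\<forall>e\<in>E. g e \<in> hom C (X (s e)) (X (t e)))"

lemma graph_category:
 fixes V :: "'v set" and E :: "'e set"
 assumes bp: "bipartite V E s t"
 obtains J :: "(nat, nat) cat" and dec :: "nat => 'v + 'e" and enc :: "'v + 'e => nat" where
  "finite_category J" "\<And>x. x \<in> V <+> E ==> dec (enc x) = x"
  "Ob J = (\<lambda>v. enc (Inl v)) ` V" "Arr J = enc ` (V <+> E)"
  "\<And>v. v \<in> V ==> Id J (enc (Inl v)) = enc (Inl v)"
  "\<And>v x y. v \<in> V ==> enc (Inl v) \<in> hom J x y \<longleftrightarrow> x = enc (Inl v) \<and> y = enc (Inl v)"
  "\<And>e x y. e \<in> E ==> enc (Inr e) \<in> hom J x y \<longleftrightarrow> x = enc (Inl (s e)) \<and> y = enc (Inl (t e))"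
  "\<And>v f x y. v \<in> V ==> f \<in> hom J x y ==> Comp J (enc (Inl v)) f = f"
  "\<And>e f. e \<in> E ==> Comp J (enc (Inr e)) f = enc (Inr e)"
proof -
 have fin: "finite (V <+> E)" using bp by (auto simp: bipartite_def)
 obtain enc :: "'v + 'e => nat" where inj: "inj_on enc (V <+> E)"
  using finite_imp_inj_to_nat_seg[OF fin] by blast
 define dec where "dec = inv_into (V <+> E) enc"
 have dec: "dec (enc x) = x" if "x \<in> V <+> E" for x
  using inj that by (simp add: dec_def)
 have decs[simp]: "\<And>v. v \<in> V ==> dec (enc (Inl v)) = Inl v" "\<And>e. e \<in> E ==> dec (enc (Inr e)) = Inr e"
  using dec[OF InlI] dec[OF InrI] by auto
 have st: "s e \<in> V" "t e \<in> V" "s e \<noteq> t e'" if "e \<in> E" "e' \<in> E" for e e'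
  using bp that by (auto simp: bipartite_def)
 define J where "J = \<lparr>Ob = (\<lambda>v. enc (Inl v)) ` V, Arr = enc ` (V <+> E),
  Dom = (\<lambda>a. case dec a of Inl v => enc (Inl v) | Inr e => enc (Inl (s e))),
  Cod = (\<lambda>a. case dec a of Inl v => enc (Inl v) | Inr e => enc (Inl (t e))),
  Id = (\<lambda>x. x), Comp = (\<lambda>g f. case dec g of Inl v => f | Inr e => g)\<rparr>"
 have enc_eq: "enc x = enc y \<longleftrightarrow> x = y" if "x \<in> V <+> E" "y \<in> V <+> E" for x y
  using inj that by (auto simp: inj_on_def)
 have enc_eqs[simp]: "enc (Inl v) = enc (Inl w) \<longleftrightarrow> v = w" if "v \<in> V" "w \<in> V" for v w
  using enc_eq[of "Inl v" "Inl w"] that by auto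
 have enc_neq[simp]: "enc (Inl v) \<noteq> enc (Inr e)" "enc (Inr e) \<noteq> enc (Inl v)" if "v \<in> V" "e \<in> E" for v e
  using enc_eq[of "Inl v" "Inr e"] enc_eq[of "Inr e" "Inl v"] that by auto
 have enc_inr[simp]: "enc (Inr e) = enc (Inr e') \<longleftrightarrow> e = e'" if "e \<in> E" "e' \<in> E" for e e'
  using enc_eq[of "Inr e" "Inr e'"] that by auto
 have h: "a \<in> hom J x y \<longleftrightarrow> (\<exists>v\<in>V. a = enc (Inl v) \<and> x = enc (Inl v) \<and> y = enc (Inl v)) \<or>
  (\<exists>e\<in>E. a = enc (Inr e) \<and> x = enc (Inl (s e)) \<and> y = enc (Inl (t e)))" for a x y
  by (auto simp: hom_def J_def)
 have c: "Comp J (enc (Inl v)) f = f" if "v \<in> V" for v f using that by (simp add: J_def)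
 have ce: "Comp J (enc (Inr e)) f = enc (Inr e)" if "e \<in> E" for e f using that by (simp add: J_def)
 have cc: "Comp J g f \<in> hom J x z" if "f \<in> hom J x y" "g \<in> hom J y z" for f g x y z
  using that unfolding h by (auto simp: c ce st) (metis st(3))+
 have "category J"
  unfolding category_def
 proof (intro conjI ballI allI)
  fix x assume "x \<in> Ob J" thus "Id J x \<in> hom J x x" by (auto simp: J_def hom_def)
 next
  fix x y z f g assume "f \<in> hom J x y" "g \<in> hom J y z"
  thus "Comp J g f \<in> hom J x z" by (rule cc)
 next
  fix x y f assume f: "f \<in> hom J x y"
  show "Comp J f (Id J x) = f" using f unfolding h by (auto simp: J_def)
  show "Comp J (Id J y) f = f" using f st unfolding h by (auto simp: J_def)
 next
  fix w x y z f g k assume "f \<in> hom J w x" "g \<in> hom J x y" "k \<in> hom J y z"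
  thus "Comp J k (Comp J g f) = Comp J (Comp J k g) f"
   unfolding h by (auto simp: c ce)
 qed (use st in "auto simp: J_def")
 hence "finite_category J" using bp fin by (auto simp: finite_category_def J_def bipartite_def)
 show ?thesis
 proof (rule that[of J dec enc])
  show "finite_category J" by fact
  show "\<And>x. x \<in> V <+> E ==> dec (enc x) = x" by (rule dec)
  show "Comp J (enc (Inl v)) f = f" if "v \<in> V" "f \<in> hom J x y" for v f x y using c[OF that(1)] .
  show "Comp J (enc (Inr e)) f = enc (Inr e)" if "e \<in> E" for e f using ce[OF that] .
 qed (auto simp: h enc_eq, auto simp: J_def)
qed

lemma graph_diagram:
 fixes V :: "'v set" and E :: "'e set" and C :: "('o, 'a) cat" and B :: "('p, 'b) cat"
 assumes bp: "bipartite V E s t" and F: "is_functor C B F" and d: "gdiag C V E s t X g"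
 obtains J :: "(nat, nat) cat" and dec enc D where
  "finite_category J" "\<And>v. v \<in> V ==> dec (enc v) = v" "Ob J = enc ` V" "is_functor J C D"
  "\<And>l \<pi>. is_cone J C D l \<pi> \<longleftrightarrow> is_gcone C V E s t X g l (\<lambda>v. \<pi> (enc v))"
  "\<And>l \<pi>. is_cone J B (comp_func F D) l \<pi> \<longleftrightarrow>
   is_gcone B V E s t (\<lambda>v. ob F (X v)) (\<lambda>e. ar F (g e)) l (\<lambda>v. \<pi> (enc v))"
proof -
 show ?thesis
 proof (rule graph_category[OF bp])
 fix J :: "(nat, nat) cat" and dec :: "nat => 'v + 'e" and enc :: "'v + 'e => nat"
 assume J: "finite_category J" "\<And>x. x \<in> V <+> E ==> dec (enc x) = x"
  "Ob J = (\<lambda>v. enc (Inl v)) ` V" "Arr J = enc ` (V <+> E)"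
  "\<And>v. v \<in> V ==> Id J (enc (Inl v)) = enc (Inl v)"
  "\<And>v x y. v \<in> V ==> enc (Inl v) \<in> hom J x y \<longleftrightarrow> x = enc (Inl v) \<and> y = enc (Inl v)"
  "\<And>e x y. e \<in> E ==> enc (Inr e) \<in> hom J x y \<longleftrightarrow> x = enc (Inl (s e)) \<and> y = enc (Inl (t e))"
  "\<And>v f x y. v \<in> V ==> f \<in> hom J x y ==> Comp J (enc (Inl v)) f = f"
  "\<And>e f. e \<in> E ==> Comp J (enc (Inr e)) f = enc (Inr e)"
 have decs[simp]: "\<And>v. v \<in> V ==> dec (enc (Inl v)) = Inl v" "\<And>e. e \<in> E ==> dec (enc (Inr e)) = Inr e"
  using J(2)[OF InlI] J(2)[OF InrI] by auto
 have st: "s e \<in> V" "t e \<in> V" if "e \<in> E" for e using bp that by (auto simp: bipartite_def)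
 have hJ: "a \<in> hom J x y \<longleftrightarrow> (\<exists>v\<in>V. a = enc (Inl v) \<and> x = enc (Inl v) \<and> y = enc (Inl v)) \<or>
  (\<exists>e\<in>E. a = enc (Inr e) \<and> x = enc (Inl (s e)) \<and> y = enc (Inl (t e)))" for a x y
 proof
  assume a: "a \<in> hom J x y"
  hence "a \<in> enc ` (V <+> E)" using J(4) by (auto simp: hom_def)
  thus "(\<exists>v\<in>V. a = enc (Inl v) \<and> x = enc (Inl v) \<and> y = enc (Inl v)) \<or>
  (\<exists>e\<in>E. a = enc (Inr e) \<and> x = enc (Inl (s e)) \<and> y = enc (Inl (t e)))"
   using a J(6,7) by auto
 qed (use J(6,7) in auto)
 have catJ: "category J" using J(1) by (auto simp: finite_category_def)
 have C: "category C" using F by (simp add: is_functor_def)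
 interpret cat C by (rule cat.intro) fact
 interpret B: cat B using F by (auto simp: is_functor_def cat_def)
 define D where "D = (\<lparr>ob_map = (\<lambda>j. X (projl (dec j))),
   ar_map = (\<lambda>a. case dec a of Inl v => Id C (X v) | Inr e => g e)\<rparr> :: (nat, nat, 'o, 'a) func)"
  have D: "is_functor J C (D)"
   unfolding is_functor_def
  proof (intro conjI ballI allI)
   fix x assume "x \<in> Ob J"
   thus "ob (D) x \<in> Ob C"
    "ar (D) (Id J x) = Id C (ob (D) x)"
    using d by (auto simp: J(3,5) D_def gdiag_def)
  next
   fix x y f assume "f \<in> hom J x y"
   thus "ar (D) f \<in> hom C (ob (D) x) (ob (D) y)"
    unfolding hJ using d by (auto simp: D_def gdiag_def st id_hom)
  next
   fix x y z f k assume fk: "f \<in> hom J x y" "k \<in> hom J y z"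
   have *: "ar (D) f \<in> hom C (ob (D) x) (ob (D) y)"
    if "f \<in> hom J x y" for f x y
    using that unfolding hJ using d by (auto simp: D_def gdiag_def st id_hom)
   from fk(2)[unfolded hJ] consider v where "v \<in> V" "k = enc (Inl v)" "y = enc (Inl v)"
    | e where "e \<in> E" "k = enc (Inr e)" "y = enc (Inl (s e))" by blast
   thus "ar (D) (Comp J k f) = ar (D) k ** ar (D) f"
   proof cases
    case 1
    hence "Comp J k f = f" using J(8) fk(1) by blast
    thus ?thesis using 1 *[OF fk(1)] id_left by (auto simp: D_def)
   next
    case 2
    have "f = enc (Inl (s e))"
    proof -
     from fk(1)[unfolded hJ] 2 have "(\<exists>v\<in>V. f = enc (Inl v) \<and> enc (Inl (s e)) = enc (Inl v)) \<or>
       (\<exists>e'\<in>E. enc (Inl (s e)) = enc (Inl (t e')))" by auto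
     hence "(\<exists>v\<in>V. f = enc (Inl v) \<and> s e = v) \<or> (\<exists>e'\<in>E. s e = t e')"
      using decs(1) st 2 by (metis sum.inject(1))
     thus ?thesis using bp 2 by (auto simp: bipartite_def)
    qed
    thus ?thesis using 2 J(9) d id_right st
     by (auto simp: D_def gdiag_def)
   qed
  qed (use C catJ in auto)
 have cone: "is_cone J B' (comp_func F' D) l \<pi> \<longleftrightarrow>
     is_gcone B' V E s t (\<lambda>v. ob F' (X v)) (\<lambda>e. ar F' (g e)) l (\<lambda>v. \<pi> (enc (Inl v)))"
   if F': "is_functor C B' F'" for B' :: "('c, 'd) cat" and F' l \<pi>
 proof -
  interpret B': cat B' using F' by (auto simp: is_functor_def cat_def)
  have "Comp B' (ar F' (Id C (X v))) (\<pi> (enc (Inl v))) = \<pi> (enc (Inl v))"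
   if "v \<in> V" "\<pi> (enc (Inl v)) \<in> hom B' l (ob F' (X v))" for v
   using that d F' B'.id_left by (auto simp: is_functor_def gdiag_def)
  moreover have "(\<forall>j k. \<forall>u\<in>hom J j k. Q u j k) \<longleftrightarrow> (\<forall>v\<in>V. Q (enc (Inl v)) (enc (Inl v)) (enc (Inl v))) \<and>
    (\<forall>e\<in>E. Q (enc (Inr e)) (enc (Inl (s e))) (enc (Inl (t e))))" (is "?L = ?R") for Q
  proof
   assume L: ?L
   show ?R by (intro conjI ballI; rule L[rule_format]; auto simp: hJ)
  next
   assume ?R thus ?L by (auto simp: hJ)
  qed
  ultimately show ?thesis
   unfolding is_cone_def is_gcone_def J(3) by (simp add: D_def comp_func_def st cong: conj_cong)
 qed
 show ?thesis
 proof (rule that[of J "\<lambda>n. projl (dec n)" "\<lambda>v. enc (Inl v)" D])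
  have "is_functor C C id_func" using C by (auto simp: is_functor_def id_func_def)
  moreover have "comp_func id_func D = D" by (simp add: id_func_def comp_func_def)
  ultimately show "is_cone J C D l \<pi> \<longleftrightarrow> is_gcone C V E s t X g l (\<lambda>v. \<pi> (enc (Inl v)))" for l \<pi>
   using cone[of C id_func l \<pi>] by (simp add: id_func_def)
 qed (auto simp: J D cone[OF F])
qed
qed

lemma is_gcone_cong:
 "(\<And>v. v \<in> V ==> \<pi> v = \<pi>' v) ==> bipartite V E s t ==>
 is_gcone C V E s t X g l \<pi> \<longleftrightarrow> is_gcone C V E s t X g l \<pi>'"
 unfolding is_gcone_def bipartite_def by auto

lemma limit_graph_iff:
 assumes bp: "bipartite V E s t" and ob: "Ob J = enc ` V" and dec: "\<And>v. v \<in> V ==> dec (enc v) = v"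
  and cone: "\<And>l \<pi>. is_cone J C D l \<pi> \<longleftrightarrow> is_gcone C V E s t X g l (\<lambda>v. \<pi> (enc v))"
 shows "is_limit J C D l \<pi> \<longleftrightarrow> is_glim C V E s t X g l (\<lambda>v. \<pi> (enc v))"
proof
 assume L: "is_limit J C D l \<pi>"
 show "is_glim C V E s t X g l (\<lambda>v. \<pi> (enc v))" unfolding is_glim_def
 proof (intro conjI allI impI)
  show "is_gcone C V E s t X g l (\<lambda>v. \<pi> (enc v))" using L cone by (auto simp: is_limit_def)
  fix m \<rho> assume r: "is_gcone C V E s t X g m \<rho>"
  have "is_cone J C D m (\<lambda>j. \<rho> (dec j))"
   unfolding cone using r is_gcone_cong[OF _ bp, where C=C and X=X and g=g and l=m and \<pi>=\<rho> and \<pi>'="\<lambda>v. \<rho> (dec (enc v))"] by (simp add: dec)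
  hence "\<exists>!h. h \<in> hom C m l \<and> (\<forall>j\<in>Ob J. Comp C (\<pi> j) h = \<rho> (dec j))"
   using L by (auto simp: is_limit_def)
  thus "\<exists>!h. h \<in> hom C m l \<and> (\<forall>v\<in>V. Comp C (\<pi> (enc v)) h = \<rho> v)"
   by (simp add: ob dec)
 qed
next
 assume L: "is_glim C V E s t X g l (\<lambda>v. \<pi> (enc v))"
 show "is_limit J C D l \<pi>" unfolding is_limit_def
 proof (intro conjI allI impI)
  show "is_cone J C D l \<pi>" using L cone by (auto simp: is_glim_def)
  fix m \<rho> assume r: "is_cone J C D m \<rho>"
  hence "\<exists>!h. h \<in> hom C m l \<and> (\<forall>v\<in>V. Comp C (\<pi> (enc v)) h = \<rho> (enc v))"
   using L by (auto simp: is_glim_def cone)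
  thus "\<exists>!h. h \<in> hom C m l \<and> (\<forall>j\<in>Ob J. Comp C (\<pi> j) h = \<rho> j)"
   by (simp add: ob)
 qed
qed

lemma glim_exists:
 fixes C :: "('o, 'a) cat"
 assumes C: "finitely_complete C" and bp: "bipartite V E s t" and d: "gdiag C V E s t X g"
 obtains l \<pi> where "is_glim C V E s t X g l \<pi>"
proof -
 have cat: "category C" using C by (auto simp: finitely_complete_def)
 show ?thesis
 proof (rule graph_diagram[OF bp _ d, of C id_func])
 fix J :: "(nat, nat) cat" and dec enc D assume J: "finite_category J"
  "\<And>v. v \<in> V ==> dec (enc v) = v" "Ob J = enc ` V" "is_functor J C D"
  "\<And>l \<pi>. is_cone J C D l \<pi> \<longleftrightarrow> is_gcone C V E s t X g l (\<lambda>v. \<pi> (enc v))"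
 then obtain l \<pi> where "is_limit J C D l \<pi>" using C unfolding finitely_complete_def by blast
 hence "is_glim C V E s t X g l (\<lambda>v. \<pi> (enc v))"
  using limit_graph_iff[OF bp J(3) J(2) J(5)] by blast
 thus ?thesis by (rule that)
 qed (use cat in "auto simp: is_functor_def id_func_def")
qed

lemma glim_preserved:
 fixes A :: "('o, 'a) cat" and B :: "('p, 'b) cat"
 assumes F: "is_functor A B F" and pres: "preserves_finite_limits A B F" and bp: "bipartite V E s t"
  and d: "gdiag A V E s t X g" and L: "is_glim A V E s t X g l \<pi>"
 shows "is_glim B V E s t (\<lambda>v. ob F (X v)) (\<lambda>e. ar F (g e)) (ob F l) (\<lambda>v. ar F (\<pi> v))"
proof -
 have cat: "category A" using F by (auto simp: is_functor_def)
 show ?thesis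
 proof (rule graph_diagram[OF bp F d])
 fix J :: "(nat, nat) cat" and dec enc D assume J: "finite_category J"
  "\<And>v. v \<in> V ==> dec (enc v) = v" "Ob J = enc ` V" "is_functor J A D"
  "\<And>l \<pi>. is_cone J A D l \<pi> \<longleftrightarrow> is_gcone A V E s t X g l (\<lambda>v. \<pi> (enc v))"
  "\<And>l \<pi>. is_cone J B (comp_func F D) l \<pi> \<longleftrightarrow>
   is_gcone B V E s t (\<lambda>v. ob F (X v)) (\<lambda>e. ar F (g e)) l (\<lambda>v. \<pi> (enc v))"
 have gc: "is_glim A V E s t X g l (\<lambda>v. \<pi> (dec (enc v)))"
 proof -
  have "is_gcone A V E s t X g l \<pi> \<longleftrightarrow> is_gcone A V E s t X g l (\<lambda>v. \<pi> (dec (enc v)))"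
   by (rule is_gcone_cong[OF _ bp]) (simp add: J(2))
  thus ?thesis using L unfolding is_glim_def by (simp add: J(2))
 qed
 hence "is_limit J A D l (\<lambda>j. \<pi> (dec j))"
  using limit_graph_iff[OF bp J(3) J(2) J(5), of l "\<lambda>j. \<pi> (dec j)"] by blast
 hence "is_limit J B (comp_func F D) (ob F l) (\<lambda>j. ar F (\<pi> (dec j)))"
  using pres J(1,4) by (auto simp: preserves_finite_limits_def)
 hence "is_glim B V E s t (\<lambda>v. ob F (X v)) (\<lambda>e. ar F (g e)) (ob F l) (\<lambda>v. ar F (\<pi> (dec (enc v))))"
  using limit_graph_iff[OF bp J(3) J(2) J(6), of "ob F l" "\<lambda>j. ar F (\<pi> (dec j))"] by blast
 moreover have "is_gcone B V E s t (\<lambda>v. ob F (X v)) (\<lambda>e. ar F (g e)) (ob F l) (\<lambda>v. ar F (\<pi> v)) \<longleftrightarrow>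
  is_gcone B V E s t (\<lambda>v. ob F (X v)) (\<lambda>e. ar F (g e)) (ob F l) (\<lambda>v. ar F (\<pi> (dec (enc v))))"
  by (rule is_gcone_cong[OF _ bp]) (simp add: J(2))
 ultimately show ?thesis unfolding is_glim_def by (simp add: J(2))
 qed
qed

section \<open>Pullbacks, equalisers and products\<close>

definition sel :: "'x => 'x => 'x => nat => 'x" where
 "sel a b c v = (if v = 0 then a else if v = 1 then b else c)"

lemma sel_simps [simp]: "sel a b c 0 = a" "sel a b c (Suc 0) = b" "sel a b c 2 = c"
 by (simp_all add: sel_def)

lemma map_sel: "(\<lambda>v. F (sel a b c v)) = sel (F a) (F b) (F c)"
 by (auto simp: sel_def)

abbreviation is_pb_glim where
 "is_pb_glim C x y z f g l p q r \<equiv>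
  is_glim C {0, 1, 2} {0, 1} (\<lambda>e. e) (\<lambda>_. 2) (sel x y z) (sel f g f) l (sel p q r)"

lemma bipartite_pullback: "bipartite {0, 1, 2 :: nat} {0, 1} (\<lambda>e. e) (\<lambda>_. 2)"
 by (auto simp: bipartite_def)

lemma bipartite_parallel: "bipartite {0, 1 :: nat} {0, 1 :: nat} (\<lambda>_. 0) (\<lambda>_. 1)"
 by (auto simp: bipartite_def)

lemma is_glim_cong:
 assumes "\<And>v. v \<in> V ==> \<pi> v = \<pi>' v" "bipartite V E s t"
 shows "is_glim C V E s t X g l \<pi> \<longleftrightarrow> is_glim C V E s t X g l \<pi>'"
 using assms(1) is_gcone_cong[of V \<pi> \<pi>' E s t C X g l, OF assms] unfolding is_glim_def by simp

lemma glim_univ: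
 "is_glim C V E s t X g l \<pi> ==> is_gcone C V E s t X g m \<rho> ==> \<exists>!h. h \<in> hom C m l \<and> (\<forall>v\<in>V. Comp C (\<pi> v) h = \<rho> v)"
 by (simp add: is_glim_def)

context cat
begin

lemma square:
 assumes "f ** p = g ** q" "f \<in> hom C x z" "p \<in> hom C l x" "g \<in> hom C y z" "q \<in> hom C l y" "h \<in> hom C w l"
 shows "f ** (p ** h) = g ** (q ** h)"
 using assoc[OF assms(2,3,6)] assoc[OF assms(4,5,6)] assms(1) by simp

lemma pullbackD:
 assumes "is_pullback C f g p q" "f \<in> hom C x z"
 shows "p \<in> hom C (Dom C p) x" "q \<in> hom C (Dom C p) (Dom C g)" "g \<in> hom C (Dom C g) z" "f ** p = g ** q"
 using assms by (auto simp: is_pullback_def hom_def)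

lemma pullback_univ:
 assumes "is_pullback C f g p q" "f \<in> hom C x z" "g \<in> hom C y z"
  "r \<in> hom C w x" "s \<in> hom C w y" "f ** r = g ** s"
 obtains h where "h \<in> hom C w (Dom C p)" "p ** h = r" "q ** h = s"
proof -
 have xy: "x = Dom C f" "y = Dom C g" using assms(2,3) by (auto simp: hom_def)
 have "\<exists>!h. h \<in> hom C w (Dom C p) \<and> p ** h = r \<and> q ** h = s"
  using assms(1,4,5,6) unfolding is_pullback_def xy by blast
 thus ?thesis using that by blast
qed

lemma pullback_joint_mono:
 assumes "is_pullback C f g p q" "f \<in> hom C x z"
  "h \<in> hom C w (Dom C p)" "k \<in> hom C w (Dom C p)" "p ** h = p ** k" "q ** h = q ** k"
 shows "h = k"
proof -
 note P = pullbackD[OF assms(1,2)]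
 have "f ** (p ** h) = g ** (q ** h)" by (rule square[OF P(4) assms(2) P(1,3,2) assms(3)])
 moreover have "Dom C f = x" using assms by (auto simp: hom_def)
 ultimately have "\<exists>!h'. h' \<in> hom C w (Dom C p) \<and> p ** h' = p ** h \<and> q ** h' = q ** h"
  using assms(1) comp_hom[OF P(1) assms(3)] comp_hom[OF P(2) assms(3)] unfolding is_pullback_def by blast
 thus ?thesis using assms(3-6) by metis
qed

lemma pullbackI:
 assumes "f \<in> hom C x z" "g \<in> hom C y z" "p \<in> hom C l x" "q \<in> hom C l y" "f ** p = g ** q"
  and "\<And>w r s. r \<in> hom C w x ==> s \<in> hom C w y ==> f ** r = g ** s ==>
   \<exists>!h. h \<in> hom C w l \<and> p ** h = r \<and> q ** h = s"
 shows "is_pullback C f g p q"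
 using assms unfolding is_pullback_def hom_def by auto

lemma pullback_iff_glim:
 assumes f: "f \<in> hom C x z" and g: "g \<in> hom C y z" and p: "p \<in> hom C l x" and q: "q \<in> hom C l y"
 shows "is_pullback C f g p q \<longleftrightarrow> is_pb_glim C x y z f g l p q (f ** p)"
proof -
 have cone: "is_gcone C {0, 1, 2} {0, 1} (\<lambda>e. e) (\<lambda>_. 2) (sel x y z) (sel f g f) w r \<longleftrightarrow>
  r 0 \<in> hom C w x \<and> r (Suc 0) \<in> hom C w y \<and> f ** r 0 = g ** r (Suc 0) \<and> r 2 = f ** r 0" for w r
  using f hom_ob unfolding is_gcone_def by auto (metis comp_hom f)
 have "f \<in> Arr C" "g \<in> Arr C" "Dom C f = x" "Dom C g = y" "Cod C f = z" "Cod C g = z" "Dom C p = l"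
  using assms by (auto simp: hom_def)
 hence "is_pullback C f g p q \<longleftrightarrow> f ** p = g ** q \<and> (\<forall>w. \<forall>r \<in> hom C w x. \<forall>s \<in> hom C w y. f ** r = g ** s -->
   (\<exists>!h. h \<in> hom C w l \<and> p ** h = r \<and> q ** h = s))"
  using p q by (auto simp: is_pullback_def)
 also have "\<dots> \<longleftrightarrow> is_pb_glim C x y z f g l p q (f ** p)" (is "?A \<longleftrightarrow> ?B")
 proof
  assume A: ?A
  show ?B unfolding is_glim_def cone
  proof (intro conjI allI impI)
   fix w r assume r: "r 0 \<in> hom C w x \<and> r (Suc 0) \<in> hom C w y \<and> f ** r 0 = g ** r (Suc 0) \<and> r 2 = f ** r 0"
   hence "\<exists>!h. h \<in> hom C w l \<and> p ** h = r 0 \<and> q ** h = r (Suc 0)" using A by blast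
   moreover have "(f ** p) ** h = r 2" if "h \<in> hom C w l" "p ** h = r 0" for h
    using that r assoc[OF f p that(1)] by simp
   ultimately show "\<exists>!h. h \<in> hom C w l \<and> (\<forall>v\<in>{0, 1, 2}. sel p q (f ** p) v ** h = r v)"
    by (simp cong: conj_cong)
  qed (use A p q in auto)
 next
  assume B: ?B
  show ?A
  proof (intro conjI allI impI ballI)
   show "f ** p = g ** q" using B[unfolded is_glim_def cone] by simp
   fix w r s assume r: "r \<in> hom C w x" "s \<in> hom C w y" "f ** r = g ** s"
   hence "\<exists>!h. h \<in> hom C w l \<and> (\<forall>v\<in>{0, 1, 2}. sel p q (f ** p) v ** h = sel r s (f ** r) v)"
    using B[unfolded is_glim_def cone, THEN conjunct2, rule_format, of "sel r s (f ** r)" w] r by simp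
   moreover have "(f ** p) ** h = f ** r" if "h \<in> hom C w l" "p ** h = r" for h
    using that r assoc[OF f p that(1)] by simp
   ultimately show "\<exists>!h. h \<in> hom C w l \<and> p ** h = r \<and> q ** h = s"
    by (simp cong: conj_cong)
  qed
 qed
 finally show ?thesis .
qed

lemma gdiag_pullback:
 "f \<in> hom C x z ==> g \<in> hom C y z ==> gdiag C {0, 1, 2} {0, 1} (\<lambda>e. e) (\<lambda>_. 2) (sel x y z) (sel f g f)"
 using hom_ob by (auto simp: gdiag_def)

lemma mono_iff_pullback:
 assumes m: "m \<in> hom C x y"
 shows "is_mono C m \<longleftrightarrow> is_pullback C m m (Id C x) (Id C x)"
proof
 assume M: "is_mono C m"
 show "is_pullback C m m (Id C x) (Id C x)"
 proof (rule pullbackI[OF m m id_hom id_hom])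
  fix w r s assume r: "r \<in> hom C w x" "s \<in> hom C w x" "m ** r = m ** s"
  hence "r = s" by (rule monoD[OF M m])
  thus "\<exists>!h. h \<in> hom C w x \<and> Id C x ** h = r \<and> Id C x ** h = s"
   using r by (intro ex1I[of _ r]) (auto simp: id_left)
 qed (use hom_ob[OF m] in auto)
next
 assume P: "is_pullback C m m (Id C x) (Id C x)"
 show "is_mono C m"
 proof (rule monoI[OF m])
  fix w r s assume r: "r \<in> hom C w x" "s \<in> hom C w x" "m ** r = m ** s"
  from pullback_univ[OF P m m this] obtain h where "h \<in> hom C w (Dom C (Id C x))" "Id C x ** h = r" "Id C x ** h = s" .
  thus "r = s" by simp
 qed
qed

lemma pullback_mono:
 assumes P: "is_pullback C f g p q" and f: "f \<in> hom C x z" and g: "is_mono C g"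
 shows "is_mono C p"
proof -
 note D = pullbackD[OF P f]
 show ?thesis
 proof (rule monoI[OF D(1)])
  fix w r s assume r: "r \<in> hom C w (Dom C p)" "s \<in> hom C w (Dom C p)" "p ** r = p ** s"
  have "f ** (p ** r) = g ** (q ** r)" "f ** (p ** s) = g ** (q ** s)"
   using square[OF D(4) f D(1,3,2)] r by blast+
  hence "q ** r = q ** s"
   using monoD[OF g D(3) comp_hom[OF D(2) r(1)] comp_hom[OF D(2) r(2)]] r(3) by simp
  thus "r = s" using pullback_joint_mono[OF P f] r by blast
 qed
qed

lemma pullback_iso:
 assumes P: "is_pullback C f g p q" and f: "f \<in> hom C x z" and g: "is_iso C g"
 shows "is_iso C p"
proof -
 note D = pullbackD[OF P f]
 obtain k where k: "k \<in> hom C z (Dom C g)" "k ** g = Id C (Dom C g)" "g ** k = Id C z"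
  using isoD[OF g D(3)] by blast
 have x: "x \<in> Ob C" using hom_ob[OF f] by simp
 have "f ** Id C x = g ** (k ** f)" using k f D assoc id_left id_right by metis
 then obtain h where h: "h \<in> hom C x (Dom C p)" "p ** h = Id C x"
  using pullback_univ[OF P f D(3) id_hom[OF x] comp_hom[OF k(1) f]] by blast
 show ?thesis by (rule mono_split_iso[OF pullback_mono[OF P f iso_mono[OF g]] D(1) h])
qed

end

lemma pullback_preserved:
 assumes F: "is_functor A B F" "preserves_finite_limits A B F" and P: "is_pullback A f g p q"
 shows "is_pullback B (ar F f) (ar F g) (ar F p) (ar F q)"
proof -
 interpret A: cat A using F by (auto simp: is_functor_def cat_def)
 interpret B: cat B using F by (auto simp: is_functor_def cat_def)
 have f: "f \<in> hom A (Dom A f) (Cod A f)" using P by (auto simp: is_pullback_def hom_def)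
 note D = A.pullbackD[OF P f]
 have Fh: "ar F k \<in> hom B (ob F x) (ob F y)" if "k \<in> hom A x y" for k x y
  using F that by (auto simp: is_functor_def)
 have *: "ar F (Comp A f p) = Comp B (ar F f) (ar F p)"
  using F D f unfolding is_functor_def by blast
 show ?thesis
  using glim_preserved[OF F bipartite_pullback A.gdiag_pullback[OF f D(3)], of "Dom A p" "sel p q (Comp A f p)"]
   A.pullback_iff_glim[OF f D(3,1,2)] P B.pullback_iff_glim[OF Fh[OF f] Fh[OF D(3)] Fh[OF D(1)] Fh[OF D(2)]]
  by (simp add: map_sel *)
qed

lemma mono_preserved:
 assumes F: "is_functor A B F" "preserves_finite_limits A B F" and m: "is_mono A m"
 shows "is_mono B (ar F m)"
proof -
 interpret A: cat A using F by (auto simp: is_functor_def cat_def)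
 interpret B: cat B using F by (auto simp: is_functor_def cat_def)
 have h: "m \<in> hom A (Dom A m) (Cod A m)" "Dom A m \<in> Ob A"
  using m A.mono_hom by (auto simp: is_mono_def A.dom_ob)
 have "ar F m \<in> hom B (ob F (Dom A m)) (ob F (Cod A m))"
  "ar F (Id A (Dom A m)) = Id B (ob F (Dom A m))"
  using F h by (auto simp: is_functor_def)
 thus ?thesis
  using pullback_preserved[OF F, of m m] A.mono_iff_pullback[OF h(1)] m B.mono_iff_pullback by metis
qed

locale lex_cat = cat +
 assumes lex: "finitely_complete C"
begin

lemma pullback_exists:
 assumes "f \<in> hom C x z" "g \<in> hom C y z"
 obtains l p q where "p \<in> hom C l x" "q \<in> hom C l y" "is_pullback C f g p q"
proof -
 obtain l \<pi> where L: "is_glim C {0, 1, 2} {0, 1} (\<lambda>e. e) (\<lambda>_. 2) (sel x y z) (sel f g f) l \<pi>"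
  using glim_exists[OF lex bipartite_pullback gdiag_pullback[OF assms]] by blast
 hence h: "\<pi> 0 \<in> hom C l x" "\<pi> (Suc 0) \<in> hom C l y" "\<pi> 2 = f ** \<pi> 0"
  by (auto simp: is_glim_def is_gcone_def)
 have "is_pb_glim C x y z f g l (\<pi> 0) (\<pi> (Suc 0)) (f ** \<pi> 0)"
  by (rule is_glim_cong[OF _ bipartite_pullback, THEN iffD1, OF _ L]) (use h in auto)
 thus ?thesis using that h pullback_iff_glim[OF assms h(1,2)] by blast
qed

lemma equaliser_exists:
 assumes f: "f \<in> hom C x y" "g \<in> hom C x y"
 obtains l e where "e \<in> hom C l x" "is_mono C e" "f ** e = g ** e"
  "\<And>w r. r \<in> hom C w x ==> f ** r = g ** r ==> \<exists>h \<in> hom C w l. e ** h = r"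
proof -
 have "gdiag C {0, 1} {0, 1} (\<lambda>_. 0) (\<lambda>_. 1) (sel x y y) (sel f g g)"
  using assms hom_ob by (auto simp: gdiag_def)
 then obtain l \<pi> where L: "is_glim C {0, 1} {0, 1} (\<lambda>_. 0) (\<lambda>_. 1) (sel x y y) (sel f g g) l \<pi>"
  using glim_exists[OF lex bipartite_parallel] by blast
 hence h: "\<pi> 0 \<in> hom C l x" "f ** \<pi> 0 = \<pi> (Suc 0)" "g ** \<pi> 0 = \<pi> (Suc 0)"
  by (auto simp: is_glim_def is_gcone_def)
 have univ: "\<exists>!h. h \<in> hom C w l \<and> \<pi> 0 ** h = r" if r: "r \<in> hom C w x" "f ** r = g ** r" for w r
 proof -
  have gc: "is_gcone C {0, 1} {0, 1} (\<lambda>_. 0) (\<lambda>_. 1) (sel x y y) (sel f g g) w (sel r (f ** r) r)"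
   using r f comp_hom hom_ob unfolding is_gcone_def by auto
  have "\<exists>!h. h \<in> hom C w l \<and> \<pi> 0 ** h = r \<and> \<pi> (Suc 0) ** h = f ** r"
   using glim_univ[OF L gc] by simp
  moreover have "\<pi> (Suc 0) ** h' = f ** r" if "h' \<in> hom C w l" "\<pi> 0 ** h' = r" for h'
   using assoc[OF f(1) h(1) that(1)] h that by simp
  ultimately show ?thesis by metis
 qed
 have "is_mono C (\<pi> 0)"
 proof (rule monoI[OF h(1)])
  fix w r s assume r: "r \<in> hom C w l" "s \<in> hom C w l" "\<pi> 0 ** r = \<pi> 0 ** s"
  have "f ** (\<pi> 0 ** r) = g ** (\<pi> 0 ** r)" using assoc[OF f(1) h(1) r(1)] assoc[OF f(2) h(1) r(1)] h by simp
  hence "\<exists>!k. k \<in> hom C w l \<and> \<pi> 0 ** k = \<pi> 0 ** r" using univ[OF comp_hom[OF h(1) r(1)]] by blast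
  thus "r = s" using r by metis
 qed
 thus ?thesis
 proof (rule that[OF h(1)])
  show "f ** \<pi> 0 = g ** \<pi> 0" using h by simp
  show "\<exists>h\<in>hom C w l. \<pi> 0 ** h = r" if "r \<in> hom C w x" "f ** r = g ** r" for w r
   using univ[OF that] by blast
 qed
qed

lemma product_exists:
 assumes "x \<in> Ob C" "y \<in> Ob C"
 obtains l p q where "p \<in> hom C l x" "q \<in> hom C l y"
  "\<And>w r s. r \<in> hom C w x ==> s \<in> hom C w y ==> \<exists>!h. h \<in> hom C w l \<and> p ** h = r \<and> q ** h = s"
proof -
 have bp: "bipartite {0, 1 :: nat} ({} :: nat set) (\<lambda>_. 0) (\<lambda>_. 0)" by (simp add: bipartite_def)
 have "gdiag C {0, 1 :: nat} ({} :: nat set) (\<lambda>_. 0) (\<lambda>_. 0) (sel x y y) (sel undefined undefined undefined)"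
  using assms by (auto simp: gdiag_def)
 then obtain l \<pi> where L: "is_glim C {0, 1 :: nat} ({} :: nat set) (\<lambda>_. 0) (\<lambda>_. 0) (sel x y y) (sel undefined undefined undefined) l \<pi>"
  using glim_exists[OF lex bp] by blast
 show ?thesis
 proof (rule that)
  show "\<pi> 0 \<in> hom C l x" "\<pi> 1 \<in> hom C l y" using L by (auto simp: is_glim_def is_gcone_def)
  fix w r s assume r: "r \<in> hom C w x" "s \<in> hom C w y"
  hence "is_gcone C {0, 1 :: nat} ({} :: nat set) (\<lambda>_. 0) (\<lambda>_. 0) (sel x y y) (sel undefined undefined undefined) w (sel r s s)"
   using hom_ob by (auto simp: is_gcone_def)
  from glim_univ[OF L this] show "\<exists>!h. h \<in> hom C w l \<and> \<pi> 0 ** h = r \<and> \<pi> 1 ** h = s"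
   by simp
 qed
qed

lemma terminal_exists: obtains l where "l \<in> Ob C" "\<And>w. w \<in> Ob C ==> \<exists>!h. h \<in> hom C w l"
proof -
 have "bipartite ({} :: nat set) ({} :: nat set) s t" "gdiag C ({} :: nat set) ({} :: nat set) s t X g" for s t X g
  by (auto simp: bipartite_def gdiag_def)
 then obtain l \<pi> where "is_glim C ({} :: nat set) ({} :: nat set) (\<lambda>_. 0) (\<lambda>_. 0) (\<lambda>_. undefined) (\<lambda>_. undefined) l \<pi>"
  using glim_exists[OF lex] by metis
 thus ?thesis using that by (auto simp: is_glim_def is_gcone_def)
qed

end

section \<open>Presheaves, elementwise\<close>

definition act :: "('o, 'u) presheaf => 'u => 'u => 'u" where
 "act P f x = set_app (ar P f) x"

definition app :: "('o, 'u) presheaf_arr => 'o => 'u => 'u" where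
 "app \<alpha> z x = set_app (fst (snd \<alpha>) z) x"

definition mk_psh :: "('o, 'u) cat => ('o => 'u set) => ('u => 'u => 'u) => ('o, 'u) presheaf" where
 "mk_psh C E a = \<lparr>ob_map = (\<lambda>z \<in> Ob C. E z),
  ar_map = (\<lambda>f \<in> Arr C. (E (Cod C f), \<lambda>x \<in> E (Cod C f). a f x, E (Dom C f)))\<rparr>"

definition mk_arr :: "('o, 'u) cat => ('o, 'u) presheaf => ('o, 'u) presheaf => ('o => 'u => 'u) =>
  ('o, 'u) presheaf_arr" where
 "mk_arr C P Q t = (P, \<lambda>z \<in> Ob C. (ob P z, \<lambda>x \<in> ob P z. t z x, ob Q z), Q)"

definition natl :: "('o, 'u) cat => 'o set => ('o, 'u) presheaf => ('o, 'u) presheaf => ('o => 'u => 'u) => bool" where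
 "natl C S P Q t \<longleftrightarrow> (\<forall>z \<in> S. \<forall>x \<in> ob P z. t z x \<in> ob Q z) \<and>
  (\<forall>z \<in> S. \<forall>w \<in> S. \<forall>f \<in> hom C w z. \<forall>x \<in> ob P z. t w (act P f x) = act Q f (t z x))"

lemma set_cat_hom: "h \<in> hom set_cat A B \<longleftrightarrow>
 small TYPE('u) A \<and> small TYPE('u) B \<and> (\<exists>f \<in> A \<rightarrow>\<^sub>E B. h = (A, f, B :: 'u set))"
 by (auto simp: set_cat_def hom_def)

locale pcat = cat C for C :: "('o, 'u) cat"
begin

abbreviation "phom \<equiv> hom (psh C)"
abbreviation "pcomp \<equiv> Comp (psh C)"

sublocale Psh: cat "psh C"
 by (rule cat.intro) (rule category_psh[OF category])

abbreviation is_psh :: "('o, 'u) presheaf => bool" where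
 "is_psh P \<equiv> is_functor (op_cat C) set_cat P"

lemma op_hom: "hom (op_cat C) x y = hom C y x"
 by (auto simp: hom_def op_cat_def)

lemma psh_small: "is_psh P ==> z \<in> Ob C ==> small TYPE('u) (ob P z)"
 by (auto simp: is_functor_def op_cat_def set_cat_def)

lemma psh_ar:
 assumes "is_psh P" "f \<in> hom C w z"
 shows "ar P f = (ob P z, \<lambda>x \<in> ob P z. act P f x, ob P w)" "act P f \<in> ob P z \<rightarrow> ob P w"
proof -
 have "ar P f \<in> hom set_cat (ob P z) (ob P w)"
  using assms by (auto simp: is_functor_def op_hom)
 then obtain h where h: "h \<in> ob P z \<rightarrow>\<^sub>E ob P w" "ar P f = (ob P z, h, ob P w)"
  by (auto simp: set_cat_hom)
 hence "act P f = h" by (auto simp: act_def set_app_def)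
 thus "ar P f = (ob P z, \<lambda>x \<in> ob P z. act P f x, ob P w)" "act P f \<in> ob P z \<rightarrow> ob P w"
  using h by (auto simp: PiE_def extensional_restrict)
qed

lemma act_in: "is_psh P ==> f \<in> hom C w z ==> x \<in> ob P z ==> act P f x \<in> ob P w"
 using psh_ar(2) by blast

lemma act_id: "is_psh P ==> z \<in> Ob C ==> x \<in> ob P z ==> act P (Id C z) x = x"
 by (auto simp: is_functor_def op_cat_def act_def set_cat_def set_app_def)

lemma act_comp:
 assumes P: "is_psh P" and f: "f \<in> hom C w z" and g: "g \<in> hom C v w" and x: "x \<in> ob P z"
 shows "act P (f ** g) x = act P g (act P f x)"
proof -
 have "ar P (f ** g) = Comp set_cat (ar P g) (ar P f)"
  using P f g unfolding is_functor_def op_hom by (auto simp: op_cat_def)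
 thus ?thesis
  using psh_ar[OF P f] psh_ar[OF P g] x by (auto simp: set_cat_def act_def[of P "f ** g"] set_app_def compose_def)
qed

lemma psh_ob: "P \<in> Ob (psh C) \<longleftrightarrow> is_psh P \<and> ob P \<in> extensional (Ob C) \<and> ar P \<in> extensional (Arr C)"
 by (auto simp: psh_def functor_cat_def Let_def op_cat_def)

lemma ob_psh: "P \<in> Ob (psh C) ==> is_psh P"
 by (simp add: psh_ob)

lemma mk_psh_el [simp]: "z \<in> Ob C ==> ob (mk_psh C E a) z = E z"
 by (simp add: mk_psh_def)

lemma mk_psh_act: "f \<in> hom C w z ==> x \<in> E z ==> act (mk_psh C E a) f x = a f x"
 by (auto simp: mk_psh_def act_def set_app_def hom_def)

lemma mk_psh_ob:
 assumes "\<And>z. z \<in> Ob C ==> small TYPE('u) (E z)"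
  and a: "\<And>w z f x. f \<in> hom C w z ==> x \<in> E z ==> a f x \<in> E w"
  and i: "\<And>z x. z \<in> Ob C ==> x \<in> E z ==> a (Id C z) x = x"
  and c: "\<And>v w z f g x. f \<in> hom C w z ==> g \<in> hom C v w ==> x \<in> E z ==> a (f ** g) x = a g (a f x)"
 shows "mk_psh C E a \<in> Ob (psh C)"
proof -
 have "is_psh (mk_psh C E a)"
  unfolding is_functor_def op_hom
 proof (intro conjI ballI allI)
  fix x assume x: "x \<in> Ob (op_cat C)"
  hence x': "x \<in> Ob C" by (simp add: op_cat_def)
  show "ob (mk_psh C E a) x \<in> Ob set_cat" using x' assms(1) by (auto simp: mk_psh_def set_cat_def)
  show "ar (mk_psh C E a) (Id (op_cat C) x) = Id set_cat (ob (mk_psh C E a) x)"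
   using x' i id_hom[OF x'] by (auto simp: mk_psh_def op_cat_def set_cat_def hom_def restrict_def fun_eq_iff)
 next
  fix x y f assume f: "f \<in> hom C y x"
  have "f \<in> Arr C" "Dom C f = y" "Cod C f = x" "y \<in> Ob C" "x \<in> Ob C" using f hom_ob[OF f] by (auto simp: hom_def)
  thus "ar (mk_psh C E a) f \<in> hom set_cat (ob (mk_psh C E a) x) (ob (mk_psh C E a) y)"
   using assms(1) a[OF f] by (auto simp: set_cat_hom mk_psh_def)
 next
  fix x y z f g assume fg: "f \<in> hom C y x" "g \<in> hom C z y"
  hence "f ** g \<in> hom C z x" using comp_hom by blast
  thus "ar (mk_psh C E a) (Comp (op_cat C) g f) = Comp set_cat (ar (mk_psh C E a) g) (ar (mk_psh C E a) f)"
   using fg a c[OF fg] by (auto simp: op_cat_def mk_psh_def set_cat_def hom_def compose_def restrict_def fun_eq_iff)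
 qed (auto intro: category_op[OF category] category_set_cat)
 thus ?thesis by (auto simp: psh_ob mk_psh_def)
qed

lemma psh_hom:
 assumes "\<alpha> \<in> phom P Q"
 shows "P \<in> Ob (psh C)" "Q \<in> Ob (psh C)" "Dom (psh C) \<alpha> = P" "Cod (psh C) \<alpha> = Q"
  "natl C (Ob C) P Q (app \<alpha>)" "\<alpha> = mk_arr C P Q (app \<alpha>)"
proof -
 obtain t where t: "\<alpha> = (P, t, Q)" "P \<in> Ob (psh C)" "Q \<in> Ob (psh C)" "nat_trans (op_cat C) set_cat P Q t"
  using assms by (auto simp: hom_def psh_def functor_cat_def Let_def)
 have tz: "t z = (ob P z, \<lambda>x\<in>ob P z. app \<alpha> z x, ob Q z)"
  "\<And>x. x \<in> ob P z ==> app \<alpha> z x \<in> ob Q z" if "z \<in> Ob C" for z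
 proof -
  have "t z \<in> hom set_cat (ob P z) (ob Q z)"
   using t(4) that by (auto simp: nat_trans_def op_cat_def)
  then obtain h where h: "h \<in> ob P z \<rightarrow>\<^sub>E ob Q z" "t z = (ob P z, h, ob Q z)"
   by (auto simp: set_cat_hom)
  moreover have "app \<alpha> z = h" using h t by (auto simp: app_def set_app_def)
  ultimately show "t z = (ob P z, \<lambda>x\<in>ob P z. app \<alpha> z x, ob Q z)"
   "\<And>x. x \<in> ob P z ==> app \<alpha> z x \<in> ob Q z" by (auto simp: PiE_def extensional_restrict)
 qed
 show "P \<in> Ob (psh C)" "Q \<in> Ob (psh C)" by fact+
 show "Dom (psh C) \<alpha> = P" "Cod (psh C) \<alpha> = Q" using assms by (auto simp: hom_def)
 have "t \<in> extensional (Ob C)" using t(4) by (auto simp: nat_trans_def op_cat_def)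
 thus "\<alpha> = mk_arr C P Q (app \<alpha>)" using t(1) tz(1) by (auto simp: mk_arr_def fun_eq_iff extensional_def)
 show "natl C (Ob C) P Q (app \<alpha>)"
  unfolding natl_def
 proof (intro conjI ballI)
  fix z w f x assume h: "z \<in> Ob C" "w \<in> Ob C" "f \<in> hom C w z" "x \<in> ob P z"
  have "Comp set_cat (t w) (ar P f) = Comp set_cat (ar Q f) (t z)"
   using t(4) h unfolding nat_trans_def op_hom by blast
  hence "compose (ob P z) (restrict (app \<alpha> w) (ob P w)) (restrict (act P f) (ob P z)) x
   = compose (ob P z) (restrict (act Q f) (ob Q z)) (restrict (app \<alpha> z) (ob P z)) x"
   using tz(1)[OF h(1)] tz(1)[OF h(2)] psh_ar[OF ob_psh[OF t(2)] h(3)] psh_ar[OF ob_psh[OF t(3)] h(3)]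
   by (simp add: set_cat_def)
  thus "app \<alpha> w (act P f x) = act Q f (app \<alpha> z x)"
   using h tz(2) act_in[OF ob_psh[OF t(2)] h(3,4)] by (simp add: compose_def)
 qed (rule tz(2))
qed

lemma app_in: "\<alpha> \<in> phom P Q ==> z \<in> Ob C ==> x \<in> ob P z ==> app \<alpha> z x \<in> ob Q z"
 using psh_hom(5) by (fastforce simp: natl_def)

lemma app_nat: "\<alpha> \<in> phom P Q ==> f \<in> hom C w z ==> x \<in> ob P z ==>
  app \<alpha> w (act P f x) = act Q f (app \<alpha> z x)"
 using psh_hom(5) hom_ob by (fastforce simp: natl_def)

lemma psh_ext:
 assumes "\<alpha> \<in> phom P Q" "\<beta> \<in> phom P Q"
  "\<And>z x. z \<in> Ob C ==> x \<in> ob P z ==> app \<alpha> z x = app \<beta> z x"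
 shows "\<alpha> = \<beta>"
proof -
 have "mk_arr C P Q (app \<alpha>) = mk_arr C P Q (app \<beta>)"
  using assms(3) by (auto simp: mk_arr_def restrict_def fun_eq_iff)
 thus ?thesis using psh_hom(6)[OF assms(1)] psh_hom(6)[OF assms(2)] by simp
qed

lemma app_mk_arr [simp]: "z \<in> Ob C ==> x \<in> ob P z ==> app (mk_arr C P Q t) z x = t z x"
 by (simp add: app_def mk_arr_def set_app_def)

lemma mk_arr_hom:
 assumes P: "P \<in> Ob (psh C)" and Q: "Q \<in> Ob (psh C)" and t: "natl C (Ob C) P Q t"
 shows "mk_arr C P Q t \<in> phom P Q"
proof -
 have tin: "t z x \<in> ob Q z" if "z \<in> Ob C" "x \<in> ob P z" for z x
  using t that by (auto simp: natl_def)
 have "nat_trans (op_cat C) set_cat P Q (\<lambda>z\<in>Ob C. (ob P z, \<lambda>x\<in>ob P z. t z x, ob Q z))"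
  unfolding nat_trans_def op_hom
 proof (intro conjI ballI allI)
  fix x assume "x \<in> Ob (op_cat C)"
  thus "(\<lambda>z\<in>Ob C. (ob P z, \<lambda>x\<in>ob P z. t z x, ob Q z)) x \<in> hom set_cat (ob P x) (ob Q x)"
   using psh_small[OF ob_psh[OF P]] psh_small[OF ob_psh[OF Q]] tin by (auto simp: set_cat_hom op_cat_def)
 next
  fix x y f assume f: "f \<in> hom C y x"
  hence "\<And>e. e \<in> ob P x ==> t y (act P f e) = act Q f (t x e)" using t hom_ob by (fastforce simp: natl_def)
  thus "Comp set_cat ((\<lambda>z\<in>Ob C. (ob P z, \<lambda>x\<in>ob P z. t z x, ob Q z)) y) (ar P f)
   = Comp set_cat (ar Q f) ((\<lambda>z\<in>Ob C. (ob P z, \<lambda>x\<in>ob P z. t z x, ob Q z)) x)"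
   using hom_ob[OF f] psh_ar[OF ob_psh[OF P] f] psh_ar[OF ob_psh[OF Q] f] tin
    act_in[OF ob_psh[OF P] f]
   by (auto simp: set_cat_def compose_def restrict_def fun_eq_iff)
 qed (auto simp: op_cat_def)
 thus ?thesis using P Q by (auto simp: mk_arr_def psh_def functor_cat_def Let_def hom_def)
qed

lemma app_comp [simp]:
 assumes "\<beta> \<in> phom Q R" "\<alpha> \<in> phom P Q" "z \<in> Ob C" "x \<in> ob P z"
 shows "app (pcomp \<beta> \<alpha>) z x = app \<beta> z (app \<alpha> z x)"
proof -
 have "\<alpha> = mk_arr C P Q (app \<alpha>)" "\<beta> = mk_arr C Q R (app \<beta>)" using psh_hom(6) assms(1,2) by blast+
 then obtain a b where ab: "\<alpha> = mk_arr C P Q a" "\<beta> = mk_arr C Q R b" by blast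
 have "a z x \<in> ob Q z" using app_in[OF assms(2,3,4)] assms ab by simp
 thus ?thesis
  using assms(3,4) unfolding ab by (simp add: mk_arr_def psh_def functor_cat_def Let_def op_cat_def app_def
    set_app_def set_cat_def compose_def)
qed

lemma app_Id [simp]: "z \<in> Ob C ==> x \<in> ob P z ==> app (Id (psh C) P) z x = x"
 by (simp add: psh_def functor_cat_def Let_def op_cat_def app_def set_app_def set_cat_def)

lemma mk_arr_homI:
 assumes "P \<in> Ob (psh C)" "Q \<in> Ob (psh C)"
  and "\<And>z x. z \<in> Ob C ==> x \<in> ob P z ==> t z x \<in> ob Q z"
  and "\<And>w z f x. f \<in> hom C w z ==> x \<in> ob P z ==> t w (act P f x) = act Q f (t z x)"
 shows "mk_arr C P Q t \<in> phom P Q"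
 using assms by (intro mk_arr_hom) (auto simp: natl_def)

lemma psh_iso:
 assumes a: "\<alpha> \<in> phom P Q" and b: "\<And>z. z \<in> Ob C ==> bij_betw (app \<alpha> z) (ob P z) (ob Q z)"
 shows "is_iso (psh C) \<alpha>"
proof -
 let ?t = "\<lambda>z. inv_into (ob P z) (app \<alpha> z)"
 have PQ: "P \<in> Ob (psh C)" "Q \<in> Ob (psh C)" using psh_hom[OF a] by auto
 have t: "?t z y \<in> ob P z" "app \<alpha> z (?t z y) = y" if "z \<in> Ob C" "y \<in> ob Q z" for z y
  using b[OF that(1)] that(2) by (auto simp: bij_betw_def inv_into_into f_inv_into_f)
 have t': "?t z (app \<alpha> z x) = x" if "z \<in> Ob C" "x \<in> ob P z" for z x
  using b[OF that(1)] that(2) by (simp add: bij_betw_inv_into_left)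
 have h: "mk_arr C Q P ?t \<in> phom Q P"
 proof (rule mk_arr_homI[OF PQ(2,1)])
  fix w z f y assume f: "f \<in> hom C w z" and y: "y \<in> ob Q z"
  hence zw: "z \<in> Ob C" "w \<in> Ob C" using hom_ob by auto
  have "app \<alpha> w (act P f (?t z y)) = act Q f y" using app_nat[OF a f t(1)[OF zw(1) y]] t(2)[OF zw(1) y] by simp
  thus "?t w (act Q f y) = act P f (?t z y)"
   using t'[OF zw(2) act_in[OF ob_psh[OF PQ(1)] f t(1)[OF zw(1) y]]] by simp
 qed (rule t)
 show ?thesis
 proof (rule Psh.isoI[OF a h])
  show "pcomp (mk_arr C Q P ?t) \<alpha> = Id (psh C) P"
   by (rule psh_ext[OF Psh.comp_hom[OF h a] Psh.id_hom[OF PQ(1)]]) (use a h t' app_in[OF a] in simp)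
  show "pcomp \<alpha> (mk_arr C Q P ?t) = Id (psh C) Q"
   by (rule psh_ext[OF Psh.comp_hom[OF a h] Psh.id_hom[OF PQ(2)]]) (use a h t in simp)
 qed
qed

end

section \<open>Smallness\<close>

lemma universe_infinite: "universe TYPE('u) ==> infinite (UNIV :: 'u set)"
 using infinite_iff_natLeq_ordLeq[of "UNIV :: 'u set"] ordLess_imp_ordLeq unfolding universe_def by blast

lemma small_subset: "small U B ==> A \<subseteq> B ==> small U A"
 unfolding small_def by (meson card_of_mono1 ordLeq_ordLess_trans)

lemma small_countable:
 assumes "universe TYPE('u)" "countable A"
 shows "small TYPE('u) A"
proof -
 have "|A| \<le>o |UNIV :: nat set|"
  using assms(2) card_of_ordLeq[of A "UNIV :: nat set"] unfolding countable_def by blast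
 hence "|A| \<le>o natLeq" using card_of_nat ordLeq_ordIso_trans by blast
 thus ?thesis using assms(1) unfolding universe_def small_def by (meson ordLeq_ordLess_trans)
qed

lemma small_Un: "universe TYPE('u) ==> small TYPE('u) A ==> small TYPE('u) B ==> small TYPE('u) (A \<union> B)"
 unfolding small_def by (rule card_of_Un_ordLess_infinite[OF universe_infinite])

lemma small_UN:
 assumes U: "universe TYPE('u)" and "finite I" "\<And>i. i \<in> I ==> small TYPE('u) (A i)"
 shows "small TYPE('u) (\<Union>i\<in>I. A i)"
 using assms(2,3)
proof (induction I)
 case empty
 thus ?case by (simp add: small_countable[OF U])
next
 case (insert i I)
 thus ?case using small_Un[OF U, of "A i" "\<Union> (A ` I)"] by simp
qed

lemma small_locally_small: "small_category K ==> locally_small K"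
 unfolding small_category_def locally_small_def hom_def by (auto intro: small_subset)

section \<open>The Yoneda embedding\<close>

lemma hom_full_sub: "hom (full_sub C S) x y = (if x \<in> S \<and> y \<in> S then hom C x y else {})"
 by (auto simp: hom_def full_sub_def)

lemma full_sub_simps [simp]: "Comp (full_sub C S) = Comp C" "Id (full_sub C S) = Id C"
 "Dom (full_sub C S) = Dom C" "Cod (full_sub C S) = Cod C" "Ob (full_sub C S) = Ob C \<inter> S"
 by (auto simp: full_sub_def)

definition yon :: "('o, 'u) cat => ('o, 'u) presheaf => 'o => 'u => ('o, 'u) presheaf_arr" where
 "yon C P c x = mk_arr C (representable C c) P (\<lambda>z g. act P g x)"

locale lpcat = pcat C for C :: "('o, 'u) cat" +
 assumes ls: "locally_small C" and U: "universe TYPE('u)"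
begin

abbreviation rep :: "'o => ('o, 'u) presheaf" where "rep \<equiv> representable C"
abbreviation yar :: "'u => ('o, 'u) presheaf_arr" where "yar \<equiv> ar (yoneda C)"

lemma rep_ob: "c \<in> Ob C ==> rep c \<in> Ob (psh C)"
 by (rule representable_psh[OF category ls])

lemma rep_el [simp]: "z \<in> Ob C ==> ob (rep c) z = hom C z c"
 by (simp add: representable_def)

lemma rep_act: "f \<in> hom C w z ==> g \<in> hom C z c ==> act (rep c) f g = g ** f"
 by (auto simp: representable_def act_def set_app_def hom_def)

lemma yar_hom: "f \<in> hom C x y ==> yar f \<in> phom (rep x) (rep y)"
 using yoneda_functor[OF category ls] by (auto simp: is_functor_def yoneda_def)

lemma yar_app: "f \<in> hom C x y ==> z \<in> Ob C ==> g \<in> hom C z x ==> app (yar f) z g = f ** g"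
 by (auto simp: yoneda_def app_def set_app_def hom_def)

lemma yon_hom:
 assumes "P \<in> Ob (psh C)" "c \<in> Ob C" "x \<in> ob P c"
 shows "yon C P c x \<in> phom (rep c) P"
 unfolding yon_def
proof (rule mk_arr_homI[OF rep_ob[OF assms(2)] assms(1)])
 show "act P g x \<in> ob P z" if "z \<in> Ob C" "g \<in> ob (rep c) z" for z g
  using that act_in[OF ob_psh[OF assms(1)] _ assms(3)] by simp
 show "act P (act (rep c) f g) x = act P f (act P g x)"
  if "f \<in> hom C w z" "g \<in> ob (rep c) z" for w z f g
 proof -
  have g: "g \<in> hom C z c" using that hom_ob[OF that(1)] by simp
  thus ?thesis using that(1) rep_act[OF that(1) g] act_comp[OF ob_psh[OF assms(1)] g that(1) assms(3)] by simp
 qed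
qed

lemma yon_app: "z \<in> Ob C ==> g \<in> hom C z c ==> app (yon C P c x) z g = act P g x"
 by (simp add: yon_def)

lemma app_yon:
 assumes "\<alpha> \<in> phom (rep c) P" "g \<in> hom C z c"
 shows "app \<alpha> z g = act P g (app \<alpha> c (Id C c))"
proof -
 have c: "z \<in> Ob C" "c \<in> Ob C" using hom_ob[OF assms(2)] by auto
 hence "act (rep c) g (Id C c) = g" using rep_act[OF assms(2) id_hom] id_left[OF assms(2)] by simp
 thus ?thesis using app_nat[OF assms(1,2), of "Id C c"] c id_hom by simp
qed

lemma rep_hom_ext:
 assumes "\<alpha> \<in> phom (rep c) P" "\<beta> \<in> phom (rep c) P" "app \<alpha> c (Id C c) = app \<beta> c (Id C c)"
 shows "\<alpha> = \<beta>"
proof (rule psh_ext[OF assms(1,2)])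
 fix z g assume "z \<in> Ob C" "g \<in> ob (rep c) z"
 hence "g \<in> hom C z c" by simp
 thus "app \<alpha> z g = app \<beta> z g" using app_yon[OF assms(1)] app_yon[OF assms(2)] assms(3) by simp
qed

lemma comp_yon:
 assumes "\<alpha> \<in> phom P Q" "c \<in> Ob C" "x \<in> ob P c"
 shows "pcomp \<alpha> (yon C P c x) = yon C Q c (app \<alpha> c x)"
proof -
 have P: "P \<in> Ob (psh C)" "Q \<in> Ob (psh C)" using psh_hom[OF assms(1)] by auto
 note h = yon_hom[OF P(1) assms(2,3)]
 show ?thesis
 proof (rule psh_ext[OF Psh.comp_hom[OF assms(1) h] yon_hom[OF P(2) assms(2) app_in[OF assms]]])
  fix z g assume z: "z \<in> Ob C" and g: "g \<in> ob (rep c) z"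
  hence g': "g \<in> hom C z c" by simp
  show "app (pcomp \<alpha> (yon C P c x)) z g = app (yon C Q c (app \<alpha> c x)) z g"
   using app_comp[OF assms(1) h z g] yon_app[OF z g'] app_nat[OF assms(1) g' assms(3)] by simp
 qed
qed

lemma yon_id: "P \<in> Ob (psh C) ==> c \<in> Ob C ==> x \<in> ob P c ==> app (yon C P c x) c (Id C c) = x"
 using yon_app[OF _ id_hom] act_id ob_psh by simp

lemma yar_full:
 assumes "\<alpha> \<in> phom (rep x) (rep y)" "x \<in> Ob C"
 shows "app \<alpha> x (Id C x) \<in> hom C x y" "\<alpha> = yar (app \<alpha> x (Id C x))"
proof -
 show h: "app \<alpha> x (Id C x) \<in> hom C x y" using app_in[OF assms, of "Id C x"] assms(2) id_hom by simp
 show "\<alpha> = yar (app \<alpha> x (Id C x))"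
  by (rule rep_hom_ext[OF assms(1) yar_hom[OF h]]) (simp add: yar_app[OF h assms(2) id_hom[OF assms(2)]] id_right[OF h])
qed

lemma yar_faithful:
 assumes "f \<in> hom C x y" "g \<in> hom C x y" "yar f = yar g" shows "f = g"
proof -
 have x: "x \<in> Ob C" using hom_ob[OF assms(1)] by simp
 have "f ** Id C x = g ** Id C x"
  using yar_app[OF assms(1) x id_hom[OF x]] yar_app[OF assms(2) x id_hom[OF x]] unfolding assms(3) by simp
 thus ?thesis unfolding id_right[OF assms(1)] id_right[OF assms(2)] .
qed

lemma yar_comp: "g \<in> hom C y z ==> f \<in> hom C x y ==> yar (g ** f) = pcomp (yar g) (yar f)"
 using yoneda_functor[OF category ls] unfolding is_functor_def by blast

lemma yar_id: "x \<in> Ob C ==> yar (Id C x) = Id (psh C) (rep x)"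
 using yoneda_functor[OF category ls] unfolding is_functor_def by (simp add: yoneda_def)

lemma psh_mono_inj:
 assumes m: "is_mono (psh C) m" "m \<in> phom P Q" and z: "z \<in> Ob C"
  and xy: "x \<in> ob P z" "y \<in> ob P z" "app m z x = app m z y"
 shows "x = y"
proof -
 have P: "P \<in> Ob (psh C)" using psh_hom[OF m(2)] by auto
 have "yon C P z x = yon C P z y"
  using Psh.monoD[OF m yon_hom[OF P z xy(1)] yon_hom[OF P z xy(2)]] comp_yon[OF m(2) z] xy by simp
 thus ?thesis using yon_id[OF P z] xy by metis
qed

lemma psh_monoI:
 assumes m: "m \<in> phom P Q" and inj: "\<And>z. z \<in> Ob C ==> inj_on (app m z) (ob P z)"
 shows "is_mono (psh C) m"
proof (rule Psh.monoI[OF m])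
 fix W r s assume r: "r \<in> phom W P" and s: "s \<in> phom W P" and e: "pcomp m r = pcomp m s"
 show "r = s"
 proof (rule psh_ext[OF r s])
  fix z x assume z: "z \<in> Ob C" "x \<in> ob W z"
  have "app m z (app r z x) = app m z (app s z x)" using app_comp[OF m r z] app_comp[OF m s z] e by simp
  thus "app r z x = app s z x" using inj[OF z(1)] app_in[OF r z] app_in[OF s z] by (auto simp: inj_on_def)
 qed
qed

section \<open>Full subcategories of presheaves containing the representables\<close>

definition fullin :: "(('o, 'u) presheaf, ('o, 'u) presheaf_arr) cat => bool" where
 "fullin E \<longleftrightarrow> category E \<and> Ob E \<subseteq> Ob (psh C) \<and> (\<forall>P \<in> Ob E. \<forall>Q \<in> Ob E. hom E P Q = phom P Q) \<and>
  Comp E = pcomp \<and> Id E = Id (psh C) \<and> Dom E = Dom (psh C) \<and> Cod E = Cod (psh C) \<and> (\<forall>c \<in> Ob C. rep c \<in> Ob E)"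

lemma fullin_psh: "fullin (psh C)"
 by (simp add: fullin_def Psh.category rep_ob)

lemma fullin_full_sub:
 assumes "fullin E" "\<And>c. c \<in> Ob C ==> rep c \<in> S"
 shows "fullin (full_sub E S)"
 using assms by (auto simp: fullin_def hom_full_sub intro: category_full_sub)

lemma fullinD:
 assumes "fullin E"
 shows "category E" "P \<in> Ob E ==> P \<in> Ob (psh C)" "P \<in> Ob E ==> Q \<in> Ob E ==> hom E P Q = phom P Q"
  "Comp E = pcomp" "Id E = Id (psh C)" "Dom E = Dom (psh C)" "Cod E = Cod (psh C)" "c \<in> Ob C ==> rep c \<in> Ob E"
 using assms by (auto simp: fullin_def)

lemma fullin_hom:
 assumes E: "fullin E" and f: "f \<in> hom E P Q"
 shows "P \<in> Ob E" "Q \<in> Ob E" "f \<in> phom P Q"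
proof -
 interpret E: cat E by (rule cat.intro) (rule fullinD[OF E])
 show P: "P \<in> Ob E" "Q \<in> Ob E" using E.hom_ob[OF f] by auto
 show "f \<in> phom P Q" using f fullinD(3)[OF E P] by simp
qed

lemma fullin_iso:
 assumes E: "fullin E" and PQ: "P \<in> Ob E" "Q \<in> Ob E" and f: "f \<in> phom P Q"
 shows "is_iso E f \<longleftrightarrow> is_iso (psh C) f"
proof -
 have "hom E P Q = phom P Q" "hom E Q P = phom Q P" using fullinD(3)[OF E] PQ by auto
 thus ?thesis using f fullinD[OF E] unfolding is_iso_def by (auto simp: hom_def)
qed

lemma yoneda_functor_in: assumes E: "fullin E" shows "is_functor C E (yoneda C)"
proof -
 have Y: "is_functor C (psh C) (yoneda C)" by (rule yoneda_functor[OF category ls])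
 have "ar (yoneda C) f \<in> hom E (ob (yoneda C) x) (ob (yoneda C) y)" if "f \<in> hom C x y" for f x y
  using yar_hom[OF that] fullinD(3)[OF E fullinD(8)[OF E] fullinD(8)[OF E]] hom_ob[OF that] by (simp add: yoneda_def)
 thus ?thesis using Y fullinD[OF E] unfolding is_functor_def by (simp add: yoneda_def)
qed

lemma limit_pointwise:
 assumes E: "fullin E" and D: "is_functor J E D" and L: "is_limit J E D P \<pi>" and z: "z \<in> Ob C"
  and x: "\<And>j. j \<in> Ob J ==> x j \<in> ob (ob D j) z"
  and xc: "\<And>j k u. u \<in> hom J j k ==> app (ar D u) z (x j) = x k"
 shows "\<exists>!y. y \<in> ob P z \<and> (\<forall>j \<in> Ob J. app (\<pi> j) z y = x j)"
proof -
 interpret J: cat J using D by (auto simp: is_functor_def cat_def)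
 have Dj: "ob D j \<in> Ob E" "ob D j \<in> Ob (psh C)" if "j \<in> Ob J" for j
  using D that fullinD(2)[OF E] by (auto simp: is_functor_def)
 note Du = fullin_hom(3)[OF E functorD(4)[OF D]]
 have P: "P \<in> Ob E" and pj: "\<And>j. j \<in> Ob J ==> \<pi> j \<in> phom P (ob D j)"
  using L fullin_hom(3)[OF E] by (auto simp: is_limit_def is_cone_def)
 have Pp: "P \<in> Ob (psh C)" using fullinD(2)[OF E P] .
 have rz: "rep z \<in> Ob E" using fullinD(8)[OF E z] .
 have yh: "yon C (ob D j) z (x j) \<in> hom E (rep z) (ob D j)" if "j \<in> Ob J" for j
  using yon_hom[OF Dj(2)[OF that] z x[OF that]] fullinD(3)[OF E rz Dj(1)[OF that]] by simp
 have "is_cone J E D (rep z) (\<lambda>j. yon C (ob D j) z (x j))"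
  unfolding is_cone_def
 proof (intro conjI ballI allI)
  fix j k u assume u: "u \<in> hom J j k"
  have jk: "j \<in> Ob J" "k \<in> Ob J" using J.hom_ob[OF u] by auto
  show "Comp E (ar D u) (yon C (ob D j) z (x j)) = yon C (ob D k) z (x k)"
   using comp_yon[OF Du[OF u] z x[OF jk(1)]] xc[OF u] fullinD(4)[OF E] by simp
 qed (use rz yh in auto)
 hence ex: "\<exists>!h. h \<in> hom E (rep z) P \<and> (\<forall>j\<in>Ob J. Comp E (\<pi> j) h = yon C (ob D j) z (x j))"
  using L unfolding is_limit_def by blast
 then obtain h where h: "h \<in> hom E (rep z) P" "\<And>j. j \<in> Ob J ==> Comp E (\<pi> j) h = yon C (ob D j) z (x j)"
  by blast
 have h': "h \<in> phom (rep z) P" using fullin_hom(3)[OF E h(1)] .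
 have idz: "Id C z \<in> ob (rep z) z" using id_hom[OF z] z by simp
 show ?thesis
 proof (intro ex1I[of _ "app h z (Id C z)"] conjI ballI)
  show "app h z (Id C z) \<in> ob P z" by (rule app_in[OF h' z idz])
  fix j assume j: "j \<in> Ob J"
  show "app (\<pi> j) z (app h z (Id C z)) = x j"
   using app_comp[OF pj[OF j] h' z idz] h(2)[OF j] yon_id[OF Dj(2)[OF j] z x[OF j]] fullinD(4)[OF E] by simp
 next
  fix y assume y: "y \<in> ob P z \<and> (\<forall>j\<in>Ob J. app (\<pi> j) z y = x j)"
  have "yon C P z y \<in> hom E (rep z) P" using yon_hom[OF Pp z] y fullinD(3)[OF E rz P] by simp
  moreover have "\<forall>j\<in>Ob J. Comp E (\<pi> j) (yon C P z y) = yon C (ob D j) z (x j)"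
   using comp_yon[OF pj z] y fullinD(4)[OF E] by simp
  ultimately have "yon C P z y = h" using ex h by blast
  thus "y = app h z (Id C z)" using yon_id[OF Pp z] y by auto
 qed
qed

lemma pullback_pointwise:
 assumes E: "fullin E" and PB: "is_pullback E f g p q" and f: "f \<in> hom E P R" and g: "g \<in> hom E Q R"
  and z: "z \<in> Ob C" and x: "x \<in> ob P z" and y: "y \<in> ob Q z" and e: "app f z x = app g z y"
 obtains w where "w \<in> ob (Dom E p) z" "app p z w = x" "app q z w = y"
proof -
 interpret E: cat E by (rule cat.intro) (rule fullinD[OF E])
 note fh = fullin_hom[OF E f] and gh = fullin_hom[OF E g]
 have d: "Dom E g = Q" using g by (auto simp: hom_def)
 note p = E.pullbackD[OF PB f, unfolded d]
 have rz: "rep z \<in> Ob E" using fullinD(8)[OF E z] .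
 have "yon C P z x \<in> hom E (rep z) P" "yon C Q z y \<in> hom E (rep z) Q"
  using yon_hom[OF fullinD(2)[OF E] z] fh gh x y fullinD(3)[OF E rz] by auto
 moreover have "Comp E f (yon C P z x) = Comp E g (yon C Q z y)"
  using comp_yon[OF fh(3) z x] comp_yon[OF gh(3) z y] e fullinD(4)[OF E] by simp
 ultimately obtain h where h: "h \<in> hom E (rep z) (Dom E p)" "Comp E p h = yon C P z x" "Comp E q h = yon C Q z y"
  by (rule E.pullback_univ[OF PB f g])
 have h': "h \<in> phom (rep z) (Dom E p)" using fullin_hom(3)[OF E h(1)] .
 have idz: "Id C z \<in> ob (rep z) z" using id_hom[OF z] z by simp
 have "app p z (app h z (Id C z)) = x"
  using app_comp[OF fullin_hom(3)[OF E p(1)] h' z idz] h(2) yon_id[OF fullinD(2)[OF E fh(1)] z x] fullinD(4)[OF E] by simp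
 moreover have "app q z (app h z (Id C z)) = y"
  using app_comp[OF fullin_hom(3)[OF E p(2)] h' z idz] h(3) yon_id[OF fullinD(2)[OF E gh(1)] z y] fullinD(4)[OF E] by simp
 ultimately show ?thesis using that app_in[OF h' z idz] by blast
qed

lemma yoneda_lex: assumes E: "fullin E" shows "preserves_finite_limits C E (yoneda C)"
 unfolding preserves_finite_limits_def
proof (intro allI impI)
 fix J :: "(nat, nat) cat" and D l \<pi> assume A: "finite_category J \<and> is_functor J C D \<and> is_limit J C D l \<pi>"
 hence D: "is_functor J C D" and L: "is_limit J C D l \<pi>" by auto
 interpret E: cat E by (rule cat.intro) (rule fullinD[OF E])
 interpret J: cat J using D by (auto simp: is_functor_def cat_def)
 have l: "l \<in> Ob C" and pj: "\<And>j. j \<in> Ob J ==> \<pi> j \<in> hom C l (ob D j)"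
  and pu: "\<And>j k u. u \<in> hom J j k ==> ar D u ** \<pi> j = \<pi> k"
  using L by (auto simp: is_limit_def is_cone_def)
 note Du = functorD(4)[OF D]
 note Dj = functorD(3)[OF D]
 have yE: "yar f \<in> hom E (rep x) (rep y)" if "f \<in> hom C x y" for f x y
  using yoneda_functor_in[OF E] that by (auto simp: is_functor_def yoneda_def)
 show "is_limit J E (comp_func (yoneda C) D) (ob (yoneda C) l) (\<lambda>j. yar (\<pi> j))"
  unfolding is_limit_def
 proof (intro conjI allI impI)
  show "is_cone J E (comp_func (yoneda C) D) (ob (yoneda C) l) (\<lambda>j. yar (\<pi> j))"
   unfolding is_cone_def
  proof (intro conjI ballI allI)
   show "ob (yoneda C) l \<in> Ob E" using fullinD(8)[OF E l] by (simp add: yoneda_def)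
   show "yar (\<pi> j) \<in> hom E (ob (yoneda C) l) (ob (comp_func (yoneda C) D) j)" if "j \<in> Ob J" for j
    using yE[OF pj[OF that]] by (simp add: yoneda_def comp_func_def)
   show "Comp E (ar (comp_func (yoneda C) D) u) (yar (\<pi> j)) = yar (\<pi> k)" if u: "u \<in> hom J j k" for u j k
    using yar_comp[OF Du[OF u] pj] pu[OF u] J.hom_ob[OF u] fullinD(4)[OF E] by (simp add: comp_func_def)
  qed
  fix M \<rho> assume c: "is_cone J E (comp_func (yoneda C) D) M \<rho>"
  have M: "M \<in> Ob E" using c by (simp add: is_cone_def)
  have Mp: "M \<in> Ob (psh C)" using fullinD(2)[OF E M] .
  have rj: "\<rho> j \<in> phom M (rep (ob D j))" if "j \<in> Ob J" for j
   using c that fullin_hom(3)[OF E] by (auto simp: is_cone_def comp_func_def yoneda_def)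
  have ru: "pcomp (yar (ar D u)) (\<rho> j) = \<rho> k" if "u \<in> hom J j k" for u j k
   using c that fullinD(4)[OF E] by (auto simp: is_cone_def comp_func_def)
  have ex: "\<exists>!h. h \<in> hom C z l \<and> (\<forall>j\<in>Ob J. \<pi> j ** h = app (\<rho> j) z x)" if z: "z \<in> Ob C" and x: "x \<in> ob M z" for z x
  proof -
   have r: "app (\<rho> j) z x \<in> hom C z (ob D j)" if "j \<in> Ob J" for j using app_in[OF rj[OF that] z x] z by simp
   have "is_cone J C D z (\<lambda>j. app (\<rho> j) z x)"
    unfolding is_cone_def
   proof (intro conjI ballI allI)
    fix j k u assume u: "u \<in> hom J j k"
    hence jk: "j \<in> Ob J" "k \<in> Ob J" using J.hom_ob by auto
    show "ar D u ** app (\<rho> j) z x = app (\<rho> k) z x"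
     using app_comp[OF yar_hom[OF Du[OF u]] rj[OF jk(1)] z x] ru[OF u] yar_app[OF Du[OF u] z r[OF jk(1)]] by simp
   qed (use z r in auto)
   thus ?thesis using L unfolding is_limit_def by blast
  qed
  define t where "t z x = (THE h. h \<in> hom C z l \<and> (\<forall>j\<in>Ob J. \<pi> j ** h = app (\<rho> j) z x))" for z x
  have t: "t z x \<in> hom C z l" "\<And>j. j \<in> Ob J ==> \<pi> j ** t z x = app (\<rho> j) z x"
   "\<And>h. h \<in> hom C z l ==> (\<And>j. j \<in> Ob J ==> \<pi> j ** h = app (\<rho> j) z x) ==> h = t z x"
   if "z \<in> Ob C" "x \<in> ob M z" for z x
  proof -
   have "t z x \<in> hom C z l \<and> (\<forall>j\<in>Ob J. \<pi> j ** t z x = app (\<rho> j) z x)"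
    unfolding t_def by (rule theI'[OF ex[OF that]])
   thus "t z x \<in> hom C z l" "\<And>j. j \<in> Ob J ==> \<pi> j ** t z x = app (\<rho> j) z x" by blast+
   show "h = t z x" if "h \<in> hom C z l" "\<And>j. j \<in> Ob J ==> \<pi> j ** h = app (\<rho> j) z x" for h
    unfolding t_def by (rule the1_equality[OF ex[OF \<open>z \<in> Ob C\<close> \<open>x \<in> ob M z\<close>], symmetric]) (use that in blast)
  qed
  have th: "mk_arr C M (rep l) t \<in> phom M (rep l)"
  proof (rule mk_arr_homI[OF Mp rep_ob[OF l]])
   show "t z x \<in> ob (rep l) z" if "z \<in> Ob C" "x \<in> ob M z" for z x using t(1)[OF that] that by simp
   fix w z f x assume f: "f \<in> hom C w z" and x: "x \<in> ob M z"
   have wz: "w \<in> Ob C" "z \<in> Ob C" using hom_ob[OF f] by auto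
   note fx = act_in[OF ob_psh[OF Mp] f x]
   have "t z x ** f = t w (act M f x)"
   proof (rule t(3)[OF wz(1) fx comp_hom[OF t(1)[OF wz(2) x] f]])
    fix j assume j: "j \<in> Ob J"
    have "app (\<rho> j) z x \<in> hom C z (ob D j)" using app_in[OF rj[OF j] wz(2) x] wz by simp
    thus "\<pi> j ** t z x ** f = app (\<rho> j) w (act M f x)"
     using assoc[OF pj[OF j] t(1)[OF wz(2) x] f] t(2)[OF wz(2) x j] app_nat[OF rj[OF j] f x] rep_act[OF f] by simp
   qed
   thus "t w (act M f x) = act (rep l) f (t z x)" using rep_act[OF f t(1)[OF wz(2) x]] by simp
  qed
  have hE: "hom E M (rep l) = phom M (rep l)" using fullinD(3)[OF E M fullinD(8)[OF E l]] .
  show "\<exists>!h. h \<in> hom E M (ob (yoneda C) l) \<and> (\<forall>j\<in>Ob J. Comp E (yar (\<pi> j)) h = \<rho> j)"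
  proof (intro ex1I[of _ "mk_arr C M (rep l) t"] conjI ballI)
   show "mk_arr C M (rep l) t \<in> hom E M (ob (yoneda C) l)" using th hE by (simp add: yoneda_def)
   fix j assume j: "j \<in> Ob J"
   have "pcomp (yar (\<pi> j)) (mk_arr C M (rep l) t) = \<rho> j"
   proof (rule psh_ext[OF Psh.comp_hom[OF yar_hom[OF pj[OF j]] th] rj[OF j]])
    fix z x assume zx: "z \<in> Ob C" "x \<in> ob M z"
    show "app (pcomp (yar (\<pi> j)) (mk_arr C M (rep l) t)) z x = app (\<rho> j) z x"
     using app_comp[OF yar_hom[OF pj[OF j]] th zx] zx yar_app[OF pj[OF j] zx(1) t(1)[OF zx]] t(2)[OF zx j] by simp
   qed
   thus "Comp E (yar (\<pi> j)) (mk_arr C M (rep l) t) = \<rho> j" using fullinD(4)[OF E] by simp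
  next
   fix h assume h: "h \<in> hom E M (ob (yoneda C) l) \<and> (\<forall>j\<in>Ob J. Comp E (yar (\<pi> j)) h = \<rho> j)"
   hence h': "h \<in> phom M (rep l)" using hE by (simp add: yoneda_def)
   show "h = mk_arr C M (rep l) t"
   proof (rule psh_ext[OF h' th])
    fix z x assume zx: "z \<in> Ob C" "x \<in> ob M z"
    have hz: "app h z x \<in> hom C z l" using app_in[OF h' zx] zx by simp
    have "app h z x = t z x"
    proof (rule t(3)[OF zx hz])
     fix j assume j: "j \<in> Ob J"
     show "\<pi> j ** app h z x = app (\<rho> j) z x"
      using app_comp[OF yar_hom[OF pj[OF j]] h' zx] h j yar_app[OF pj[OF j] zx(1) hz] fullinD(4)[OF E] by simp
    qed
    thus "app h z x = app (mk_arr C M (rep l) t) z x" using zx by simp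
   qed
  qed
 qed
qed

end

section \<open>Small presheaves\<close>

definition generated_on :: "('o, 'u) cat => 'o set => ('o, 'u) presheaf => bool" where
 "generated_on C S P \<longleftrightarrow> (\<forall>z \<in> Ob C. \<forall>x \<in> ob P z. \<exists>w \<in> S. \<exists>y \<in> ob P w. \<exists>f \<in> hom C z w. x = act P f y)"

definition kan_on :: "('o, 'u) cat => 'o set => ('o, 'u) presheaf => bool" where
 "kan_on C S P \<longleftrightarrow> generated_on C S P \<and>
  (\<forall>G t. is_functor (op_cat C) set_cat G \<and> natl C S P G t -->
   (\<exists>s. natl C (Ob C) P G s \<and> (\<forall>z \<in> S. \<forall>x \<in> ob P z. s z x = t z x)))"

definition comps :: "'o set => ('o, 'u) presheaf => ('o, 'u) presheaf => ('o => 'u => 'u) => 'o => 'u set_arr" where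
 "comps S P G t = (\<lambda>z \<in> S. (ob P z, \<lambda>x \<in> ob P z. t z x, ob G z))"

lemma natlD:
 assumes "natl C S P Q t" "z \<in> S" "x \<in> ob P z"
 shows "t z x \<in> ob Q z" "w \<in> S ==> f \<in> hom C w z ==> t w (act P f x) = act Q f (t z x)"
 using assms unfolding natl_def by blast+

lemma natl_subset: "natl C S P Q t ==> S' \<subseteq> S ==> natl C S' P Q t"
 unfolding natl_def by blast

lemma natl_comp:
 assumes s: "natl C S P Q s" and t: "natl C S Q R t"
 shows "natl C S P R (\<lambda>z x. t z (s z x))"
 unfolding natl_def using natlD[OF s] natlD[OF t] by simp

lemma comp_func_id_func [simp]: "comp_func P id_func = P"
 by (simp add: comp_func_def id_func_def)

lemma id_func_ob [simp]: "ob id_func x = x"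
 by (simp add: id_func_def)

context pcat
begin

lemma kan_on_unique:
 assumes K: "generated_on C S P" and s: "natl C (Ob C) P G s" "natl C (Ob C) P G s'" and S: "S \<subseteq> Ob C"
  and e: "\<And>z x. z \<in> S ==> x \<in> ob P z ==> s z x = s' z x" and z: "z \<in> Ob C" and x: "x \<in> ob P z"
 shows "s z x = s' z x"
proof -
 obtain w y f where w: "w \<in> S" "y \<in> ob P w" "f \<in> hom C z w" "x = act P f y"
  using K z x unfolding generated_on_def by blast
 have wO: "w \<in> Ob C" using w S by blast
 show ?thesis unfolding w(4) using natlD(2)[OF s(1) wO w(2) z w(3)] natlD(2)[OF s(2) wO w(2) z w(3)] e[OF w(1,2)] by simp
qed

lemma full_sub_Ob: "full_sub C (Ob C) = C"
proof -
 have "{f \<in> Arr C. Dom C f \<in> Ob C \<and> Cod C f \<in> Ob C} = Arr C" using dom_ob cod_ob by blast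
 thus ?thesis by (simp add: full_sub_def)
qed

lemma op_full_hom: "hom (op_cat (full_sub C S)) x y = (if x \<in> S \<and> y \<in> S then hom C y x else {})"
proof -
 have "hom (op_cat (full_sub C S)) x y = hom (full_sub C S) y x" by (auto simp: hom_def op_cat_def)
 thus ?thesis by (simp add: hom_full_sub)
qed

lemma nat_trans_elementwise:
 assumes P: "is_psh P" and G: "is_psh G" and S: "S \<subseteq> Ob C"
 shows "nat_trans (op_cat (full_sub C S)) set_cat P G \<tau> \<longleftrightarrow> (\<exists>t. natl C S P G t \<and> \<tau> = comps S P G t)"
proof
 have ob: "Ob (op_cat (full_sub C S)) = S" using S by (auto simp: op_cat_def)
 assume nt: "nat_trans (op_cat (full_sub C S)) set_cat P G \<tau>"
 define t where "t z x = set_app (\<tau> z) x" for z x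
 have tz: "\<tau> z = (ob P z, \<lambda>x\<in>ob P z. t z x, ob G z)"
  "\<And>x. x \<in> ob P z ==> t z x \<in> ob G z" if "z \<in> S" for z
 proof -
  have "\<tau> z \<in> hom set_cat (ob P z) (ob G z)" using nt that by (auto simp: nat_trans_def ob)
  then obtain h where h: "h \<in> ob P z \<rightarrow>\<^sub>E ob G z" "\<tau> z = (ob P z, h, ob G z)"
   by (auto simp: set_cat_hom)
  moreover have "t z = h" using h by (auto simp: t_def set_app_def)
  ultimately show "\<tau> z = (ob P z, \<lambda>x\<in>ob P z. t z x, ob G z)"
   "\<And>x. x \<in> ob P z ==> t z x \<in> ob G z" by (auto simp: PiE_def extensional_restrict)
 qed
 have "natl C S P G t"
  unfolding natl_def
 proof (intro conjI ballI)
  fix z w f x assume h: "z \<in> S" "w \<in> S" "f \<in> hom C w z" "x \<in> ob P z"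
  have "f \<in> hom (op_cat (full_sub C S)) z w" using h by (simp add: op_full_hom)
  hence "Comp set_cat (\<tau> w) (ar P f) = Comp set_cat (ar G f) (\<tau> z)"
   using nt unfolding nat_trans_def by blast
  hence "compose (ob P z) (restrict (t w) (ob P w)) (restrict (act P f) (ob P z)) x
   = compose (ob P z) (restrict (act G f) (ob G z)) (restrict (t z) (ob P z)) x"
   using tz(1)[OF h(1)] tz(1)[OF h(2)] psh_ar[OF P h(3)] psh_ar[OF G h(3)] by (simp add: set_cat_def)
  thus "t w (act P f x) = act G f (t z x)"
   using h tz(2) act_in[OF P h(3,4)] by (simp add: compose_def)
 qed (rule tz(2))
 moreover have "\<tau> = comps S P G t"
  using nt tz(1) unfolding nat_trans_def ob comps_def by (auto simp: fun_eq_iff extensional_def)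
 ultimately show "\<exists>t. natl C S P G t \<and> \<tau> = comps S P G t" by blast
next
 have ob: "Ob (op_cat (full_sub C S)) = S" using S by (auto simp: op_cat_def)
 assume "\<exists>t. natl C S P G t \<and> \<tau> = comps S P G t"
 then obtain t where t: "natl C S P G t" "\<tau> = comps S P G t" by blast
 show "nat_trans (op_cat (full_sub C S)) set_cat P G \<tau>"
  unfolding nat_trans_def ob t(2)
 proof (intro conjI ballI allI)
  fix x assume x: "x \<in> S"
  thus "comps S P G t x \<in> hom set_cat (ob P x) (ob G x)"
   using psh_small[OF P, of x] psh_small[OF G, of x] natlD(1)[OF t(1) x] S by (auto simp: set_cat_hom comps_def)
 next
  fix x y f assume "f \<in> hom (op_cat (full_sub C S)) x y"
  hence f: "f \<in> hom C y x" "x \<in> S" "y \<in> S" by (auto simp: op_full_hom split: if_splits)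
  show "Comp set_cat (comps S P G t y) (ar P f) = Comp set_cat (ar G f) (comps S P G t x)"
   using f psh_ar[OF P f(1)] psh_ar[OF G f(1)] natlD[OF t(1) f(2)] act_in[OF P f(1)]
   by (auto simp: set_cat_def compose_def restrict_def fun_eq_iff comps_def)
 qed (simp add: comps_def)
qed

lemma nat_trans_elementwise_all:
 assumes "is_psh P" "is_psh G"
 shows "nat_trans (op_cat C) set_cat P G \<tau> \<longleftrightarrow> (\<exists>t. natl C (Ob C) P G t \<and> \<tau> = comps (Ob C) P G t)"
 using nat_trans_elementwise[OF assms subset_refl] by (simp add: full_sub_Ob)

lemma comps_eq_iff: "comps S P G t = comps S P G t' \<longleftrightarrow> (\<forall>z\<in>S. \<forall>x\<in>ob P z. t z x = t' z x)"
 by (auto simp: comps_def restrict_def fun_eq_iff)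

lemma comps_comp:
 assumes "S \<subseteq> S'" "natl C S P Q e" "z \<in> S"
 shows "Comp set_cat (comps S' Q G s z) (comps S P Q e z) = (ob P z, \<lambda>x\<in>ob P z. s z (e z x), ob G z)"
 using assms natlD(1)[OF assms(2,3)] by (auto simp: comps_def set_cat_def compose_def restrict_def fun_eq_iff)

lemma restricted_functor:
 assumes P: "is_psh P"
 shows "is_functor (op_cat (full_sub C S)) (op_cat C) id_func" "is_functor (op_cat (full_sub C S)) set_cat P"
proof -
 have cat: "category (op_cat (full_sub C S))" by (intro category_op category_full_sub category)
 have h: "hom (op_cat (full_sub C S)) x y \<subseteq> hom (op_cat C) x y" for x y by (auto simp: op_full_hom op_hom)
 have ob: "Ob (op_cat (full_sub C S)) \<subseteq> Ob (op_cat C)" "Id (op_cat (full_sub C S)) = Id (op_cat C)"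
  "Comp (op_cat (full_sub C S)) = Comp (op_cat C)" by (auto simp: op_cat_def)
 show "is_functor (op_cat (full_sub C S)) (op_cat C) id_func"
  using cat h ob category_op[OF category] unfolding is_functor_def id_func_def by auto
 show "is_functor (op_cat (full_sub C S)) set_cat P"
  unfolding is_functor_def
 proof (intro conjI ballI allI)
  fix x y z f g assume "f \<in> hom (op_cat (full_sub C S)) x y" "g \<in> hom (op_cat (full_sub C S)) y z"
  hence "f \<in> hom (op_cat C) x y" "g \<in> hom (op_cat C) y z" using h by blast+
  thus "ar P (Comp (op_cat (full_sub C S)) g f) = Comp set_cat (ar P g) (ar P f)"
   using P ob(3) unfolding is_functor_def by simp
 qed (use cat h ob P in "auto simp: is_functor_def subset_iff")
qed

text \<open>The unit of a Kan extension along a full inclusion is invertible: the image of the unit generates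
  a subpresheaf into which the identity factors, and the identity also extends.\<close>

lemma small_presheaf_kan:
 assumes sp: "small_presheaf C P"
 obtains S where "S \<subseteq> Ob C" "small TYPE('u) S" "kan_on C S P"
proof -
 have Pob: "P \<in> Ob (psh C)" using sp by (simp add: small_presheaf_def)
 have P: "is_psh P" using ob_psh[OF Pob] .
 obtain S \<eta> where S: "S \<subseteq> Ob C" "small TYPE('u) S"
  and lan: "is_left_kan_extension (op_cat (full_sub C S)) (op_cat C) set_cat id_func P P \<eta>"
  using sp unfolding small_presheaf_def by auto
 have nt: "nat_trans (op_cat (full_sub C S)) set_cat P P \<eta>" using lan by (simp add: is_left_kan_extension_def)
 obtain e where e: "natl C S P P e" "\<eta> = comps S P P e"
  using nt unfolding nat_trans_elementwise[OF P P S(1)] by blast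
 have ob: "Ob (op_cat (full_sub C S)) = S" using S by (auto simp: op_cat_def)
 have univ: "\<exists>!\<sigma>. nat_trans (op_cat C) set_cat P G \<sigma> \<and> (\<forall>a\<in>S. Comp set_cat (\<sigma> a) (\<eta> a) = comps S P G t a)"
  if G: "is_psh G" and t: "natl C S P G t" for G t
 proof -
  have "nat_trans (op_cat (full_sub C S)) set_cat P G (comps S P G t)"
   unfolding nat_trans_elementwise[OF P G S(1)] using t by blast
  thus ?thesis using lan G unfolding is_left_kan_extension_def ob by simp
 qed
 have agree: "(\<forall>a\<in>S. Comp set_cat (comps (Ob C) P G s a) (\<eta> a) = comps S P G t a) \<longleftrightarrow>
   (\<forall>z\<in>S. \<forall>x\<in>ob P z. s z (e z x) = t z x)" for G s t
  unfolding e(2) using comps_comp[OF S(1) e(1)] by (simp add: comps_def restrict_def fun_eq_iff) metis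
 have ex: "\<exists>s. natl C (Ob C) P G s \<and> (\<forall>z\<in>S. \<forall>x\<in>ob P z. s z (e z x) = t z x)"
  if G: "is_psh G" and t: "natl C S P G t" for G t
 proof -
  obtain \<sigma> where "nat_trans (op_cat C) set_cat P G \<sigma>" "\<forall>a\<in>S. Comp set_cat (\<sigma> a) (\<eta> a) = comps S P G t a"
   using univ[OF G t] by blast
  thus ?thesis unfolding nat_trans_elementwise_all[OF P G] using agree by blast
 qed
 have uniq: "s z x = s' z x" if G: "is_psh G" and s: "natl C (Ob C) P G s" "natl C (Ob C) P G s'"
   and eq: "\<And>z x. z \<in> S ==> x \<in> ob P z ==> s z (e z x) = s' z (e z x)" and zx: "z \<in> Ob C" "x \<in> ob P z"
  for G s s' z x
 proof -
  have t: "natl C S P G (\<lambda>z x. s z (e z x))" by (rule natl_comp[OF e(1) natl_subset[OF s(1) S(1)]])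
  have "nat_trans (op_cat C) set_cat P G (comps (Ob C) P G s)" "nat_trans (op_cat C) set_cat P G (comps (Ob C) P G s')"
   unfolding nat_trans_elementwise_all[OF P G] using s by blast+
  moreover have "\<forall>a\<in>S. Comp set_cat (comps (Ob C) P G s a) (\<eta> a) = comps S P G (\<lambda>z x. s z (e z x)) a"
   "\<forall>a\<in>S. Comp set_cat (comps (Ob C) P G s' a) (\<eta> a) = comps S P G (\<lambda>z x. s z (e z x)) a"
   unfolding agree using eq by simp_all
  ultimately have "comps (Ob C) P G s = comps (Ob C) P G s'" using univ[OF G t] by blast
  thus ?thesis unfolding comps_eq_iff using zx by blast
 qed
 define I where "I z = {x \<in> ob P z. \<exists>w\<in>S. \<exists>y\<in>ob P w. \<exists>f\<in>hom C z w. x = act P f (e w y)}" for z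
 have Iob: "mk_psh C I (act P) \<in> Ob (psh C)"
 proof (rule mk_psh_ob)
  show "small TYPE('u) (I z)" if "z \<in> Ob C" for z
   by (rule small_subset[OF psh_small[OF P that]]) (auto simp: I_def)
  show "act P (Id C z) x = x" if "z \<in> Ob C" "x \<in> I z" for z x
   by (rule act_id[OF P]) (use that in "auto simp: I_def")
  show "act P (f ** g) x = act P g (act P f x)" if "f \<in> hom C w z" "g \<in> hom C v w" "x \<in> I z" for v w z f g x
   by (rule act_comp[OF P that(1,2)]) (use that in "auto simp: I_def")
  fix w z f x assume f: "f \<in> hom C w z" and x: "x \<in> I z"
  obtain v y g where v: "v \<in> S" "y \<in> ob P v" "g \<in> hom C z v" "x = act P g (e v y)" using x by (auto simp: I_def)
  have "act P f x = act P (g ** f) (e v y)" using act_comp[OF P v(3) f natlD(1)[OF e(1) v(1,2)]] v(4) by simp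
  moreover have "act P f x \<in> ob P w" using act_in[OF P f] x by (simp add: I_def)
  ultimately show "act P f x \<in> I w" using v(1,2) comp_hom[OF v(3) f] unfolding I_def by blast
 qed
 have eI: "e z x \<in> I z" if z: "z \<in> S" and x: "x \<in> ob P z" for z x
 proof -
  have "z \<in> Ob C" using z S by blast
  thus ?thesis using natlD(1)[OF e(1) z x] act_id[OF P _ natlD(1)[OF e(1) z x]] id_hom z x unfolding I_def by force
 qed
 have "natl C S P (mk_psh C I (act P)) e"
  unfolding natl_def
 proof (intro conjI ballI)
  show "e z x \<in> ob (mk_psh C I (act P)) z" if "z \<in> S" "x \<in> ob P z" for z x
   using eI[OF that] that S by (simp add: subset_iff)
  show "e w (act P f x) = act (mk_psh C I (act P)) f (e z x)"
   if "z \<in> S" "w \<in> S" "f \<in> hom C w z" "x \<in> ob P z" for z w f x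
   using natlD(2)[OF e(1) that(1,4,2,3)] mk_psh_act[OF that(3), of "e z x" I] eI[OF that(1,4)] by simp
 qed
 then obtain s where s: "natl C (Ob C) P (mk_psh C I (act P)) s" "\<And>z x. z \<in> S ==> x \<in> ob P z ==> s z (e z x) = e z x"
  using ex[OF ob_psh[OF Iob]] by blast
 have sI: "s z x \<in> I z" if "z \<in> Ob C" "x \<in> ob P z" for z x using natlD(1)[OF s(1) that] that by simp
 have sP: "natl C (Ob C) P P s"
  unfolding natl_def
 proof (intro conjI ballI)
  show "s z x \<in> ob P z" if "z \<in> Ob C" "x \<in> ob P z" for z x using sI[OF that] by (simp add: I_def)
  show "s w (act P f x) = act P f (s z x)"
   if "z \<in> Ob C" "w \<in> Ob C" "f \<in> hom C w z" "x \<in> ob P z" for z w f x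
   using natlD(2)[OF s(1) that(1,4,2,3)] mk_psh_act[OF that(3), of "s z x" I] sI[OF that(1,4)] by simp
 qed
 have idP: "natl C (Ob C) P P (\<lambda>z x. x)" by (simp add: natl_def)
 have PI: "x \<in> I z" if "z \<in> Ob C" "x \<in> ob P z" for z x
  using uniq[OF P sP idP s(2) that] sI[OF that] by simp
 have "generated_on C S P"
  unfolding generated_on_def using PI natlD(1)[OF e(1)] unfolding I_def by blast
 moreover have "\<exists>s. natl C (Ob C) P G s \<and> (\<forall>z\<in>S. \<forall>x\<in>ob P z. s z x = t z x)"
  if G: "is_psh G" and t: "natl C S P G t" for G t
 proof -
  obtain s where s: "natl C (Ob C) P G s" "\<And>z x. z \<in> S ==> x \<in> ob P z ==> s z (e z x) = t z (e z x)"
   using ex[OF G natl_comp[OF e(1) t]] by blast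
  have "s z x = t z x" if z: "z \<in> S" and x: "x \<in> ob P z" for z x
  proof -
   have "x \<in> I z" using PI z x S by blast
   then obtain w y f where w: "w \<in> S" "y \<in> ob P w" "f \<in> hom C z w" "x = act P f (e w y)"
    by (auto simp: I_def)
   have "x = e z (act P f y)" using natlD(2)[OF e(1) w(1,2) z w(3)] w(4) by simp
   thus ?thesis using s(2)[OF z act_in[OF P w(3,2)]] by simp
  qed
  thus ?thesis using s(1) by blast
 qed
 ultimately have "kan_on C S P" unfolding kan_on_def by blast
 thus ?thesis using that S by blast
qed

lemma kan_small_presheaf:
 assumes Pob: "P \<in> Ob (psh C)" and S: "S \<subseteq> Ob C" "small TYPE('u) S" and K: "kan_on C S P"
 shows "small_presheaf C P"
proof -
 have P: "is_psh P" using ob_psh[OF Pob] .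
 have ob: "Ob (op_cat (full_sub C S)) = S" using S by (auto simp: op_cat_def)
 have gen: "generated_on C S P" using K by (simp add: kan_on_def)
 have idP: "natl C S P P (\<lambda>z x. x)" by (simp add: natl_def)
 define \<eta> where "\<eta> = comps S P P (\<lambda>z x. x)"
 have agree: "(\<forall>a\<in>S. Comp set_cat (comps (Ob C) P G s a) (\<eta> a) = comps S P G t a) \<longleftrightarrow>
   (\<forall>z\<in>S. \<forall>x\<in>ob P z. s z x = t z x)" for G s t
  unfolding \<eta>_def using comps_comp[OF S(1) idP] by (simp add: comps_def restrict_def fun_eq_iff) metis
 have "is_left_kan_extension (op_cat (full_sub C S)) (op_cat C) set_cat id_func (comp_func P id_func) P \<eta>"
  unfolding is_left_kan_extension_def comp_func_id_func ob
 proof (intro conjI allI impI)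
  show "nat_trans (op_cat (full_sub C S)) set_cat P P \<eta>"
   unfolding nat_trans_elementwise[OF P P S(1)] \<eta>_def using idP by blast
  fix G \<tau> assume A: "is_functor (op_cat C) set_cat G \<and> nat_trans (op_cat (full_sub C S)) set_cat P G \<tau>"
  hence G: "is_psh G" by blast
  obtain t where t: "natl C S P G t" "\<tau> = comps S P G t" using A unfolding nat_trans_elementwise[OF P G S(1)] by blast
  obtain s where s: "natl C (Ob C) P G s" "\<And>z x. z \<in> S ==> x \<in> ob P z ==> s z x = t z x"
   using K G t(1) unfolding kan_on_def by blast
  show "\<exists>!\<sigma>. nat_trans (op_cat C) set_cat P G \<sigma> \<and> (\<forall>a\<in>S. Comp set_cat (\<sigma> (ob id_func a)) (\<eta> a) = \<tau> a)"
  proof (rule ex1I[of _ "comps (Ob C) P G s"])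
   have "\<forall>a\<in>S. Comp set_cat (comps (Ob C) P G s a) (\<eta> a) = \<tau> a" unfolding t(2) agree using s(2) by blast
   thus "nat_trans (op_cat C) set_cat P G (comps (Ob C) P G s) \<and>
     (\<forall>a\<in>S. Comp set_cat (comps (Ob C) P G s (ob id_func a)) (\<eta> a) = \<tau> a)"
    unfolding nat_trans_elementwise_all[OF P G] using s(1) by (auto simp: id_func_def)
   fix \<sigma> assume sg: "nat_trans (op_cat C) set_cat P G \<sigma> \<and> (\<forall>a\<in>S. Comp set_cat (\<sigma> (ob id_func a)) (\<eta> a) = \<tau> a)"
   then obtain s' where s': "natl C (Ob C) P G s'" "\<sigma> = comps (Ob C) P G s'"
    unfolding nat_trans_elementwise_all[OF P G] by blast
   have "\<forall>a\<in>S. Comp set_cat (comps (Ob C) P G s' a) (\<eta> a) = comps S P G t a"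
    using sg unfolding s'(2) t(2) by (simp add: id_func_def)
   hence "\<And>z x. z \<in> S ==> x \<in> ob P z ==> s' z x = s z x" unfolding agree using s(2) by simp
   hence "\<forall>z\<in>Ob C. \<forall>x\<in>ob P z. s' z x = s z x" using kan_on_unique[OF gen s'(1) s(1) S(1)] by blast
   thus "\<sigma> = comps (Ob C) P G s" unfolding s'(2) comps_eq_iff .
  qed
 qed (use restricted_functor[OF P] P in auto)
 thus ?thesis unfolding small_presheaf_def using Pob S by blast
qed

lemma kan_on_mono:
 assumes P: "is_psh P" and K: "kan_on C S P" and S: "S \<subseteq> S'" "S' \<subseteq> Ob C"
 shows "kan_on C S' P"
proof -
 have gen: "generated_on C S P" using K by (simp add: kan_on_def)
 have "\<exists>s. natl C (Ob C) P G s \<and> (\<forall>z\<in>S'. \<forall>x\<in>ob P z. s z x = t z x)"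
  if G: "is_psh G" and t: "natl C S' P G t" for G t
 proof -
  obtain s where s: "natl C (Ob C) P G s" "\<And>z x. z \<in> S ==> x \<in> ob P z ==> s z x = t z x"
   using K G natl_subset[OF t S(1)] unfolding kan_on_def by blast
  have "s z x = t z x" if z: "z \<in> S'" and x: "x \<in> ob P z" for z x
  proof -
   have zO: "z \<in> Ob C" using z S by blast
   obtain w y f where w: "w \<in> S" "y \<in> ob P w" "f \<in> hom C z w" "x = act P f y"
    using gen zO x unfolding generated_on_def by blast
   have wS: "w \<in> S'" "w \<in> Ob C" using w S by auto
   show ?thesis unfolding w(4)
    using natlD(2)[OF s(1) wS(2) w(2) zO w(3)] natlD(2)[OF t wS(1) w(2) z w(3)] s(2)[OF w(1,2)] by simp
  qed
  thus ?thesis using s(1) by blast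
 qed
 moreover have "generated_on C S' P" using gen S(1) unfolding generated_on_def by blast
 ultimately show ?thesis unfolding kan_on_def by blast
qed

section \<open>Unions of images\<close>

definition img :: "('o, 'u) presheaf => ('o, 'u) presheaf_arr set => ('o, 'u) presheaf" where
 "img P A = mk_psh C (\<lambda>z. {x \<in> ob P z. \<exists>\<alpha>\<in>A. \<exists>y\<in>ob (Dom (psh C) \<alpha>) z. x = app \<alpha> z y}) (act P)"

definition into :: "('o, 'u) presheaf => ('o, 'u) presheaf_arr set => bool" where
 "into P A \<longleftrightarrow> P \<in> Ob (psh C) \<and> (\<forall>\<alpha>\<in>A. \<alpha> \<in> phom (Dom (psh C) \<alpha>) P)"

lemma img_el: "z \<in> Ob C ==> ob (img P A) z = {x \<in> ob P z. \<exists>\<alpha>\<in>A. \<exists>y\<in>ob (Dom (psh C) \<alpha>) z. x = app \<alpha> z y}"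
 by (simp add: img_def)

lemma img_act: "f \<in> hom C w z ==> x \<in> ob (img P A) z ==> act (img P A) f x = act P f x"
 unfolding img_def using hom_ob by (intro mk_psh_act) auto

lemma img_ob: assumes A: "into P A" shows "img P A \<in> Ob (psh C)"
proof -
 have P: "P \<in> Ob (psh C)" using A by (simp add: into_def)
 note P' = ob_psh[OF P]
 show ?thesis unfolding img_def
 proof (rule mk_psh_ob)
  fix w z f x assume f: "f \<in> hom C w z" and x: "x \<in> {x \<in> ob P z. \<exists>\<alpha>\<in>A. \<exists>y\<in>ob (Dom (psh C) \<alpha>) z. x = app \<alpha> z y}"
  then obtain \<alpha> y where a: "\<alpha> \<in> A" "y \<in> ob (Dom (psh C) \<alpha>) z" "x = app \<alpha> z y" "x \<in> ob P z" by blast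
  have ah: "\<alpha> \<in> phom (Dom (psh C) \<alpha>) P" using A a(1) by (simp add: into_def)
  have "act P f x = app \<alpha> w (act (Dom (psh C) \<alpha>) f y)" using app_nat[OF ah f a(2)] a(3) by simp
  moreover have "act (Dom (psh C) \<alpha>) f y \<in> ob (Dom (psh C) \<alpha>) w"
   using act_in[OF ob_psh f a(2)] psh_hom[OF ah] by blast
  ultimately show "act P f x \<in> {x \<in> ob P w. \<exists>\<alpha>\<in>A. \<exists>y\<in>ob (Dom (psh C) \<alpha>) w. x = app \<alpha> w y}"
   using act_in[OF P' f a(4)] a(1) by blast
 next
  show "small TYPE('u) {x \<in> ob P z. \<exists>\<alpha>\<in>A. \<exists>y\<in>ob (Dom (psh C) \<alpha>) z. x = app \<alpha> z y}" if "z \<in> Ob C" for z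
   by (rule small_subset[OF psh_small[OF P' that]]) blast
 qed (auto simp: act_id[OF P'] act_comp[OF P'])
qed

lemma app_img: "into P A ==> \<alpha> \<in> A ==> z \<in> Ob C ==> y \<in> ob (Dom (psh C) \<alpha>) z ==> app \<alpha> z y \<in> ob (img P A) z"
 using app_in[of \<alpha> "Dom (psh C) \<alpha>" P z y] by (auto simp: img_el into_def)

lemma img_incl: assumes A: "into P A" shows "mk_arr C (img P A) P (\<lambda>z x. x) \<in> phom (img P A) P"
 using A by (intro mk_arr_homI img_ob) (auto simp: into_def img_el img_act)

lemma img_corestrict:
 assumes A: "into P A" and a: "\<alpha> \<in> A"
 shows "mk_arr C (Dom (psh C) \<alpha>) (img P A) (app \<alpha>) \<in> phom (Dom (psh C) \<alpha>) (img P A)"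
proof -
 have ah: "\<alpha> \<in> phom (Dom (psh C) \<alpha>) P" using A a by (simp add: into_def)
 show ?thesis
 proof (rule mk_arr_homI[OF _ img_ob[OF A]])
  show "Dom (psh C) \<alpha> \<in> Ob (psh C)" using psh_hom[OF ah] by blast
  show "app \<alpha> z x \<in> ob (img P A) z" if "z \<in> Ob C" "x \<in> ob (Dom (psh C) \<alpha>) z" for z x
   by (rule app_img[OF A a that])
  show "app \<alpha> w (act (Dom (psh C) \<alpha>) f x) = act (img P A) f (app \<alpha> z x)"
   if "f \<in> hom C w z" "x \<in> ob (Dom (psh C) \<alpha>) z" for w z f x
   using app_nat[OF ah that] img_act[OF that(1) app_img[OF A a _ that(2)]] hom_ob[OF that(1)] by simp
 qed
qed

lemma img_descend:
 assumes A: "into P A" and G: "is_psh G" and b: "\<And>\<alpha>. \<alpha> \<in> A ==> natl C (Ob C) (Dom (psh C) \<alpha>) G (b \<alpha>)"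
  and compat: "\<And>\<alpha> \<alpha>' z y y'. \<alpha> \<in> A ==> \<alpha>' \<in> A ==> z \<in> Ob C ==> y \<in> ob (Dom (psh C) \<alpha>) z ==>
   y' \<in> ob (Dom (psh C) \<alpha>') z ==> app \<alpha> z y = app \<alpha>' z y' ==> b \<alpha> z y = b \<alpha>' z y'"
 obtains s where "natl C (Ob C) (img P A) G s"
  "\<And>\<alpha> z y. \<alpha> \<in> A ==> z \<in> Ob C ==> y \<in> ob (Dom (psh C) \<alpha>) z ==> s z (app \<alpha> z y) = b \<alpha> z y"
proof -
 define s where "s z x = (SOME v. \<exists>\<alpha>\<in>A. \<exists>y\<in>ob (Dom (psh C) \<alpha>) z. x = app \<alpha> z y \<and> v = b \<alpha> z y)" for z x
 have s: "s z (app \<alpha> z y) = b \<alpha> z y" if "\<alpha> \<in> A" "z \<in> Ob C" "y \<in> ob (Dom (psh C) \<alpha>) z" for \<alpha> z y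
  unfolding s_def
 proof (rule some_equality)
  show "\<exists>\<alpha>'\<in>A. \<exists>y'\<in>ob (Dom (psh C) \<alpha>') z. app \<alpha> z y = app \<alpha>' z y' \<and> b \<alpha> z y = b \<alpha>' z y'" using that by blast
  fix v assume "\<exists>\<alpha>'\<in>A. \<exists>y'\<in>ob (Dom (psh C) \<alpha>') z. app \<alpha> z y = app \<alpha>' z y' \<and> v = b \<alpha>' z y'"
  then obtain \<alpha>' y' where q: "\<alpha>' \<in> A" "y' \<in> ob (Dom (psh C) \<alpha>') z" "app \<alpha> z y = app \<alpha>' z y'" "v = b \<alpha>' z y'" by blast
  show "v = b \<alpha> z y" using compat[OF that(1) q(1) that(2,3) q(2,3)] q(4) by simp
 qed
 have "natl C (Ob C) (img P A) G s"
  unfolding natl_def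
 proof (intro conjI ballI)
  fix z x assume z: "z \<in> Ob C" and "x \<in> ob (img P A) z"
  then obtain \<alpha> y where q: "\<alpha> \<in> A" "y \<in> ob (Dom (psh C) \<alpha>) z" "x = app \<alpha> z y" by (auto simp: img_el)
  thus "s z x \<in> ob G z" using s[OF q(1) z q(2)] natlD(1)[OF b[OF q(1)] z q(2)] by simp
 next
  fix z w f x assume z: "z \<in> Ob C" and w: "w \<in> Ob C" and f: "f \<in> hom C w z" and x: "x \<in> ob (img P A) z"
  then obtain \<alpha> y where q: "\<alpha> \<in> A" "y \<in> ob (Dom (psh C) \<alpha>) z" "x = app \<alpha> z y" by (auto simp: img_el)
  have ah: "\<alpha> \<in> phom (Dom (psh C) \<alpha>) P" using A q(1) by (simp add: into_def)
  have fy: "act (Dom (psh C) \<alpha>) f y \<in> ob (Dom (psh C) \<alpha>) w"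
   using act_in[OF ob_psh f q(2)] psh_hom[OF ah] by blast
  have "act (img P A) f x = app \<alpha> w (act (Dom (psh C) \<alpha>) f y)" using img_act[OF f x] app_nat[OF ah f q(2)] q(3) by simp
  thus "s w (act (img P A) f x) = act G f (s z x)"
   using s[OF q(1) w fy] s[OF q(1) z q(2)] q(3) natlD(2)[OF b[OF q(1)] z q(2) w f] by simp
 qed
 thus ?thesis using that s by blast
qed

text \<open>\<open>R\<close> with \<open>p\<close>, \<open>q\<close> covers the pullback of \<open>\<alpha>\<close> and \<open>\<alpha>'\<close>, so it presents the relations in \<open>img P A\<close>.\<close>

definition covers_pb :: "('o, 'u) presheaf => ('o, 'u) presheaf_arr => ('o, 'u) presheaf_arr =>
  ('o, 'u) presheaf_arr => ('o, 'u) presheaf_arr => bool" where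
 "covers_pb R p q \<alpha> \<alpha>' \<longleftrightarrow> p \<in> phom R (Dom (psh C) \<alpha>) \<and> q \<in> phom R (Dom (psh C) \<alpha>') \<and>
  (\<forall>z\<in>Ob C. \<forall>w\<in>ob R z. app \<alpha> z (app p z w) = app \<alpha>' z (app q z w)) \<and>
  (\<forall>z\<in>Ob C. \<forall>y\<in>ob (Dom (psh C) \<alpha>) z. \<forall>y'\<in>ob (Dom (psh C) \<alpha>') z. app \<alpha> z y = app \<alpha>' z y' -->
    (\<exists>w\<in>ob R z. app p z w = y \<and> app q z w = y'))"

lemma kan_on_img:
 assumes A: "into P A" and S: "S \<subseteq> Ob C" and K: "\<And>\<alpha>. \<alpha> \<in> A ==> kan_on C S (Dom (psh C) \<alpha>)"
  and R: "\<And>\<alpha> \<alpha>'. \<alpha> \<in> A ==> \<alpha>' \<in> A ==> \<exists>R p q. kan_on C S R \<and> covers_pb R p q \<alpha> \<alpha>'"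
 shows "kan_on C S (img P A)"
proof -
 have "generated_on C S (img P A)"
  unfolding generated_on_def
 proof (intro ballI)
  fix z x assume z: "z \<in> Ob C" and x: "x \<in> ob (img P A) z"
  then obtain \<alpha> y where q: "\<alpha> \<in> A" "y \<in> ob (Dom (psh C) \<alpha>) z" "x = app \<alpha> z y" by (auto simp: img_el)
  have ah: "\<alpha> \<in> phom (Dom (psh C) \<alpha>) P" using A q(1) by (simp add: into_def)
  obtain w v f where w: "w \<in> S" "v \<in> ob (Dom (psh C) \<alpha>) w" "f \<in> hom C z w" "y = act (Dom (psh C) \<alpha>) f v"
   using K[OF q(1)] z q(2) unfolding kan_on_def generated_on_def by blast
  have wO: "w \<in> Ob C" using w S by blast
  have "x = act (img P A) f (app \<alpha> w v)"
   using q(3) w(4) app_nat[OF ah w(3,2)] img_act[OF w(3) app_img[OF A q(1) wO w(2)]] by simp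
  thus "\<exists>w\<in>S. \<exists>y\<in>ob (img P A) w. \<exists>f\<in>hom C z w. x = act (img P A) f y"
   using w app_img[OF A q(1) wO w(2)] by blast
 qed
 moreover have "\<exists>s. natl C (Ob C) (img P A) G s \<and> (\<forall>z\<in>S. \<forall>x\<in>ob (img P A) z. s z x = t z x)"
  if G: "is_psh G" and t: "natl C S (img P A) G t" for G t
 proof -
  have "\<exists>s. natl C (Ob C) (Dom (psh C) \<alpha>) G s \<and> (\<forall>z\<in>S. \<forall>y\<in>ob (Dom (psh C) \<alpha>) z. s z y = t z (app \<alpha> z y))"
   if a: "\<alpha> \<in> A" for \<alpha>
  proof -
   have h: "mk_arr C (Dom (psh C) \<alpha>) (img P A) (app \<alpha>) \<in> phom (Dom (psh C) \<alpha>) (img P A)"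
    by (rule img_corestrict[OF A a])
   have "natl C S (Dom (psh C) \<alpha>) (img P A) (app \<alpha>)"
    using natl_subset[OF psh_hom(5)[OF h] S] psh_hom(1)[OF h] act_in[OF ob_psh] S hom_ob
    unfolding natl_def by (simp add: subset_iff)
   from natl_comp[OF this t] show ?thesis using K[OF a] G unfolding kan_on_def by blast
  qed
  then obtain b where b: "\<And>\<alpha>. \<alpha> \<in> A ==> natl C (Ob C) (Dom (psh C) \<alpha>) G (b \<alpha>)"
   "\<And>\<alpha> z y. \<alpha> \<in> A ==> z \<in> S ==> y \<in> ob (Dom (psh C) \<alpha>) z ==> b \<alpha> z y = t z (app \<alpha> z y)"
   by metis
  have compat: "b \<alpha> z y = b \<alpha>' z y'" if a: "\<alpha> \<in> A" "\<alpha>' \<in> A" and z: "z \<in> Ob C" and y: "y \<in> ob (Dom (psh C) \<alpha>) z"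
    "y' \<in> ob (Dom (psh C) \<alpha>') z" "app \<alpha> z y = app \<alpha>' z y'" for \<alpha> \<alpha>' z y y'
  proof -
   obtain R p q where R': "kan_on C S R" "covers_pb R p q \<alpha> \<alpha>'" using R[OF a] by blast
   have p: "p \<in> phom R (Dom (psh C) \<alpha>)" and q: "q \<in> phom R (Dom (psh C) \<alpha>')"
    using R'(2) by (auto simp: covers_pb_def)
   obtain w where w: "w \<in> ob R z" "app p z w = y" "app q z w = y'"
    using R'(2) z y unfolding covers_pb_def by blast
   have "b \<alpha> z (app p z w) = b \<alpha>' z (app q z w)"
   proof (rule kan_on_unique[OF _ natl_comp[OF psh_hom(5)[OF p] b(1)[OF a(1)]] natl_comp[OF psh_hom(5)[OF q] b(1)[OF a(2)]] S _ z w(1)])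
    show "generated_on C S R" using R'(1) by (simp add: kan_on_def)
    fix z x assume zx: "z \<in> S" "x \<in> ob R z"
    hence zO: "z \<in> Ob C" using S by blast
    have "app \<alpha> z (app p z x) = app \<alpha>' z (app q z x)" using R'(2) zO zx(2) by (simp add: covers_pb_def)
    thus "b \<alpha> z (app p z x) = b \<alpha>' z (app q z x)"
     using b(2)[OF a(1) zx(1) app_in[OF p zO zx(2)]] b(2)[OF a(2) zx(1) app_in[OF q zO zx(2)]] by simp
   qed
   thus "b \<alpha> z y = b \<alpha>' z y'" using w by simp
  qed
  obtain s where s: "natl C (Ob C) (img P A) G s"
   "\<And>\<alpha> z y. \<alpha> \<in> A ==> z \<in> Ob C ==> y \<in> ob (Dom (psh C) \<alpha>) z ==> s z (app \<alpha> z y) = b \<alpha> z y"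
   by (rule img_descend[OF A G b(1) compat]) (assumption | rule that)+
  have "s z x = t z x" if z: "z \<in> S" and x: "x \<in> ob (img P A) z" for z x
  proof -
   have zO: "z \<in> Ob C" using z S by blast
   obtain \<alpha> y where q: "\<alpha> \<in> A" "y \<in> ob (Dom (psh C) \<alpha>) z" "x = app \<alpha> z y" using x zO by (auto simp: img_el)
   show ?thesis using s(2)[OF q(1) zO q(2)] b(2)[OF q(1) z q(2)] q(3) by simp
  qed
  thus ?thesis using s(1) by blast
 qed
 ultimately show ?thesis unfolding kan_on_def by blast
qed

end

section \<open>Sieves and colimits weighted by them\<close>

text \<open>The weight \<open>\<phi>\<close> is, up to isomorphism, the sieve on \<open>y\<close> generated by \<open>T\<close>, with \<open>x t\<close> corresponding to \<open>t\<close>.\<close>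

definition gen_by :: "('k, 'u) cat => ('k, 'u) presheaf => 'k => 'u set => ('u => 'u) => bool" where
 "gen_by K \<phi> y T x \<longleftrightarrow> finite T \<and> y \<in> Ob K \<and> (\<forall>t\<in>T. t \<in> hom K (Dom K t) y \<and> x t \<in> ob \<phi> (Dom K t)) \<and>
  (\<forall>k\<in>Ob K. \<forall>z\<in>ob \<phi> k. \<exists>t\<in>T. \<exists>u\<in>hom K k (Dom K t). z = act \<phi> u (x t)) \<and>
  (\<forall>t\<in>T. \<forall>t'\<in>T. \<forall>k. \<forall>u\<in>hom K k (Dom K t). \<forall>u'\<in>hom K k (Dom K t').
   act \<phi> u (x t) = act \<phi> u' (x t') \<longleftrightarrow> Comp K t u = Comp K t' u')"

lemma gen_byD:
 assumes "gen_by K \<phi> y T x"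
 shows "finite T" "y \<in> Ob K" "t \<in> T ==> t \<in> hom K (Dom K t) y" "t \<in> T ==> x t \<in> ob \<phi> (Dom K t)"
  "t \<in> T ==> t' \<in> T ==> u \<in> hom K k (Dom K t) ==> u' \<in> hom K k (Dom K t') ==>
   act \<phi> u (x t) = act \<phi> u' (x t') \<longleftrightarrow> Comp K t u = Comp K t' u'"
 using assms unfolding gen_by_def by blast+

lemma gen_byE:
 assumes "gen_by K \<phi> y T x" "k \<in> Ob K" "z \<in> ob \<phi> k"
 obtains t u where "t \<in> T" "u \<in> hom K k (Dom K t)" "z = act \<phi> u (x t)"
 using assms unfolding gen_by_def by blast

lemma weighted_colimit_unique:
 assumes E: "category E" and P: "is_weighted_colimit K \<phi> E D P \<gamma>" and Q: "is_weighted_colimit K \<phi> E D Q \<delta>"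
  and cat: "category K" and D: "is_functor K E D"
 shows "isomorphic E P Q"
proof -
 interpret E: cat E by (rule cat.intro) fact
 have cP: "is_weighted_cocone K \<phi> E D P \<gamma>" and cQ: "is_weighted_cocone K \<phi> E D Q \<delta>"
  using P Q by (auto simp: is_weighted_colimit_def)
 have PQ: "P \<in> Ob E" "Q \<in> Ob E" using cP cQ by (auto simp: is_weighted_cocone_def)
 have hg: "\<gamma> k x \<in> hom E (ob D k) P" "\<delta> k x \<in> hom E (ob D k) Q" if "k \<in> Ob K" "x \<in> ob \<phi> k" for k x
  using cP cQ that by (auto simp: is_weighted_cocone_def)
 obtain f where f: "f \<in> hom E P Q" "\<And>k x. k \<in> Ob K ==> x \<in> ob \<phi> k ==> Comp E f (\<gamma> k x) = \<delta> k x"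
  using P cQ unfolding is_weighted_colimit_def by blast
 obtain g where g: "g \<in> hom E Q P" "\<And>k x. k \<in> Ob K ==> x \<in> ob \<phi> k ==> Comp E g (\<delta> k x) = \<gamma> k x"
  using Q cP unfolding is_weighted_colimit_def by blast
 have "\<exists>!h. h \<in> hom E P P \<and> (\<forall>k\<in>Ob K. \<forall>x\<in>ob \<phi> k. Comp E h (\<gamma> k x) = \<gamma> k x)"
  using P cP unfolding is_weighted_colimit_def by blast
 moreover have "Comp E (Comp E g f) (\<gamma> k x) = \<gamma> k x" "Comp E (Id E P) (\<gamma> k x) = \<gamma> k x" if "k \<in> Ob K" "x \<in> ob \<phi> k" for k x
  using E.assoc[OF g(1) f(1) hg(1)[OF that]] f(2)[OF that] g(2)[OF that] E.id_left[OF hg(1)[OF that]] by simp_all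
 ultimately have gf: "Comp E g f = Id E P" using E.comp_hom[OF g(1) f(1)] E.id_hom[OF PQ(1)] by blast
 have "\<exists>!h. h \<in> hom E Q Q \<and> (\<forall>k\<in>Ob K. \<forall>x\<in>ob \<phi> k. Comp E h (\<delta> k x) = \<delta> k x)"
  using Q cQ unfolding is_weighted_colimit_def by blast
 moreover have "Comp E (Comp E f g) (\<delta> k x) = \<delta> k x" "Comp E (Id E Q) (\<delta> k x) = \<delta> k x" if "k \<in> Ob K" "x \<in> ob \<phi> k" for k x
  using E.assoc[OF f(1) g(1) hg(2)[OF that]] f(2)[OF that] g(2)[OF that] E.id_left[OF hg(2)[OF that]] by simp_all
 ultimately have fg: "Comp E f g = Id E Q" using E.comp_hom[OF f(1) g(1)] E.id_hom[OF PQ(2)] by blast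
 show ?thesis unfolding isomorphic_def using f(1) E.isoI[OF f(1) g(1) gf fg] by blast
qed

context lpcat
begin

lemma rep_small: assumes c: "c \<in> Ob C" shows "small_presheaf C (rep c)"
proof (rule kan_small_presheaf[OF rep_ob[OF c], of "{c}"])
 show "{c} \<subseteq> Ob C" using c by simp
 show "small TYPE('u) {c}" by (rule small_countable[OF U]) simp
 have idc: "Id C c \<in> ob (rep c) c" using c id_hom by simp
 have "generated_on C {c} (rep c)"
  unfolding generated_on_def
 proof (intro ballI)
  fix z x assume z: "z \<in> Ob C" and "x \<in> ob (rep c) z"
  hence x: "x \<in> hom C z c" by simp
  have "x = act (rep c) x (Id C c)" using rep_act[OF x id_hom[OF c]] id_left[OF x] by simp
  thus "\<exists>w\<in>{c}. \<exists>y\<in>ob (rep c) w. \<exists>f\<in>hom C z w. x = act (rep c) f y" using idc x by blast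
 qed
 moreover have "\<exists>s. natl C (Ob C) (rep c) G s \<and> (\<forall>z\<in>{c}. \<forall>x\<in>ob (rep c) z. s z x = t z x)"
  if G: "is_psh G" and t: "natl C {c} (rep c) G t" for G t
 proof (intro exI conjI ballI)
  have tc: "t c (Id C c) \<in> ob G c" using natlD(1)[OF t _ idc] by simp
  show "natl C (Ob C) (rep c) G (\<lambda>z g. act G g (t c (Id C c)))"
   unfolding natl_def
  proof (intro conjI ballI)
   show "act G g (t c (Id C c)) \<in> ob G z" if "z \<in> Ob C" "g \<in> ob (rep c) z" for z g
    using act_in[OF G _ tc] that by simp
   fix z w f g assume "z \<in> Ob C" "w \<in> Ob C" and f: "f \<in> hom C w z" and g: "g \<in> ob (rep c) z"
   hence g': "g \<in> hom C z c" by simp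
   show "act G (act (rep c) f g) (t c (Id C c)) = act G f (act G g (t c (Id C c)))"
    using rep_act[OF f g'] act_comp[OF G g' f tc] by simp
  qed
  fix z x assume "z \<in> {c}" "x \<in> ob (rep c) z"
  hence z: "z = c" and x: "x \<in> hom C c c" using c by auto
  have "act (rep c) x (Id C c) = x" using rep_act[OF x id_hom[OF c]] id_left[OF x] by simp
  thus "act G x (t c (Id C c)) = t z x" using natlD(2)[OF t _ idc _ x] z by simp
 qed
 ultimately show "kan_on C {c} (rep c)" unfolding kan_on_def by blast
qed

lemma fullin_small: "fullin (small_psh C)"
 unfolding small_psh_def by (rule fullin_full_sub[OF fullin_psh]) (simp add: rep_small)

lemma small_psh_ob: "P \<in> Ob (small_psh C) \<longleftrightarrow> small_presheaf C P"
 by (auto simp: small_psh_def small_presheaf_def)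

context
 fixes K :: "('k, 'u) cat" and D \<phi> y T x
 assumes K: "finitely_complete K" and phi: "\<phi> \<in> Ob (psh K)" and gen: "gen_by K \<phi> y T x"
  and D: "is_functor K (small_psh C) D" and lexD: "preserves_finite_limits K (small_psh C) D"
begin

interpretation K: lex_cat K
 using K by unfold_locales (auto simp: finitely_complete_def)

interpretation K: pcat K
 by unfold_locales

private lemma Dob: "k \<in> Ob K ==> ob D k \<in> Ob (small_psh C)"
 using D by (auto simp: is_functor_def)

private lemma Dhom: "u \<in> hom K j k ==> ar D u \<in> hom (small_psh C) (ob D j) (ob D k)"
 using D by (auto simp: is_functor_def)

private lemma Dpsh: "u \<in> hom K j k ==> ar D u \<in> phom (ob D j) (ob D k)"
 by (rule fullin_hom(3)[OF fullin_small Dhom])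

private lemma Dcomp: "v \<in> hom K j k ==> u \<in> hom K i j ==> ar D (Comp K v u) = pcomp (ar D v) (ar D u)"
 using D fullinD(4)[OF fullin_small] unfolding is_functor_def by simp

private lemma Dapp:
 "v \<in> hom K j k ==> u \<in> hom K i j ==> w \<in> Ob C ==> e \<in> ob (ob D i) w ==>
  app (ar D (Comp K v u)) w e = app (ar D v) w (app (ar D u) w e)"
 using app_comp[OF Dpsh Dpsh] Dcomp by simp

private lemma domD: "t \<in> T ==> Dom (psh C) (ar D t) = ob D (Dom K t)"
 by (rule psh_hom(3)[OF Dpsh[OF gen_byD(3)[OF gen]]])

private lemma intoD: "into (ob D y) (ar D ` T)"
 unfolding into_def using Dpsh[OF gen_byD(3)[OF gen]] domD fullinD(2)[OF fullin_small Dob[OF gen_byD(2)[OF gen]]] by simp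

private lemma pb:
 assumes t: "t \<in> T" "t' \<in> T"
 obtains l p q where "p \<in> hom K l (Dom K t)" "q \<in> hom K l (Dom K t')" "Comp K t p = Comp K t' q"
  "covers_pb (ob D l) (ar D p) (ar D q) (ar D t) (ar D t')"
proof -
 note th = gen_byD(3)[OF gen t(1)] gen_byD(3)[OF gen t(2)]
 obtain l p q where pq: "p \<in> hom K l (Dom K t)" "q \<in> hom K l (Dom K t')" "is_pullback K t t' p q"
  by (rule K.pullback_exists[OF th])
 have c: "Comp K t p = Comp K t' q" using K.pullbackD(4)[OF pq(3) th(1)] .
 have PB: "is_pullback (small_psh C) (ar D t) (ar D t') (ar D p) (ar D q)"
  by (rule pullback_preserved[OF D lexD pq(3)])
 have dp: "Dom (small_psh C) (ar D p) = ob D l" using Dhom[OF pq(1)] by (simp add: hom_def)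
 have "covers_pb (ob D l) (ar D p) (ar D q) (ar D t) (ar D t')"
  unfolding covers_pb_def domD[OF t(1)] domD[OF t(2)]
 proof (intro conjI ballI impI)
  show "ar D p \<in> phom (ob D l) (ob D (Dom K t))" "ar D q \<in> phom (ob D l) (ob D (Dom K t'))"
   by (rule Dpsh[OF pq(1)], rule Dpsh[OF pq(2)])
  show "app (ar D t) z (app (ar D p) z w) = app (ar D t') z (app (ar D q) z w)"
   if "z \<in> Ob C" "w \<in> ob (ob D l) z" for z w
   using Dapp[OF th(1) pq(1) that] Dapp[OF th(2) pq(2) that] c by simp
  fix z a b assume z: "z \<in> Ob C" "a \<in> ob (ob D (Dom K t)) z" "b \<in> ob (ob D (Dom K t')) z"
   "app (ar D t) z a = app (ar D t') z b"
  obtain w where "w \<in> ob (Dom (small_psh C) (ar D p)) z" "app (ar D p) z w = a" "app (ar D q) z w = b"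
   by (rule pullback_pointwise[OF fullin_small PB Dhom[OF th(1)] Dhom[OF th(2)] z])
  thus "\<exists>w\<in>ob (ob D l) z. app (ar D p) z w = a \<and> app (ar D q) z w = b" unfolding dp by blast
 qed
 thus ?thesis using that[OF pq(1,2) c] by blast
qed

lemma img_small: "small_presheaf C (img (ob D y) (ar D ` T))"
proof -
 have fin: "finite T" using gen_byD(1)[OF gen] .
 have "\<exists>S. S \<subseteq> Ob C \<and> small TYPE('u) S \<and> kan_on C S P" if "P \<in> Ob (small_psh C)" for P
  using small_presheaf_kan[of P] that unfolding small_psh_ob by metis
 then obtain S0 where S0: "\<And>P. P \<in> Ob (small_psh C) ==> S0 P \<subseteq> Ob C \<and> small TYPE('u) (S0 P) \<and> kan_on C (S0 P) P"
  by metis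
 have Dt: "ob D (Dom K t) \<in> Ob (small_psh C)" if "t \<in> T" for t
  using Dob gen_byD(3)[OF gen that] K.hom_ob by blast
 have "\<exists>R S. S \<subseteq> Ob C \<and> small TYPE('u) S \<and> kan_on C S R \<and> (\<exists>p q. covers_pb R p q (ar D t) (ar D t'))"
  if "t \<in> T" "t' \<in> T" for t t'
 proof -
  obtain l p q where pq: "p \<in> hom K l (Dom K t)" "covers_pb (ob D l) (ar D p) (ar D q) (ar D t) (ar D t')"
   using pb[OF \<open>t \<in> T\<close> \<open>t' \<in> T\<close>] by metis
  have "ob D l \<in> Ob (small_psh C)" using Dob K.hom_ob[OF pq(1)] by blast
  thus ?thesis using S0 pq(2) by blast
 qed
 then obtain R S1 where S1: "\<And>t t'. t \<in> T ==> t' \<in> T ==> S1 t t' \<subseteq> Ob C \<and> small TYPE('u) (S1 t t') \<and>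
   kan_on C (S1 t t') (R t t') \<and> (\<exists>p q. covers_pb (R t t') p q (ar D t) (ar D t'))"
  by metis
 define S where "S = (\<Union>t\<in>T. S0 (ob D (Dom K t))) \<union> (\<Union>t\<in>T. \<Union>t'\<in>T. S1 t t')"
 have S: "S \<subseteq> Ob C" using S0[OF Dt] S1 unfolding S_def by blast
 have "small TYPE('u) S"
  unfolding S_def using S0[OF Dt] S1 by (intro small_Un[OF U] small_UN[OF U fin]) auto
 moreover have "kan_on C S (img (ob D y) (ar D ` T))"
 proof (rule kan_on_img[OF intoD S])
  show "kan_on C S (Dom (psh C) \<alpha>)" if "\<alpha> \<in> ar D ` T" for \<alpha>
  proof -
   obtain t where t: "t \<in> T" "\<alpha> = ar D t" using \<open>\<alpha> \<in> ar D ` T\<close> by blast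
   show ?thesis unfolding t(2) domD[OF t(1)]
    by (rule kan_on_mono[OF ob_psh[OF fullinD(2)[OF fullin_small Dt[OF t(1)]]] _ _ S, of "S0 (ob D (Dom K t))"])
     (use S0[OF Dt[OF t(1)]] t(1) in "auto simp: S_def")
  qed
  show "\<exists>R p q. kan_on C S R \<and> covers_pb R p q \<alpha> \<alpha>'" if "\<alpha> \<in> ar D ` T" "\<alpha>' \<in> ar D ` T" for \<alpha> \<alpha>'
  proof -
   obtain t t' where t: "t \<in> T" "t' \<in> T" "\<alpha> = ar D t" "\<alpha>' = ar D t'"
    using \<open>\<alpha> \<in> ar D ` T\<close> \<open>\<alpha>' \<in> ar D ` T\<close> by blast
   obtain p q where pq: "covers_pb (R t t') p q \<alpha> \<alpha>'" using S1[OF t(1,2)] t by blast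
   hence "is_psh (R t t')" using ob_psh psh_hom(1) unfolding covers_pb_def by blast
   moreover have "S1 t t' \<subseteq> S" using t(1,2) by (auto simp: S_def)
   ultimately have "kan_on C S (R t t')" using kan_on_mono[OF _ _ _ S] S1[OF t(1,2)] by blast
   thus ?thesis using pq by blast
  qed
 qed
 ultimately show ?thesis using kan_small_presheaf[OF img_ob[OF intoD] S] by blast
qed

lemma img_weighted_colimit: "\<exists>\<gamma>. is_weighted_colimit K \<phi> (small_psh C) D (img (ob D y) (ar D ` T)) \<gamma>"
proof -
 let ?I = "img (ob D y) (ar D ` T)"
 have phi': "K.is_psh \<phi>" using K.ob_psh[OF phi] .
 have IE: "?I \<in> Ob (small_psh C)" using img_small by (simp add: small_psh_ob)
 note Iob = img_ob[OF intoD]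
 define m where "m k z = (SOME g. \<exists>t\<in>T. \<exists>u\<in>hom K k (Dom K t). z = act \<phi> u (x t) \<and> g = Comp K t u)" for k z
 have m: "m k (act \<phi> u (x t)) = Comp K t u" if "t \<in> T" "u \<in> hom K k (Dom K t)" for t u k
  unfolding m_def
 proof (rule some_equality)
  show "\<exists>t'\<in>T. \<exists>u'\<in>hom K k (Dom K t'). act \<phi> u (x t) = act \<phi> u' (x t') \<and> Comp K t u = Comp K t' u'" using that by blast
  fix g assume "\<exists>t'\<in>T. \<exists>u'\<in>hom K k (Dom K t'). act \<phi> u (x t) = act \<phi> u' (x t') \<and> g = Comp K t' u'"
  then obtain t' u' where "t' \<in> T" "u' \<in> hom K k (Dom K t')" "act \<phi> u (x t) = act \<phi> u' (x t')" "g = Comp K t' u'" by blast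
  thus "g = Comp K t u" using gen_byD(5)[OF gen that(1) _ that(2)] by metis
 qed
 define \<gamma> where "\<gamma> k z = mk_arr C (ob D k) ?I (app (ar D (m k z)))" for k z
 have Dk: "ob D k \<in> Ob (psh C)" if "k \<in> Ob K" for k using fullinD(2)[OF fullin_small Dob[OF that]] .
 have appI: "app (ar D (Comp K t u)) w e \<in> ob ?I w"
  if t: "t \<in> T" and u: "u \<in> hom K k (Dom K t)" and w: "w \<in> Ob C" and e: "e \<in> ob (ob D k) w" for t u k w e
  using app_img[OF intoD _ w, of "ar D t"] domD[OF t] t app_in[OF Dpsh[OF u] w e] Dapp[OF gen_byD(3)[OF gen t] u w e] by simp
 have \<gamma>h: "\<gamma> k z \<in> phom (ob D k) ?I" if k: "k \<in> Ob K" and z: "z \<in> ob \<phi> k" for k z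
 proof -
  obtain t u where t: "t \<in> T" "u \<in> hom K k (Dom K t)" "z = act \<phi> u (x t)" by (rule gen_byE[OF gen k z])
  have mh: "m k z = Comp K t u" using m[OF t(1,2)] t(3) by simp
  show ?thesis unfolding \<gamma>_def mh
  proof (rule mk_arr_homI[OF Dk[OF k] Iob])
   show "app (ar D (Comp K t u)) w e \<in> ob ?I w" if "w \<in> Ob C" "e \<in> ob (ob D k) w" for w e
    by (rule appI[OF t(1,2) that])
   fix w v f e assume f: "f \<in> hom C w v" and e: "e \<in> ob (ob D k) v"
   have v: "v \<in> Ob C" using hom_ob[OF f] by simp
   show "app (ar D (Comp K t u)) w (act (ob D k) f e) = act ?I f (app (ar D (Comp K t u)) v e)"
    using app_nat[OF Dpsh[OF K.comp_hom[OF gen_byD(3)[OF gen t(1)] t(2)]] f e] img_act[OF f appI[OF t(1,2) v e]] by simp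
  qed
 qed
 have \<gamma>app: "app (\<gamma> k z) w e = app (ar D (m k z)) w e" if "w \<in> Ob C" "e \<in> ob (ob D k) w" for k z w e
  using that by (simp add: \<gamma>_def)
 have \<gamma>E: "\<gamma> k z \<in> hom (small_psh C) (ob D k) ?I" if "k \<in> Ob K" "z \<in> ob \<phi> k" for k z
  using \<gamma>h[OF that] fullinD(3)[OF fullin_small Dob[OF that(1)] IE] by simp
 have "is_weighted_cocone K \<phi> (small_psh C) D ?I \<gamma>"
  unfolding is_weighted_cocone_def
 proof (intro conjI ballI allI)
  fix j k v z assume v: "v \<in> hom K j k" and z: "z \<in> ob \<phi> k"
  have jk: "j \<in> Ob K" "k \<in> Ob K" using K.hom_ob[OF v] by auto
  obtain t u where t: "t \<in> T" "u \<in> hom K k (Dom K t)" "z = act \<phi> u (x t)" by (rule gen_byE[OF gen jk(2) z])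
  note th = gen_byD(3)[OF gen t(1)]
  have az: "act \<phi> v z = act \<phi> (Comp K u v) (x t)" using K.act_comp[OF phi' t(2) v gen_byD(4)[OF gen t(1)]] t(3) by simp
  have mz: "m j (act \<phi> v z) = Comp K (m k z) v"
   using m[OF t(1) K.comp_hom[OF t(2) v]] m[OF t(1,2)] az t(3) K.assoc[OF th t(2) v] by simp
  have azin: "act \<phi> v z \<in> ob \<phi> j" by (rule K.act_in[OF phi' v z])
  have mh: "m k z \<in> hom K k y" using m[OF t(1,2)] t(3) K.comp_hom[OF th t(2)] by simp
  have "\<gamma> j (act \<phi> v z) = pcomp (\<gamma> k z) (ar D v)"
  proof (rule psh_ext[OF \<gamma>h[OF jk(1) azin] Psh.comp_hom[OF \<gamma>h[OF jk(2) z] Dpsh[OF v]]])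
   fix w e assume we: "w \<in> Ob C" "e \<in> ob (ob D j) w"
   show "app (\<gamma> j (act \<phi> v z)) w e = app (pcomp (\<gamma> k z) (ar D v)) w e"
    using app_comp[OF \<gamma>h[OF jk(2) z] Dpsh[OF v] we] \<gamma>app[OF we] \<gamma>app[OF we(1) app_in[OF Dpsh[OF v] we]]
     Dapp[OF mh v we] mz by simp
  qed
  thus "\<gamma> j (set_app (ar \<phi> v) z) = Comp (small_psh C) (\<gamma> k z) (ar D v)"
   using fullinD(4)[OF fullin_small] by (simp add: act_def)
 qed (use IE \<gamma>E in auto)
 moreover have "\<exists>!h. h \<in> hom (small_psh C) ?I d \<and> (\<forall>k\<in>Ob K. \<forall>z\<in>ob \<phi> k. Comp (small_psh C) h (\<gamma> k z) = \<delta> k z)"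
  if cc: "is_weighted_cocone K \<phi> (small_psh C) D d \<delta>" for d \<delta>
 proof -
  have d: "d \<in> Ob (small_psh C)" using cc by (simp add: is_weighted_cocone_def)
  note dp = fullinD(2)[OF fullin_small d]
  have \<delta>h: "\<delta> k z \<in> phom (ob D k) d" if "k \<in> Ob K" "z \<in> ob \<phi> k" for k z
   using cc that fullin_hom(3)[OF fullin_small] by (auto simp: is_weighted_cocone_def)
  have \<delta>c: "\<delta> j (act \<phi> v z) = pcomp (\<delta> k z) (ar D v)" if "v \<in> hom K j k" "z \<in> ob \<phi> k" for j k v z
   using cc that fullinD(4)[OF fullin_small] by (auto simp: is_weighted_cocone_def act_def)
  have dk: "Dom K t \<in> Ob K" if "t \<in> T" for t using K.hom_ob[OF gen_byD(3)[OF gen that]] by simp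
  define \<tau> where "\<tau> \<alpha> = (SOME t. t \<in> T \<and> ar D t = \<alpha>)" for \<alpha>
  have \<tau>: "\<tau> \<alpha> \<in> T" "ar D (\<tau> \<alpha>) = \<alpha>" if "\<alpha> \<in> ar D ` T" for \<alpha>
   using someI_ex[of "\<lambda>t. t \<in> T \<and> ar D t = \<alpha>"] that unfolding \<tau>_def by blast+
  define b where "b \<alpha> = app (\<delta> (Dom K (\<tau> \<alpha>)) (x (\<tau> \<alpha>)))" for \<alpha>
  have bh: "natl C (Ob C) (Dom (psh C) \<alpha>) d (b \<alpha>)" if "\<alpha> \<in> ar D ` T" for \<alpha>
   using psh_hom(5)[OF \<delta>h[OF dk[OF \<tau>(1)[OF that]] gen_byD(4)[OF gen \<tau>(1)[OF that]]]] domD[OF \<tau>(1)[OF that]] \<tau>(2)[OF that]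
   unfolding b_def by simp
  have compat0: "app (\<delta> (Dom K t) (x t)) w e = app (\<delta> (Dom K t') (x t')) w e'"
   if t: "t \<in> T" "t' \<in> T" and w: "w \<in> Ob C" and e: "e \<in> ob (ob D (Dom K t)) w" "e' \<in> ob (ob D (Dom K t')) w"
    and eq: "app (ar D t) w e = app (ar D t') w e'" for t t' w e e'
  proof -
   obtain l p q where pq: "p \<in> hom K l (Dom K t)" "q \<in> hom K l (Dom K t')" "Comp K t p = Comp K t' q"
    "covers_pb (ob D l) (ar D p) (ar D q) (ar D t) (ar D t')" by (rule pb[OF t])
   obtain r where r: "r \<in> ob (ob D l) w" "app (ar D p) w r = e" "app (ar D q) w r = e'"
    using pq(4)[unfolded covers_pb_def domD[OF t(1)] domD[OF t(2)]] w e eq by blast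
   have "act \<phi> p (x t) = act \<phi> q (x t')" using gen_byD(5)[OF gen t pq(1,2)] pq(3) by simp
   hence "pcomp (\<delta> (Dom K t) (x t)) (ar D p) = pcomp (\<delta> (Dom K t') (x t')) (ar D q)"
    using \<delta>c[OF pq(1) gen_byD(4)[OF gen t(1)]] \<delta>c[OF pq(2) gen_byD(4)[OF gen t(2)]] by simp
   thus ?thesis
    using app_comp[OF \<delta>h[OF dk[OF t(1)] gen_byD(4)[OF gen t(1)]] Dpsh[OF pq(1)] w r(1)]
     app_comp[OF \<delta>h[OF dk[OF t(2)] gen_byD(4)[OF gen t(2)]] Dpsh[OF pq(2)] w r(1)] r(2,3) by simp
  qed
  have compat: "b \<alpha> w e = b \<alpha>' w e'" if a: "\<alpha> \<in> ar D ` T" "\<alpha>' \<in> ar D ` T" and w: "w \<in> Ob C"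
    and e: "e \<in> ob (Dom (psh C) \<alpha>) w" "e' \<in> ob (Dom (psh C) \<alpha>') w" and eq: "app \<alpha> w e = app \<alpha>' w e'" for \<alpha> \<alpha>' w e e'
  proof -
   have "e \<in> ob (ob D (Dom K (\<tau> \<alpha>))) w" "e' \<in> ob (ob D (Dom K (\<tau> \<alpha>'))) w"
    using e domD[OF \<tau>(1)[OF a(1)]] domD[OF \<tau>(1)[OF a(2)]] \<tau>(2)[OF a(1)] \<tau>(2)[OF a(2)] by auto
   thus ?thesis unfolding b_def using compat0[OF \<tau>(1)[OF a(1)] \<tau>(1)[OF a(2)] w] eq \<tau>(2)[OF a(1)] \<tau>(2)[OF a(2)] by simp
  qed
  obtain s where s: "natl C (Ob C) ?I d s"
   "\<And>\<alpha> w e. \<alpha> \<in> ar D ` T ==> w \<in> Ob C ==> e \<in> ob (Dom (psh C) \<alpha>) w ==> s w (app \<alpha> w e) = b \<alpha> w e"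
   by (rule img_descend[OF intoD ob_psh[OF dp] bh compat]) (assumption | rule that)+
  have s': "s w (app (ar D t) w e) = app (\<delta> (Dom K t) (x t)) w e"
   if t: "t \<in> T" and w: "w \<in> Ob C" and e: "e \<in> ob (ob D (Dom K t)) w" for t w e
  proof -
   have ta: "ar D t \<in> ar D ` T" using t by blast
   have "ob D (Dom K (\<tau> (ar D t))) = ob D (Dom K t)" using domD[OF t] domD[OF \<tau>(1)[OF ta]] \<tau>(2)[OF ta] by simp
   hence "b (ar D t) w e = app (\<delta> (Dom K t) (x t)) w e"
    unfolding b_def using compat0[OF \<tau>(1)[OF ta] t w _ e] e \<tau>(2)[OF ta] by simp
   thus ?thesis using s(2)[OF ta w] domD[OF t] e by simp
  qed
  note sh = mk_arr_hom[OF Iob dp s(1)]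
  have hE: "hom (small_psh C) ?I d = phom ?I d" by (rule fullinD(3)[OF fullin_small IE d])
  have key: "pcomp h (\<gamma> k z) = \<delta> k z \<longleftrightarrow> (\<forall>w\<in>Ob C. \<forall>e\<in>ob (ob D k) w. app h w (app (ar D (m k z)) w e) = app (\<delta> k z) w e)"
   if h: "h \<in> phom ?I d" and k: "k \<in> Ob K" and z: "z \<in> ob \<phi> k" for h k z
  proof -
   have "app (pcomp h (\<gamma> k z)) w e = app h w (app (ar D (m k z)) w e)"
    if "w \<in> Ob C" "e \<in> ob (ob D k) w" for w e
    using app_comp[OF h \<gamma>h[OF k z] that] \<gamma>app[OF that] by simp
   thus ?thesis using psh_ext[OF Psh.comp_hom[OF h \<gamma>h[OF k z]] \<delta>h[OF k z]] by auto
  qed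
  show ?thesis
  proof (intro ex1I[of _ "mk_arr C ?I d s"] conjI ballI)
   show "mk_arr C ?I d s \<in> hom (small_psh C) ?I d" using sh hE by simp
   fix k z assume k: "k \<in> Ob K" and z: "z \<in> ob \<phi> k"
   obtain t u where t: "t \<in> T" "u \<in> hom K k (Dom K t)" "z = act \<phi> u (x t)" by (rule gen_byE[OF gen k z])
   have "app (mk_arr C ?I d s) w (app (ar D (m k z)) w e) = app (\<delta> k z) w e"
    if we: "w \<in> Ob C" "e \<in> ob (ob D k) w" for w e
   proof -
    note ue = app_in[OF Dpsh[OF t(2)] we]
    have "app (ar D (m k z)) w e = app (ar D t) w (app (ar D u) w e)"
     using m[OF t(1,2)] t(3) Dapp[OF gen_byD(3)[OF gen t(1)] t(2) we] by simp
    moreover have "app (ar D t) w (app (ar D u) w e) \<in> ob ?I w"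
     using appI[OF t(1,2) we] Dapp[OF gen_byD(3)[OF gen t(1)] t(2) we] by simp
    moreover have "app (\<delta> k z) w e = app (\<delta> (Dom K t) (x t)) w (app (ar D u) w e)"
     using \<delta>c[OF t(2) gen_byD(4)[OF gen t(1)]] t(3) app_comp[OF \<delta>h[OF dk[OF t(1)] gen_byD(4)[OF gen t(1)]] Dpsh[OF t(2)] we] by simp
    ultimately show ?thesis using we s'[OF t(1) we(1) ue] by simp
   qed
   thus "Comp (small_psh C) (mk_arr C ?I d s) (\<gamma> k z) = \<delta> k z"
    using key[OF sh k z] fullinD(4)[OF fullin_small] by simp
  next
   fix h assume h: "h \<in> hom (small_psh C) ?I d \<and> (\<forall>k\<in>Ob K. \<forall>z\<in>ob \<phi> k. Comp (small_psh C) h (\<gamma> k z) = \<delta> k z)"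
   hence hp: "h \<in> phom ?I d" using hE by simp
   show "h = mk_arr C ?I d s"
   proof (rule psh_ext[OF hp sh])
    fix w v assume w: "w \<in> Ob C" and v: "v \<in> ob ?I w"
    then obtain t e where t: "t \<in> T" "e \<in> ob (ob D (Dom K t)) w" "v = app (ar D t) w e"
     using domD by (auto simp: img_el)
    note xt = gen_byD(4)[OF gen t(1)]
    have idt: "Id K (Dom K t) \<in> hom K (Dom K t) (Dom K t)" using K.id_hom[OF dk[OF t(1)]] .
    have "m (Dom K t) (x t) = t"
     using m[OF t(1) idt] K.act_id[OF phi' dk[OF t(1)] xt] K.id_right[OF gen_byD(3)[OF gen t(1)]] by simp
    moreover have "pcomp h (\<gamma> (Dom K t) (x t)) = \<delta> (Dom K t) (x t)"
     using h dk[OF t(1)] xt fullinD(4)[OF fullin_small] by simp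
    ultimately have "app h w v = app (\<delta> (Dom K t) (x t)) w e"
     using key[OF hp dk[OF t(1)] xt] w t(2,3) by simp
    thus "app h w v = app (mk_arr C ?I d s) w v" using s'[OF t(1) w t(2)] t(3) w v by simp
   qed
  qed
 qed
 ultimately show ?thesis unfolding is_weighted_colimit_def by blast
qed

end

end

lemma is_unionD:
 assumes "is_union C x S m"
 shows "s \<in> S ==> is_subobject C x s" "is_subobject C x m" "s \<in> S ==> sub_le C s m"
  "is_subobject C x n ==> (\<And>s. s \<in> S ==> sub_le C s n) ==> sub_le C m n"
 using assms unfolding is_union_def by blast+

lemma (in cat) coequaliserD:
 assumes "is_coequaliser C p q e"
 shows "e \<in> hom C (Cod C p) (Cod C e)" "e ** p = e ** q" "p \<in> hom C (Dom C p) (Cod C p)" "q \<in> hom C (Dom C p) (Cod C p)"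
  "r \<in> hom C (Cod C p) w ==> r ** p = r ** q ==> \<exists>!h. h \<in> hom C (Cod C e) w \<and> h ** e = r"
 using assms hom_arr unfolding is_coequaliser_def by simp_all

context lpcat
begin

definition sv :: "'o => 'u set => ('o, 'u) presheaf" where
 "sv y T = img (rep y) (yar ` T)"

definition gens :: "'o => 'u set => bool" where
 "gens y T \<longleftrightarrow> y \<in> Ob C \<and> (\<forall>t\<in>T. t \<in> hom C (Dom C t) y)"

lemma gensD: "gens y T ==> y \<in> Ob C" "gens y T ==> t \<in> T ==> t \<in> hom C (Dom C t) y"
 "gens y T ==> t \<in> T ==> Dom C t \<in> Ob C"
 using hom_ob by (auto simp: gens_def)

lemma dom_yar: "t \<in> hom C x y ==> Dom (psh C) (yar t) = rep x"
 by (rule psh_hom(3)[OF yar_hom])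

lemma sv_into: "gens y T ==> into (rep y) (yar ` T)"
 unfolding into_def using rep_ob yar_hom[OF gensD(2)] dom_yar[OF gensD(2)] gensD(1) by auto

lemma sv_ob: "gens y T ==> sv y T \<in> Ob (psh C)"
 unfolding sv_def by (rule img_ob[OF sv_into])

lemma sv_el:
 assumes G: "gens y T" and z: "z \<in> Ob C"
 shows "g \<in> ob (sv y T) z \<longleftrightarrow> (\<exists>t\<in>T. \<exists>u\<in>hom C z (Dom C t). g = t ** u)"
proof -
 have "g \<in> ob (sv y T) z \<longleftrightarrow> g \<in> hom C z y \<and> (\<exists>t\<in>T. \<exists>u\<in>ob (Dom (psh C) (yar t)) z. g = app (yar t) z u)"
  unfolding sv_def by (simp add: img_el z)
 also have "\<dots> \<longleftrightarrow> g \<in> hom C z y \<and> (\<exists>t\<in>T. \<exists>u\<in>hom C z (Dom C t). g = t ** u)"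
  using dom_yar[OF gensD(2)[OF G]] yar_app[OF gensD(2)[OF G] z] z by (simp cong: bex_cong)
 also have "\<dots> \<longleftrightarrow> (\<exists>t\<in>T. \<exists>u\<in>hom C z (Dom C t). g = t ** u)"
  using comp_hom[OF gensD(2)[OF G]] by blast
 finally show ?thesis .
qed

lemma sv_sub: "gens y T ==> z \<in> Ob C ==> g \<in> ob (sv y T) z ==> g \<in> hom C z y"
 using comp_hom[OF gensD(2)] by (auto simp: sv_el)

lemma sv_mem: "gens y T ==> t \<in> T ==> u \<in> hom C z (Dom C t) ==> t ** u \<in> ob (sv y T) z"
 using hom_ob by (auto simp: sv_el)

lemma sv_gen: "gens y T ==> t \<in> T ==> t \<in> ob (sv y T) (Dom C t)"
 using sv_mem[of y T t "Id C (Dom C t)" "Dom C t"] id_right[OF gensD(2)] id_hom[OF gensD(3)] by simp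

lemma sv_act:
 assumes G: "gens y T" and f: "f \<in> hom C w z" and g: "g \<in> ob (sv y T) z"
 shows "act (sv y T) f g = g ** f"
proof -
 have z: "z \<in> Ob C" using hom_ob[OF f] by simp
 show ?thesis using img_act[OF f, of g "rep y" "yar ` T"] g rep_act[OF f sv_sub[OF G z g]] unfolding sv_def by simp
qed

abbreviation sv_incl :: "'o => 'u set => ('o, 'u) presheaf_arr" where
 "sv_incl y T \<equiv> mk_arr C (sv y T) (rep y) (\<lambda>z x. x)"

lemma sv_incl_hom: "gens y T ==> sv_incl y T \<in> phom (sv y T) (rep y)"
 unfolding sv_def by (rule img_incl[OF sv_into])

lemma sv_incl_mono: "gens y T ==> is_mono (psh C) (sv_incl y T)"
 by (rule psh_monoI[OF sv_incl_hom]) (auto simp: inj_on_def)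

abbreviation sv_to :: "'o => 'u set => 'u => ('o, 'u) presheaf_arr" where
 "sv_to y T t \<equiv> mk_arr C (rep (Dom C t)) (sv y T) (app (yar t))"

lemma sv_to_hom:
 assumes G: "gens y T" and t: "t \<in> T"
 shows "sv_to y T t \<in> phom (rep (Dom C t)) (sv y T)"
 unfolding sv_def using img_corestrict[OF sv_into[OF G], of "yar t"] t dom_yar[OF gensD(2)[OF G t]] by simp

lemma sv_to_app:
 "gens y T ==> t \<in> T ==> z \<in> Ob C ==> u \<in> hom C z (Dom C t) ==> app (sv_to y T t) z u = t ** u"
 using yar_app[OF gensD(2)] by simp

lemma sv_descend:
 assumes G: "gens y T" and P: "P \<in> Ob (psh C)" and b: "\<And>t. t \<in> T ==> b t \<in> ob P (Dom C t)"
  and compat: "\<And>t t' z u u'. t \<in> T ==> t' \<in> T ==> u \<in> hom C z (Dom C t) ==> u' \<in> hom C z (Dom C t') ==>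
   t ** u = t' ** u' ==> act P u (b t) = act P u' (b t')"
 obtains h where "h \<in> phom (sv y T) P"
  "\<And>t z u. t \<in> T ==> u \<in> hom C z (Dom C t) ==> app h z (t ** u) = act P u (b t)"
  "\<And>t. t \<in> T ==> app h (Dom C t) t = b t"
proof -
 note P' = ob_psh[OF P]
 define s where "s z g = (SOME v. \<exists>t\<in>T. \<exists>u\<in>hom C z (Dom C t). g = t ** u \<and> v = act P u (b t))" for z g
 have s: "s z (t ** u) = act P u (b t)" if "t \<in> T" "u \<in> hom C z (Dom C t)" for t u z
  unfolding s_def
 proof (rule some_equality)
  show "\<exists>t'\<in>T. \<exists>u'\<in>hom C z (Dom C t'). t ** u = t' ** u' \<and> act P u (b t) = act P u' (b t')" using that by blast
  fix v assume "\<exists>t'\<in>T. \<exists>u'\<in>hom C z (Dom C t'). t ** u = t' ** u' \<and> v = act P u' (b t')"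
  then obtain t' u' where "t' \<in> T" "u' \<in> hom C z (Dom C t')" "t ** u = t' ** u'" "v = act P u' (b t')" by blast
  thus "v = act P u (b t)" using compat[OF that(1) _ that(2)] by simp
 qed
 have h: "mk_arr C (sv y T) P s \<in> phom (sv y T) P"
 proof (rule mk_arr_homI[OF sv_ob[OF G] P])
  fix z g assume z: "z \<in> Ob C" and g: "g \<in> ob (sv y T) z"
  then obtain t u where t: "t \<in> T" "u \<in> hom C z (Dom C t)" "g = t ** u" by (auto simp: sv_el[OF G z])
  show "s z g \<in> ob P z" using s[OF t(1,2)] t(3) act_in[OF P' t(2) b[OF t(1)]] by simp
 next
  fix w z f g assume f: "f \<in> hom C w z" and g: "g \<in> ob (sv y T) z"
  have z: "z \<in> Ob C" using hom_ob[OF f] by simp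
  obtain t u where t: "t \<in> T" "u \<in> hom C z (Dom C t)" "g = t ** u" using g by (auto simp: sv_el[OF G z])
  have "act (sv y T) f g = t ** (u ** f)" using sv_act[OF G f g] t(3) assoc[OF gensD(2)[OF G t(1)] t(2) f] by simp
  thus "s w (act (sv y T) f g) = act P f (s z g)"
   using s[OF t(1) comp_hom[OF t(2) f]] s[OF t(1,2)] t(3) act_comp[OF P' t(2) f b[OF t(1)]] by simp
 qed
 have e: "app (mk_arr C (sv y T) P s) z (t ** u) = act P u (b t)" if "t \<in> T" "u \<in> hom C z (Dom C t)" for t z u
  using s[OF that] sv_mem[OF G that] hom_ob[OF that(2)] by simp
 have "app (mk_arr C (sv y T) P s) (Dom C t) t = b t" if "t \<in> T" for t
  using e[OF that id_hom[OF gensD(3)[OF G that]]] id_right[OF gensD(2)[OF G that]] act_id[OF P' gensD(3)[OF G that] b[OF that]] by simp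
 thus ?thesis using that[OF h e] by blast
qed

lemma sv_hom_ext:
 assumes G: "gens y T" and h: "h \<in> phom (sv y T) P" "k \<in> phom (sv y T) P"
  and e: "\<And>t. t \<in> T ==> app h (Dom C t) t = app k (Dom C t) t"
 shows "h = k"
proof (rule psh_ext[OF h])
 fix z g assume z: "z \<in> Ob C" and "g \<in> ob (sv y T) z"
 then obtain t u where t: "t \<in> T" "u \<in> hom C z (Dom C t)" "g = t ** u" by (auto simp: sv_el[OF G z])
 have "g = act (sv y T) u t" using sv_act[OF G t(2) sv_gen[OF G t(1)]] t(3) by simp
 thus "app h z g = app k z g"
  using app_nat[OF h(1) t(2) sv_gen[OF G t(1)]] app_nat[OF h(2) t(2) sv_gen[OF G t(1)]] e[OF t(1)] by simp
qed

lemma sv_gen_by: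
 assumes G: "gens y T" and fin: "finite T"
 shows "gen_by C (sv y T) y T (\<lambda>t. t)"
 unfolding gen_by_def
proof (intro conjI ballI allI)
 show "\<exists>t\<in>T. \<exists>u\<in>hom C k (Dom C t). z = act (sv y T) u t" if k: "k \<in> Ob C" and z: "z \<in> ob (sv y T) k" for k z
 proof -
  obtain t u where t: "t \<in> T" "u \<in> hom C k (Dom C t)" "z = t ** u" using z by (auto simp: sv_el[OF G k])
  have "z = act (sv y T) u t" using sv_act[OF G t(2) sv_gen[OF G t(1)]] t(3) by simp
  thus ?thesis using t(1,2) by blast
 qed
 show "act (sv y T) u t = act (sv y T) u' t' \<longleftrightarrow> t ** u = t' ** u'"
  if t: "t \<in> T" "t' \<in> T" and u: "u \<in> hom C k (Dom C t)" "u' \<in> hom C k (Dom C t')" for t t' k u u'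
  using sv_act[OF G u(1) sv_gen[OF G t(1)]] sv_act[OF G u(2) sv_gen[OF G t(2)]] by simp
qed (use fin gensD[OF G] sv_gen[OF G] in auto)

lemma sv_coequaliser:
 assumes f: "f \<in> hom C x y" and kp: "is_kernel_pair (psh C) (yar f) p q"
 shows "is_coequaliser (psh C) p q (sv_to y {f} f)"
proof -
 have Df: "Dom C f = x" using f by (simp add: hom_def)
 have G: "gens y {f}" using f hom_ob[OF f] Df by (simp add: gens_def)
 note yf = yar_hom[OF f]
 have PB: "is_pullback (psh C) (yar f) (yar f) p q" using kp by (simp add: is_kernel_pair_def)
 note pb = Psh.pullbackD[OF PB yf, unfolded dom_yar[OF f]]
 have e: "sv_to y {f} f \<in> phom (rep x) (sv y {f})" using sv_to_hom[OF G, of f] Df by simp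
 have eapp: "app (sv_to y {f} f) z u = f ** u" if "u \<in> hom C z x" for z u
  using sv_to_app[OF G, of f z u] that hom_ob[OF that] Df by simp
 have univ: "\<exists>!h. h \<in> phom (sv y {f}) W \<and> pcomp h (sv_to y {f} f) = r"
  if r: "r \<in> phom (rep x) W" and rc: "pcomp r p = pcomp r q" for W r
 proof -
  have W: "W \<in> Ob (psh C)" using psh_hom[OF r] by blast
  have idx: "Id C x \<in> ob (rep x) x" using hom_ob[OF f] id_hom by simp
  have rapp: "act W u (app r x (Id C x)) = app r z u" if "u \<in> hom C z x" for u z using app_yon[OF r that] by simp
  obtain h where h: "h \<in> phom (sv y {f}) W"
   "\<And>t z u. t \<in> {f} ==> u \<in> hom C z (Dom C t) ==> app h z (t ** u) = act W u (app r x (Id C x))"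
   "\<And>t. t \<in> {f} ==> app h (Dom C t) t = app r x (Id C x)"
  proof (rule sv_descend[OF G W])
   show "app r x (Id C x) \<in> ob W (Dom C t)" if "t \<in> {f}" for t
    using app_in[OF r _ idx] that Df hom_ob[OF f] by simp
   fix t t' z u u' assume "t \<in> {f}" "t' \<in> {f}" "u \<in> hom C z (Dom C t)" "u' \<in> hom C z (Dom C t')" "t ** u = t' ** u'"
   hence u: "u \<in> hom C z x" "u' \<in> hom C z x" "f ** u = f ** u'" using Df by auto
   have z: "z \<in> Ob C" using hom_ob[OF u(1)] by simp
   obtain w where w: "w \<in> ob (Dom (psh C) p) z" "app p z w = u" "app q z w = u'"
    by (rule pullback_pointwise[OF fullin_psh PB yf yf z, of u u']) (use u z yar_app[OF f z] in auto)
   have "app r z u = app r z u'"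
    using app_comp[OF r pb(1) z w(1)] app_comp[OF r pb(2) z w(1)] rc w by simp
   thus "act W u (app r x (Id C x)) = act W u' (app r x (Id C x))" using rapp[OF u(1)] rapp[OF u(2)] by simp
  qed (assumption | rule that)+
  show ?thesis
  proof (intro ex1I[of _ h] conjI)
   show "h \<in> phom (sv y {f}) W" by (rule h(1))
   show "pcomp h (sv_to y {f} f) = r"
   proof (rule psh_ext[OF Psh.comp_hom[OF h(1) e] r])
    fix z u assume zu: "z \<in> Ob C" "u \<in> ob (rep x) z"
    hence u: "u \<in> hom C z x" by simp
    show "app (pcomp h (sv_to y {f} f)) z u = app r z u"
     using app_comp[OF h(1) e zu] eapp[OF u] h(2)[of f u z] u Df rapp[OF u] by simp
   qed
   fix k assume k: "k \<in> phom (sv y {f}) W \<and> pcomp k (sv_to y {f} f) = r"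
   show "k = h"
   proof (rule sv_hom_ext[OF G _ h(1)])
    show "app k (Dom C t) t = app h (Dom C t) t" if "t \<in> {f}" for t
     using app_comp[of k "sv y {f}" W "sv_to y {f} f" "rep x" x "Id C x"] k e idx hom_ob[OF f] eapp[OF id_hom]
      id_right[OF f] h(3)[of f] that Df by simp
   qed (use k in simp)
  qed
 qed
 have "pcomp (sv_to y {f} f) p = pcomp (sv_to y {f} f) q"
 proof (rule psh_ext[OF Psh.comp_hom[OF e pb(1)] Psh.comp_hom[OF e pb(2)]])
  fix z w assume zw: "z \<in> Ob C" "w \<in> ob (Dom (psh C) p) z"
  have h: "app p z w \<in> hom C z x" "app q z w \<in> hom C z x" using app_in[OF pb(1) zw] app_in[OF pb(2) zw] zw(1) by auto
  have "f ** app p z w = f ** app q z w"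
   using app_comp[OF yf pb(1) zw] app_comp[OF yf pb(2) zw] pb(4) yar_app[OF f zw(1) h(1)] yar_app[OF f zw(1) h(2)] by simp
  thus "app (pcomp (sv_to y {f} f) p) z w = app (pcomp (sv_to y {f} f) q) z w"
   using app_comp[OF e pb(1) zw] app_comp[OF e pb(2) zw] eapp[OF h(1)] eapp[OF h(2)] by simp
 qed
 moreover have "Cod (psh C) p = rep x" "Cod (psh C) (sv_to y {f} f) = sv y {f}" "p \<in> Arr (psh C)"
  using pb(1) e by (auto simp: hom_def)
 ultimately show ?thesis unfolding is_coequaliser_def using pb e univ by simp
qed

lemma sv_union:
 assumes G: "gens y T" and mono: "\<And>t. t \<in> T ==> is_mono C t"
 shows "is_union (psh C) (rep y) (yar ` T) (sv_incl y T)"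
proof -
 have y: "y \<in> Ob C" using gensD(1)[OF G] .
 have mt: "is_mono (psh C) (yar t)" if "t \<in> T" for t
  by (rule mono_preserved[OF yoneda_functor_in[OF fullin_psh] yoneda_lex[OF fullin_psh] mono[OF that]])
 have dc: "Dom (psh C) (sv_incl y T) = sv y T" "Cod (psh C) (sv_incl y T) = rep y"
  using sv_incl_hom[OF G] by (auto simp: hom_def)
 show ?thesis unfolding is_union_def
 proof (intro conjI ballI allI impI)
  show "is_subobject (psh C) (rep y) a" if "a \<in> yar ` T" for a
   using that mt yar_hom[OF gensD(2)[OF G]] by (auto simp: is_subobject_def hom_def)
  show "is_subobject (psh C) (rep y) (sv_incl y T)" using sv_incl_mono[OF G] dc by (simp add: is_subobject_def)
  fix a assume "a \<in> yar ` T"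
  then obtain t where t: "t \<in> T" "a = yar t" by blast
  note th = sv_to_hom[OF G t(1)]
  have "pcomp (sv_incl y T) (sv_to y T t) = yar t"
  proof (rule psh_ext[OF Psh.comp_hom[OF sv_incl_hom[OF G] th] yar_hom[OF gensD(2)[OF G t(1)]]])
   fix z u assume zu: "z \<in> Ob C" "u \<in> ob (rep (Dom C t)) z"
   show "app (pcomp (sv_incl y T) (sv_to y T t)) z u = app (yar t) z u"
    using app_comp[OF sv_incl_hom[OF G] th zu] app_in[OF th zu] zu by simp
  qed
  thus "sub_le (psh C) a (sv_incl y T)"
   unfolding sub_le_def dc t(2) dom_yar[OF gensD(2)[OF G t(1)]] using th by blast
 next
  fix n assume n: "is_subobject (psh C) (rep y) n \<and> (\<forall>s\<in>yar ` T. sub_le (psh C) s n)"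
  let ?N = "Dom (psh C) n"
  have nm: "is_mono (psh C) n" and nc: "Cod (psh C) n = rep y" using n by (simp_all add: is_subobject_def)
  note nh = Psh.mono_hom[OF nm, unfolded nc]
  have N: "?N \<in> Ob (psh C)" using psh_hom[OF nh] by blast
  have "\<exists>k \<in> phom (rep (Dom C t)) ?N. pcomp n k = yar t" if "t \<in> T" for t
  proof -
   have "sub_le (psh C) (yar t) n" using n that by blast
   thus ?thesis unfolding sub_le_def dom_yar[OF gensD(2)[OF G that]] .
  qed
  then obtain k where k: "\<And>t. t \<in> T ==> k t \<in> phom (rep (Dom C t)) ?N" "\<And>t. t \<in> T ==> pcomp n (k t) = yar t"
   by metis
  let ?b = "\<lambda>t. app (k t) (Dom C t) (Id C (Dom C t))"
  have ka: "app n z (act ?N u (?b t)) = t ** u" if t: "t \<in> T" and u: "u \<in> hom C z (Dom C t)" for t z u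
  proof -
   have z: "z \<in> Ob C" using hom_ob[OF u] by simp
   have "act ?N u (?b t) = app (k t) z u" using app_yon[OF k(1)[OF t] u] by simp
   thus ?thesis using app_comp[OF nh k(1)[OF t] z, of u] u z k(2)[OF t] yar_app[OF gensD(2)[OF G t] z u] by simp
  qed
  have idt: "Id C (Dom C t) \<in> ob (rep (Dom C t)) (Dom C t)" if "t \<in> T" for t
   using id_hom[OF gensD(3)[OF G that]] gensD(3)[OF G that] by simp
  have bin: "?b t \<in> ob ?N (Dom C t)" if "t \<in> T" for t
   by (rule app_in[OF k(1)[OF that] gensD(3)[OF G that] idt[OF that]])
  obtain h where h: "h \<in> phom (sv y T) ?N"
   "\<And>t z u. t \<in> T ==> u \<in> hom C z (Dom C t) ==> app h z (t ** u) = act ?N u (?b t)"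
   "\<And>t. t \<in> T ==> app h (Dom C t) t = ?b t"
  proof (rule sv_descend[OF G N bin])
   fix t t' z u u' assume t: "t \<in> T" "t' \<in> T" and u: "u \<in> hom C z (Dom C t)" "u' \<in> hom C z (Dom C t')" and e: "t ** u = t' ** u'"
   have z: "z \<in> Ob C" using hom_ob[OF u(1)] by simp
   show "act ?N u (?b t) = act ?N u' (?b t')"
    by (rule psh_mono_inj[OF nm nh z act_in[OF ob_psh[OF N] u(1) bin[OF t(1)]] act_in[OF ob_psh[OF N] u(2) bin[OF t(2)]]])
     (use ka[OF t(1) u(1)] ka[OF t(2) u(2)] e in simp)
  qed (assumption | rule that)+
  have "pcomp n h = sv_incl y T"
  proof (rule sv_hom_ext[OF G Psh.comp_hom[OF nh h(1)] sv_incl_hom[OF G]])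
   fix t assume t: "t \<in> T"
   have "app n (Dom C t) (?b t) = t"
    using ka[OF t id_hom[OF gensD(3)[OF G t]]] act_id[OF ob_psh[OF N] gensD(3)[OF G t] bin[OF t]] id_right[OF gensD(2)[OF G t]] by simp
   thus "app (pcomp n h) (Dom C t) t = app (sv_incl y T) (Dom C t) t"
    using app_comp[OF nh h(1) gensD(3)[OF G t] sv_gen[OF G t]] h(3)[OF t] gensD(3)[OF G t] sv_gen[OF G t] by simp
  qed
  thus "sub_le (psh C) (sv_incl y T) n" unfolding sub_le_def dc using h(1) by blast
 qed
qed

lemma coequaliser_gen_by:
 assumes f: "f \<in> hom C x y" and kp: "is_kernel_pair (psh C) (yar f) p q" and ce: "is_coequaliser (psh C) p q e"
 shows "gen_by C (Cod (psh C) e) y {f} (\<lambda>_. app e x (Id C x))"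
proof -
 have Df: "Dom C f = x" using f by (simp add: hom_def)
 have xy: "x \<in> Ob C" "y \<in> Ob C" using hom_ob[OF f] by auto
 have G: "gens y {f}" using f xy Df by (simp add: gens_def)
 let ?e0 = "sv_to y {f} f" let ?Q = "Cod (psh C) e"
 have ce0: "is_coequaliser (psh C) p q ?e0" by (rule sv_coequaliser[OF f kp])
 have e0: "?e0 \<in> phom (rep x) (sv y {f})" using sv_to_hom[OF G, of f] Df by simp
 have cp: "Cod (psh C) p = rep x"
 proof -
  have "is_pullback (psh C) (yar f) (yar f) p q" using kp by (simp add: is_kernel_pair_def)
  from Psh.pullbackD(1)[OF this yar_hom[OF f]] show ?thesis by (simp add: hom_def)
 qed
 have e: "e \<in> phom (rep x) ?Q" using ce cp by (simp add: is_coequaliser_def)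
 have Q: "?Q \<in> Ob (psh C)" using psh_hom[OF e] by blast
 have "\<exists>!h. h \<in> phom ?Q (sv y {f}) \<and> pcomp h e = ?e0"
  using Psh.coequaliserD(5)[OF ce, of ?e0] Psh.coequaliserD(2)[OF ce0] cp e0 by simp
 then obtain h where h: "h \<in> phom ?Q (sv y {f})" "pcomp h e = ?e0" by blast
 have "Cod (psh C) ?e0 = sv y {f}" using e0 by (simp add: hom_def)
 hence "\<exists>!h. h \<in> phom (sv y {f}) ?Q \<and> pcomp h ?e0 = e"
  using Psh.coequaliserD(5)[OF ce0, of e] Psh.coequaliserD(2)[OF ce] cp e by simp
 then obtain k where k: "k \<in> phom (sv y {f}) ?Q" "pcomp k ?e0 = e" by blast
 have "\<exists>!r. r \<in> phom ?Q ?Q \<and> pcomp r e = e"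
  using Psh.coequaliserD(5)[OF ce, of e] Psh.coequaliserD(2)[OF ce] cp e by simp
 moreover have "pcomp (pcomp k h) e = e" using Psh.assoc[OF k(1) h(1) e] h(2) k(2) by simp
 moreover have "pcomp (Id (psh C) ?Q) e = e" by (rule Psh.id_left[OF e])
 ultimately have kh: "pcomp k h = Id (psh C) ?Q" using Psh.comp_hom[OF k(1) h(1)] Psh.id_hom[OF Q] by blast
 have ea: "app e z u = act ?Q u (app e x (Id C x))" if "u \<in> hom C z x" for z u by (rule app_yon[OF e that])
 have he: "app h z (app e z u) = f ** u" if u: "u \<in> hom C z x" for z u
  using app_comp[OF h(1) e, of z u] h(2) sv_to_app[OF G, of f z u] u hom_ob[OF u] Df by simp
 have ke: "app k z (f ** u) = app e z u" if u: "u \<in> hom C z x" for z u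
  using app_comp[OF k(1) e0, of z u] k(2) sv_to_app[OF G, of f z u] u hom_ob[OF u] Df by simp
 show ?thesis unfolding gen_by_def
 proof (intro conjI ballI allI)
  show "app e x (Id C x) \<in> ob ?Q (Dom C t)" if "t \<in> {f}" for t using app_in[OF e xy(1)] id_hom xy that Df by simp
  show "\<exists>t\<in>{f}. \<exists>u\<in>hom C z (Dom C t). v = act ?Q u (app e x (Id C x))" if z: "z \<in> Ob C" and v: "v \<in> ob ?Q z" for z v
  proof -
   obtain u where u: "u \<in> hom C z x" "app h z v = f ** u" using app_in[OF h(1) z v] sv_el[OF G z] Df by auto
   have "v = app k z (app h z v)" using app_comp[OF k(1) h(1) z v] kh z v by simp
   thus ?thesis using ke[OF u(1)] u(2) ea[OF u(1)] u(1) Df by auto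
  qed
  show "act ?Q u (app e x (Id C x)) = act ?Q u' (app e x (Id C x)) \<longleftrightarrow> t ** u = t' ** u'"
   if "t \<in> {f}" "t' \<in> {f}" "u \<in> hom C z (Dom C t)" "u' \<in> hom C z (Dom C t')" for t t' z u u'
  proof -
   have u: "u \<in> hom C z x" "u' \<in> hom C z x" "t = f" "t' = f" using that Df by auto
   show ?thesis using he[OF u(1)] he[OF u(2)] ke[OF u(1)] ke[OF u(2)] ea[OF u(1)] ea[OF u(2)] u(3,4) by metis
  qed
 qed (use xy f Df in auto)
qed

lemma union_gen_by:
 assumes G: "gens y T" and fin: "finite T" and mono: "\<And>t. t \<in> T ==> is_mono C t"
  and un: "is_union (psh C) (rep y) (yar ` T) v"
 shows "\<exists>x. gen_by C (Dom (psh C) v) y T x"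
proof -
 let ?i = "sv_incl y T" let ?V = "Dom (psh C) v"
 have ui: "is_union (psh C) (rep y) (yar ` T) ?i" by (rule sv_union[OF G mono])
 have ih: "?i \<in> phom (sv y T) (rep y)" by (rule sv_incl_hom[OF G])
 have Di: "Dom (psh C) ?i = sv y T" using ih by (simp add: hom_def)
 have vm: "is_mono (psh C) v" and vc: "Cod (psh C) v = rep y" using un by (simp_all add: is_union_def is_subobject_def)
 note vh = Psh.mono_hom[OF vm, unfolded vc]
 have V: "?V \<in> Ob (psh C)" using psh_hom[OF vh] by blast
 have "sub_le (psh C) ?i v" by (rule is_unionD(4)[OF ui is_unionD(2)[OF un] is_unionD(3)[OF un]])
 have "sub_le (psh C) v ?i" by (rule is_unionD(4)[OF un is_unionD(2)[OF ui] is_unionD(3)[OF ui]])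
 then obtain h where h: "h \<in> phom ?V (sv y T)" "pcomp ?i h = v" unfolding sub_le_def Di by blast
 obtain k where k: "k \<in> phom (sv y T) ?V" "pcomp v k = ?i"
  using \<open>sub_le (psh C) ?i v\<close> unfolding sub_le_def Di by blast
 have va: "app v z w = app h z w" if "z \<in> Ob C" "w \<in> ob ?V z" for z w
  using app_comp[OF ih h(1) that] h(2) app_in[OF h(1) that] that(1) by simp
 have ka: "app v z (app k z g) = g" if "z \<in> Ob C" "g \<in> ob (sv y T) z" for z g
  using app_comp[OF vh k(1) that] k(2) that by simp
 have kact: "app k z (t ** u) = act ?V u (app k (Dom C t) t)" if "t \<in> T" "u \<in> hom C z (Dom C t)" for t u z
  using app_nat[OF k(1) that(2) sv_gen[OF G that(1)]] sv_act[OF G that(2) sv_gen[OF G that(1)]] by simp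
 have "gen_by C ?V y T (\<lambda>t. app k (Dom C t) t)"
  unfolding gen_by_def
 proof (intro conjI ballI allI)
  show "app k (Dom C t) t \<in> ob ?V (Dom C t)" if "t \<in> T" for t
   by (rule app_in[OF k(1) gensD(3)[OF G that] sv_gen[OF G that]])
  show "\<exists>t\<in>T. \<exists>u\<in>hom C z (Dom C t). w = act ?V u (app k (Dom C t) t)" if z: "z \<in> Ob C" and w: "w \<in> ob ?V z" for z w
  proof -
   note hw = app_in[OF h(1) z w]
   obtain t u where t: "t \<in> T" "u \<in> hom C z (Dom C t)" "app h z w = t ** u" using hw by (auto simp: sv_el[OF G z])
   have "w = app k z (app h z w)"
    by (rule psh_mono_inj[OF vm vh z w app_in[OF k(1) z hw]]) (use ka[OF z hw] va[OF z w] in simp)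
   thus ?thesis using kact[OF t(1,2)] t by auto
  qed
  show "act ?V u (app k (Dom C t) t) = act ?V u' (app k (Dom C t') t') \<longleftrightarrow> t ** u = t' ** u'"
   if t: "t \<in> T" "t' \<in> T" and u: "u \<in> hom C z (Dom C t)" "u' \<in> hom C z (Dom C t')" for t t' z u u'
  proof -
   have z: "z \<in> Ob C" using hom_ob[OF u(1)] by simp
   show ?thesis using kact[OF t(1) u(1)] kact[OF t(2) u(2)] ka[OF z sv_mem[OF G t(1) u(1)]] ka[OF z sv_mem[OF G t(2) u(2)]] by metis
  qed
 qed (use fin gensD[OF G] in auto)
 thus ?thesis by blast
qed

end

lemma lpcat_small:
 fixes K :: "('k, 'u) cat"
 assumes "universe TYPE('u)" "small_category K" shows "lpcat K"
 using assms small_locally_small[OF assms(2)] by unfold_locales (auto simp: small_category_def)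

lemma weights_coh_gen_by:
 fixes K :: "('u, 'u) cat"
 assumes U: "universe TYPE('u)" and w: "(K, \<phi>) \<in> weights_coh"
 shows "\<exists>y T x. gen_by K \<phi> y T x"
proof -
 have lw: "small_category K" using weights_coh_lex[OF U w] by (simp add: lex_weight_def)
 interpret K: lpcat K by (rule lpcat_small[OF U lw])
 consider "(K, \<phi>) \<in> weights_reg" | "terminal_category K" "is_initial (psh K) \<phi>"
  | m n v where "free_lex_on_mono_cospan K m n"
   "is_union (psh K) (representable K (Cod K m)) {ar (yoneda K) m, ar (yoneda K) n} v" "Dom (psh K) v = \<phi>"
  using w by (auto simp: weights_coh_def weights_or_def)
 thus ?thesis
 proof cases
  case 1
  then obtain f p q e where f: "free_lex_on_arrow K f" "is_kernel_pair (psh K) (ar (yoneda K) f) p q"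
   "is_coequaliser (psh K) p q e" "Cod (psh K) e = \<phi>" by (auto simp: weights_reg_def)
  have "f \<in> hom K (Dom K f) (Cod K f)" using f(1) by (auto simp: free_lex_on_arrow_def hom_def)
  from K.coequaliser_gen_by[OF this f(2,3)] show ?thesis using f(4) by blast
 next
  case 2
  then obtain y where y: "Ob K = {y}" by (auto simp: terminal_category_def)
  have G: "K.gens y {}" using y by (simp add: K.gens_def)
  obtain h where h: "h \<in> hom (psh K) \<phi> (K.sv y {})" using 2(2) K.sv_ob[OF G] unfolding is_initial_def by blast
  have "ob \<phi> k = {}" if "k \<in> Ob K" for k using K.app_in[OF h that] K.sv_el[OF G that] by blast
  hence "gen_by K \<phi> y {} (\<lambda>t. t)" using y by (simp add: gen_by_def)
  thus ?thesis by blast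
 next
  case 3
  let ?y = "Cod K m"
  have mn: "is_mono K m" "is_mono K n" "Cod K n = ?y" using 3(1) by (auto simp: free_lex_on_mono_cospan_def mono_cospan_def)
  have "K.gens ?y {m, n}" using K.mono_hom[OF mn(1)] K.mono_hom[OF mn(2)] mn(3) K.hom_ob by (auto simp: K.gens_def)
  thus ?thesis using K.union_gen_by[of ?y "{m, n}" v] mn 3(2,3) by auto
 qed
qed

lemma sieve_weight_reg:
 fixes K :: "('u, 'u) cat"
 assumes U: "universe TYPE('u)" and K: "small_category K" "free_lex_on_arrow K f"
 shows "(K, lpcat.sv K (Cod K f) {f}) \<in> weights_coh"
proof -
 interpret K: lpcat K by (rule lpcat_small[OF U K(1)])
 interpret K: lex_cat K using K(2) by unfold_locales (simp add: free_lex_on_arrow_def)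
 have f: "f \<in> hom K (Dom K f) (Cod K f)" using K(2) by (auto simp: free_lex_on_arrow_def hom_def)
 obtain l p q where "is_pullback K f f p q" by (rule K.pullback_exists[OF f f])
 hence kp: "is_kernel_pair (psh K) (ar (yoneda K) f) (ar (yoneda K) p) (ar (yoneda K) q)"
  unfolding is_kernel_pair_def by (rule pullback_preserved[OF K.yoneda_functor_in[OF K.fullin_psh] K.yoneda_lex[OF K.fullin_psh]])
 have G: "K.gens (Cod K f) {f}" using f K.hom_ob[OF f] by (simp add: K.gens_def)
 have "Cod (psh K) (K.sv_to (Cod K f) {f} f) = K.sv (Cod K f) {f}" using K.sv_to_hom[OF G] by (auto simp: hom_def)
 thus ?thesis using K kp K.sv_coequaliser[OF f kp] unfolding weights_coh_def weights_reg_def by blast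
qed

lemma sieve_weight_or:
 fixes K :: "('u, 'u) cat"
 assumes U: "universe TYPE('u)" and K: "small_category K" "free_lex_on_mono_cospan K m n"
 shows "(K, lpcat.sv K (Cod K m) {m, n}) \<in> weights_coh"
proof -
 interpret K: lpcat K by (rule lpcat_small[OF U K(1)])
 have mn: "is_mono K m" "is_mono K n" "Cod K n = Cod K m" using K(2) by (auto simp: free_lex_on_mono_cospan_def mono_cospan_def)
 have G: "K.gens (Cod K m) {m, n}" using K.mono_hom[OF mn(1)] K.mono_hom[OF mn(2)] mn(3) K.hom_ob by (auto simp: K.gens_def)
 have "is_union (psh K) (K.rep (Cod K m)) {K.yar m, K.yar n} (K.sv_incl (Cod K m) {m, n})"
  using K.sv_union[OF G] mn by auto
 moreover have "Dom (psh K) (K.sv_incl (Cod K m) {m, n}) = K.sv (Cod K m) {m, n}"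
  using K.sv_incl_hom[OF G] by (auto simp: hom_def)
 ultimately show ?thesis using K unfolding weights_coh_def weights_or_def by blast
qed

lemma sieve_weight_initial:
 fixes K :: "('u, 'u) cat"
 assumes U: "universe TYPE('u)" and K: "small_category K" "terminal_category K" "y \<in> Ob K"
 shows "(K, lpcat.sv K y {}) \<in> weights_coh"
proof -
 interpret K: lpcat K by (rule lpcat_small[OF U K(1)])
 have G: "K.gens y {}" using K(3) by (simp add: K.gens_def)
 have "is_initial (psh K) (K.sv y {})"
  unfolding is_initial_def
 proof (intro conjI ballI)
  show "K.sv y {} \<in> Ob (psh K)" by (rule K.sv_ob[OF G])
  fix P assume P: "P \<in> Ob (psh K)"
  obtain h where "h \<in> hom (psh K) (K.sv y {}) P" by (rule K.sv_descend[OF G P]) auto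
  thus "\<exists>!f. f \<in> hom (psh K) (K.sv y {}) P" using K.sv_hom_ext[OF G] by blast
 qed
 thus ?thesis using K unfolding weights_coh_def weights_or_def by blast
qed

section \<open>Free finitely complete categories on families of arrows\<close>

text \<open>
  A model is a family of functions \<open>X\<^sub>i \<rightarrow> X\<^sub>0\<close> (\<open>i \<in> I\<close>), injective if \<open>mo\<close> is set. It is coded by the
  disjoint union \<open>V\<close> of all its sets, the first component of an element telling its sort, together with
  the joint extension \<open>e\<close> of the functions by the identity of \<open>X\<^sub>0\<close>. The free finitely complete category
  is the opposite of the category of finite models.
\<close>

definition model :: "nat set => bool => (nat \<times> 'x) set => (nat \<times> 'x => nat \<times> 'x) => bool" where
 "model I mo V e \<longleftrightarrow> (\<forall>v\<in>V. (fst v = 0 \<or> fst v \<in> I) \<and> e v \<in> V \<and> fst (e v) = 0 \<and> (fst v = 0 --> e v = v)) \<and>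
  (mo --> (\<forall>v\<in>V. \<forall>w\<in>V. fst v = fst w \<and> e v = e w --> v = w))"

definition mhom :: "(nat \<times> 'x) set => (nat \<times> 'x => nat \<times> 'x) => (nat \<times> 'y) set => (nat \<times> 'y => nat \<times> 'y) =>
  (nat \<times> 'x => nat \<times> 'y) => bool" where
 "mhom V e V' e' h \<longleftrightarrow> (\<forall>v\<in>V. h v \<in> V' \<and> fst (h v) = fst v \<and> h (e v) = e' (h v))"

lemma modelD:
 assumes "model I mo V e" "v \<in> V"
 shows "fst v = 0 \<or> fst v \<in> I" "e v \<in> V" "fst (e v) = 0" "fst v = 0 ==> e v = v"
  "mo ==> w \<in> V ==> fst v = fst w ==> e v = e w ==> v = w"
 using assms unfolding model_def by blast+

lemma mhomD:
 assumes "mhom V e V' e' h" "v \<in> V"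
 shows "h v \<in> V'" "fst (h v) = fst v" "h (e v) = e' (h v)"
 using assms unfolding mhom_def by blast+

lemma mhom_comp:
 assumes h: "mhom V e V' e' h" and k: "mhom V' e' V'' e'' k"
 shows "mhom V e V'' e'' (\<lambda>v. k (h v))"
 unfolding mhom_def using mhomD[OF h] mhomD[OF k] by simp

locale fm = lex_cat_base: cat K for K :: "('k, 'a) cat" +
 fixes I :: "nat set" and mo :: bool and md :: "'k => (nat \<times> nat) set \<times> (nat \<times> nat => nat \<times> nat)"
  and hm :: "'a => nat \<times> nat => nat \<times> nat"
 assumes finI: "finite I" "0 \<notin> I"
  and md: "k \<in> Ob K ==> finite (fst (md k)) \<and> model I mo (fst (md k)) (snd (md k))"
  and md_surj: "finite V ==> model I mo V e ==> \<exists>k\<in>Ob K. fst (md k) = V \<and> (\<forall>v\<in>V. snd (md k) v = e v)"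
  and hm: "u \<in> hom K j k ==> mhom (fst (md k)) (snd (md k)) (fst (md j)) (snd (md j)) (hm u)"
  and hm_full: "j \<in> Ob K ==> k \<in> Ob K ==> mhom (fst (md k)) (snd (md k)) (fst (md j)) (snd (md j)) h ==>
   \<exists>u\<in>hom K j k. \<forall>v\<in>fst (md k). hm u v = h v"
  and hm_faithful: "u \<in> hom K j k ==> u' \<in> hom K j k ==> (\<And>v. v \<in> fst (md k) ==> hm u v = hm u' v) ==> u = u'"
  and hm_id: "k \<in> Ob K ==> v \<in> fst (md k) ==> hm (Id K k) v = v"
  and hm_comp: "f \<in> hom K j k ==> g \<in> hom K k l ==> v \<in> fst (md l) ==> hm (Comp K g f) v = hm f (hm g v)"
begin

abbreviation "V k \<equiv> fst (md k)"
abbreviation "e k \<equiv> snd (md k)"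

lemmas mdl = conjunct2[OF md] and finV = conjunct1[OF md]

lemma obD: "u \<in> hom K j k ==> j \<in> Ob K" "u \<in> hom K j k ==> k \<in> Ob K"
 using lex_cat_base.hom_ob by blast+

lemma finite_submodel:
 fixes W :: "(nat \<times> 'x) set"
 assumes M: "model I mo W d" and F: "F \<subseteq> W" "finite F" "\<And>v. v \<in> F ==> d v \<in> F"
 obtains k g g' where "k \<in> Ob K" "mhom F d (V k) (e k) g" "mhom (V k) (e k) W d g'" "\<And>v. v \<in> F ==> g' (g v) = v"
  "\<And>v. v \<in> V k ==> g' v \<in> F"
proof -
 obtain \<nu> :: "nat \<times> 'x => nat" where inj: "inj_on \<nu> F" using finite_imp_inj_to_nat_seg[OF F(2)] by blast
 define g where "g v = (fst v, \<nu> v)" for v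
 have injg: "inj_on g F" using inj by (auto simp: g_def inj_on_def)
 define g' where "g' = inv_into F g"
 have gg: "g' (g v) = v" if "v \<in> F" for v using injg that by (simp add: g'_def)
 have fg: "fst (g v) = fst v" for v by (simp add: g_def)
 have "model I mo (g ` F) (\<lambda>n. g (d (g' n)))"
  unfolding model_def
 proof (intro conjI ballI impI)
  fix n assume "n \<in> g ` F"
  then obtain v where v: "v \<in> F" "n = g v" by blast
  note vW = modelD[OF M, of v]
  show "fst n = 0 \<or> fst n \<in> I" using vW v F(1) fg by auto
  show "g (d (g' n)) \<in> g ` F" using v gg F(3) by simp
  show "fst (g (d (g' n))) = 0" using v gg fg vW F(1) by auto
  show "g (d (g' n)) = n" if "fst n = 0" using v gg fg vW F(1) that by auto
 next
  fix n n' assume mo and "n \<in> g ` F" "n' \<in> g ` F" and eq: "fst n = fst n' \<and> g (d (g' n)) = g (d (g' n'))"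
  then obtain v v' where v: "v \<in> F" "n = g v" "v' \<in> F" "n' = g v'" by blast
  have "d v = d v'" using eq v gg injg F(3) by (auto simp: inj_on_def)
  moreover have "fst v = fst v'" using eq v fg by simp
  ultimately have "v = v'" using modelD(5)[OF M, of v v'] \<open>mo\<close> v F(1) by auto
  thus "n = n'" using v by simp
 qed
 then obtain k where k: "k \<in> Ob K" "V k = g ` F" "\<forall>v\<in>g ` F. e k v = g (d (g' v))"
  using md_surj[of "g ` F"] F(2) by blast
 show ?thesis
 proof (rule that[OF k(1)])
  show "mhom F d (V k) (e k) g" unfolding mhom_def using k(2,3) gg fg by simp
  show "mhom (V k) (e k) W d g'" unfolding mhom_def using k(2,3) gg fg F by auto
  show "g' (g v) = v" if "v \<in> F" for v using gg that .
  show "g' v \<in> F" if "v \<in> V k" for v using that k(2) gg by auto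
 qed
qed

definition cocone :: "('j, 'i) cat => ('j, 'i, 'k, 'a) func => (nat \<times> 'x) set => (nat \<times> 'x => nat \<times> 'x) =>
  ('j => nat \<times> nat => nat \<times> 'x) => bool" where
 "cocone J D W d c \<longleftrightarrow> (\<forall>j\<in>Ob J. mhom (V (ob D j)) (e (ob D j)) W d (c j)) \<and>
  (\<forall>j k. \<forall>u\<in>hom J j k. \<forall>v\<in>V (ob D k). c j (hm (ar D u) v) = c k v)"

lemma coconeD:
 assumes "cocone J D W d c"
 shows "j \<in> Ob J ==> mhom (V (ob D j)) (e (ob D j)) W d (c j)"
  "u \<in> hom J j k ==> v \<in> V (ob D k) ==> c j (hm (ar D u) v) = c k v"
 using assms unfolding cocone_def by blast+

lemma cone_cocone:
 assumes D: "is_functor J K D" and c: "is_cone J K D m \<rho>"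
 shows "cocone J D (V m) (e m) (\<lambda>j. hm (\<rho> j))"
proof -
 interpret J: cat J using D by (auto simp: is_functor_def cat_def)
 have \<rho>: "\<rho> j \<in> hom K m (ob D j)" if "j \<in> Ob J" for j using c that by (simp add: is_cone_def)
 show ?thesis unfolding cocone_def
 proof (intro conjI ballI allI)
  show "mhom (V (ob D j)) (e (ob D j)) (V m) (e m) (hm (\<rho> j))" if "j \<in> Ob J" for j by (rule hm[OF \<rho>[OF that]])
  fix j k u v assume u: "u \<in> hom J j k" and v: "v \<in> V (ob D k)"
  have "ar D u \<in> hom K (ob D j) (ob D k)" using D u by (auto simp: is_functor_def)
  from hm_comp[OF \<rho> this v] show "hm (\<rho> j) (hm (ar D u) v) = hm (\<rho> k) v"
   using c u J.hom_ob[OF u] by (auto simp: is_cone_def)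
 qed
qed

lemma cocone_cone:
 assumes D: "is_functor J K D" and c: "cocone J D (V m) (e m) c" and m: "m \<in> Ob K"
 obtains \<rho> where "is_cone J K D m \<rho>" "\<And>j v. j \<in> Ob J ==> v \<in> V (ob D j) ==> hm (\<rho> j) v = c j v"
proof -
 interpret J: cat J using D by (auto simp: is_functor_def cat_def)
 note Dj = functorD(3)[OF D]
 have "\<forall>j\<in>Ob J. \<exists>u\<in>hom K m (ob D j). \<forall>v\<in>V (ob D j). hm u v = c j v"
  using hm_full[OF m Dj coconeD(1)[OF c]] by blast
 then obtain \<rho> where \<rho>: "\<And>j. j \<in> Ob J ==> \<rho> j \<in> hom K m (ob D j)"
  "\<And>j v. j \<in> Ob J ==> v \<in> V (ob D j) ==> hm (\<rho> j) v = c j v" by metis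
 have "is_cone J K D m \<rho>"
  unfolding is_cone_def
 proof (intro conjI ballI allI)
  fix j k u assume u: "u \<in> hom J j k"
  have jk: "j \<in> Ob J" "k \<in> Ob J" using J.hom_ob[OF u] by auto
  note Du = functorD(4)[OF D u]
  show "Comp K (ar D u) (\<rho> j) = \<rho> k"
  proof (rule hm_faithful[OF lex_cat_base.comp_hom[OF Du \<rho>(1)[OF jk(1)]] \<rho>(1)[OF jk(2)]])
   fix v assume v: "v \<in> V (ob D k)"
   show "hm (Comp K (ar D u) (\<rho> j)) v = hm (\<rho> k) v"
    using hm_comp[OF \<rho>(1)[OF jk(1)] Du v] \<rho>(2)[OF jk(1) mhomD(1)[OF hm[OF Du] v]] \<rho>(2)[OF jk(2) v] coconeD(2)[OF c u v] by simp
  qed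
 qed (use m \<rho> in auto)
 thus ?thesis using that \<rho>(2) by blast
qed

text \<open>Each cocone lands in a finite submodel, so limits in \<open>K\<close> are colimits with respect to all models.\<close>

lemma limit_colimit_unique:
 fixes W :: "(nat \<times> 'x) set"
 assumes D: "is_functor J K D" and L: "is_limit J K D l \<pi>" and M: "model I mo W d"
  and h: "mhom (V l) (e l) W d h" "mhom (V l) (e l) W d h'"
  and eq: "\<And>j v. j \<in> Ob J ==> v \<in> V (ob D j) ==> h (hm (\<pi> j) v) = h' (hm (\<pi> j) v)"
  and v: "v \<in> V l"
 shows "h v = h' v"
proof -
 interpret J: cat J using D by (auto simp: is_functor_def cat_def)
 have cn: "is_cone J K D l \<pi>" using L by (simp add: is_limit_def)
 hence l: "l \<in> Ob K" and \<pi>: "\<And>j. j \<in> Ob J ==> \<pi> j \<in> hom K l (ob D j)"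
  and \<pi>u: "\<And>j k u. u \<in> hom J j k ==> Comp K (ar D u) (\<pi> j) = \<pi> k" by (auto simp: is_cone_def)
 let ?F = "h ` V l \<union> h' ` V l"
 obtain k g g' where k: "k \<in> Ob K" "mhom ?F d (V k) (e k) g" "\<And>v. v \<in> ?F ==> g' (g v) = v"
 proof (rule finite_submodel[OF M, of ?F])
  show "?F \<subseteq> W" using mhomD(1)[OF h(1)] mhomD(1)[OF h(2)] by blast
  show "finite ?F" using finV[OF l] by simp
  show "d v \<in> ?F" if "v \<in> ?F" for v
  proof -
   from that consider w where "w \<in> V l" "v = h w" | w where "w \<in> V l" "v = h' w" by blast
   thus ?thesis
   proof cases
    case 1 thus ?thesis using mhomD(3)[OF h(1) 1(1)] modelD(2)[OF mdl[OF l] 1(1)] by (metis UnI1 imageI)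
   next
    case 2 thus ?thesis using mhomD(3)[OF h(2) 2(1)] modelD(2)[OF mdl[OF l] 2(1)] by (metis UnI2 imageI)
   qed
  qed
 qed blast
 have "mhom (V l) (e l) ?F d h" "mhom (V l) (e l) ?F d h'"
  using mhomD[OF h(1)] mhomD[OF h(2)] by (auto simp: mhom_def)
 from mhom_comp[OF this(1) k(2)] mhom_comp[OF this(2) k(2)]
 obtain a b where a: "a \<in> hom K k l" "\<forall>v\<in>V l. hm a v = g (h v)" and b: "b \<in> hom K k l" "\<forall>v\<in>V l. hm b v = g (h' v)"
  using hm_full[OF k(1) l] by metis
 have pa: "Comp K (\<pi> j) a = Comp K (\<pi> j) b" if j: "j \<in> Ob J" for j
 proof (rule hm_faithful[OF lex_cat_base.comp_hom[OF \<pi>[OF j] a(1)] lex_cat_base.comp_hom[OF \<pi>[OF j] b(1)]])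
  fix v assume v: "v \<in> V (ob D j)"
  note w = mhomD(1)[OF hm[OF \<pi>[OF j]] v]
  show "hm (Comp K (\<pi> j) a) v = hm (Comp K (\<pi> j) b) v"
   using hm_comp[OF a(1) \<pi>[OF j] v] hm_comp[OF b(1) \<pi>[OF j] v] a(2) b(2) w eq[OF j v] by simp
 qed
 have "is_cone J K D k (\<lambda>j. Comp K (\<pi> j) a)"
  unfolding is_cone_def
 proof (intro conjI ballI allI)
  fix j i u assume u: "u \<in> hom J j i"
  note Du = functorD(4)[OF D u]
  show "Comp K (ar D u) (Comp K (\<pi> j) a) = Comp K (\<pi> i) a"
   using lex_cat_base.assoc[OF Du \<pi> a(1)] \<pi>u[OF u] J.hom_ob[OF u] by simp
 qed (use k(1) lex_cat_base.comp_hom[OF \<pi> a(1)] in auto)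
 hence "\<exists>!x. x \<in> hom K k l \<and> (\<forall>j\<in>Ob J. Comp K (\<pi> j) x = Comp K (\<pi> j) a)"
  using L unfolding is_limit_def by blast
 hence "a = b" using a(1) b(1) pa by metis
 hence gg: "g (h v) = g (h' v)" using a(2) b(2) v by metis
 have F: "h v \<in> ?F" "h' v \<in> ?F" using v by blast+
 have "h v = g' (g (h v))" by (rule k(3)[OF F(1), symmetric])
 also have "\<dots> = h' v" unfolding gg by (rule k(3)[OF F(2)])
 finally show ?thesis .
qed

lemma limit_colimit_exists:
 fixes W :: "(nat \<times> 'x) set"
 assumes D: "is_functor J K D" and J: "finite (Ob J)" and L: "is_limit J K D l \<pi>" and M: "model I mo W d"
  and c: "cocone J D W d c"
 obtains h where "mhom (V l) (e l) W d h" "\<And>j v. j \<in> Ob J ==> v \<in> V (ob D j) ==> h (hm (\<pi> j) v) = c j v"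
proof -
 interpret J: cat J using D by (auto simp: is_functor_def cat_def)
 have \<pi>: "\<And>j. j \<in> Ob J ==> \<pi> j \<in> hom K l (ob D j)" using L by (simp add: is_limit_def is_cone_def)
 note Dj = functorD(3)[OF D]
 let ?F = "\<Union>j\<in>Ob J. c j ` V (ob D j)"
 obtain k g g' where k: "k \<in> Ob K" "mhom ?F d (V k) (e k) g" "mhom (V k) (e k) W d g'" "\<And>v. v \<in> ?F ==> g' (g v) = v"
 proof (rule finite_submodel[OF M, of ?F])
  show "?F \<subseteq> W" using mhomD(1)[OF coconeD(1)[OF c]] by blast
  show "finite ?F" using J finV[OF Dj] by simp
  show "d v \<in> ?F" if "v \<in> ?F" for v
  proof -
   from that obtain j w where j: "j \<in> Ob J" "w \<in> V (ob D j)" "v = c j w" by blast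
   show ?thesis using mhomD(3)[OF coconeD(1)[OF c j(1)] j(2)] modelD(2)[OF mdl[OF Dj[OF j(1)]] j(2)] j(1,3) by (metis UN_I imageI)
  qed
 qed blast
 have "cocone J D (V k) (e k) (\<lambda>j v. g (c j v))"
  unfolding cocone_def
 proof (intro conjI ballI allI)
  fix j assume j: "j \<in> Ob J"
  have "mhom (V (ob D j)) (e (ob D j)) ?F d (c j)" using mhomD[OF coconeD(1)[OF c j]] j by (auto simp: mhom_def)
  from mhom_comp[OF this k(2)] show "mhom (V (ob D j)) (e (ob D j)) (V k) (e k) (\<lambda>v. g (c j v))" .
 qed (simp add: coconeD(2)[OF c])
 then obtain \<rho> where \<rho>: "is_cone J K D k \<rho>" "\<And>j v. j \<in> Ob J ==> v \<in> V (ob D j) ==> hm (\<rho> j) v = g (c j v)"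
  by (rule cocone_cone[OF D _ k(1)]) blast
 then obtain u where u: "u \<in> hom K k l" "\<And>j. j \<in> Ob J ==> Comp K (\<pi> j) u = \<rho> j"
  using L unfolding is_limit_def by blast
 show ?thesis
 proof (rule that[OF mhom_comp[OF hm[OF u(1)] k(3)]])
  fix j v assume j: "j \<in> Ob J" and v: "v \<in> V (ob D j)"
  have "hm u (hm (\<pi> j) v) = g (c j v)" using hm_comp[OF u(1) \<pi>[OF j] v] u(2)[OF j] \<rho>(2)[OF j v] by simp
  moreover have "c j v \<in> ?F" using j v by blast
  ultimately show "g' (hm u (hm (\<pi> j) v)) = c j v" using k(4)[of "c j v"] by simp
 qed
qed

lemma finitely_complete: "finitely_complete K"
 unfolding finitely_complete_def
proof (intro conjI allI impI)
 fix J :: "(nat, nat) cat" and D assume A: "finite_category J \<and> is_functor J K D"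
 hence D: "is_functor J K D" and fJ: "finite (Ob J)" by (auto simp: finite_category_def)
 interpret J: cat J using D by (auto simp: is_functor_def cat_def)
 note Dj = functorD(3)[OF D]
 note Du = functorD(4)[OF D]
 define X where "X = (SIGMA j:Ob J. V (ob D j))"
 have finX: "finite X" unfolding X_def using fJ finV[OF Dj] by (intro finite_SigmaI) auto
 define R :: "nat \<times> nat \<times> nat => nat \<times> nat \<times> nat => bool" where
  "R p q \<longleftrightarrow> fst (snd p) = fst (snd q) \<and> (\<forall>m c. m \<in> Ob K \<and> cocone J D (V m) (e m) c --> c (fst p) (snd p) = c (fst q) (snd q))" for p q
 define \<sigma> where "\<sigma> p = (fst (snd p), \<lambda>m c. if m \<in> Ob K \<and> cocone J D (V m) (e m) c then c (fst p) (snd p) else undefined)"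
  for p :: "nat \<times> nat \<times> nat"
 have R\<sigma>: "R p q \<longleftrightarrow> \<sigma> p = \<sigma> q" for p q
  unfolding R_def \<sigma>_def prod.inject fun_eq_iff by (intro conj_cong refl iff_allI) auto
 define r where "r p = (SOME q. q \<in> X \<and> R q p)" for p
 have r: "r p \<in> X" "R (r p) p" if "p \<in> X" for p
 proof -
  have "p \<in> X \<and> R p p" using that by (simp add: R_def)
  hence "r p \<in> X \<and> R (r p) p" unfolding r_def by (rule someI)
  thus "r p \<in> X" "R (r p) p" by auto
 qed
 have r_eq: "r p = r q" if "R p q" for p q
  using that unfolding r_def R\<sigma> by simp
 have r_iff: "r p = r q \<longleftrightarrow> R p q" if "p \<in> X" "q \<in> X" for p q
  using r(2)[OF that(1)] r(2)[OF that(2)] r_eq[of p q] unfolding R\<sigma> by auto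
 define x where "x j v = (fst v, to_nat (r (j, v)))" for j and v :: "nat \<times> nat"
 have x_iff: "x j v = x k w \<longleftrightarrow> R (j, v) (k, w)" if "(j, v) \<in> X" "(k, w) \<in> X" for j v k w
  using r_iff[OF that] unfolding x_def by (auto simp: R_def)
 have x_fst: "fst (x j v) = fst v" for j v by (simp add: x_def)
 define W where "W = (\<lambda>(j, v). x j v) ` X"
 define d where "d n = (let q = from_nat (snd n) in x (fst q) (e (ob D (fst q)) (snd q)))" for n :: "nat \<times> nat"
 have WE: "\<exists>j v. j \<in> Ob J \<and> v \<in> V (ob D j) \<and> n = x j v" if "n \<in> W" for n using that by (auto simp: W_def X_def)
 have WI: "x j v \<in> W" if "j \<in> Ob J" "v \<in> V (ob D j)" for j v using that by (force simp: W_def X_def)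
 have XI: "(j, v) \<in> X" if "j \<in> Ob J" "v \<in> V (ob D j)" for j v using that by (simp add: X_def)
 have eV: "e (ob D j) v \<in> V (ob D j)" if "j \<in> Ob J" "v \<in> V (ob D j)" for j v using modelD(2)[OF mdl[OF Dj] that(2)] that(1) .
 have d: "d (x j v) = x j (e (ob D j) v)" if jv: "j \<in> Ob J" "v \<in> V (ob D j)" for j v
 proof -
  obtain k w where q: "r (j, v) = (k, w)" by (cases "r (j, v)")
  have kw: "k \<in> Ob J" "w \<in> V (ob D k)" "R (k, w) (j, v)" using r[OF XI[OF jv]] q by (auto simp: X_def)
  have "R (k, e (ob D k) w) (j, e (ob D j) v)"
   unfolding R_def fst_conv snd_conv
  proof (intro conjI allI impI)
   show "fst (e (ob D k) w) = fst (e (ob D j) v)"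
    using modelD(3)[OF mdl[OF Dj[OF kw(1)]] kw(2)] modelD(3)[OF mdl[OF Dj[OF jv(1)]] jv(2)] by simp
   fix m c assume mc: "m \<in> Ob K \<and> cocone J D (V m) (e m) c"
   hence "c k w = c j v" using kw(3) by (auto simp: R_def)
   thus "c k (e (ob D k) w) = c j (e (ob D j) v)"
    using mhomD(3)[OF coconeD(1)[OF _ kw(1)] kw(2)] mhomD(3)[OF coconeD(1)[OF _ jv(1)] jv(2)] mc by metis
  qed
  thus ?thesis using x_iff[OF XI[OF kw(1) eV[OF kw(1,2)]] XI[OF jv(1) eV[OF jv]]] q by (simp add: d_def x_def)
 qed
 have "model I mo W d"
  unfolding model_def
 proof (intro conjI ballI impI)
  fix n assume "n \<in> W"
  then obtain j v where jv: "j \<in> Ob J" "v \<in> V (ob D j)" "n = x j v" using WE by blast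
  note M = modelD[OF mdl[OF Dj[OF jv(1)]] jv(2)]
  show "fst n = 0 \<or> fst n \<in> I" using M(1) jv(3) x_fst by simp
  show "d n \<in> W" using d[OF jv(1,2)] WI[OF jv(1) eV[OF jv(1,2)]] jv(3) by simp
  show "fst (d n) = 0" using d[OF jv(1,2)] x_fst M(3) jv(3) by simp
  show "d n = n" if "fst n = 0" using d[OF jv(1,2)] M(4) x_fst jv(3) that by simp
 next
  fix n n' assume mo and "n \<in> W" "n' \<in> W" and eq: "fst n = fst n' \<and> d n = d n'"
  then obtain j v k w where jv: "j \<in> Ob J" "v \<in> V (ob D j)" "n = x j v" and kw: "k \<in> Ob J" "w \<in> V (ob D k)" "n' = x k w"
   using WE by metis
  have Re: "R (j, e (ob D j) v) (k, e (ob D k) w)"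
   using eq d[OF jv(1,2)] d[OF kw(1,2)] jv(3) kw(3) x_iff[OF XI[OF jv(1) eV[OF jv(1,2)]] XI[OF kw(1) eV[OF kw(1,2)]]] by simp
  have "R (j, v) (k, w)"
   unfolding R_def fst_conv snd_conv
  proof (intro conjI allI impI)
   show f: "fst v = fst w" using eq jv(3) kw(3) x_fst by simp
   fix m c assume mc: "m \<in> Ob K \<and> cocone J D (V m) (e m) c"
   hence m: "m \<in> Ob K" and cc: "cocone J D (V m) (e m) c" by auto
   note cj = mhomD[OF coconeD(1)[OF cc jv(1)] jv(2)] and ck = mhomD[OF coconeD(1)[OF cc kw(1)] kw(2)]
   have "c j (e (ob D j) v) = c k (e (ob D k) w)" using Re m cc by (simp add: R_def)
   thus "c j v = c k w" using modelD(5)[OF mdl[OF m] cj(1) \<open>mo\<close> ck(1)] cj ck f by simp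
  qed
  thus "n = n'" using x_iff[OF XI[OF jv(1,2)] XI[OF kw(1,2)]] jv(3) kw(3) by simp
 qed
 moreover have "finite W" using finX by (simp add: W_def)
 ultimately obtain l where l: "l \<in> Ob K" "V l = W" "\<forall>v\<in>W. e l v = d v" using md_surj by blast
 have el: "e l (x j v) = x j (e (ob D j) v)" if "j \<in> Ob J" "v \<in> V (ob D j)" for j v
  using l(3) WI[OF that] d[OF that] by simp
 have "cocone J D (V l) (e l) x"
  unfolding cocone_def
 proof (intro conjI ballI allI)
  show "mhom (V (ob D j)) (e (ob D j)) (V l) (e l) (x j)" if "j \<in> Ob J" for j
   unfolding mhom_def l(2) using WI[OF that] x_fst el[OF that] by simp
  fix j k u v assume u: "u \<in> hom J j k" and v: "v \<in> V (ob D k)"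
  have jk: "j \<in> Ob J" "k \<in> Ob J" using J.hom_ob[OF u] by auto
  note uv = mhomD[OF hm[OF Du[OF u]] v]
  have "R (j, hm (ar D u) v) (k, v)" unfolding R_def fst_conv snd_conv using uv(2) coconeD(2)[OF _ u v] by blast
  thus "x j (hm (ar D u) v) = x k v" using x_iff[OF XI[OF jk(1) uv(1)] XI[OF jk(2) v]] by simp
 qed
 then obtain \<pi> where \<pi>: "is_cone J K D l \<pi>" "\<And>j v. j \<in> Ob J ==> v \<in> V (ob D j) ==> hm (\<pi> j) v = x j v"
  by (rule cocone_cone[OF D _ l(1)]) blast
 have \<pi>h: "\<pi> j \<in> hom K l (ob D j)" if "j \<in> Ob J" for j using \<pi>(1) that by (simp add: is_cone_def)
 have "is_limit J K D l \<pi>"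
  unfolding is_limit_def
 proof (intro conjI allI impI)
  fix m \<rho> assume c: "is_cone J K D m \<rho>"
  have m: "m \<in> Ob K" and \<rho>: "\<And>j. j \<in> Ob J ==> \<rho> j \<in> hom K m (ob D j)" using c by (auto simp: is_cone_def)
  have cc: "cocone J D (V m) (e m) (\<lambda>j. hm (\<rho> j))" by (rule cone_cocone[OF D c])
  define h where "h n = (let q = from_nat (snd n) in hm (\<rho> (fst q)) (snd q))" for n :: "nat \<times> nat"
  have h: "h (x j v) = hm (\<rho> j) v" if jv: "j \<in> Ob J" "v \<in> V (ob D j)" for j v
  proof -
   have "(\<lambda>j. hm (\<rho> j)) (fst (r (j, v))) (snd (r (j, v))) = (\<lambda>j. hm (\<rho> j)) (fst (j, v)) (snd (j, v))"
    using r(2)[OF XI[OF jv]] m cc unfolding R_def by blast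
   thus ?thesis by (simp add: h_def x_def Let_def)
  qed
  have "mhom (V l) (e l) (V m) (e m) h"
   unfolding mhom_def
  proof
   fix n assume "n \<in> V l"
   then obtain j v where jv: "j \<in> Ob J" "v \<in> V (ob D j)" "n = x j v" using WE[of n] l(2) by blast
   note q = mhomD[OF coconeD(1)[OF cc jv(1)] jv(2)]
   show "h n \<in> V m \<and> fst (h n) = fst n \<and> h (e l n) = e m (h n)"
    using q h[OF jv(1,2)] h[OF jv(1) eV[OF jv(1,2)]] el[OF jv(1,2)] x_fst jv(3) by simp
  qed
  then obtain u where u: "u \<in> hom K m l" "\<forall>n\<in>V l. hm u n = h n" using hm_full[OF m l(1)] by blast
  have key: "Comp K (\<pi> j) u' = \<rho> j \<longleftrightarrow> (\<forall>v\<in>V (ob D j). hm u' (x j v) = hm (\<rho> j) v)"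
   if j: "j \<in> Ob J" and u': "u' \<in> hom K m l" for j u'
  proof -
   have "hm (Comp K (\<pi> j) u') v = hm u' (x j v)" if "v \<in> V (ob D j)" for v
    using hm_comp[OF u' \<pi>h[OF j] that] \<pi>(2)[OF j that] by simp
   thus ?thesis using hm_faithful[OF lex_cat_base.comp_hom[OF \<pi>h[OF j] u'] \<rho>[OF j]] by auto
  qed
  show "\<exists>!h. h \<in> hom K m l \<and> (\<forall>j\<in>Ob J. Comp K (\<pi> j) h = \<rho> j)"
  proof (rule ex1I[of _ u])
   show "u \<in> hom K m l \<and> (\<forall>j\<in>Ob J. Comp K (\<pi> j) u = \<rho> j)" using u key h WI l(2) by simp
   fix u' assume u': "u' \<in> hom K m l \<and> (\<forall>j\<in>Ob J. Comp K (\<pi> j) u' = \<rho> j)"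
   show "u' = u"
   proof (rule hm_faithful[OF _ u(1)])
    fix n assume n: "n \<in> V l"
    then obtain j v where jv: "j \<in> Ob J" "v \<in> V (ob D j)" "n = x j v" using WE[of n] l(2) by blast
    show "hm u' n = hm u n" using u' key jv u(2) n h[OF jv(1,2)] by auto
   qed (use u' in simp)
  qed
 qed (rule \<pi>(1))
 thus "\<exists>l \<pi>. is_limit J K D l \<pi>" by blast
qed (rule lex_cat_base.category)

end

context fm
begin

definition sorts :: "nat set" where "sorts = insert 0 I"

lemma sortsD: "v \<in> V k ==> k \<in> Ob K ==> fst v \<in> sorts"
 using modelD(1)[OF mdl] by (auto simp: sorts_def)

definition edges :: "'k => (nat \<times> nat) set" where "edges k = {v \<in> V k. fst v \<noteq> 0}"

lemma bipartite_model:
 assumes k: "k \<in> Ob K"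
 shows "bipartite (V k) (edges k) (\<lambda>v. v) (e k)"
proof -
 have E: "v \<in> V k" "fst v \<noteq> 0" if "v \<in> edges k" for v using that by (simp_all add: edges_def)
 have e: "e k v \<in> V k" "fst (e k v) = 0" if "v \<in> edges k" for v using modelD(2,3)[OF mdl[OF k] E(1)[OF that]] .
 have "finite (edges k)" by (rule finite_subset[OF _ finV[OF k]]) (use E in blast)
 thus ?thesis unfolding bipartite_def using finV[OF k] E e by (intro conjI ballI notI) (blast | metis imageE)+
qed

text \<open>\<open>F k\<close> represents the functor sending \<open>z\<close> to the maps from the model \<open>k\<close> into the model \<open>B(z, X -)\<close>.\<close>

definition lex_ext :: "('o, 'b) cat => (nat => 'o) => (nat => 'b) => ('k, 'a, 'o, 'b) func => ('k => nat \<times> nat => 'b) => bool" where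
 "lex_ext B X g F \<epsilon> \<longleftrightarrow> is_functor K B F \<and> preserves_finite_limits K B F \<and>
  (\<forall>k\<in>Ob K. \<forall>v\<in>V k. \<epsilon> k v \<in> hom B (ob F k) (X (fst v))) \<and>
  (\<forall>k\<in>Ob K. \<forall>v\<in>V k. fst v \<noteq> 0 --> Comp B (g (fst v)) (\<epsilon> k v) = \<epsilon> k (e k v)) \<and>
  (\<forall>k\<in>Ob K. \<forall>z c. z \<in> Ob B \<and> (\<forall>v\<in>V k. c v \<in> hom B z (X (fst v))) \<and> (\<forall>v\<in>V k. fst v \<noteq> 0 --> Comp B (g (fst v)) (c v) = c (e k v)) -->
   (\<exists>!h. h \<in> hom B z (ob F k) \<and> (\<forall>v\<in>V k. Comp B (\<epsilon> k v) h = c v))) \<and>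
  (\<forall>j k. \<forall>u\<in>hom K j k. \<forall>v\<in>V k. Comp B (\<epsilon> k v) (ar F u) = \<epsilon> j (hm u v))"

context
 fixes B :: "('o, 'b) cat" and X :: "nat => 'o" and g :: "nat => 'b"
 assumes B: "finitely_complete B" and X: "s \<in> sorts ==> X s \<in> Ob B"
  and g: "s \<in> I ==> g s \<in> hom B (X s) (X 0)" and gm: "mo ==> s \<in> I ==> is_mono B (g s)"
begin

interpretation B: lex_cat B
 using B by unfold_locales (auto simp: finitely_complete_def)

private definition pts :: "'k => 'o => (nat \<times> nat => 'b) => bool" where
 "pts k z c \<longleftrightarrow> z \<in> Ob B \<and> (\<forall>v\<in>V k. c v \<in> hom B z (X (fst v))) \<and> (\<forall>v\<in>edges k. Comp B (g (fst v)) (c v) = c (e k v))"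

private lemma ptsD:
 assumes "pts k z c" "v \<in> V k"
 shows "c v \<in> hom B z (X (fst v))" "fst v \<noteq> 0 ==> Comp B (g (fst v)) (c v) = c (e k v)"
 using assms unfolding pts_def edges_def by blast+

private lemma pts_ob: "pts k z c ==> z \<in> Ob B" by (simp add: pts_def)

private lemma rep_exists:
 assumes k: "k \<in> Ob K"
 shows "\<exists>l \<epsilon>. pts k l \<epsilon> \<and> (\<forall>z c. pts k z c --> (\<exists>!h. h \<in> hom B z l \<and> (\<forall>v\<in>V k. Comp B (\<epsilon> v) h = c v)))"
proof -
 have "gdiag B (V k) (edges k) (\<lambda>v. v) (e k) (\<lambda>v. X (fst v)) (\<lambda>v. g (fst v))"
  unfolding gdiag_def
 proof (intro conjI ballI)
  show "X (fst v) \<in> Ob B" if "v \<in> V k" for v using X[OF sortsD[OF that k]] .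
  fix v assume "v \<in> edges k"
  hence v: "v \<in> V k" "fst v \<noteq> 0" by (auto simp: edges_def)
  note m = modelD[OF mdl[OF k] v(1)]
  show "g (fst v) \<in> hom B (X (fst v)) (X (fst (e k v)))" using g[of "fst v"] m(1,3) v(2) by simp
 qed
 then obtain l \<epsilon> where "is_glim B (V k) (edges k) (\<lambda>v. v) (e k) (\<lambda>v. X (fst v)) (\<lambda>v. g (fst v)) l \<epsilon>"
  using glim_exists[OF B bipartite_model[OF k]] by blast
 thus ?thesis unfolding is_glim_def is_gcone_def pts_def by blast
qed

private definition Fo :: "'k => 'o" where
 "Fo k = (SOME l. \<exists>\<epsilon>. pts k l \<epsilon> \<and> (\<forall>z c. pts k z c --> (\<exists>!h. h \<in> hom B z l \<and> (\<forall>v\<in>V k. Comp B (\<epsilon> v) h = c v))))"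

private definition \<epsilon> :: "'k => nat \<times> nat => 'b" where
 "\<epsilon> k = (SOME \<epsilon>. pts k (Fo k) \<epsilon> \<and> (\<forall>z c. pts k z c --> (\<exists>!h. h \<in> hom B z (Fo k) \<and> (\<forall>v\<in>V k. Comp B (\<epsilon> v) h = c v))))"

private lemma \<epsilon>:
 assumes k: "k \<in> Ob K"
 shows "pts k (Fo k) (\<epsilon> k)" "pts k z c ==> \<exists>!h. h \<in> hom B z (Fo k) \<and> (\<forall>v\<in>V k. Comp B (\<epsilon> k v) h = c v)"
proof -
 have "\<exists>\<epsilon>. pts k (Fo k) \<epsilon> \<and> (\<forall>z c. pts k z c --> (\<exists>!h. h \<in> hom B z (Fo k) \<and> (\<forall>v\<in>V k. Comp B (\<epsilon> v) h = c v)))"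
  unfolding Fo_def by (rule someI_ex[OF rep_exists[OF k]])
 from someI_ex[OF this] have *: "pts k (Fo k) (\<epsilon> k) \<and> (\<forall>z c. pts k z c --> (\<exists>!h. h \<in> hom B z (Fo k) \<and> (\<forall>v\<in>V k. Comp B (\<epsilon> k v) h = c v)))"
  unfolding \<epsilon>_def .
 show "pts k (Fo k) (\<epsilon> k)" using * by (rule conjunct1)
 show "pts k z c ==> \<exists>!h. h \<in> hom B z (Fo k) \<and> (\<forall>v\<in>V k. Comp B (\<epsilon> k v) h = c v)" using * by simp
qed

private lemma Fo_ob: "k \<in> Ob K ==> Fo k \<in> Ob B"
 by (rule pts_ob[OF \<epsilon>(1)])

private lemma \<epsilon>_hom: "k \<in> Ob K ==> v \<in> V k ==> \<epsilon> k v \<in> hom B (Fo k) (X (fst v))"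
 by (rule ptsD(1)[OF \<epsilon>(1)])

private lemma \<epsilon>_ext:
 assumes k: "k \<in> Ob K" and h: "h \<in> hom B z (Fo k)" "h' \<in> hom B z (Fo k)"
  and eq: "\<And>v. v \<in> V k ==> Comp B (\<epsilon> k v) h = Comp B (\<epsilon> k v) h'"
 shows "h = h'"
proof -
 have "pts k z (\<lambda>v. Comp B (\<epsilon> k v) h)"
  unfolding pts_def
 proof (intro conjI ballI)
  show "z \<in> Ob B" using B.hom_ob[OF h(1)] by simp
  show "Comp B (\<epsilon> k v) h \<in> hom B z (X (fst v))" if "v \<in> V k" for v by (rule B.comp_hom[OF \<epsilon>_hom[OF k that] h(1)])
  fix v assume "v \<in> edges k"
  hence v: "v \<in> V k" "fst v \<noteq> 0" by (auto simp: edges_def)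
  have "fst v \<in> I" using modelD(1)[OF mdl[OF k] v(1)] v(2) by simp
  from B.assoc[OF g[OF this] \<epsilon>_hom[OF k v(1)] h(1)] show "Comp B (g (fst v)) (Comp B (\<epsilon> k v) h) = Comp B (\<epsilon> k (e k v)) h"
   using ptsD(2)[OF \<epsilon>(1)[OF k] v] by simp
 qed
 from \<epsilon>(2)[OF k this] have "\<exists>!x. x \<in> hom B z (Fo k) \<and> (\<forall>v\<in>V k. Comp B (\<epsilon> k v) x = Comp B (\<epsilon> k v) h)" .
 thus ?thesis using h eq by metis
qed

private lemma pts_hm:
 assumes u: "u \<in> hom K j k" and c: "pts j z c"
 shows "pts k z (\<lambda>v. c (hm u v))"
 unfolding pts_def
proof (intro conjI ballI)
 note h = mhomD[OF hm[OF u]]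
 show "z \<in> Ob B" by (rule pts_ob[OF c])
 show "c (hm u v) \<in> hom B z (X (fst v))" if "v \<in> V k" for v using ptsD(1)[OF c h(1)[OF that]] h(2)[OF that] by simp
 fix v assume "v \<in> edges k"
 hence v: "v \<in> V k" "fst v \<noteq> 0" by (auto simp: edges_def)
 show "Comp B (g (fst v)) (c (hm u v)) = c (hm u (e k v))" using ptsD(2)[OF c h(1)[OF v(1)]] h[OF v(1)] v(2) by simp
qed

private definition Fa :: "'a => 'b" where
 "Fa u = (THE h. h \<in> hom B (Fo (Dom K u)) (Fo (Cod K u)) \<and>
  (\<forall>v\<in>V (Cod K u). Comp B (\<epsilon> (Cod K u) v) h = \<epsilon> (Dom K u) (hm u v)))"

private lemma Fa:
 assumes u: "u \<in> hom K j k"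
 shows "Fa u \<in> hom B (Fo j) (Fo k)" "v \<in> V k ==> Comp B (\<epsilon> k v) (Fa u) = \<epsilon> j (hm u v)"
proof -
 have d: "Dom K u = j" "Cod K u = k" using u by (auto simp: hom_def)
 have "\<exists>!h. h \<in> hom B (Fo j) (Fo k) \<and> (\<forall>v\<in>V k. Comp B (\<epsilon> k v) h = \<epsilon> j (hm u v))"
  by (rule \<epsilon>(2)[OF obD(2)[OF u] pts_hm[OF u \<epsilon>(1)[OF obD(1)[OF u]]]])
 from theI'[OF this] have *: "Fa u \<in> hom B (Fo j) (Fo k) \<and> (\<forall>v\<in>V k. Comp B (\<epsilon> k v) (Fa u) = \<epsilon> j (hm u v))"
  unfolding Fa_def d .
 show "Fa u \<in> hom B (Fo j) (Fo k)" using * by (rule conjunct1)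
 show "v \<in> V k ==> Comp B (\<epsilon> k v) (Fa u) = \<epsilon> j (hm u v)" using * by simp
qed

private definition F :: "('k, 'a, 'o, 'b) func" where "F = \<lparr>ob_map = Fo, ar_map = Fa\<rparr>"

private lemma F_simps: "ob F = Fo" "ar F = Fa" by (simp_all add: F_def)

private lemma F_functor: "is_functor K B F"
 unfolding is_functor_def F_simps
proof (intro conjI ballI allI)
 fix k assume k: "k \<in> Ob K"
 show "Fo k \<in> Ob B" by (rule Fo_ob[OF k])
 note i = lex_cat_base.id_hom[OF k]
 show "Fa (Id K k) = Id B (Fo k)"
 proof (rule \<epsilon>_ext[OF k Fa(1)[OF i] B.id_hom[OF Fo_ob[OF k]]])
  fix v assume v: "v \<in> V k"
  show "Comp B (\<epsilon> k v) (Fa (Id K k)) = Comp B (\<epsilon> k v) (Id B (Fo k))"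
   using Fa(2)[OF i v] hm_id[OF k v] B.id_right[OF \<epsilon>_hom[OF k v]] by simp
 qed
next
 fix j k l u w assume u: "u \<in> hom K j k" and w: "w \<in> hom K k l"
 note uw = lex_cat_base.comp_hom[OF w u]
 show "Fa (Comp K w u) = Comp B (Fa w) (Fa u)"
 proof (rule \<epsilon>_ext[OF obD(2)[OF w] Fa(1)[OF uw] B.comp_hom[OF Fa(1)[OF w] Fa(1)[OF u]]])
  fix v assume v: "v \<in> V l"
  show "Comp B (\<epsilon> l v) (Fa (Comp K w u)) = Comp B (\<epsilon> l v) (Comp B (Fa w) (Fa u))"
   using Fa(2)[OF uw v] hm_comp[OF u w v] B.assoc[OF \<epsilon>_hom[OF obD(2)[OF w] v] Fa(1)[OF w] Fa(1)[OF u]]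
    Fa(2)[OF w v] Fa(2)[OF u mhomD(1)[OF hm[OF w] v]] by simp
 qed
qed (use Fa(1) lex_cat_base.category B.category in auto)

private definition pmodel :: "'o => (nat \<times> 'b) set" where
 "pmodel z = {v. fst v \<in> sorts \<and> snd v \<in> hom B z (X (fst v))}"

private definition pmap :: "nat \<times> 'b => nat \<times> 'b" where
 "pmap v = (0, if fst v = 0 then snd v else Comp B (g (fst v)) (snd v))"

private lemma pmodel: "model I mo (pmodel z) pmap"
 unfolding model_def
proof (intro conjI ballI impI)
 fix v assume v: "v \<in> pmodel z"
 show "fst v = 0 \<or> fst v \<in> I" using v by (auto simp: pmodel_def sorts_def)
 show "pmap v \<in> pmodel z"
  using v B.comp_hom[OF g] by (auto simp: pmodel_def pmap_def sorts_def)
 show "fst (pmap v) = 0" by (simp add: pmap_def)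
 show "pmap v = v" if "fst v = 0" using that by (simp add: pmap_def prod_eq_iff)
next
 fix v w assume mo and v: "v \<in> pmodel z" and w: "w \<in> pmodel z" and eq: "fst v = fst w \<and> pmap v = pmap w"
 show "v = w"
 proof (cases "fst v = 0")
  case True
  hence "pmap v = v" "pmap w = w" using eq by (simp_all add: pmap_def prod_eq_iff)
  from box_equals[OF conjunct2[OF eq] this] show ?thesis .
 next
  case False
  moreover have "fst v \<in> sorts" using v by (simp add: pmodel_def)
  ultimately have s: "fst v \<in> I" by (simp add: sorts_def)
  have fw: "fst w = fst v" and pe: "snd (pmap v) = snd (pmap w)" using eq by simp_all
  have ce: "Comp B (g (fst v)) (snd v) = Comp B (g (fst v)) (snd w)" using pe False by (simp add: pmap_def fw)
  have sv: "snd v \<in> hom B z (X (fst v))" "snd w \<in> hom B z (X (fst v))" using v w by (simp_all add: pmodel_def fw)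
  have "snd v = snd w" by (rule B.monoD[OF gm[OF \<open>mo\<close> s] g[OF s] sv ce])
  thus ?thesis using eq by (simp add: prod_eq_iff)
 qed
qed

private lemma pts_mhom:
 assumes k: "k \<in> Ob K"
 shows "pts k z c ==> mhom (V k) (e k) (pmodel z) pmap (\<lambda>v. (fst v, c v))"
  and "z \<in> Ob B ==> mhom (V k) (e k) (pmodel z) pmap h ==> pts k z (\<lambda>v. snd (h v))"
proof -
 note m = modelD[OF mdl[OF k]]
 show "mhom (V k) (e k) (pmodel z) pmap (\<lambda>v. (fst v, c v))" if c: "pts k z c"
  unfolding mhom_def
 proof
  fix v assume v: "v \<in> V k"
  have "c (e k v) = (if fst v = 0 then c v else Comp B (g (fst v)) (c v))"
   using ptsD(2)[OF c v] m(4)[OF v] by simp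
  thus "(fst v, c v) \<in> pmodel z \<and> fst (fst v, c v) = fst v \<and> (fst (e k v), c (e k v)) = pmap (fst v, c v)"
   using ptsD(1)[OF c v] sortsD[OF v k] m(3)[OF v] by (simp add: pmodel_def pmap_def)
 qed
 show "pts k z (\<lambda>v. snd (h v))" if z: "z \<in> Ob B" and h: "mhom (V k) (e k) (pmodel z) pmap h"
  unfolding pts_def
 proof (intro conjI ballI)
  show "snd (h v) \<in> hom B z (X (fst v))" if "v \<in> V k" for v
   using mhomD(1,2)[OF h that] by (simp add: pmodel_def)
  fix v assume "v \<in> edges k"
  hence v: "v \<in> V k" "fst v \<noteq> 0" by (auto simp: edges_def)
  show "Comp B (g (fst v)) (snd (h v)) = snd (h (e k v))" using mhomD(2,3)[OF h v(1)] v(2) by (simp add: pmap_def)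
 qed (rule z)
qed

private lemma F_lex: "preserves_finite_limits K B F"
 unfolding preserves_finite_limits_def
proof (intro allI impI)
 fix J :: "(nat, nat) cat" and D l \<pi> assume A: "finite_category J \<and> is_functor J K D \<and> is_limit J K D l \<pi>"
 hence D: "is_functor J K D" and L: "is_limit J K D l \<pi>" and fJ: "finite (Ob J)" by (auto simp: finite_category_def)
 interpret J: cat J using D by (auto simp: is_functor_def cat_def)
 note Dj = functorD(3)[OF D]
 note Du = functorD(4)[OF D]
 have l: "l \<in> Ob K" and \<pi>: "\<And>j. j \<in> Ob J ==> \<pi> j \<in> hom K l (ob D j)"
  and \<pi>u: "\<And>j k u. u \<in> hom J j k ==> Comp K (ar D u) (\<pi> j) = \<pi> k"
  using L by (auto simp: is_limit_def is_cone_def)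
 show "is_limit J B (comp_func F D) (ob F l) (\<lambda>j. ar F (\<pi> j))"
  unfolding is_limit_def F_simps
 proof (intro conjI allI impI)
  show "is_cone J B (comp_func F D) (Fo l) (\<lambda>j. Fa (\<pi> j))"
   unfolding is_cone_def comp_func_def F_simps
  proof (intro conjI ballI allI)
   fix j k u assume u: "u \<in> hom J j k"
   have "Comp B (Fa (ar D u)) (Fa (\<pi> j)) = Fa (Comp K (ar D u) (\<pi> j))"
    using F_functor Du[OF u] \<pi> J.hom_ob[OF u] unfolding is_functor_def F_simps by metis
   thus "Comp B (ar \<lparr>ob_map = \<lambda>x. Fo (ob D x), ar_map = \<lambda>f. Fa (ar D f)\<rparr> u) (Fa (\<pi> j)) = Fa (\<pi> k)"
    using \<pi>u[OF u] by simp
  qed (use Fo_ob[OF l] Fa(1)[OF \<pi>] in auto)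
  fix m \<rho> assume c: "is_cone J B (comp_func F D) m \<rho>"
  have m: "m \<in> Ob B" and \<rho>: "\<And>j. j \<in> Ob J ==> \<rho> j \<in> hom B m (Fo (ob D j))"
   and \<rho>u: "\<And>j k u. u \<in> hom J j k ==> Comp B (Fa (ar D u)) (\<rho> j) = \<rho> k"
   using c by (auto simp: is_cone_def comp_func_def F_simps)
  define c where "c j v = (fst v, Comp B (\<epsilon> (ob D j) v) (\<rho> j))" for j and v :: "nat \<times> nat"
  have cc: "cocone J D (pmodel m) pmap c"
   unfolding cocone_def
  proof (intro conjI ballI allI)
   fix j assume j: "j \<in> Ob J"
   have "pts (ob D j) m (\<lambda>v. Comp B (\<epsilon> (ob D j) v) (\<rho> j))"
    unfolding pts_def
   proof (intro conjI ballI)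
    show "Comp B (\<epsilon> (ob D j) v) (\<rho> j) \<in> hom B m (X (fst v))" if "v \<in> V (ob D j)" for v
     by (rule B.comp_hom[OF \<epsilon>_hom[OF Dj[OF j] that] \<rho>[OF j]])
    fix v assume "v \<in> edges (ob D j)"
    hence v: "v \<in> V (ob D j)" "fst v \<noteq> 0" by (auto simp: edges_def)
    have "fst v \<in> I" using modelD(1)[OF mdl[OF Dj[OF j]] v(1)] v(2) by simp
    from B.assoc[OF g[OF this] \<epsilon>_hom[OF Dj[OF j] v(1)] \<rho>[OF j]]
    show "Comp B (g (fst v)) (Comp B (\<epsilon> (ob D j) v) (\<rho> j)) = Comp B (\<epsilon> (ob D j) (e (ob D j) v)) (\<rho> j)"
     using ptsD(2)[OF \<epsilon>(1)[OF Dj[OF j]] v] by simp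
   qed (rule m)
   from pts_mhom(1)[OF Dj[OF j] this] show "mhom (V (ob D j)) (e (ob D j)) (pmodel m) pmap (c j)"
    unfolding c_def .
  next
   fix j k u v assume u: "u \<in> hom J j k" and v: "v \<in> V (ob D k)"
   have jk: "j \<in> Ob J" "k \<in> Ob J" using J.hom_ob[OF u] by auto
   have "Comp B (\<epsilon> (ob D j) (hm (ar D u) v)) (\<rho> j) = Comp B (\<epsilon> (ob D k) v) (\<rho> k)"
    using Fa(2)[OF Du[OF u] v] B.assoc[OF \<epsilon>_hom[OF Dj[OF jk(2)] v] Fa(1)[OF Du[OF u]] \<rho>[OF jk(1)]] \<rho>u[OF u] by simp
   thus "c j (hm (ar D u) v) = c k v" using mhomD(2)[OF hm[OF Du[OF u]] v] by (simp add: c_def)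
  qed
  obtain h where h: "mhom (V l) (e l) (pmodel m) pmap h" "\<And>j v. j \<in> Ob J ==> v \<in> V (ob D j) ==> h (hm (\<pi> j) v) = c j v"
   by (rule limit_colimit_exists[OF D fJ L pmodel cc]) (assumption | rule that)+
  obtain k where k: "k \<in> hom B m (Fo l)" "\<And>v. v \<in> V l ==> Comp B (\<epsilon> l v) k = snd (h v)"
   using \<epsilon>(2)[OF l pts_mhom(2)[OF l m h(1)]] by blast
  have key: "Comp B (Fa (\<pi> j)) k' = \<rho> j \<longleftrightarrow> (\<forall>v\<in>V (ob D j). Comp B (\<epsilon> l (hm (\<pi> j) v)) k' = snd (c j v))"
   if j: "j \<in> Ob J" and k': "k' \<in> hom B m (Fo l)" for j k'
  proof -
   have "Comp B (\<epsilon> (ob D j) v) (Comp B (Fa (\<pi> j)) k') = Comp B (\<epsilon> l (hm (\<pi> j) v)) k'" if "v \<in> V (ob D j)" for v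
    using B.assoc[OF \<epsilon>_hom[OF Dj[OF j] that] Fa(1)[OF \<pi>[OF j]] k'] Fa(2)[OF \<pi>[OF j] that] by simp
   thus ?thesis using \<epsilon>_ext[OF Dj[OF j] B.comp_hom[OF Fa(1)[OF \<pi>[OF j]] k'] \<rho>[OF j]] by (auto simp: c_def)
  qed
  have \<pi>V: "hm (\<pi> j) v \<in> V l" if "j \<in> Ob J" "v \<in> V (ob D j)" for j v using mhomD(1)[OF hm[OF \<pi>[OF that(1)]] that(2)] .
  show "\<exists>!h. h \<in> hom B m (Fo l) \<and> (\<forall>j\<in>Ob J. Comp B (Fa (\<pi> j)) h = \<rho> j)"
  proof (rule ex1I[of _ k])
   show "k \<in> hom B m (Fo l) \<and> (\<forall>j\<in>Ob J. Comp B (Fa (\<pi> j)) k = \<rho> j)"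
    using key[OF _ k(1)] k h(2) \<pi>V by simp
   fix k' assume k': "k' \<in> hom B m (Fo l) \<and> (\<forall>j\<in>Ob J. Comp B (Fa (\<pi> j)) k' = \<rho> j)"
   hence k'h: "k' \<in> hom B m (Fo l)" by simp
   have "pts l m (\<lambda>v. Comp B (\<epsilon> l v) k')"
    unfolding pts_def
   proof (intro conjI ballI)
    show "Comp B (\<epsilon> l v) k' \<in> hom B m (X (fst v))" if "v \<in> V l" for v by (rule B.comp_hom[OF \<epsilon>_hom[OF l that] k'h])
    fix v assume "v \<in> edges l"
    hence v: "v \<in> V l" "fst v \<noteq> 0" by (auto simp: edges_def)
    have "fst v \<in> I" using modelD(1)[OF mdl[OF l] v(1)] v(2) by simp
    from B.assoc[OF g[OF this] \<epsilon>_hom[OF l v(1)] k'h]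
    show "Comp B (g (fst v)) (Comp B (\<epsilon> l v) k') = Comp B (\<epsilon> l (e l v)) k'" using ptsD(2)[OF \<epsilon>(1)[OF l] v] by simp
   qed (rule m)
   from pts_mhom(1)[OF l this] have h': "mhom (V l) (e l) (pmodel m) pmap (\<lambda>v. (fst v, Comp B (\<epsilon> l v) k'))" .
   have "(fst v, Comp B (\<epsilon> l v) k') = h v" if v: "v \<in> V l" for v
   proof (rule limit_colimit_unique[OF D L pmodel h' h(1) _ v])
    fix j v assume j: "j \<in> Ob J" and v: "v \<in> V (ob D j)"
    have "Comp B (\<epsilon> l (hm (\<pi> j) v)) k' = snd (c j v)" using key[OF j k'h] k' j v by blast
    thus "(fst (hm (\<pi> j) v), Comp B (\<epsilon> l (hm (\<pi> j) v)) k') = h (hm (\<pi> j) v)"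
     using h(2)[OF j v] mhomD(2)[OF hm[OF \<pi>[OF j]] v] by (simp add: c_def)
   qed
   hence "\<And>v. v \<in> V l ==> Comp B (\<epsilon> l v) k' = Comp B (\<epsilon> l v) k" using k(2) by (metis snd_conv)
   thus "k' = k" by (rule \<epsilon>_ext[OF l k'h k(1)])
  qed
 qed
qed

lemma lex_extension_aux: "\<exists>F \<epsilon>. lex_ext B X g F \<epsilon>"
proof (rule exI[of _ F], rule exI[of _ \<epsilon>], unfold F_simps lex_ext_def, intro conjI ballI allI impI)
 show "\<exists>!h. h \<in> hom B z (Fo k) \<and> (\<forall>v\<in>V k. Comp B (\<epsilon> k v) h = c v)"
  if "k \<in> Ob K" "z \<in> Ob B \<and> (\<forall>v\<in>V k. c v \<in> hom B z (X (fst v))) \<and> (\<forall>v\<in>V k. fst v \<noteq> 0 --> Comp B (g (fst v)) (c v) = c (e k v))" for k z c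
  by (rule \<epsilon>(2)[OF that(1)]) (use that(2) in "auto simp: pts_def edges_def")
qed (use F_functor F_lex \<epsilon>_hom ptsD(2)[OF \<epsilon>(1)] Fa(2) in auto)

end

text \<open>The generators: \<open>r 0\<close> and \<open>f i : r i \<rightarrow> r 0\<close> are represented by the free models on one element of sort \<open>i\<close>.\<close>

definition is_gen :: "(nat => 'k) => (nat => 'a) => bool" where
 "is_gen r f \<longleftrightarrow> (\<forall>s\<in>sorts. r s \<in> Ob K \<and> V (r s) = {(s, 0), (0, 0)} \<and> e (r s) (s, 0) = (0, 0) \<and> e (r s) (0, 0) = (0, 0)) \<and>
  (\<forall>s\<in>I. f s \<in> hom K (r s) (r 0) \<and> hm (f s) (0, 0) = (0, 0))"

lemma gen_exists: obtains r f where "is_gen r f"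
proof -
 have "\<exists>k\<in>Ob K. V k = {(s, 0), (0, 0)} \<and> e k (s, 0) = (0, 0) \<and> e k (0, 0) = (0, 0)" if "s \<in> sorts" for s
 proof -
  have "model I mo {(s, 0 :: nat), (0, 0)} (\<lambda>_. (0, 0))" using that by (auto simp: model_def sorts_def)
  from md_surj[OF _ this] show ?thesis by auto
 qed
 then obtain r where r: "\<And>s. s \<in> sorts ==> r s \<in> Ob K \<and> V (r s) = {(s, 0), (0, 0)} \<and> e (r s) (s, 0) = (0, 0) \<and> e (r s) (0, 0) = (0, 0)"
  by metis
 have "\<exists>u\<in>hom K (r s) (r 0). hm u (0, 0) = (0, 0)" if "s \<in> I" for s
 proof -
  have "s \<in> sorts" "0 \<in> sorts" using that by (auto simp: sorts_def)
  note rs = r[OF this(1)] and r0 = r[OF this(2)]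
  have "mhom (V (r 0)) (e (r 0)) (V (r s)) (e (r s)) (\<lambda>v. v)" using rs r0 by (simp add: mhom_def)
  from hm_full[OF _ _ this] show ?thesis using rs r0 by simp
 qed
 then obtain f where "\<And>s. s \<in> I ==> f s \<in> hom K (r s) (r 0) \<and> hm (f s) (0, 0) = (0, 0)" by metis
 thus ?thesis using that r unfolding is_gen_def by blast
qed

context
 fixes r f
 assumes gen: "is_gen r f"
begin

lemma r: "s \<in> sorts ==> r s \<in> Ob K" "s \<in> sorts ==> V (r s) = {(s, 0), (0, 0)}" "s \<in> sorts ==> e (r s) (s, 0) = (0, 0)"
  "s \<in> sorts ==> e (r s) (0, 0) = (0, 0)"
 and f: "s \<in> I ==> f s \<in> hom K (r s) (r 0)" "s \<in> I ==> hm (f s) (0, 0) = (0, 0)"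
 using gen by (auto simp: is_gen_def)

lemma sorts0: "0 \<in> sorts" and sortsI: "s \<in> I ==> s \<in> sorts"
 by (auto simp: sorts_def)

lemma gen_mono: assumes mo and i: "s \<in> I" shows "is_mono K (f s)"
proof (rule lex_cat_base.monoI[OF f(1)[OF i]])
 note s = sortsI[OF i]
 fix w a b assume a: "a \<in> hom K w (r s)" and b: "b \<in> hom K w (r s)" and eq: "Comp K (f s) a = Comp K (f s) b"
 have v: "(0, 0) \<in> V (r 0)" "(0, 0) \<in> V (r s)" "(s, 0) \<in> V (r s)" using r(2)[OF s] r(2)[OF sorts0] by auto
 have 0: "hm a (0, 0) = hm b (0, 0)" using hm_comp[OF a f(1)[OF i] v(1)] hm_comp[OF b f(1)[OF i] v(1)] f(2)[OF i] eq by simp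
 note ha = mhomD[OF hm[OF a] v(3)] and hb = mhomD[OF hm[OF b] v(3)]
 have "e w (hm a (s, 0)) = e w (hm b (s, 0))" using ha(3) hb(3) 0 r(3)[OF s] by simp
 hence 1: "hm a (s, 0) = hm b (s, 0)" using modelD(5)[OF mdl[OF obD(1)[OF a]] ha(1) \<open>mo\<close> hb(1)] ha(2) hb(2) by simp
 show "a = b" by (rule hm_faithful[OF a b]) (use 0 1 r(2)[OF s] in auto)
qed

lemma lex_extension:
 fixes B :: "('o, 'b) cat"
 assumes B: "finitely_complete B" and X: "\<And>s. s \<in> sorts ==> X s \<in> Ob B"
  and g: "\<And>s. s \<in> I ==> g s \<in> hom B (X s) (X 0)" and gm: "\<And>s. mo ==> s \<in> I ==> is_mono B (g s)"
 obtains F i where "lex_functor K B F" "\<And>s. s \<in> sorts ==> i s \<in> hom B (ob F (r s)) (X s) \<and> is_iso B (i s)"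
  "\<And>s. s \<in> I ==> Comp B (i 0) (ar F (f s)) = Comp B (g s) (i s)"
proof -
 interpret B: lex_cat B using B by unfold_locales (auto simp: finitely_complete_def)
 obtain F \<epsilon> where L: "lex_ext B X g F \<epsilon>" using lex_extension_aux[of B X g] B X g gm by blast
 have F: "is_functor K B F" "preserves_finite_limits K B F" using L by (simp_all add: lex_ext_def)
 have \<epsilon>: "\<epsilon> k v \<in> hom B (ob F k) (X (fst v))" if "k \<in> Ob K" "v \<in> V k" for k v
  using L that unfolding lex_ext_def by blast
 have \<epsilon>e: "Comp B (g (fst v)) (\<epsilon> k v) = \<epsilon> k (e k v)" if "k \<in> Ob K" "v \<in> V k" "fst v \<noteq> 0" for k v
  using L that unfolding lex_ext_def by blast
 have univ: "\<exists>!h. h \<in> hom B z (ob F k) \<and> (\<forall>v\<in>V k. Comp B (\<epsilon> k v) h = c v)"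
  if "k \<in> Ob K" "z \<in> Ob B \<and> (\<forall>v\<in>V k. c v \<in> hom B z (X (fst v))) \<and> (\<forall>v\<in>V k. fst v \<noteq> 0 --> Comp B (g (fst v)) (c v) = c (e k v))" for k z c
  using conjunct1[OF conjunct2[OF conjunct2[OF conjunct2[OF conjunct2[OF L[unfolded lex_ext_def]]]]]] that by blast
 have Fa: "Comp B (\<epsilon> k v) (ar F u) = \<epsilon> j (hm u v)" if "u \<in> hom K j k" "v \<in> V k" for j k u v
  using conjunct2[OF conjunct2[OF conjunct2[OF conjunct2[OF conjunct2[OF L[unfolded lex_ext_def]]]]]] that by blast
 define i where "i s = \<epsilon> (r s) (s, 0)" for s
 have ih: "i s \<in> hom B (ob F (r s)) (X s)" if s: "s \<in> sorts" for s
  using \<epsilon>[OF r(1)[OF s], of "(s, 0)"] r(2)[OF s] by (simp add: i_def)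
 have \<epsilon>0: "\<epsilon> (r s) (0, 0) = (if s = 0 then i s else Comp B (g s) (i s))" if s: "s \<in> sorts" for s
  using \<epsilon>e[OF r(1)[OF s], of "(s, 0)"] r(2,3)[OF s] by (simp add: i_def)
 have gs: "g s \<in> hom B (X s) (X 0)" if "s \<in> sorts" "s \<noteq> 0" for s using g that by (auto simp: sorts_def)
 have ii: "is_iso B (i s)" if s: "s \<in> sorts" for s
 proof -
  note Xs = X[OF s]
  define c where "c v = (if v = (s, 0) then Id B (X s) else g s)" for v :: "nat \<times> nat"
  have pc: "X s \<in> Ob B \<and> (\<forall>v\<in>V (r s). c v \<in> hom B (X s) (X (fst v))) \<and>
    (\<forall>v\<in>V (r s). fst v \<noteq> 0 --> Comp B (g (fst v)) (c v) = c (e (r s) v))"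
   using Xs B.id_hom[OF Xs] gs[OF s] B.id_right[OF gs[OF s]] r(3)[OF s] unfolding r(2)[OF s] c_def by auto
  obtain h where h: "h \<in> hom B (X s) (ob F (r s))" "\<And>v. v \<in> V (r s) ==> Comp B (\<epsilon> (r s) v) h = c v"
   using univ[OF r(1)[OF s] pc] by blast
  have ihd: "Comp B (i s) h = Id B (X s)" using h(2)[of "(s, 0)"] r(2)[OF s] by (simp add: i_def c_def)
  have Fr: "ob F (r s) \<in> Ob B" using B.hom_ob[OF ih[OF s]] by simp
  have hi: "Comp B h (i s) \<in> hom B (ob F (r s)) (ob F (r s))" by (rule B.comp_hom[OF h(1) ih[OF s]])
  have "Comp B (\<epsilon> (r s) v) (Comp B h (i s)) = \<epsilon> (r s) v" if v: "v \<in> V (r s)" for v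
  proof -
   have "Comp B (\<epsilon> (r s) v) (Comp B h (i s)) = Comp B (c v) (i s)"
    using B.assoc[OF \<epsilon>[OF r(1)[OF s] v] h(1) ih[OF s]] h(2)[OF v] by simp
   also have "\<dots> = \<epsilon> (r s) v"
   proof (cases "v = (s, 0)")
    case True thus ?thesis using B.id_left[OF ih[OF s]] by (simp add: c_def i_def)
   next
    case False
    hence "v = (0, 0)" "s \<noteq> 0" using v r(2)[OF s] by auto
    thus ?thesis using \<epsilon>0[OF s] by (simp add: c_def)
   qed
   finally show ?thesis .
  qed
  moreover have "\<exists>!x. x \<in> hom B (ob F (r s)) (ob F (r s)) \<and> (\<forall>v\<in>V (r s). Comp B (\<epsilon> (r s) v) x = \<epsilon> (r s) v)"
   by (rule univ[OF r(1)[OF s]]) (use Fr \<epsilon>[OF r(1)[OF s]] \<epsilon>e[OF r(1)[OF s]] in blast)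
  moreover have "Comp B (\<epsilon> (r s) v) (Id B (ob F (r s))) = \<epsilon> (r s) v" if "v \<in> V (r s)" for v
   by (rule B.id_right[OF \<epsilon>[OF r(1)[OF s] that]])
  ultimately have "Comp B h (i s) = Id B (ob F (r s))" using hi B.id_hom[OF Fr] by metis
  thus ?thesis using B.isoI[OF ih[OF s] h(1)] ihd by simp
 qed
 show ?thesis
 proof (rule that)
  show "lex_functor K B F" using F by (simp add: lex_functor_def)
  show "i s \<in> hom B (ob F (r s)) (X s) \<and> is_iso B (i s)" if "s \<in> sorts" for s using ih ii that by simp
  fix s assume s: "s \<in> I"
  have "Comp B (i 0) (ar F (f s)) = \<epsilon> (r s) (0, 0)"
   using Fa[OF f(1)[OF s], of "(0, 0)"] r(2)[OF sorts0] f(2)[OF s] by (simp add: i_def)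
  moreover have "s \<noteq> 0" using s finI(2) by metis
  ultimately show "Comp B (i 0) (ar F (f s)) = Comp B (g s) (i s)" using \<epsilon>0[OF sortsI[OF s]] by simp
 qed
qed

lemma point_exists:
 assumes k: "k \<in> Ob K" and v: "v \<in> V k"
 shows "\<exists>u\<in>hom K k (r (fst v)). hm u (fst v, 0) = v \<and> hm u (0, 0) = e k v"
proof -
 have s: "fst v \<in> sorts" by (rule sortsD[OF v k])
 note m = modelD[OF mdl[OF k] v]
 have "mhom (V (r (fst v))) (e (r (fst v))) (V k) (e k) (\<lambda>w. if w = (fst v, 0) then v else e k v)"
  unfolding mhom_def r(2)[OF s] using v m r(3,4)[OF s] modelD(4)[OF mdl[OF k] m(2)] by auto
 from hm_full[OF k r(1)[OF s] this] obtain u where u: "u \<in> hom K k (r (fst v))"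
  "\<forall>w\<in>V (r (fst v)). hm u w = (if w = (fst v, 0) then v else e k v)" by blast
 have "hm u (0, 0) = e k v" using u(2) r(2)[OF s] m(4) by auto
 thus ?thesis using u r(2)[OF s] by auto
qed

definition pt :: "'k => nat \<times> nat => 'a" where
 "pt k v = (SOME u. u \<in> hom K k (r (fst v)) \<and> hm u (fst v, 0) = v \<and> hm u (0, 0) = e k v)"

lemma pt:
 assumes "k \<in> Ob K" "v \<in> V k"
 shows "pt k v \<in> hom K k (r (fst v))" "hm (pt k v) (fst v, 0) = v" "hm (pt k v) (0, 0) = e k v"
proof -
 have "pt k v \<in> hom K k (r (fst v)) \<and> hm (pt k v) (fst v, 0) = v \<and> hm (pt k v) (0, 0) = e k v"
  unfolding pt_def by (rule someI_ex[OF point_exists[OF assms, unfolded Bex_def]])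
 thus "pt k v \<in> hom K k (r (fst v))" "hm (pt k v) (fst v, 0) = v" "hm (pt k v) (0, 0) = e k v"
  by (rule conjunct1, rule conjunct1[OF conjunct2], rule conjunct2[OF conjunct2])
qed

lemma to_gen_eq:
 assumes s: "s \<in> sorts" and u: "u \<in> hom K k (r s)" "u' \<in> hom K k (r s)" and eq: "hm u (s, 0) = hm u' (s, 0)"
 shows "u = u'"
proof (rule hm_faithful[OF u])
 have v: "(s, 0) \<in> V (r s)" using r(2)[OF s] by simp
 have "hm u (0, 0) = hm u' (0, 0)" using mhomD(3)[OF hm[OF u(1)] v] mhomD(3)[OF hm[OF u(2)] v] eq r(3)[OF s] by simp
 thus "hm u w = hm u' w" if "w \<in> V (r s)" for w using that eq r(2)[OF s] by auto
qed

lemma pt_comp: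
 assumes u: "u \<in> hom K j k" and v: "v \<in> V k"
 shows "Comp K (pt k v) u = pt j (hm u v)"
proof -
 have jk: "j \<in> Ob K" "k \<in> Ob K" using obD[OF u] by auto
 note h = mhomD[OF hm[OF u] v]
 have s: "fst v \<in> sorts" by (rule sortsD[OF v jk(2)])
 note p = pt[OF jk(2) v] and q = pt[OF jk(1) h(1), unfolded h(2)]
 show ?thesis
  by (rule to_gen_eq[OF s lex_cat_base.comp_hom[OF p(1) u] q(1)])
   (use hm_comp[OF u p(1), of "(fst v, 0)"] r(2)[OF s] p(2) q(2) in simp)
qed

lemma f_pt:
 assumes k: "k \<in> Ob K" and v: "v \<in> edges k"
 shows "fst v \<in> I" "Comp K (f (fst v)) (pt k v) = pt k (e k v)"
proof -
 have v: "v \<in> V k" "fst v \<noteq> 0" using v by (auto simp: edges_def)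
 note m = modelD[OF mdl[OF k] v(1)]
 show s: "fst v \<in> I" using m(1) v(2) by simp
 note p = pt[OF k v(1)] and q = pt[OF k m(2), unfolded m(3)]
 show "Comp K (f (fst v)) (pt k v) = pt k (e k v)"
  by (rule to_gen_eq[OF sorts0 lex_cat_base.comp_hom[OF f(1)[OF s] p(1)] q(1)])
   (use hm_comp[OF p(1) f(1)[OF s], of "(0, 0)"] r(2)[OF sorts0] f(2)[OF s] p(3) q(2) in simp)
qed

lemma model_glim:
 assumes k: "k \<in> Ob K"
 shows "gdiag K (V k) (edges k) (\<lambda>v. v) (e k) (\<lambda>v. r (fst v)) (\<lambda>v. f (fst v))"
  and "is_glim K (V k) (edges k) (\<lambda>v. v) (e k) (\<lambda>v. r (fst v)) (\<lambda>v. f (fst v)) k (pt k)"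
proof -
 note m = modelD[OF mdl[OF k]]
 have e0: "fst (e k v) = 0" if "v \<in> edges k" for v using m(3)[of v] that by (simp add: edges_def)
 show "gdiag K (V k) (edges k) (\<lambda>v. v) (e k) (\<lambda>v. r (fst v)) (\<lambda>v. f (fst v))"
  unfolding gdiag_def using r(1)[OF sortsD[OF _ k]] f(1)[OF f_pt(1)[OF k]] e0 by simp
 show "is_glim K (V k) (edges k) (\<lambda>v. v) (e k) (\<lambda>v. r (fst v)) (\<lambda>v. f (fst v)) k (pt k)"
  unfolding is_glim_def
 proof (intro conjI allI impI)
  show "is_gcone K (V k) (edges k) (\<lambda>v. v) (e k) (\<lambda>v. r (fst v)) (\<lambda>v. f (fst v)) k (pt k)"
   unfolding is_gcone_def using k pt(1)[OF k] f_pt(2)[OF k] by simp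
  fix n \<rho> assume c: "is_gcone K (V k) (edges k) (\<lambda>v. v) (e k) (\<lambda>v. r (fst v)) (\<lambda>v. f (fst v)) n \<rho>"
  have n: "n \<in> Ob K" and \<rho>: "\<And>v. v \<in> V k ==> \<rho> v \<in> hom K n (r (fst v))"
   and \<rho>e: "\<And>v. v \<in> edges k ==> Comp K (f (fst v)) (\<rho> v) = \<rho> (e k v)" using c by (auto simp: is_gcone_def)
  define h where "h v = hm (\<rho> v) (fst v, 0)" for v
  have vs: "(fst v, 0) \<in> V (r (fst v))" "(0, 0) \<in> V (r (fst v))" if "v \<in> V k" for v using r(2)[OF sortsD[OF that k]] by auto
  have "mhom (V k) (e k) (V n) (e n) h"
   unfolding mhom_def
  proof
   fix v assume v: "v \<in> V k"
   note q = mhomD[OF hm[OF \<rho>[OF v]] vs(1)[OF v]]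
   have "h (e k v) = e n (h v)"
   proof (cases "fst v = 0")
    case True
    hence "fst (h v) = 0" using q(2) by (simp add: h_def)
    thus ?thesis using True m(4)[OF v] modelD(4)[OF mdl[OF n]] q(1) by (simp add: h_def)
   next
    case False
    hence ve: "v \<in> edges k" using v by (simp add: edges_def)
    have "h (e k v) = hm (Comp K (f (fst v)) (\<rho> v)) (0, 0)" using \<rho>e[OF ve] m(3)[OF v] by (simp add: h_def)
    also have "\<dots> = hm (\<rho> v) (0, 0)"
     using hm_comp[OF \<rho>[OF v] f(1)[OF f_pt(1)[OF k ve]], of "(0, 0)"] r(2)[OF sorts0] f(2)[OF f_pt(1)[OF k ve]] by simp
    also have "\<dots> = e n (h v)" using q(3) r(3)[OF sortsD[OF v k]] by (simp add: h_def)
    finally show ?thesis .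
   qed
   thus "h v \<in> V n \<and> fst (h v) = fst v \<and> h (e k v) = e n (h v)" using q by (simp add: h_def)
  qed
  then obtain u where u: "u \<in> hom K n k" "\<forall>v\<in>V k. hm u v = h v" using hm_full[OF n k] by blast
  have key: "Comp K (pt k v) u' = \<rho> v \<longleftrightarrow> hm u' v = h v" if u': "u' \<in> hom K n k" and v: "v \<in> V k" for u' v
  proof -
   note c = lex_cat_base.comp_hom[OF pt(1)[OF k v] u']
   have "hm (Comp K (pt k v) u') (fst v, 0) = hm u' v" using hm_comp[OF u' pt(1)[OF k v] vs(1)[OF v]] pt(2)[OF k v] by simp
   thus ?thesis using to_gen_eq[OF sortsD[OF v k] c \<rho>[OF v]] by (auto simp: h_def)
  qed
  show "\<exists>!h. h \<in> hom K n k \<and> (\<forall>v\<in>V k. Comp K (pt k v) h = \<rho> v)"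
  proof (rule ex1I[of _ u])
   show "u \<in> hom K n k \<and> (\<forall>v\<in>V k. Comp K (pt k v) u = \<rho> v)" using u key[OF u(1)] by simp
   fix u' assume u': "u' \<in> hom K n k \<and> (\<forall>v\<in>V k. Comp K (pt k v) u' = \<rho> v)"
   show "u' = u" by (rule hm_faithful[OF conjunct1[OF u'] u(1)]) (use u' key[OF conjunct1[OF u']] u(2) in simp)
  qed
 qed
qed

lemma nat_trans_extension:
 fixes B :: "('o, 'b) cat"
 assumes F: "lex_functor K B F" and G: "lex_functor K B G"
  and a: "\<And>s. s \<in> sorts ==> a s \<in> hom B (ob F (r s)) (ob G (r s))"
  and af: "\<And>s. s \<in> I ==> Comp B (a 0) (ar F (f s)) = Comp B (ar G (f s)) (a s)"
 shows "\<exists>!\<alpha>. nat_trans K B F G \<alpha> \<and> (\<forall>s\<in>sorts. \<alpha> (r s) = a s)"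
proof -
 have Ff: "is_functor K B F" "is_functor K B G" "preserves_finite_limits K B F" "preserves_finite_limits K B G"
  using F G by (auto simp: lex_functor_def)
 interpret B: cat B using Ff by (auto simp: is_functor_def cat_def)
 have Fh: "ar F u \<in> hom B (ob F j) (ob F k)" "ar G u \<in> hom B (ob G j) (ob G k)" if "u \<in> hom K j k" for u j k
  using Ff that by (auto simp: is_functor_def)
 have Fc: "ar F (Comp K w u) = Comp B (ar F w) (ar F u)" "ar G (Comp K w u) = Comp B (ar G w) (ar G u)"
  if "u \<in> hom K j k" "w \<in> hom K k l" for u w j k l
  using Ff that unfolding is_functor_def by blast+
 have Fi: "ar F (Id K k) = Id B (ob F k)" "ar G (Id K k) = Id B (ob G k)" if "k \<in> Ob K" for k
  using Ff that unfolding is_functor_def by blast+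
 have ex: "\<exists>!h. h \<in> hom B (ob F k) (ob G k) \<and> (\<forall>v\<in>V k. Comp B (ar G (pt k v)) h = Comp B (a (fst v)) (ar F (pt k v)))"
  if k: "k \<in> Ob K" for k
 proof (rule glim_univ[OF glim_preserved[OF Ff(2,4) bipartite_model[OF k] model_glim(1)[OF k] model_glim(2)[OF k]]])
  show "is_gcone B (V k) (edges k) (\<lambda>v. v) (e k) (\<lambda>v. ob G (r (fst v))) (\<lambda>v. ar G (f (fst v))) (ob F k)
    (\<lambda>v. Comp B (a (fst v)) (ar F (pt k v)))"
   unfolding is_gcone_def
  proof (intro conjI ballI)
   show "ob F k \<in> Ob B" using Ff(1) k by (auto simp: is_functor_def)
   show "Comp B (a (fst v)) (ar F (pt k v)) \<in> hom B (ob F k) (ob G (r (fst v)))" if "v \<in> V k" for v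
    by (rule B.comp_hom[OF a[OF sortsD[OF that k]] Fh(1)[OF pt(1)[OF k that]]])
   fix v assume ve: "v \<in> edges k"
   hence v: "v \<in> V k" by (simp add: edges_def)
   note s = f_pt(1)[OF k ve] and p = pt(1)[OF k v]
   have "Comp B (ar G (f (fst v))) (Comp B (a (fst v)) (ar F (pt k v))) = Comp B (a 0) (Comp B (ar F (f (fst v))) (ar F (pt k v)))"
    by (rule B.square[OF af[OF s, symmetric] Fh(2)[OF f(1)[OF s]] a[OF sortsI[OF s]] a[OF sorts0] Fh(1)[OF f(1)[OF s]] Fh(1)[OF p]])
   also have "\<dots> = Comp B (a (fst (e k v))) (ar F (pt k (e k v)))"
    using Fc(1)[OF p f(1)[OF s]] f_pt(2)[OF k ve] modelD(3)[OF mdl[OF k] v] by simp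
   finally show "Comp B (ar G (f (fst v))) (Comp B (a (fst v)) (ar F (pt k v))) = Comp B (a (fst (e k v))) (ar F (pt k (e k v)))" .
  qed
 qed
 define \<alpha> where "\<alpha> = (\<lambda>k\<in>Ob K. THE h. h \<in> hom B (ob F k) (ob G k) \<and> (\<forall>v\<in>V k. Comp B (ar G (pt k v)) h = Comp B (a (fst v)) (ar F (pt k v))))"
 have \<alpha>: "\<alpha> k \<in> hom B (ob F k) (ob G k)" "\<And>v. v \<in> V k ==> Comp B (ar G (pt k v)) (\<alpha> k) = Comp B (a (fst v)) (ar F (pt k v))"
  "\<And>h. h \<in> hom B (ob F k) (ob G k) ==> (\<And>v. v \<in> V k ==> Comp B (ar G (pt k v)) h = Comp B (a (fst v)) (ar F (pt k v))) ==> h = \<alpha> k"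
  if k: "k \<in> Ob K" for k
 proof -
  have *: "\<alpha> k \<in> hom B (ob F k) (ob G k) \<and> (\<forall>v\<in>V k. Comp B (ar G (pt k v)) (\<alpha> k) = Comp B (a (fst v)) (ar F (pt k v)))"
   using theI'[OF ex[OF k]] k by (simp add: \<alpha>_def)
  thus "\<alpha> k \<in> hom B (ob F k) (ob G k)" "\<And>v. v \<in> V k ==> Comp B (ar G (pt k v)) (\<alpha> k) = Comp B (a (fst v)) (ar F (pt k v))" by blast+
  show "h = \<alpha> k" if "h \<in> hom B (ob F k) (ob G k)" "\<And>v. v \<in> V k ==> Comp B (ar G (pt k v)) h = Comp B (a (fst v)) (ar F (pt k v))" for h
   using ex[OF k] * that by (elim ex1E) metis
 qed
 have joint: "x = y" if k: "k \<in> Ob K" and x: "x \<in> hom B z (ob G k)" "y \<in> hom B z (ob G k)"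
  and eq: "\<And>v. v \<in> V k ==> Comp B (ar G (pt k v)) x = Comp B (ar G (pt k v)) y" for k x y z
 proof -
  note gl = glim_preserved[OF Ff(2,4) bipartite_model[OF k] model_glim(1)[OF k] model_glim(2)[OF k]]
  have "is_gcone B (V k) (edges k) (\<lambda>v. v) (e k) (\<lambda>v. ob G (r (fst v))) (\<lambda>v. ar G (f (fst v))) z
    (\<lambda>v. Comp B (ar G (pt k v)) x)"
   unfolding is_gcone_def
  proof (intro conjI ballI)
   show "z \<in> Ob B" using B.hom_ob[OF x(1)] by simp
   show "Comp B (ar G (pt k v)) x \<in> hom B z (ob G (r (fst v)))" if "v \<in> V k" for v
    by (rule B.comp_hom[OF Fh(2)[OF pt(1)[OF k that]] x(1)])
   fix v assume ve: "v \<in> edges k"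
   hence v: "v \<in> V k" by (simp add: edges_def)
   note s = f_pt(1)[OF k ve] and p = pt(1)[OF k v]
   show "Comp B (ar G (f (fst v))) (Comp B (ar G (pt k v)) x) = Comp B (ar G (pt k (e k v))) x"
    using B.assoc[OF Fh(2)[OF f(1)[OF s]] Fh(2)[OF p] x(1)] Fc(2)[OF p f(1)[OF s]] f_pt(2)[OF k ve] by simp
  qed
  from glim_univ[OF gl this] show ?thesis using x eq by metis
 qed
 have nat: "nat_trans K B F G \<alpha>"
  unfolding nat_trans_def
 proof (intro conjI ballI allI)
  show "\<alpha> \<in> extensional (Ob K)" by (simp add: \<alpha>_def)
  fix j k u assume u: "u \<in> hom K j k"
  have jk: "j \<in> Ob K" "k \<in> Ob K" using obD[OF u] by auto
  show "Comp B (\<alpha> k) (ar F u) = Comp B (ar G u) (\<alpha> j)"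
  proof (rule joint[OF jk(2) B.comp_hom[OF \<alpha>(1)[OF jk(2)] Fh(1)[OF u]] B.comp_hom[OF Fh(2)[OF u] \<alpha>(1)[OF jk(1)]]])
   fix v assume v: "v \<in> V k"
   note p = pt(1)[OF jk(2) v] and h = mhomD[OF hm[OF u] v] and as = a[OF sortsD[OF v jk(2)]]
   have "Comp B (ar G (pt k v)) (Comp B (\<alpha> k) (ar F u)) = Comp B (a (fst v)) (Comp B (ar F (pt k v)) (ar F u))"
    by (rule B.square[OF \<alpha>(2)[OF jk(2) v] Fh(2)[OF p] \<alpha>(1)[OF jk(2)] as Fh(1)[OF p] Fh(1)[OF u]])
   also have "\<dots> = Comp B (a (fst (hm u v))) (ar F (pt j (hm u v)))" using Fc(1)[OF u p] pt_comp[OF u v] h(2) by simp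
   also have "\<dots> = Comp B (ar G (pt j (hm u v))) (\<alpha> j)" using \<alpha>(2)[OF jk(1) h(1)] by simp
   also have "\<dots> = Comp B (ar G (pt k v)) (Comp B (ar G u) (\<alpha> j))"
    using Fc(2)[OF u p] pt_comp[OF u v] B.assoc[OF Fh(2)[OF p] Fh(2)[OF u] \<alpha>(1)[OF jk(1)]] by simp
   finally show "Comp B (ar G (pt k v)) (Comp B (\<alpha> k) (ar F u)) = Comp B (ar G (pt k v)) (Comp B (ar G u) (\<alpha> j))" .
  qed
 qed (rule \<alpha>(1))
 have \<alpha>r: "\<alpha> (r s) = a s" if s: "s \<in> sorts" for s
 proof (rule \<alpha>(3)[OF r(1)[OF s] a[OF s], symmetric])
  fix v assume v: "v \<in> V (r s)"
  note p = pt[OF r(1)[OF s] v]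
  consider "v = (s, 0)" | "v = (0, 0)" "s \<in> I" using v r(2)[OF s] s by (auto simp: sorts_def)
  thus "Comp B (ar G (pt (r s) v)) (a s) = Comp B (a (fst v)) (ar F (pt (r s) v))"
  proof cases
   case 1
   have "pt (r s) v = Id K (r s)"
    by (rule to_gen_eq[OF s _ lex_cat_base.id_hom[OF r(1)[OF s]]]) (use p 1 v hm_id[OF r(1)[OF s] v] in auto)
   thus ?thesis using Fi[OF r(1)[OF s]] B.id_left[OF a[OF s]] B.id_right[OF a[OF s]] 1 by simp
  next
   case 2
   have "pt (r s) v = f s"
    by (rule to_gen_eq[OF sorts0 _ f(1)[OF 2(2)]]) (use p 2 f(2) in auto)
   thus ?thesis using af[OF 2(2)] 2 by simp
  qed
 qed
 show ?thesis
 proof (rule ex1I[of _ \<alpha>])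
  show "nat_trans K B F G \<alpha> \<and> (\<forall>s\<in>sorts. \<alpha> (r s) = a s)" using nat \<alpha>r by blast
  fix \<beta> assume \<beta>: "nat_trans K B F G \<beta> \<and> (\<forall>s\<in>sorts. \<beta> (r s) = a s)"
  hence be: "\<beta> \<in> extensional (Ob K)" and bh: "\<And>k. k \<in> Ob K ==> \<beta> k \<in> hom B (ob F k) (ob G k)"
   and bn: "\<And>j k u. u \<in> hom K j k ==> Comp B (\<beta> k) (ar F u) = Comp B (ar G u) (\<beta> j)"
   and br: "\<And>s. s \<in> sorts ==> \<beta> (r s) = a s" unfolding nat_trans_def by blast+
  have "\<beta> k = \<alpha> k" if k: "k \<in> Ob K" for k
   by (rule \<alpha>(3)[OF k bh[OF k]]) (use bn[OF pt(1)[OF k]] br[OF sortsD[OF _ k]] in simp)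
  thus "\<beta> = \<alpha>" using be by (auto simp: \<alpha>_def extensional_def fun_eq_iff)
 qed
qed

end

end

definition fin_models :: "nat set => bool => ((nat \<times> nat) set \<times> (nat \<times> nat => nat \<times> nat)) set" where
 "fin_models I mo = {(V, e). finite V \<and> model I mo V e \<and> e \<in> extensional V}"

definition fin_homs where
 "fin_homs I mo = {(M, h, N). M \<in> fin_models I mo \<and> N \<in> fin_models I mo \<and>
  mhom (fst N) (snd N) (fst M) (snd M) h \<and> h \<in> extensional (fst N)}"

lemma countable_fin_maps:
 "countable ({(V, f). finite V \<and> f \<in> extensional V} :: ((nat \<times> nat) set \<times> (nat \<times> nat => nat \<times> nat)) set)" (is "countable ?P")
proof -
 let ?\<phi> = "\<lambda>p :: (nat \<times> nat) set \<times> (nat \<times> nat => nat \<times> nat). (fst p, (\<lambda>v. (v, snd p v)) ` fst p)"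
 have "inj_on ?\<phi> ?P"
 proof (rule inj_onI)
  fix p q assume p: "p \<in> ?P" and q: "q \<in> ?P" and eq: "?\<phi> p = ?\<phi> q"
  have eq': "fst p = fst q \<and> (\<lambda>v. (v, snd p v)) ` fst p = (\<lambda>v. (v, snd q v)) ` fst q"
   using eq unfolding prod.inject .
  note V = conjunct1[OF eq'] and G = conjunct2[OF eq']
  have ext: "snd p \<in> extensional (fst p)" "snd q \<in> extensional (fst q)" using p q by auto
  have "snd p v = snd q v" for v
  proof (cases "v \<in> fst p")
   case True
   hence "(v, snd p v) \<in> (\<lambda>v. (v, snd p v)) ` fst p" by blast
   thus ?thesis unfolding G by auto
  next
   case False
   thus ?thesis using extensional_arb[OF ext(1) False] extensional_arb[OF ext(2) False[unfolded V]] by simp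
  qed
  hence "snd p = snd q" by (rule HOL.ext)
  with V show "p = q" by (rule prod_eqI)
 qed
 moreover have "?\<phi> ` ?P \<subseteq> Collect finite \<times> Collect finite" by auto
 hence "countable (?\<phi> ` ?P)"
  by (rule countable_subset) (intro countable_SIGMA countable_Collect_finite)
 ultimately show ?thesis using countable_image_inj_on by blast
qed

lemma countable_fin_models: "countable (fin_models I mo)"
 by (rule countable_subset[OF _ countable_fin_maps]) (auto simp: fin_models_def)

lemma countable_fin_homs: "countable (fin_homs I mo)"
proof -
 let ?P = "{(V, f). finite V \<and> f \<in> extensional V} :: ((nat \<times> nat) set \<times> (nat \<times> nat => nat \<times> nat)) set"
 let ?\<psi> = "\<lambda>p. (fst p, (fst (snd (snd p)), fst (snd p)), snd (snd p))"
 have "inj_on ?\<psi> (fin_homs I mo)" by (rule inj_onI) (auto simp: prod_eq_iff)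
 moreover have "?\<psi> ` fin_homs I mo \<subseteq> ?P \<times> ?P \<times> ?P" by (auto simp: fin_homs_def fin_models_def)
 hence "countable (?\<psi> ` fin_homs I mo)"
  by (rule countable_subset) (intro countable_SIGMA countable_fin_maps)
 ultimately show ?thesis using countable_image_inj_on by blast
qed

lemma countable_inj:
 assumes "universe TYPE('u)" "countable A"
 obtains a :: "'x => 'u" where "inj_on a A"
proof -
 have "|A| \<le>o |UNIV :: 'u set|" using small_countable[OF assms] ordLess_imp_ordLeq unfolding small_def by blast
 thus ?thesis using that card_of_ordLeq[of A "UNIV :: 'u set"] by blast
qed

lemma fm_exists:
 assumes U: "universe TYPE('u)" and I: "finite I" "0 \<notin> I"
 obtains K :: "('u, 'u) cat" and md hm where "small_category K" "fm K I mo md hm"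
proof -
 let ?M = "fin_models I mo" and ?H = "fin_homs I mo"
 obtain a :: "(nat \<times> nat) set \<times> (nat \<times> nat => nat \<times> nat) => 'u" where a: "inj_on a ?M"
  by (rule countable_inj[OF U countable_fin_models])
 obtain b :: "((nat \<times> nat) set \<times> (nat \<times> nat => nat \<times> nat)) \<times> (nat \<times> nat => nat \<times> nat) \<times> ((nat \<times> nat) set \<times> (nat \<times> nat => nat \<times> nat)) => 'u"
  where b: "inj_on b ?H" by (rule countable_inj[OF U countable_fin_homs])
 define a' where "a' = inv_into ?M a"
 define b' where "b' = inv_into ?H b"
 have a'[simp]: "a' (a M) = M" if "M \<in> ?M" for M using a that by (simp add: a'_def)
 have b'[simp]: "b' (b p) = p" if "p \<in> ?H" for p using b that by (simp add: b'_def)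
 define K where "K = \<lparr>Ob = a ` ?M, Arr = b ` ?H, Dom = (\<lambda>x. a (fst (b' x))), Cod = (\<lambda>x. a (snd (snd (b' x)))),
  Id = (\<lambda>x. b (a' x, restrict (\<lambda>v. v) (fst (a' x)), a' x)),
  Comp = (\<lambda>y x. b (fst (b' x), restrict (\<lambda>v. fst (snd (b' x)) (fst (snd (b' y)) v)) (fst (snd (snd (b' y)))), snd (snd (b' y))))\<rparr>"
 have HM: "M \<in> ?M" "N \<in> ?M" "mhom (fst N) (snd N) (fst M) (snd M) h" "h \<in> extensional (fst N)" if "(M, h, N) \<in> ?H" for M h N
  using that by (auto simp: fin_homs_def)
 have h: "u \<in> hom K x y \<longleftrightarrow> (\<exists>M h N. (M, h, N) \<in> ?H \<and> u = b (M, h, N) \<and> x = a M \<and> y = a N)" for u x y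
 proof
  assume "u \<in> hom K x y"
  then obtain p where p: "p \<in> ?H" "u = b p" "x = a (fst p)" "y = a (snd (snd p))" by (auto simp: hom_def K_def)
  obtain M h N where "p = (M, h, N)" by (cases p)
  thus "\<exists>M h N. (M, h, N) \<in> ?H \<and> u = b (M, h, N) \<and> x = a M \<and> y = a N"
   using p by (intro exI[of _ M] exI[of _ h] exI[of _ N]) simp
 next
  assume "\<exists>M h N. (M, h, N) \<in> ?H \<and> u = b (M, h, N) \<and> x = a M \<and> y = a N"
  thus "u \<in> hom K x y" by (auto simp: hom_def K_def)
 qed
 have a_eq: "a M = a N \<longleftrightarrow> M = N" if "M \<in> ?M" "N \<in> ?M" for M N using a that by (auto simp: inj_on_def)
 have cmpH: "(M, restrict (\<lambda>v. f (g v)) (fst P), P) \<in> ?H" if "(M, f, N) \<in> ?H" "(N, g, P) \<in> ?H" for M N P f g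
 proof -
  have "snd P v \<in> fst P" if "v \<in> fst P" for v using modelD(2)[of I mo "fst P" "snd P" v] HM(2)[OF \<open>(N, g, P) \<in> ?H\<close>] that
   by (auto simp: fin_models_def)
  hence "mhom (fst P) (snd P) (fst M) (snd M) (restrict (\<lambda>v. f (g v)) (fst P))"
   using mhomD[OF HM(3)[OF that(1)]] mhomD[OF HM(3)[OF that(2)]] by (simp add: mhom_def)
  thus ?thesis using HM[OF that(1)] HM[OF that(2)] by (auto simp: fin_homs_def)
 qed
 have cmp: "Comp K (b (N, g, P)) (b (M, f, N)) = b (M, restrict (\<lambda>v. f (g v)) (fst P), P)"
  if "(M, f, N) \<in> ?H" "(N, g, P) \<in> ?H" for M N P f g using that by (simp add: K_def)
 have idH: "(M, restrict (\<lambda>v. v) (fst M), M) \<in> ?H" if "M \<in> ?M" for M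
 proof -
  have "snd M v \<in> fst M" if "v \<in> fst M" for v using modelD(2)[of I mo "fst M" "snd M" v] \<open>M \<in> ?M\<close> that by (auto simp: fin_models_def)
  thus ?thesis using that by (auto simp: fin_homs_def mhom_def)
 qed
 have idK: "Id K (a M) = b (M, restrict (\<lambda>v. v) (fst M), M)" if "M \<in> ?M" for M using that by (simp add: K_def)
 have obK: "Ob K = a ` ?M" by (simp add: K_def)
 have "category K"
  unfolding category_def
 proof (intro conjI ballI allI)
  fix u assume "u \<in> Arr K"
  then obtain p where "p \<in> ?H" "u = b p" by (auto simp: K_def)
  thus "Dom K u \<in> Ob K" "Cod K u \<in> Ob K" by (auto simp: K_def fin_homs_def)
 next
  fix x assume "x \<in> Ob K"
  then obtain M where M: "M \<in> ?M" "x = a M" by (auto simp: obK)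
  show "Id K x \<in> hom K x x" unfolding h M(2) idK[OF M(1)] using idH[OF M(1)] by blast
 next
  fix x y z u w assume "u \<in> hom K x y" "w \<in> hom K y z"
  then obtain M f N N' g P where H: "(M, f, N) \<in> ?H" "u = b (M, f, N)" "x = a M" "y = a N" "(N', g, P) \<in> ?H" "w = b (N', g, P)" "y = a N'" "z = a P"
   unfolding h by blast
  have "N' = N" using H HM a_eq by metis
  thus "Comp K w u \<in> hom K x z" using cmp[OF H(1)] cmpH[OF H(1)] H unfolding h by blast
 next
  fix x y u assume "u \<in> hom K x y"
  then obtain M f N where H: "(M, f, N) \<in> ?H" "u = b (M, f, N)" "x = a M" "y = a N" unfolding h by blast
  note q = HM[OF H(1)]
  have "restrict (\<lambda>v. restrict (\<lambda>v. v) (fst M) (f v)) (fst N) = f"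
   using mhomD(1)[OF q(3)] q(4) by (auto simp: fun_eq_iff extensional_def)
  thus "Comp K u (Id K x) = u" using cmp[OF idH[OF q(1)] H(1)] idK[OF q(1)] H by simp
  have "restrict (\<lambda>v. f (restrict (\<lambda>v. v) (fst N) v)) (fst N) = f"
   using q(4) by (auto simp: fun_eq_iff extensional_def)
  thus "Comp K (Id K y) u = u" using cmp[OF H(1) idH[OF q(2)]] idK[OF q(2)] H by simp
 next
  fix w x y z u s t assume "u \<in> hom K w x" "s \<in> hom K x y" "t \<in> hom K y z"
  then obtain M f N N' g P P' k Q where H: "(M, f, N) \<in> ?H" "u = b (M, f, N)" "x = a N" "(N', g, P) \<in> ?H" "s = b (N', g, P)" "x = a N'" "y = a P"
   "(P', k, Q) \<in> ?H" "t = b (P', k, Q)" "y = a P'"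
   unfolding h by metis
  have e: "N' = N" "P' = P" using H HM a_eq by metis+
  note H1 = H(4)[unfolded e] and H2 = H(8)[unfolded e]
  have "restrict (\<lambda>v. restrict (\<lambda>v. f (g v)) (fst P) (k v)) (fst Q) = restrict (\<lambda>v. f (restrict (\<lambda>v. g (k v)) (fst Q) v)) (fst Q)"
   using mhomD(1)[OF HM(3)[OF H2]] by (auto simp: fun_eq_iff)
  thus "Comp K t (Comp K s u) = Comp K (Comp K t s) u"
   using cmp[OF H(1) H1] cmp[OF H1 H2] cmp[OF cmpH[OF H(1) H1] H2] cmp[OF H(1) cmpH[OF H1 H2]] H(2,5,9) e by simp
 qed
 moreover have "small TYPE('u) (Ob K)" "small TYPE('u) (Arr K)"
  by (auto simp: K_def intro!: small_countable[OF U] countable_image countable_fin_models countable_fin_homs)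
 ultimately have sK: "small_category K" by (simp add: small_category_def)
 define hm where "hm u = fst (snd (b' u))" for u
 have hmb: "hm (b (M, f, N)) = f" if "(M, f, N) \<in> ?H" for M f N using that by (simp add: hm_def)
 have "fm K I mo a' hm"
 proof (unfold_locales)
  show "category K" "finite I" "0 \<notin> I" by fact+
  show "finite (fst (a' k)) \<and> model I mo (fst (a' k)) (snd (a' k))" if "k \<in> Ob K" for k
   using that by (auto simp: obK fin_models_def)
  show "\<exists>k\<in>Ob K. fst (a' k) = V \<and> (\<forall>v\<in>V. snd (a' k) v = e v)" if V: "finite V" "model I mo V e" for V e
  proof -
   have "model I mo V (restrict e V)" using V(2) modelD(2)[OF V(2)] by (auto simp: model_def)
   hence "(V, restrict e V) \<in> ?M" using V(1) by (simp add: fin_models_def)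
   thus ?thesis unfolding obK by (intro bexI[of _ "a (V, restrict e V)"]) auto
  qed
  show "mhom (fst (a' k)) (snd (a' k)) (fst (a' j)) (snd (a' j)) (hm u)" if "u \<in> hom K j k" for u j k
  proof -
   obtain M f N where H: "(M, f, N) \<in> ?H" "u = b (M, f, N)" "j = a M" "k = a N" using \<open>u \<in> hom K j k\<close> unfolding h by blast
   show ?thesis using HM[OF H(1)] hmb[OF H(1)] H(2-4) by simp
  qed
  show "\<exists>u\<in>hom K j k. \<forall>v\<in>fst (a' k). hm u v = h' v"
   if j: "j \<in> Ob K" and k: "k \<in> Ob K" and m: "mhom (fst (a' k)) (snd (a' k)) (fst (a' j)) (snd (a' j)) h'" for j k h'
  proof -
   obtain M N where M: "M \<in> ?M" "j = a M" "N \<in> ?M" "k = a N" using j k by (auto simp: obK)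
   have "snd N v \<in> fst N" if "v \<in> fst N" for v using modelD(2)[of I mo "fst N" "snd N" v] M(3) that by (auto simp: fin_models_def)
   hence H: "(M, restrict h' (fst N), N) \<in> ?H" using m M by (auto simp: fin_homs_def mhom_def)
   have "b (M, restrict h' (fst N), N) \<in> hom K j k" unfolding h M(2,4) using H by blast
   moreover have "\<forall>v\<in>fst (a' k). hm (b (M, restrict h' (fst N), N)) v = h' v" using hmb[OF H] M(3,4) by simp
   ultimately show ?thesis by blast
  qed
  show "u = u'" if u: "u \<in> hom K j k" "u' \<in> hom K j k" and eq: "\<And>v. v \<in> fst (a' k) ==> hm u v = hm u' v" for u u' j k
  proof -
   obtain M f N where H: "(M, f, N) \<in> ?H" "u = b (M, f, N)" "j = a M" "k = a N" using u(1) unfolding h by blast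
   obtain M' f' N' where H': "(M', f', N') \<in> ?H" "u' = b (M', f', N')" "j = a M'" "k = a N'" using u(2) unfolding h by blast
   have MN: "M' = M" "N' = N" using H H' HM a_eq by metis+
   have "f v = f' v" for v
   proof (cases "v \<in> fst N")
    case True thus ?thesis using eq[of v] hmb[OF H(1)] hmb[OF H'(1)] H H' HM(2)[OF H(1)] by simp
   next
    case False
    have "f' \<in> extensional (fst N)" using HM(4)[OF H'(1)] unfolding MN(2) .
    thus ?thesis using extensional_arb[OF HM(4)[OF H(1)] False] extensional_arb[OF _ False, of f'] by simp
   qed
   hence "f = f'" by (rule ext)
   thus ?thesis using H(2) H'(2) MN by simp
  qed
  show "hm (Id K k) v = v" if k: "k \<in> Ob K" and v: "v \<in> fst (a' k)" for k v
  proof -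
   obtain M where M: "M \<in> ?M" "k = a M" using k unfolding obK by blast
   show ?thesis using v hmb[OF idH[OF M(1)]] idK[OF M(1)] M by simp
  qed
  show "hm (Comp K w u) v = hm u (hm w v)" if u: "u \<in> hom K j k" and w: "w \<in> hom K k l" and v: "v \<in> fst (a' l)" for u w j k l v
  proof -
   obtain M f N N' g P where H: "(M, f, N) \<in> ?H" "u = b (M, f, N)" "k = a N" "(N', g, P) \<in> ?H" "w = b (N', g, P)" "k = a N'" "l = a P"
    using u w unfolding h by blast
   have e: "N' = N" using H HM a_eq by metis
   note H1 = H(4)[unfolded e]
   show ?thesis using cmp[OF H(1) H1] hmb[OF cmpH[OF H(1) H1]] hmb[OF H(1)] hmb[OF H1] H e HM(2)[OF H1] v by simp
  qed
 qed
 thus ?thesis using that sK by blast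
qed

lemma free_arrow_exists:
 fixes C :: "('o, 'b) cat"
 assumes U: "universe TYPE('u)" and C: "finitely_complete C" and c: "c \<in> Arr C"
 obtains K :: "('u, 'u) cat" and f F i j where "small_category K" "free_lex_on_arrow K f" "lex_functor K C F"
  "i \<in> hom C (ob F (Dom K f)) (Dom C c)" "is_iso C i" "j \<in> hom C (ob F (Cod K f)) (Cod C c)" "is_iso C j"
  "Comp C j (ar F f) = Comp C c i"
proof -
 obtain K :: "('u, 'u) cat" and md hm where sK: "small_category K" and "fm K {1} False md hm"
  by (rule fm_exists[OF U, of "{1}" False]) auto
 then interpret K: fm K "{1}" False md hm by simp
 obtain r f where gen: "K.is_gen r f" by (rule K.gen_exists)
 have S: "K.sorts = {0, 1}" unfolding K.sorts_def by (rule refl)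
 have fh: "f 1 \<in> hom K (r 1) (r 0)" using K.f(1)[OF gen] by simp
 have df: "Dom K (f 1) = r 1" "Cod K (f 1) = r 0" "f 1 \<in> Arr K" using fh by (auto simp: hom_def)
 have ext: "\<exists>F i j. lex_functor K B F \<and> i \<in> hom B (ob F (Dom K (f 1))) (Dom B g) \<and> is_iso B i \<and>
    j \<in> hom B (ob F (Cod K (f 1))) (Cod B g) \<and> is_iso B j \<and> Comp B j (ar F (f 1)) = Comp B g i"
  if B: "finitely_complete B" and g: "g \<in> Arr B" for B :: "('p, 'q) cat" and g
 proof -
  interpret B: cat B using B by unfold_locales (simp add: finitely_complete_def)
  obtain F i where F: "lex_functor K B F"
   "\<And>s. s \<in> K.sorts ==> i s \<in> hom B (ob F (r s)) ((\<lambda>s. if s = 0 then Cod B g else Dom B g) s) \<and> is_iso B (i s)"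
   "\<And>s. s \<in> {1} ==> Comp B (i 0) (ar F (f s)) = Comp B ((\<lambda>_. g) s) (i s)"
   by (rule K.lex_extension[OF gen B, of "\<lambda>s. if s = 0 then Cod B g else Dom B g" "\<lambda>_. g"])
    (use B.dom_ob[OF g] B.cod_ob[OF g] B.hom_arr[OF g] in auto)
  show ?thesis unfolding df using F(1) F(2)[of 0] F(2)[of 1] F(3)[of 1] S by auto
 qed
 have free: "free_lex_on_arrow K (f 1)"
  unfolding free_lex_on_arrow_def
 proof (intro conjI allI impI ballI)
  show "finitely_complete K" by (rule K.finitely_complete)
  fix D :: "('u, 'u) cat" and g assume a: "finitely_complete D \<and> locally_small D" and b: "g \<in> Arr D"
  show "\<exists>F i j. lex_functor K D F \<and> i \<in> hom D (ob F (Dom K (f 1))) (Dom D g) \<and> is_iso D i \<and>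
    j \<in> hom D (ob F (Cod K (f 1))) (Cod D g) \<and> is_iso D j \<and> Comp D j (ar F (f 1)) = Comp D g i"
   by (rule ext[OF conjunct1[OF a] b])
 next
  fix D :: "('u, 'u) cat" and F G a b
  assume "lex_functor K D F \<and> lex_functor K D G \<and> a \<in> hom D (ob F (Dom K (f 1))) (ob G (Dom K (f 1))) \<and>
   b \<in> hom D (ob F (Cod K (f 1))) (ob G (Cod K (f 1))) \<and> Comp D b (ar F (f 1)) = Comp D (ar G (f 1)) a"
  hence H: "lex_functor K D F" "lex_functor K D G" "a \<in> hom D (ob F (r 1)) (ob G (r 1))"
   "b \<in> hom D (ob F (r 0)) (ob G (r 0))" "Comp D b (ar F (f 1)) = Comp D (ar G (f 1)) a" unfolding df by auto
  have "\<exists>!\<alpha>. nat_trans K D F G \<alpha> \<and> (\<forall>s\<in>K.sorts. \<alpha> (r s) = (\<lambda>s. if s = 0 then b else a) s)"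
   by (rule K.nat_trans_extension[OF gen H(1,2)]) (use H S in auto)
  thus "\<exists>!\<alpha>. nat_trans K D F G \<alpha> \<and> \<alpha> (Dom K (f 1)) = a \<and> \<alpha> (Cod K (f 1)) = b"
   unfolding df S by (simp add: conj_commute)
 qed (rule df(3))
 show ?thesis using ext[OF C c] by (elim exE conjE) (rule that[OF sK free]; assumption)
qed

lemma free_cospan_exists:
 fixes C :: "('o, 'b) cat"
 assumes U: "universe TYPE('u)" and C: "finitely_complete C" and c: "mono_cospan C c d"
 obtains K :: "('u, 'u) cat" and m n F i j k where "small_category K" "free_lex_on_mono_cospan K m n" "lex_functor K C F"
  "i \<in> hom C (ob F (Dom K m)) (Dom C c)" "is_iso C i" "j \<in> hom C (ob F (Dom K n)) (Dom C d)" "is_iso C j"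
  "k \<in> hom C (ob F (Cod K m)) (Cod C c)" "is_iso C k"
  "Comp C k (ar F m) = Comp C c i" "Comp C k (ar F n) = Comp C d j"
proof -
 obtain K :: "('u, 'u) cat" and md hm where sK: "small_category K" and "fm K {1, 2} True md hm"
  by (rule fm_exists[OF U, of "{1, 2}" True]) auto
 then interpret K: fm K "{1, 2}" True md hm by simp
 obtain r f where gen: "K.is_gen r f" by (rule K.gen_exists)
 have S: "K.sorts = {0, 1, 2}" unfolding K.sorts_def by (rule refl)
 have fh: "f 1 \<in> hom K (r 1) (r 0)" "f 2 \<in> hom K (r 2) (r 0)" using K.f(1)[OF gen] by auto
 have df: "Dom K (f 1) = r 1" "Cod K (f 1) = r 0" "Dom K (f 2) = r 2" "Cod K (f 2) = r 0" using fh by (auto simp: hom_def)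
 have mc: "mono_cospan K (f 1) (f 2)" using K.gen_mono[OF gen] df by (simp add: mono_cospan_def)
 have ext: "\<exists>F i j k. lex_functor K B F \<and> i \<in> hom B (ob F (Dom K (f 1))) (Dom B m') \<and> is_iso B i \<and>
    j \<in> hom B (ob F (Dom K (f 2))) (Dom B n') \<and> is_iso B j \<and>
    k \<in> hom B (ob F (Cod K (f 1))) (Cod B m') \<and> is_iso B k \<and>
    Comp B k (ar F (f 1)) = Comp B m' i \<and> Comp B k (ar F (f 2)) = Comp B n' j"
  if B: "finitely_complete B" and mn: "mono_cospan B m' n'" for B :: "('p, 'q) cat" and m' n'
 proof -
  interpret B: cat B using B by unfold_locales (simp add: finitely_complete_def)
  have mm: "is_mono B m'" "is_mono B n'" "Cod B n' = Cod B m'" using mn by (auto simp: mono_cospan_def)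
  let ?X = "\<lambda>s :: nat. if s = 0 then Cod B m' else if s = 1 then Dom B m' else Dom B n'" and ?g = "\<lambda>s :: nat. if s = 1 then m' else n'"
  obtain F i where F: "lex_functor K B F" "\<And>s. s \<in> K.sorts ==> i s \<in> hom B (ob F (r s)) (?X s) \<and> is_iso B (i s)"
   "\<And>s. s \<in> {1, 2} ==> Comp B (i 0) (ar F (f s)) = Comp B (?g s) (i s)"
   by (rule K.lex_extension[OF gen B, of ?X ?g])
    (use B.mono_hom[OF mm(1)] B.mono_hom[OF mm(2)] mm B.hom_ob in "auto split: if_splits")
  show ?thesis unfolding df using F(1) F(2)[of 0] F(2)[of 1] F(2)[of 2] F(3)[of 1] F(3)[of 2] S by auto
 qed
 have free: "free_lex_on_mono_cospan K (f 1) (f 2)"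
  unfolding free_lex_on_mono_cospan_def
 proof (intro conjI allI impI ballI)
  show "finitely_complete K" by (rule K.finitely_complete)
  fix D :: "('u, 'u) cat" and m' n' assume a: "finitely_complete D \<and> locally_small D" and b: "mono_cospan D m' n'"
  show "\<exists>F i j k. lex_functor K D F \<and> i \<in> hom D (ob F (Dom K (f 1))) (Dom D m') \<and> is_iso D i \<and>
    j \<in> hom D (ob F (Dom K (f 2))) (Dom D n') \<and> is_iso D j \<and>
    k \<in> hom D (ob F (Cod K (f 1))) (Cod D m') \<and> is_iso D k \<and>
    Comp D k (ar F (f 1)) = Comp D m' i \<and> Comp D k (ar F (f 2)) = Comp D n' j"
   by (rule ext[OF conjunct1[OF a] b])
 next
  fix D :: "('u, 'u) cat" and F G a b c
  assume "lex_functor K D F \<and> lex_functor K D G \<and> a \<in> hom D (ob F (Dom K (f 1))) (ob G (Dom K (f 1))) \<and>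
   b \<in> hom D (ob F (Dom K (f 2))) (ob G (Dom K (f 2))) \<and> c \<in> hom D (ob F (Cod K (f 1))) (ob G (Cod K (f 1))) \<and>
   Comp D c (ar F (f 1)) = Comp D (ar G (f 1)) a \<and> Comp D c (ar F (f 2)) = Comp D (ar G (f 2)) b"
  hence H: "lex_functor K D F" "lex_functor K D G" "a \<in> hom D (ob F (r 1)) (ob G (r 1))"
   "b \<in> hom D (ob F (r 2)) (ob G (r 2))" "c \<in> hom D (ob F (r 0)) (ob G (r 0))"
   "Comp D c (ar F (f 1)) = Comp D (ar G (f 1)) a" "Comp D c (ar F (f 2)) = Comp D (ar G (f 2)) b"
   unfolding df by auto
  have "\<exists>!\<alpha>. nat_trans K D F G \<alpha> \<and> (\<forall>s\<in>K.sorts. \<alpha> (r s) = (\<lambda>s. if s = 0 then c else if s = 1 then a else b) s)"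
   by (rule K.nat_trans_extension[OF gen H(1,2)]) (use H S in auto)
  moreover have "(\<forall>s\<in>K.sorts. \<alpha> (r s) = (\<lambda>s. if s = 0 then c else if s = 1 then a else b) s) \<longleftrightarrow>
    \<alpha> (Dom K (f 1)) = a \<and> \<alpha> (Dom K (f 2)) = b \<and> \<alpha> (Cod K (f 1)) = c" for \<alpha>
   unfolding df S by auto
  ultimately show "\<exists>!\<alpha>. nat_trans K D F G \<alpha> \<and> \<alpha> (Dom K (f 1)) = a \<and> \<alpha> (Dom K (f 2)) = b \<and> \<alpha> (Cod K (f 1)) = c" by simp
 qed (rule mc)
 show ?thesis using ext[OF C c] by (elim exE conjE) (rule that[OF sK free]; assumption)
qed

section \<open>Effective-epimorphic families\<close>

locale lexp = lpcat C + lex_cat C for C :: "('o, 'u) cat"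
begin

text \<open>\<open>eff c T\<close>: the family \<open>T\<close> of arrows into \<open>c\<close> exhibits \<open>c\<close> as the colimit of the sieve it generates.\<close>

definition compat :: "'u set => ('u => 'u) => 'o => bool" where
 "compat T r Z \<longleftrightarrow> Z \<in> Ob C \<and> (\<forall>t\<in>T. r t \<in> hom C (Dom C t) Z) \<and>
  (\<forall>t\<in>T. \<forall>t'\<in>T. \<forall>z. \<forall>u\<in>hom C z (Dom C t). \<forall>u'\<in>hom C z (Dom C t'). t ** u = t' ** u' --> r t ** u = r t' ** u')"

definition eff :: "'o => 'u set => bool" where
 "eff c T \<longleftrightarrow> gens c T \<and> (\<forall>r Z. compat T r Z --> (\<exists>!h. h \<in> hom C c Z \<and> (\<forall>t\<in>T. h ** t = r t)))"

lemma compatD: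
 assumes "compat T r Z"
 shows "Z \<in> Ob C" "t \<in> T ==> r t \<in> hom C (Dom C t) Z"
  "t \<in> T ==> t' \<in> T ==> u \<in> hom C z (Dom C t) ==> u' \<in> hom C z (Dom C t') ==> t ** u = t' ** u' ==> r t ** u = r t' ** u'"
 using assms unfolding compat_def by blast+

lemma compatI:
 assumes "Z \<in> Ob C" "\<And>t. t \<in> T ==> r t \<in> hom C (Dom C t) Z"
  "\<And>t t' z u u'. t \<in> T ==> t' \<in> T ==> u \<in> hom C z (Dom C t) ==> u' \<in> hom C z (Dom C t') ==> t ** u = t' ** u' ==> r t ** u = r t' ** u'"
 shows "compat T r Z"
 using assms unfolding compat_def by blast

lemma eff_gens: "eff c T ==> gens c T"
 by (simp add: eff_def)

lemma eff_ex: assumes "eff c T" "compat T r Z" obtains h where "h \<in> hom C c Z" "\<And>t. t \<in> T ==> h ** t = r t"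
 using assms unfolding eff_def by blast

lemma eff_ext:
 assumes E: "eff c T" and h: "h \<in> hom C c Z" "h' \<in> hom C c Z" and eq: "\<And>t. t \<in> T ==> h ** t = h' ** t"
 shows "h = h'"
proof -
 note G = gensD[OF eff_gens[OF E]]
 have "compat T (\<lambda>t. h ** t) Z"
 proof (rule compatI)
  show "Z \<in> Ob C" using hom_ob[OF h(1)] by simp
  show "h ** t \<in> hom C (Dom C t) Z" if "t \<in> T" for t by (rule comp_hom[OF h(1) G(2)[OF that]])
  show "(h ** t) ** u = (h ** t') ** u'" if "t \<in> T" "t' \<in> T" "u \<in> hom C z (Dom C t)" "u' \<in> hom C z (Dom C t')" "t ** u = t' ** u'" for t t' z u u'
   using assoc[OF h(1) G(2)[OF that(1)] that(3)] assoc[OF h(1) G(2)[OF that(2)] that(4)] that(5) by simp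
 qed
 hence "\<exists>!k. k \<in> hom C c Z \<and> (\<forall>t\<in>T. k ** t = h ** t)" using E unfolding eff_def by blast
 thus ?thesis using h eq by metis
qed

lemma effI:
 assumes "gens c T" "\<And>r Z. compat T r Z ==> \<exists>h\<in>hom C c Z. \<forall>t\<in>T. h ** t = r t"
  "\<And>h h' Z. h \<in> hom C c Z ==> h' \<in> hom C c Z ==> (\<And>t. t \<in> T ==> h ** t = h' ** t) ==> h = h'"
 shows "eff c T"
 unfolding eff_def
proof (intro conjI allI impI)
 fix r Z assume "compat T r Z"
 then obtain h where h: "h \<in> hom C c Z" "\<forall>t\<in>T. h ** t = r t" using assms(2) by blast
 show "\<exists>!h. h \<in> hom C c Z \<and> (\<forall>t\<in>T. h ** t = r t)"
 proof (rule ex1I[of _ h])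
  show "k = h" if "k \<in> hom C c Z \<and> (\<forall>t\<in>T. k ** t = r t)" for k
   by (rule assms(3)[OF conjunct1[OF that] h(1)]) (use that h(2) in simp)
 qed (use h in blast)
qed (rule assms(1))

lemma eff_sub_le:
 assumes E: "eff M P" and m: "m \<in> hom C M d" and n: "is_mono C n" "n \<in> hom C N d"
  and k: "\<And>p. p \<in> P ==> \<exists>k\<in>hom C (Dom C p) N. n ** k = m ** p"
 shows "\<exists>h\<in>hom C M N. n ** h = m"
proof -
 note G = gensD[OF eff_gens[OF E]]
 obtain r where r: "\<And>p. p \<in> P ==> r p \<in> hom C (Dom C p) N" "\<And>p. p \<in> P ==> n ** r p = m ** p" using k by metis
 have "compat P r N"
 proof (rule compatI)
  show "N \<in> Ob C" using hom_ob[OF n(2)] by simp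
  fix t t' z u u' assume t: "t \<in> P" "t' \<in> P" and u: "u \<in> hom C z (Dom C t)" "u' \<in> hom C z (Dom C t')" and e: "t ** u = t' ** u'"
  have "n ** (r t ** u) = m ** (t ** u)" by (rule square[OF r(2)[OF t(1)] n(2) r(1)[OF t(1)] m G(2)[OF t(1)] u(1)])
  moreover have "n ** (r t' ** u') = m ** (t' ** u')" by (rule square[OF r(2)[OF t(2)] n(2) r(1)[OF t(2)] m G(2)[OF t(2)] u(2)])
  ultimately show "r t ** u = r t' ** u'"
   using monoD[OF n comp_hom[OF r(1)[OF t(1)] u(1)] comp_hom[OF r(1)[OF t(2)] u(2)]] e by simp
 qed (rule r(1))
 then obtain h where h: "h \<in> hom C M N" "\<And>t. t \<in> P ==> h ** t = r t" using eff_ex[OF E] by blast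
 have "n ** h = m"
  by (rule eff_ext[OF E comp_hom[OF n(2) h(1)] m]) (use assoc[OF n(2) h(1) G(2)] h(2) r(2) in simp)
 thus ?thesis using h(1) by blast
qed

lemma eff_iso:
 assumes E: "eff c T" and k: "k \<in> hom C c c'" "is_iso C k"
 shows "eff c' ((\<lambda>t. k ** t) ` T)"
proof -
 note G = gensD[OF eff_gens[OF E]]
 obtain k' where k': "k' \<in> hom C c' c" "k' ** k = Id C c" "k ** k' = Id C c'" using isoD[OF k(2,1)] by blast
 have kt: "k ** t \<in> hom C (Dom C t) c'" "Dom C (k ** t) = Dom C t" if "t \<in> T" for t
  using comp_hom[OF k(1) G(2)[OF that]] by (auto simp: hom_def)
 show ?thesis
 proof (rule effI)
  show "gens c' ((\<lambda>t. k ** t) ` T)" using kt hom_ob[OF k(1)] by (simp add: gens_def)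
  fix r Z assume c: "compat ((\<lambda>t. k ** t) ` T) r Z"
  have r: "r (k ** t) \<in> hom C (Dom C t) Z" if "t \<in> T" for t using compatD(2)[OF c, of "k ** t"] kt(2)[OF that] that by simp
  have "compat T (\<lambda>t. r (k ** t)) Z"
  proof (rule compatI[OF compatD(1)[OF c] r])
   fix t t' z u u' assume t: "t \<in> T" "t' \<in> T" and u: "u \<in> hom C z (Dom C t)" "u' \<in> hom C z (Dom C t')" and e: "t ** u = t' ** u'"
   have "(k ** t) ** u = (k ** t') ** u'" using assoc[OF k(1) G(2)[OF t(1)] u(1)] assoc[OF k(1) G(2)[OF t(2)] u(2)] e by simp
   thus "r (k ** t) ** u = r (k ** t') ** u'"
    using compatD(3)[OF c imageI[OF t(1)] imageI[OF t(2)], of u z u'] u kt(2)[OF t(1)] kt(2)[OF t(2)] by simp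
  qed
  then obtain h where h: "h \<in> hom C c Z" "\<And>t. t \<in> T ==> h ** t = r (k ** t)" using eff_ex[OF E] by blast
  have "(h ** k') ** (k ** t) = r (k ** t)" if t: "t \<in> T" for t
  proof -
   have "k' ** (k ** t) = t" using assoc[OF k'(1) k(1) G(2)[OF t]] k'(2) id_left[OF G(2)[OF t]] by simp
   thus ?thesis using assoc[OF h(1) k'(1) kt(1)[OF t]] h(2)[OF t] by simp
  qed
  thus "\<exists>h\<in>hom C c' Z. \<forall>t\<in>(\<lambda>t. k ** t) ` T. h ** t = r t" using comp_hom[OF h(1) k'(1)] by blast
 next
  fix h h' Z assume h: "h \<in> hom C c' Z" "h' \<in> hom C c' Z" and eq: "\<And>t. t \<in> (\<lambda>t. k ** t) ` T ==> h ** t = h' ** t"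
  have "h ** k = h' ** k"
   by (rule eff_ext[OF E comp_hom[OF h(1) k(1)] comp_hom[OF h(2) k(1)]])
    (use assoc[OF h(1) k(1) G(2)] assoc[OF h(2) k(1) G(2)] eq in simp)
  hence "h ** (k ** k') = h' ** (k ** k')" by (rule square[OF _ h(1) k(1) h(2) k(1) k'(1)])
  thus "h = h'" unfolding k'(3) id_right[OF h(1)] id_right[OF h(2)] .
 qed
qed

lemma eff_regular_epi:
 assumes E: "eff y {e}" and e: "e \<in> hom C x y"
 shows "is_regular_epi C e"
  and "p \<in> hom C l x ==> q \<in> hom C l x ==> e ** p = e ** q ==>
   (\<And>z u u'. u \<in> hom C z x ==> u' \<in> hom C z x ==> e ** u = e ** u' ==> \<exists>h\<in>hom C z l. p ** h = u \<and> q ** h = u') ==>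
   is_coequaliser C p q e"
proof -
 have de: "Dom C e = x" "Cod C e = y" using e by (auto simp: hom_def)
 show coeq: "is_coequaliser C p q e"
  if p: "p \<in> hom C l x" and q: "q \<in> hom C l x" and pq: "e ** p = e ** q"
   and kp: "\<And>z u u'. u \<in> hom C z x ==> u' \<in> hom C z x ==> e ** u = e ** u' ==> \<exists>h\<in>hom C z l. p ** h = u \<and> q ** h = u'" for p q l
 proof -
  have "\<exists>!h. h \<in> hom C y w \<and> h ** e = r" if r: "r \<in> hom C x w" "r ** p = r ** q" for r w
  proof -
   have "compat {e} (\<lambda>_. r) w"
   proof (rule compatI)
    show "w \<in> Ob C" using hom_ob[OF r(1)] by simp
    show "r \<in> hom C (Dom C t) w" if "t \<in> {e}" for t using r that de by simp
    fix t t' z u u' assume "t \<in> {e}" "t' \<in> {e}" "u \<in> hom C z (Dom C t)" "u' \<in> hom C z (Dom C t')" "t ** u = t' ** u'"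
    hence u: "u \<in> hom C z x" "u' \<in> hom C z x" "e ** u = e ** u'" using de by auto
    obtain h where h: "h \<in> hom C z l" "p ** h = u" "q ** h = u'" using kp[OF u] by blast
    show "r ** u = r ** u'" using square[OF r(2) r(1) p r(1) q h(1)] h(2,3) by simp
   qed
   hence "\<exists>!h. h \<in> hom C y w \<and> (\<forall>t\<in>{e}. h ** t = r)" using E unfolding eff_def by blast
   thus ?thesis by simp
  qed
  moreover have "p \<in> Arr C" "Dom C p = l" "Cod C p = x" using p by (auto simp: hom_def)
  ultimately show ?thesis unfolding is_coequaliser_def de using p q e pq by simp
 qed
 obtain l p q where pq: "p \<in> hom C l x" "q \<in> hom C l x" "is_pullback C e e p q" by (rule pullback_exists[OF e e])
 have dp: "Dom C p = l" using pq(1) by (simp add: hom_def)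
 have "is_coequaliser C p q e"
 proof (rule coeq[OF pq(1,2) pullbackD(4)[OF pq(3) e]])
  fix z u u' assume u: "u \<in> hom C z x" "u' \<in> hom C z x" "e ** u = e ** u'"
  obtain h where "h \<in> hom C z (Dom C p)" "p ** h = u" "q ** h = u'" by (rule pullback_univ[OF pq(3) e e u])
  thus "\<exists>h\<in>hom C z l. p ** h = u \<and> q ** h = u'" unfolding dp by blast
 qed
 thus "is_regular_epi C e" unfolding is_regular_epi_def by blast
qed

lemma regular_epi_eff:
 assumes e: "is_regular_epi C e"
 shows "eff (Cod C e) {e}" "e \<in> hom C (Dom C e) (Cod C e)"
proof -
 obtain p q where ce: "is_coequaliser C p q e" using e by (auto simp: is_regular_epi_def)
 note c = coequaliserD[OF ce]
 have de: "Dom C e = Cod C p" using c(1) by (simp add: hom_def)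
 show eh: "e \<in> hom C (Dom C e) (Cod C e)" using c(1) unfolding de .
 show "eff (Cod C e) {e}"
 proof (rule effI)
  show "gens (Cod C e) {e}" using eh hom_ob[OF eh] by (simp add: gens_def)
  fix r Z assume cr: "compat {e} r Z"
  have r: "r e \<in> hom C (Cod C p) Z" using compatD(2)[OF cr] de by simp
  have "r e ** p = r e ** q" using compatD(3)[OF cr, of e e p "Dom C p" q] c de by simp
  thus "\<exists>h\<in>hom C (Cod C e) Z. \<forall>t\<in>{e}. h ** t = r t" using c(5)[OF r] by auto
 next
  fix h h' Z assume h: "h \<in> hom C (Cod C e) Z" "h' \<in> hom C (Cod C e) Z" and "\<And>t. t \<in> {e} ==> h ** t = h' ** t"
  hence eq: "h ** e = h' ** e" by simp
  have "(h ** e) ** p = (h ** e) ** q" using assoc[OF h(1) c(1) c(3)] assoc[OF h(1) c(1) c(4)] c(2) by simp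
  from c(5)[OF comp_hom[OF h(1) c(1)] this] show "h = h'" using h eq by metis
 qed
qed

lemma sub_leI: "h \<in> hom C x y ==> Dom C m = x ==> Dom C n = y ==> n ** h = m ==> sub_le C m n"
 by (auto simp: sub_le_def)

lemma subobject_hom: "is_subobject C x m ==> m \<in> hom C (Dom C m) x" "is_subobject C x m ==> is_mono C m"
 using mono_hom by (auto simp: is_subobject_def)

lemma subobjectI: "is_mono C m ==> m \<in> hom C y x ==> is_subobject C x m"
 by (simp add: is_subobject_def hom_def)

lemma sub_le_trans:
 assumes "sub_le C a b" "sub_le C b c" "is_subobject C x c"
 shows "sub_le C a c"
proof -
 obtain h where h: "h \<in> hom C (Dom C a) (Dom C b)" "b ** h = a" using assms(1) by (auto simp: sub_le_def)
 obtain k where k: "k \<in> hom C (Dom C b) (Dom C c)" "c ** k = b" using assms(2) by (auto simp: sub_le_def)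
 have "c ** (k ** h) = a" using assoc[OF subobject_hom(1)[OF assms(3)] k(1) h(1)] h(2) k(2) by simp
 thus ?thesis using comp_hom[OF k(1) h(1)] by (auto simp: sub_le_def)
qed

lemma is_unionI:
 assumes "\<And>s. s \<in> S ==> is_subobject C x s" "is_subobject C x m" "\<And>s. s \<in> S ==> sub_le C s m"
  "\<And>n. is_subobject C x n ==> (\<And>s. s \<in> S ==> sub_le C s n) ==> sub_le C m n"
 shows "is_union C x S m"
 using assms unfolding is_union_def by blast

lemma union_insert:
 assumes m0: "is_union C x S m0" and m: "is_union C x {m0, s} m"
 shows "is_union C x (insert s S) m"
proof (rule is_unionI)
 have mm: "is_subobject C x m" by (rule is_unionD(2)[OF m])
 show "is_subobject C x t" if "t \<in> insert s S" for t using that is_unionD(1)[OF m0] is_unionD(1)[OF m] by blast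
 show "is_subobject C x m" by (rule mm)
 show "sub_le C t m" if "t \<in> insert s S" for t
 proof (cases "t = s")
  case True thus ?thesis using is_unionD(3)[OF m] by blast
 next
  case False
  hence "t \<in> S" using that by blast
  thus ?thesis using sub_le_trans[OF is_unionD(3)[OF m0] is_unionD(3)[OF m] mm] by blast
 qed
 fix n assume n: "is_subobject C x n" and le: "\<And>t. t \<in> insert s S ==> sub_le C t n"
 have "sub_le C m0 n" using is_unionD(4)[OF m0 n] le by blast
 thus "sub_le C m n" using is_unionD(4)[OF m n] le by blast
qed

lemma union_split:
 assumes m: "is_union C x (insert s S) m" and m0: "is_union C x S m0"
 shows "is_union C x {m0, s} m"
proof (rule is_unionI)
 show "is_subobject C x t" if "t \<in> {m0, s}" for t using that is_unionD(2)[OF m0] is_unionD(1)[OF m] by blast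
 show "is_subobject C x m" by (rule is_unionD(2)[OF m])
 have "sub_le C m0 m" by (rule is_unionD(4)[OF m0 is_unionD(2)[OF m]]) (use is_unionD(3)[OF m] in blast)
 thus "sub_le C t m" if "t \<in> {m0, s}" for t using that is_unionD(3)[OF m] by blast
 fix n assume n: "is_subobject C x n" and le: "\<And>t. t \<in> {m0, s} ==> sub_le C t n"
 show "sub_le C m n"
 proof (rule is_unionD(4)[OF m n])
  fix t assume "t \<in> insert s S"
  then consider "t = s" | "t \<in> S" by blast
  thus "sub_le C t n"
  proof cases
   case 1 thus ?thesis using le by blast
  next
   case 2 thus ?thesis using sub_le_trans[OF is_unionD(3)[OF m0 2] _ n] le by blast
  qed
 qed
qed

definition good :: "'u set => bool" where
 "good T \<longleftrightarrow> T = {} \<or> (\<exists>f. T = {f}) \<or> (\<exists>a b. T = {a, b} \<and> is_mono C a \<and> is_mono C b)"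

lemma good_finite: "good T ==> finite T"
 by (auto simp: good_def)

lemma good_image:
 assumes "good T" "\<And>t. t \<in> T ==> is_mono C t ==> is_mono C (p t)"
 shows "good (p ` T)"
 using assms(1) unfolding good_def
proof (elim disjE exE conjE)
 fix a b assume "T = {a, b}" "is_mono C a" "is_mono C b"
 thus "p ` T = {} \<or> (\<exists>f. p ` T = {f}) \<or> (\<exists>a b. p ` T = {a, b} \<and> is_mono C a \<and> is_mono C b)"
  using assms(2) by (intro disjI2 exI[of _ "p a"] exI[of _ "p b"]) auto
qed auto

definition factorises :: bool where
 "factorises \<longleftrightarrow> (\<forall>x T. gens x T \<and> good T --> (\<exists>M m e. is_mono C m \<and> m \<in> hom C M x \<and>
  (\<forall>t\<in>T. e t \<in> hom C (Dom C t) M \<and> m ** e t = t) \<and> eff M (e ` T)))"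

definition stable :: bool where
 "stable \<longleftrightarrow> (\<forall>x T d f p q. good T \<and> eff x T \<and> f \<in> hom C d x \<and> (\<forall>t\<in>T. is_pullback C f t (p t) (q t)) --> eff d (p ` T))"

lemma union_exists_good:
 assumes F: factorises and G: "gens x T" and T: "good T" and mono: "\<And>t. t \<in> T ==> is_mono C t"
 shows "\<exists>m. is_union C x T m"
proof -
 obtain M m e where m: "is_mono C m" "m \<in> hom C M x" "\<And>t. t \<in> T ==> e t \<in> hom C (Dom C t) M"
  "\<And>t. t \<in> T ==> m ** e t = t" "eff M (e ` T)" using F G T unfolding factorises_def by metis
 have dm: "Dom C m = M" using m(2) by (simp add: hom_def)
 have "is_union C x T m"
 proof (rule is_unionI)
  show "is_subobject C x t" if "t \<in> T" for t by (rule subobjectI[OF mono[OF that] gensD(2)[OF G that]])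
  show "is_subobject C x m" by (rule subobjectI[OF m(1,2)])
  show "sub_le C t m" if "t \<in> T" for t by (rule sub_leI[OF m(3)[OF that] refl dm m(4)[OF that]])
  fix n assume n: "is_subobject C x n" and le: "\<And>t. t \<in> T ==> sub_le C t n"
  have "\<exists>h\<in>hom C M (Dom C n). n ** h = m"
  proof (rule eff_sub_le[OF m(5,2) subobject_hom(2)[OF n] subobject_hom(1)[OF n]])
   fix p assume "p \<in> e ` T"
   then obtain t where t: "t \<in> T" "p = e t" by blast
   have "Dom C p = Dom C t" using m(3)[OF t(1)] t(2) by (simp add: hom_def)
   thus "\<exists>k\<in>hom C (Dom C p) (Dom C n). n ** k = m ** p" using le[OF t(1)] m(4)[OF t(1)] t(2) by (simp add: sub_le_def)
  qed
  thus "sub_le C m n" unfolding sub_le_def dm .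
 qed
 thus ?thesis by blast
qed

lemma union_exists:
 assumes F: factorises and x: "x \<in> Ob C" and S: "finite S" "\<And>s. s \<in> S ==> is_subobject C x s"
 shows "\<exists>m. is_union C x S m"
 using S
proof (induction S)
 case empty
 show ?case by (rule union_exists_good[OF F]) (auto simp: gens_def good_def x)
next
 case (insert s S)
 then obtain m0 where m0: "is_union C x S m0" by blast
 note s0 = is_unionD(2)[OF m0] and ss = insert.prems[of s, simplified]
 have "\<exists>m. is_union C x {m0, s} m"
 proof (rule union_exists_good[OF F])
  show "gens x {m0, s}" using x subobject_hom(1)[OF s0] subobject_hom(1)[OF ss] by (simp add: gens_def)
  show "good {m0, s}" using subobject_hom(2)[OF s0] subobject_hom(2)[OF ss] by (auto simp: good_def)
  show "is_mono C t" if "t \<in> {m0, s}" for t using that subobject_hom(2)[OF s0] subobject_hom(2)[OF ss] by auto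
 qed
 thus ?case using union_insert[OF m0] by blast
qed

lemma union_eff:
 assumes F: factorises and T: "good T" and un: "is_union C x T m"
 obtains e where "\<And>t. t \<in> T ==> e t \<in> hom C (Dom C t) (Dom C m)" "\<And>t. t \<in> T ==> m ** e t = t" "eff (Dom C m) (e ` T)"
proof -
 let ?M = "Dom C m"
 note sm = is_unionD(2)[OF un]
 note m = subobject_hom[OF sm]
 have "\<exists>h\<in>hom C (Dom C t) ?M. m ** h = t" if "t \<in> T" for t using is_unionD(3)[OF un that] by (simp add: sub_le_def)
 then obtain e where e: "\<And>t. t \<in> T ==> e t \<in> hom C (Dom C t) ?M" "\<And>t. t \<in> T ==> m ** e t = t" by metis
 have de: "Dom C (e t) = Dom C t" if "t \<in> T" for t using e(1)[OF that] by (simp add: hom_def)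
 have G: "gens ?M (e ` T)" using e(1) de hom_ob[OF m(1)] by (simp add: gens_def)
 have "good (e ` T)"
  by (rule good_image[OF T]) (rule mono_comp_cancel[OF m(2) m(1) e(1)], auto simp: e(2))
 then obtain N n e' where n: "is_mono C n" "n \<in> hom C N ?M" "\<And>s. s \<in> e ` T ==> e' s \<in> hom C (Dom C s) N"
  "\<And>s. s \<in> e ` T ==> n ** e' s = s" "eff N (e' ` e ` T)" using F G unfolding factorises_def by metis
 have mn: "m ** n \<in> hom C N x" by (rule comp_hom[OF m(1) n(2)])
 have "sub_le C m (m ** n)"
 proof (rule is_unionD(4)[OF un subobjectI[OF comp_mono[OF m(2,1) n(1,2)] mn]])
  fix t assume t: "t \<in> T"
  have he: "e' (e t) \<in> hom C (Dom C t) N" using n(3)[of "e t"] de[OF t] t by simp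
  have "(m ** n) ** e' (e t) = t" using assoc[OF m(1) n(2) he] n(4)[of "e t"] e(2)[OF t] t by simp
  thus "sub_le C t (m ** n)" using he mn by (intro sub_leI[OF he]) (auto simp: hom_def)
 qed
 moreover have "Dom C (m ** n) = N" using mn by (simp add: hom_def)
 ultimately obtain h where h: "h \<in> hom C ?M N" "(m ** n) ** h = m" by (auto simp: sub_le_def)
 have "m ** (n ** h) = m ** Id C ?M" using assoc[OF m(1) n(2) h(1)] h(2) id_right[OF m(1)] by simp
 hence "n ** h = Id C ?M" using monoD[OF m(2,1) comp_hom[OF n(2) h(1)] id_hom] hom_ob[OF m(1)] by simp
 hence "is_iso C n" by (rule mono_split_iso[OF n(1,2) h(1)])
 hence "eff ?M ((\<lambda>t. n ** t) ` e' ` e ` T)" using eff_iso[OF n(5,2)] by blast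
 moreover have "(\<lambda>t. n ** t) ` e' ` e ` T = e ` T" using n(4) by (auto simp: image_image)
 ultimately have "eff ?M (e ` T)" by simp
 from that[OF e this] show ?thesis .
qed

lemma union_pullback_good:
 assumes F: factorises and st: stable and T: "good (s ` I)" and un: "is_union C x (s ` I) m"
  and f: "f \<in> hom C d x" and s': "\<And>i. i \<in> I ==> \<exists>t. is_pullback C f (s i) (s' i) t" and m': "is_pullback C f m m' g"
 shows "is_union C d (s' ` I) m'"
proof -
 note sm = is_unionD(2)[OF un]
 note m = subobject_hom[OF sm]
 obtain e where e: "\<And>t. t \<in> s ` I ==> e t \<in> hom C (Dom C t) (Dom C m)" "\<And>t. t \<in> s ` I ==> m ** e t = t" "eff (Dom C m) (e ` s ` I)"
  by (rule union_eff[OF F T un]) blast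
 note m'D = pullbackD[OF m' f]
 have m'm: "is_mono C m'" by (rule pullback_mono[OF m' f m(2)])
 have "\<exists>p q. is_pullback C g (e t) p q" if t: "t \<in> s ` I" for t
 proof -
  obtain l p q where "p \<in> hom C l (Dom C m')" "is_pullback C g (e t) p q" by (rule pullback_exists[OF m'D(2) e(1)[OF t]])
  thus ?thesis by blast
 qed
 then obtain P Q where PQ: "\<And>t. t \<in> s ` I ==> is_pullback C g (e t) (P t) (Q t)" by metis
 have ge: "good (e ` s ` I)"
  by (rule good_image[OF T]) (rule mono_comp_cancel[OF m(2) m(1) e(1)], auto simp: e(2))
 define p q where "p = (\<lambda>a. P (m ** a))" and "q = (\<lambda>a. Q (m ** a))"
 have pq: "is_pullback C g a (p a) (q a)" if a: "a \<in> e ` s ` I" for a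
 proof -
  obtain t where "t \<in> s ` I" "a = e t" using a by blast
  with PQ[OF this(1)] e(2)[OF this(1)] show ?thesis unfolding p_def q_def by simp
 qed
 have E: "eff (Dom C m') (p ` e ` s ` I)"
  by (rule st[unfolded stable_def, rule_format, of "e ` s ` I" "Dom C m" g "Dom C m'" p q])
   (intro conjI ballI ge e(3) m'D(2) pq, assumption)
 have s'D: "is_subobject C d (s' i)" "\<exists>t. s' i \<in> hom C (Dom C (s' i)) d \<and> t \<in> hom C (Dom C (s' i)) (Dom C (s i)) \<and> f ** s' i = s i ** t \<and> is_pullback C f (s i) (s' i) t"
  if i: "i \<in> I" for i
 proof -
  obtain t where t: "is_pullback C f (s i) (s' i) t" using s'[OF i] by blast
  note D = pullbackD[OF t f]
  have "is_mono C (s i)" using subobject_hom(2)[OF is_unionD(1)[OF un]] i by blast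
  thus "is_subobject C d (s' i)" using subobjectI[OF pullback_mono[OF t f] D(1)] by blast
  show "\<exists>t. s' i \<in> hom C (Dom C (s' i)) d \<and> t \<in> hom C (Dom C (s' i)) (Dom C (s i)) \<and> f ** s' i = s i ** t \<and> is_pullback C f (s i) (s' i) t"
   using D t by blast
 qed
 show ?thesis
 proof (rule is_unionI)
  show "is_subobject C d a" if "a \<in> s' ` I" for a using that s'D(1) by blast
  show "is_subobject C d m'" by (rule subobjectI[OF m'm m'D(1)])
  fix a assume "a \<in> s' ` I"
  then obtain i where i: "i \<in> I" "a = s' i" by blast
  obtain t where t: "s' i \<in> hom C (Dom C (s' i)) d" "t \<in> hom C (Dom C (s' i)) (Dom C (s i))" "f ** s' i = s i ** t" using s'D(2)[OF i(1)] by blast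
  have si: "s i \<in> s ` I" using i(1) by blast
  have "f ** s' i = m ** (e (s i) ** t)" using t(3) assoc[OF m(1) e(1)[OF si] t(2)] e(2)[OF si] by simp
  then obtain h where h: "h \<in> hom C (Dom C (s' i)) (Dom C m')" "m' ** h = s' i"
   using pullback_univ[OF m' f m(1) t(1) comp_hom[OF e(1)[OF si] t(2)]] by blast
  show "sub_le C a m'" unfolding i(2) by (rule sub_leI[OF h(1) refl refl h(2)])
 next
  fix n assume n: "is_subobject C d n" and le: "\<And>a. a \<in> s' ` I ==> sub_le C a n"
  note nh = subobject_hom[OF n]
  have "\<exists>h\<in>hom C (Dom C m') (Dom C n). n ** h = m'"
  proof (rule eff_sub_le[OF E m'D(1) nh(2,1)])
   fix b assume "b \<in> p ` e ` s ` I"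
   then obtain i where i: "i \<in> I" "b = p (e (s i))" by blast
   have si: "s i \<in> s ` I" using i(1) by blast
   note pb = pq[OF imageI[OF si], folded i(2)]
   note bD = pullbackD[OF pb m'D(2)]
   have deq: "Dom C (e (s i)) = Dom C (s i)" using e(1)[OF si] by (simp add: hom_def)
   obtain t where t: "s' i \<in> hom C (Dom C (s' i)) d" "is_pullback C f (s i) (s' i) t" using s'D(2)[OF i(1)] by blast
   have sh: "s i \<in> hom C (Dom C (s i)) x" by (rule subobject_hom(1)[OF is_unionD(1)[OF un si]])
   note qh = bD(2)[unfolded deq]
   have "f ** (m' ** b) = m ** (g ** b)" by (rule square[OF m'D(4) f m'D(1) m(1) m'D(2) bD(1)])
   also have "\<dots> = m ** (e (s i) ** q (e (s i)))" using bD(4) by simp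
   also have "\<dots> = s i ** q (e (s i))" using assoc[OF m(1) e(1)[OF si] qh] e(2)[OF si] by simp
   finally obtain h where h: "h \<in> hom C (Dom C b) (Dom C (s' i))" "s' i ** h = m' ** b"
    using pullback_univ[OF t(2) f sh comp_hom[OF m'D(1) bD(1)] qh] by blast
   obtain k where k: "k \<in> hom C (Dom C (s' i)) (Dom C n)" "n ** k = s' i" using le[of "s' i"] i(1) by (auto simp: sub_le_def)
   have "n ** (k ** h) = m' ** b" using assoc[OF nh(1) k(1) h(1)] k(2) h(2) by simp
   thus "\<exists>k\<in>hom C (Dom C b) (Dom C n). n ** k = m' ** b" using comp_hom[OF k(1) h(1)] by blast
  qed
  thus "sub_le C m' n" unfolding sub_le_def .
 qed
qed

lemma union_pullback:
 fixes n :: nat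
 assumes F: factorises and st: stable and f: "f \<in> hom C d x"
 shows "is_union C x (s ` {..<n}) m ==> (\<And>i. i < n ==> \<exists>t. is_pullback C f (s i) (s' i) t) ==>
  is_pullback C f m m' g ==> is_union C d (s' ` {..<n}) m'"
proof (induction n arbitrary: m m' g)
 case 0
 show ?case by (rule union_pullback_good[OF F st _ 0(1) f _ 0(3)]) (auto simp: good_def)
next
 case (Suc n)
 have x: "x \<in> Ob C" using hom_ob[OF f] by simp
 have ins: "s ` {..<Suc n} = insert (s n) (s ` {..<n})" "s' ` {..<Suc n} = insert (s' n) (s' ` {..<n})"
  by (simp_all add: lessThan_Suc)
 note un = Suc.prems(1)[unfolded ins]
 have "\<exists>m0. is_union C x (s ` {..<n}) m0" by (rule union_exists[OF F x]) (use is_unionD(1)[OF un] in auto)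
 then obtain m0 where m0: "is_union C x (s ` {..<n}) m0" by blast
 note m0h = subobject_hom[OF is_unionD(2)[OF m0]]
 obtain l m0' g0 where m0': "is_pullback C f m0 m0' g0" by (rule pullback_exists[OF f m0h(1)])
 have u0: "is_union C d (s' ` {..<n}) m0'" by (rule Suc.IH[OF m0 _ m0']) (use Suc.prems(2) in simp)
 have u1: "is_union C x {m0, s n} m" by (rule union_split[OF un m0])
 let ?s = "\<lambda>i :: nat. if i = 0 then m0 else s n" and ?s' = "\<lambda>i :: nat. if i = 0 then m0' else s' n"
 have im: "?s ` {0, 1} = {m0, s n}" "?s' ` {0, 1} = {m0', s' n}" by auto
 have "good {m0, s n}"
  unfolding good_def using m0h(2) subobject_hom(2)[OF is_unionD(1)[OF un]] by blast
 hence gd: "good (?s ` {0, 1})" unfolding im .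
 have pbs: "\<exists>t. is_pullback C f (?s i) (?s' i) t" if "i \<in> {0, 1}" for i
  using m0' Suc.prems(2)[of n] that by auto
 have "is_union C d (?s' ` {0, 1}) m'"
  by (rule union_pullback_good[OF F st gd _ f pbs Suc.prems(3)]) (unfold im, rule u1)
 thus ?case unfolding ins unfolding im by (rule union_insert[OF u0])
qed

lemma coherentI:
 assumes F: factorises and st: stable
 shows "coherent_category C"
 unfolding coherent_category_def regular_category_def
proof (intro conjI allI impI ballI)
 show "finitely_complete C" by (rule lex)
next
 fix f p q assume "is_kernel_pair C f p q"
 hence pb: "is_pullback C f f p q" by (simp add: is_kernel_pair_def)
 hence f: "f \<in> hom C (Dom C f) (Cod C f)" by (auto simp: is_pullback_def hom_def)
 note D = pullbackD[OF pb f]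
 have "gens (Cod C f) {f}" "good {f}" using f hom_ob[OF f] by (auto simp: gens_def good_def)
 then obtain M m e where m: "is_mono C m" "m \<in> hom C M (Cod C f)" "\<And>t. t \<in> {f} ==> e t \<in> hom C (Dom C t) M"
  "\<And>t. t \<in> {f} ==> m ** e t = t" "eff M (e ` {f})" using F unfolding factorises_def by metis
 let ?e = "e f"
 have e: "?e \<in> hom C (Dom C f) M" "m ** ?e = f" using m(3,4) by auto
 have mono: "?e ** u = ?e ** u' \<longleftrightarrow> f ** u = f ** u'" if u: "u \<in> hom C z (Dom C f)" "u' \<in> hom C z (Dom C f)" for u u' z
  using assoc[OF m(2) e(1) u(1)] assoc[OF m(2) e(1) u(2)] e(2) monoD[OF m(1,2) comp_hom[OF e(1) u(1)] comp_hom[OF e(1) u(2)]] by auto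
 have "is_coequaliser C p q ?e"
 proof (rule eff_regular_epi(2)[OF _ e(1) D(1,2)])
  show "eff M {?e}" using m(5) by simp
  show "?e ** p = ?e ** q" using mono[OF D(1,2)] D(4) by simp
  fix z u u' assume u: "u \<in> hom C z (Dom C f)" "u' \<in> hom C z (Dom C f)" "?e ** u = ?e ** u'"
  hence "f ** u = f ** u'" using mono by blast
  from pullback_univ[OF pb f f u(1,2) this] show "\<exists>h\<in>hom C z (Dom C p). p ** h = u \<and> q ** h = u'" by blast
 qed
 thus "\<exists>e. is_coequaliser C p q e" by blast
next
 fix f e p q assume A: "is_regular_epi C e \<and> is_pullback C f e p q"
 hence pb: "is_pullback C f e p q" by simp
 have f: "f \<in> hom C (Dom C f) (Cod C e)" using pb by (auto simp: is_pullback_def hom_def)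
 have "good {e}" by (auto simp: good_def)
 have "eff (Dom C f) ((\<lambda>_. p) ` {e})"
  using st[unfolded stable_def, rule_format, of "{e}" "Cod C e" f "Dom C f" "\<lambda>_. p" "\<lambda>_. q"]
   \<open>good {e}\<close> regular_epi_eff(1)[OF conjunct1[OF A]] f pb by simp
 hence "eff (Dom C f) {p}" by simp
 thus "is_regular_epi C p" using eff_regular_epi(1)[OF _ pullbackD(1)[OF pb f]] by blast
next
 fix x S assume "x \<in> Ob C" "finite S \<and> (\<forall>s\<in>S. is_subobject C x s)"
 thus "\<exists>m. is_union C x S m" using union_exists[OF F] by blast
next
 fix f and n :: nat and s m s' m'
 assume "f \<in> Arr C" and A: "is_union C (Cod C f) (s ` {..<n}) m \<and> (\<forall>i<n. \<exists>t. is_pullback C f (s i) (s' i) t) \<and> (\<exists>t. is_pullback C f m m' t)"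
 obtain g where "is_pullback C f m m' g" using A by blast
 from union_pullback[OF F st hom_arr[OF \<open>f \<in> Arr C\<close>] conjunct1[OF A] _ this]
 show "is_union C (Dom C f) (s' ` {..<n}) m'" using A by blast
qed

end

section \<open>Exact categories are coherent\<close>

lemma lex_functor_comp:
 assumes F: "lex_functor A B F" and G: "lex_functor B D G"
 shows "lex_functor A D (comp_func G F)"
proof -
 have f: "is_functor A B F" "is_functor B D G" and p: "preserves_finite_limits A B F" "preserves_finite_limits B D G"
  using F G by (auto simp: lex_functor_def)
 interpret A: cat A using f by (auto simp: is_functor_def cat_def)
 have 1: "is_functor A D (comp_func G F)"
  unfolding is_functor_def
 proof (intro conjI ballI allI)
  fix x y z u v assume u: "u \<in> hom A x y" and v: "v \<in> hom A y z"
  have "ar F u \<in> hom B (ob F x) (ob F y)" "ar F v \<in> hom B (ob F y) (ob F z)"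
   using f(1) u v by (auto simp: is_functor_def)
  moreover have "ar F (Comp A v u) = Comp B (ar F v) (ar F u)" using f(1) u v unfolding is_functor_def by blast
  ultimately show "ar (comp_func G F) (Comp A v u) = Comp D (ar (comp_func G F) v) (ar (comp_func G F) u)"
   using f(2) unfolding is_functor_def by (simp add: comp_func_def)
 qed (use f in "auto simp: is_functor_def comp_func_def")
 have "preserves_finite_limits A D (comp_func G F)"
  unfolding preserves_finite_limits_def
 proof (intro allI impI)
  fix J :: "(nat, nat) cat" and E l \<pi> assume H: "finite_category J \<and> is_functor J A E \<and> is_limit J A E l \<pi>"
  have "is_limit J B (comp_func F E) (ob F l) (\<lambda>j. ar F (\<pi> j))" using p(1) H unfolding preserves_finite_limits_def by blast
  moreover have "is_functor J B (comp_func F E)"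
   unfolding is_functor_def
  proof (intro conjI ballI allI)
   fix x y z u v assume u: "u \<in> hom J x y" and v: "v \<in> hom J y z"
   have "ar E u \<in> hom A (ob E x) (ob E y)" "ar E v \<in> hom A (ob E y) (ob E z)"
    using H u v by (auto simp: is_functor_def)
   moreover have "ar E (Comp J v u) = Comp A (ar E v) (ar E u)" using H u v unfolding is_functor_def by blast
   ultimately show "ar (comp_func F E) (Comp J v u) = Comp B (ar (comp_func F E) v) (ar (comp_func F E) u)"
    using f(1) unfolding is_functor_def by (simp add: comp_func_def)
  qed (use f H in "auto simp: is_functor_def comp_func_def")
  ultimately have "is_limit J D (comp_func G (comp_func F E)) (ob G (ob F l)) (\<lambda>j. ar G (ar F (\<pi> j)))"
   using p(2) H unfolding preserves_finite_limits_def by blast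
  thus "is_limit J D (comp_func (comp_func G F) E) (ob (comp_func G F) l) (\<lambda>j. ar (comp_func G F) (\<pi> j))"
   by (simp add: comp_func_def)
 qed
 with 1 show ?thesis by (simp add: lex_functor_def)
qed

context lexp
begin

lemma sv_small:
 assumes G: "gens y T" and fin: "finite T"
 shows "small_presheaf C (sv y T)"
 using img_small[OF lex sv_ob[OF G] sv_gen_by[OF G fin] yoneda_functor_in[OF fullin_small] yoneda_lex[OF fullin_small]]
 by (simp add: sv_def yoneda_def)

lemma Phi_l_obs_iso:
 assumes P: "P \<in> Phi_l_obs \<Phi> C" "small_presheaf C P" and Q: "small_presheaf C Q"
  and a: "\<alpha> \<in> phom P Q" "is_iso (psh C) \<alpha>"
 shows "Q \<in> Phi_l_obs \<Phi> C"
proof (rule Phi_l_obs.replete[OF P(1)])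
 have ob: "P \<in> Ob (small_psh C)" "Q \<in> Ob (small_psh C)" using P Q by (auto simp: small_psh_ob)
 have "is_iso (small_psh C) \<alpha>" using fullin_iso[OF fullin_small ob a(1)] a(2) by simp
 thus "isomorphic (small_psh C) P Q" unfolding isomorphic_def using a(1) fullinD(3)[OF fullin_small ob] by blast
qed

lemma sieve_colimit:
 fixes K :: "('u, 'u) cat"
 assumes K: "small_category K" "finitely_complete K" and w: "(K, lpcat.sv K y T) \<in> weights_coh"
  and G: "lpcat.gens K y T" and fin: "finite T" and F: "lex_functor K C F"
 shows "sv (ob F y) (ar F ` T) \<in> Phi_l_obs weights_coh C"
proof -
 interpret K: lpcat K by (rule lpcat_small[OF U K(1)])
 let ?D = "comp_func (yoneda C) F"
 have Y: "lex_functor C (small_psh C) (yoneda C)"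
  using yoneda_functor_in[OF fullin_small] yoneda_lex[OF fullin_small] by (simp add: lex_functor_def)
 have D: "lex_functor K (small_psh C) ?D" by (rule lex_functor_comp[OF F Y])
 have Dy: "ob ?D y = rep (ob F y)" "ar ?D ` T = yar ` ar F ` T"
  by (auto simp: comp_func_def yoneda_def image_image)
 obtain \<gamma> where "is_weighted_colimit K (K.sv y T) (small_psh C) ?D (img (ob ?D y) (ar ?D ` T)) \<gamma>"
  using img_weighted_colimit[OF K(2) K.sv_ob[OF G] K.sv_gen_by[OF G fin]] D unfolding lex_functor_def by blast
 hence wc: "is_weighted_colimit K (K.sv y T) (small_psh C) ?D (sv (ob F y) (ar F ` T)) \<gamma>"
  unfolding sv_def Dy .
 show ?thesis
 proof (rule Phi_l_obs.lex_colimit[OF w D _ wc])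
  fix k assume "k \<in> Ob K"
  hence "ob F k \<in> Ob C" using F by (auto simp: lex_functor_def is_functor_def)
  thus "ob ?D k \<in> Phi_l_obs weights_coh C" by (simp add: comp_func_def yoneda_def Phi_l_obs.repr)
 qed
qed

lemma sv_transport:
 assumes G: "gens y (\<sigma> ` I)" and G': "gens y' (\<tau> ` I)" and k: "k \<in> hom C y y'" "is_iso C k"
  and i: "\<And>a. a \<in> I ==> i a \<in> hom C (Dom C (\<sigma> a)) (Dom C (\<tau> a)) \<and> is_iso C (i a)"
  and c: "\<And>a. a \<in> I ==> k ** \<sigma> a = \<tau> a ** i a"
 shows "\<exists>\<alpha>\<in>phom (sv y (\<sigma> ` I)) (sv y' (\<tau> ` I)). is_iso (psh C) \<alpha>"
proof -
 note km = iso_mono[OF k(2)]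
 obtain k' where k': "k' \<in> hom C y' y" "k' ** k = Id C y" "k ** k' = Id C y'" using isoD[OF k(2,1)] by blast
 have sh: "\<sigma> a \<in> hom C (Dom C (\<sigma> a)) y" "\<tau> a \<in> hom C (Dom C (\<tau> a)) y'" if "a \<in> I" for a
  using gensD(2)[OF G] gensD(2)[OF G'] that by auto
 have mem: "k ** g \<in> ob (sv y' (\<tau> ` I)) z" if z: "z \<in> Ob C" and g: "g \<in> ob (sv y (\<sigma> ` I)) z" for g z
 proof -
  obtain a u where a: "a \<in> I" "u \<in> hom C z (Dom C (\<sigma> a))" "g = \<sigma> a ** u" using g sv_el[OF G z] by blast
  note ia = conjunct1[OF i[OF a(1)]]
  have "k ** g = \<tau> a ** (i a ** u)" unfolding a(3) by (rule square[OF c[OF a(1)] k(1) sh(1)[OF a(1)] sh(2)[OF a(1)] ia a(2)])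
  thus ?thesis using sv_mem[OF G' imageI[OF a(1)] comp_hom[OF ia a(2)]] by simp
 qed
 have \<alpha>: "mk_arr C (sv y (\<sigma> ` I)) (sv y' (\<tau> ` I)) (\<lambda>z g. k ** g) \<in> phom (sv y (\<sigma> ` I)) (sv y' (\<tau> ` I))"
 proof (rule mk_arr_homI[OF sv_ob[OF G] sv_ob[OF G'] mem])
  fix w z f g assume f: "f \<in> hom C w z" and g: "g \<in> ob (sv y (\<sigma> ` I)) z"
  have z: "z \<in> Ob C" using hom_ob[OF f] by simp
  show "k ** act (sv y (\<sigma> ` I)) f g = act (sv y' (\<tau> ` I)) f (k ** g)"
   using sv_act[OF G f g] sv_act[OF G' f mem[OF z g]] assoc[OF k(1) sv_sub[OF G z g] f] by simp
 qed
 have "is_iso (psh C) (mk_arr C (sv y (\<sigma> ` I)) (sv y' (\<tau> ` I)) (\<lambda>z g. k ** g))"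
 proof (rule psh_iso[OF \<alpha>])
  fix z assume z: "z \<in> Ob C"
  show "bij_betw (app (mk_arr C (sv y (\<sigma> ` I)) (sv y' (\<tau> ` I)) (\<lambda>z g. k ** g)) z) (ob (sv y (\<sigma> ` I)) z) (ob (sv y' (\<tau> ` I)) z)"
   unfolding bij_betw_def
  proof (intro conjI)
   show "inj_on (app (mk_arr C (sv y (\<sigma> ` I)) (sv y' (\<tau> ` I)) (\<lambda>z g. k ** g)) z) (ob (sv y (\<sigma> ` I)) z)"
   proof (rule inj_onI)
    fix g g' assume g: "g \<in> ob (sv y (\<sigma> ` I)) z" "g' \<in> ob (sv y (\<sigma> ` I)) z"
     and "app (mk_arr C (sv y (\<sigma> ` I)) (sv y' (\<tau> ` I)) (\<lambda>z g. k ** g)) z g = app (mk_arr C (sv y (\<sigma> ` I)) (sv y' (\<tau> ` I)) (\<lambda>z g. k ** g)) z g'"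
    hence "k ** g = k ** g'" using z by simp
    thus "g = g'" by (rule monoD[OF km k(1) sv_sub[OF G z g(1)] sv_sub[OF G z g(2)]])
   qed
   have "g' \<in> (\<lambda>g. k ** g) ` ob (sv y (\<sigma> ` I)) z" if g': "g' \<in> ob (sv y' (\<tau> ` I)) z" for g'
   proof -
    obtain a u where a: "a \<in> I" "u \<in> hom C z (Dom C (\<tau> a))" "g' = \<tau> a ** u" using g' sv_el[OF G' z] by blast
    note ia = i[OF a(1)]
    obtain j where j: "j \<in> hom C (Dom C (\<tau> a)) (Dom C (\<sigma> a))" "i a ** j = Id C (Dom C (\<tau> a))"
     using isoD[OF conjunct2[OF ia] conjunct1[OF ia]] by blast
    have "k ** (\<sigma> a ** (j ** u)) = \<tau> a ** (i a ** (j ** u))"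
     by (rule square[OF c[OF a(1)] k(1) sh(1)[OF a(1)] sh(2)[OF a(1)] conjunct1[OF ia] comp_hom[OF j(1) a(2)]])
    also have "\<dots> = g'" using assoc[OF conjunct1[OF ia] j(1) a(2)] j(2) id_left[OF a(2)] a(3) by simp
    finally show ?thesis using sv_mem[OF G imageI[OF a(1)] comp_hom[OF j(1) a(2)]] by blast
   qed
   thus "app (mk_arr C (sv y (\<sigma> ` I)) (sv y' (\<tau> ` I)) (\<lambda>z g. k ** g)) z ` ob (sv y (\<sigma> ` I)) z = ob (sv y' (\<tau> ` I)) z"
    using mem[OF z] z by (auto simp: image_iff)
  qed
 qed
 with \<alpha> show ?thesis by blast
qed

lemma sv_Phi_l_obs:
 assumes G: "gens y T" and T: "good T"
 shows "sv y T \<in> Phi_l_obs weights_coh C"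
proof -
 note small = sv_small[OF G good_finite[OF T]]
 consider "T = {}" | f where "T = {f}" | a b where "T = {a, b}" "is_mono C a" "is_mono C b" using T by (auto simp: good_def)
 thus ?thesis
 proof cases
  case 1
  obtain l where l: "l \<in> Ob C" "\<And>w. w \<in> Ob C ==> \<exists>!h. h \<in> hom C w l" by (rule terminal_exists) blast
  define K :: "('u, 'u) cat" where "K = \<lparr>Ob = {undefined}, Arr = {undefined}, Dom = (\<lambda>_. undefined), Cod = (\<lambda>_. undefined),
   Id = (\<lambda>_. undefined), Comp = (\<lambda>_ _. undefined)\<rparr>"
  have "category K" by (auto simp: K_def category_def hom_def)
  hence tK: "terminal_category K" by (simp add: terminal_category_def K_def)
  have sK: "small_category K" using \<open>category K\<close> unfolding small_category_def by (simp add: K_def small_countable[OF U])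
  interpret K: lpcat K by (rule lpcat_small[OF U sK])
  have yK: "undefined \<in> Ob K" by (simp add: K_def)
  have GK: "K.gens undefined {}" using yK by (simp add: K.gens_def)
  have w: "(K, K.sv undefined {}) \<in> weights_coh" by (rule sieve_weight_initial[OF U sK tK yK])
  have fK: "finitely_complete K" using weights_coh_lex[OF U w] by (simp add: lex_weight_def)
  define F :: "('u, 'u, 'o, 'u) func" where "F = \<lparr>ob_map = (\<lambda>_. l), ar_map = (\<lambda>_. Id C l)\<rparr>"
  have Ff: "is_functor K C F"
   unfolding is_functor_def F_def using \<open>category K\<close> category l id_hom[OF l(1)] id_left[OF id_hom[OF l(1)]] by simp
  have "preserves_finite_limits K C F"
   unfolding preserves_finite_limits_def
  proof (intro allI impI)
   fix J :: "(nat, nat) cat" and D m \<pi>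
   show "is_limit J C (comp_func F D) (ob F m) (\<lambda>j. ar F (\<pi> j))"
    unfolding is_limit_def
   proof (intro conjI allI impI)
    show "is_cone J C (comp_func F D) (ob F m) (\<lambda>j. ar F (\<pi> j))"
     using l(1) id_hom[OF l(1)] id_left[OF id_hom[OF l(1)]] by (simp add: is_cone_def comp_func_def F_def)
    fix n \<rho> assume c: "is_cone J C (comp_func F D) n \<rho>"
    hence n: "n \<in> Ob C" and \<rho>: "\<And>j. j \<in> Ob J ==> \<rho> j \<in> hom C n l" by (auto simp: is_cone_def comp_func_def F_def)
    show "\<exists>!h. h \<in> hom C n (ob F m) \<and> (\<forall>j\<in>Ob J. ar F (\<pi> j) ** h = \<rho> j)"
    proof (rule ex1E[OF l(2)[OF n]])
     fix h assume h: "h \<in> hom C n l" "\<forall>k. k \<in> hom C n l --> k = h"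
     have "\<forall>j\<in>Ob J. ar F (\<pi> j) ** h = \<rho> j"
     proof
      fix j assume "j \<in> Ob J"
      hence "\<rho> j = h" using h(2) \<rho> by blast
      thus "ar F (\<pi> j) ** h = \<rho> j" using id_left[OF h(1)] by (simp add: F_def)
     qed
     hence 1: "h \<in> hom C n (ob F m) \<and> (\<forall>j\<in>Ob J. ar F (\<pi> j) ** h = \<rho> j)" using h(1) by (simp add: F_def)
     show ?thesis
     proof (rule ex1I, rule 1)
      fix k assume "k \<in> hom C n (ob F m) \<and> (\<forall>j\<in>Ob J. ar F (\<pi> j) ** k = \<rho> j)"
      hence "k \<in> hom C n l" by (simp add: F_def)
      thus "k = h" using h(2)[rule_format, of k] by simp
     qed
    qed
   qed
  qed
  with Ff have "sv l {} \<in> Phi_l_obs weights_coh C"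
   using sieve_colimit[OF sK fK w GK, of F] by (simp add: lex_functor_def F_def)
  moreover have Gl: "gens l {}" using l(1) by (simp add: gens_def)
  have G0: "gens y {}" using G 1 by simp
  have em: "ob (sv l {}) z = {}" "ob (sv y {}) z = {}" if "z \<in> Ob C" for z
   using sv_el[OF Gl that] sv_el[OF G0 that] by blast+
  have \<alpha>: "mk_arr C (sv l {}) (sv y {}) (\<lambda>z g. g) \<in> phom (sv l {}) (sv y {})"
   by (rule mk_arr_homI[OF sv_ob[OF Gl] sv_ob[OF G0]]) (use em hom_ob in auto)
  have "is_iso (psh C) (mk_arr C (sv l {}) (sv y {}) (\<lambda>z g. g))"
   by (rule psh_iso[OF \<alpha>]) (simp add: em bij_betw_def)
  ultimately show ?thesis using Phi_l_obs_iso[OF _ sv_small[OF Gl] _ \<alpha>] small 1 by simp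
 next
  case 2
  have f: "f \<in> hom C (Dom C f) y" using gensD(2)[OF G] 2 by simp
  have fA: "f \<in> Arr C" "Cod C f = y" using f by (auto simp: hom_def)
  obtain K :: "('u, 'u) cat" and g F i j where K: "small_category K" "free_lex_on_arrow K g" "lex_functor K C F"
   "i \<in> hom C (ob F (Dom K g)) (Dom C f)" "is_iso C i" "j \<in> hom C (ob F (Cod K g)) (Cod C f)" "is_iso C j"
   "j ** ar F g = f ** i" by (rule free_arrow_exists[OF U lex fA(1)])
  interpret K: lpcat K by (rule lpcat_small[OF U K(1)])
  have fK: "finitely_complete K" and gA: "g \<in> Arr K" using K(2) by (auto simp: free_lex_on_arrow_def)
  have gh: "g \<in> hom K (Dom K g) (Cod K g)" using gA by (simp add: hom_def)
  have GK: "K.gens (Cod K g) {g}" using gh K.hom_ob[OF gh] by (simp add: K.gens_def)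
  have P: "sv (ob F (Cod K g)) (ar F ` {g}) \<in> Phi_l_obs weights_coh C"
   by (rule sieve_colimit[OF K(1) fK sieve_weight_reg[OF U K(1,2)] GK _ K(3)]) simp
  have Fg: "ar F g \<in> hom C (ob F (Dom K g)) (ob F (Cod K g))"
   using K(3) gh by (auto simp: lex_functor_def is_functor_def)
  hence dF: "Dom C (ar F g) = ob F (Dom K g)" by (simp add: hom_def)
  have GF: "gens (ob F (Cod K g)) (ar F ` {g})" using Fg dF hom_ob[OF Fg] by (simp add: gens_def)
  have Gf: "gens y ((\<lambda>_. f) ` {g})" using G 2 by simp
  obtain \<alpha> where "\<alpha> \<in> phom (sv (ob F (Cod K g)) (ar F ` {g})) (sv y ((\<lambda>_. f) ` {g}))" "is_iso (psh C) \<alpha>"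
   using sv_transport[OF GF Gf K(6)[unfolded fA(2)] K(7), of "\<lambda>_. i"] K(4,5,8) dF by auto
  thus ?thesis using Phi_l_obs_iso[OF P sv_small[OF GF]] small 2 by simp
 next
  case 3
  have ab: "a \<in> hom C (Dom C a) y" "b \<in> hom C (Dom C b) y" using gensD(2)[OF G] 3(1) by auto
  have cod: "Cod C a = y" "Cod C b = y" using ab by (auto simp: hom_def)
  have mc: "mono_cospan C a b" using 3 cod by (simp add: mono_cospan_def)
  obtain K :: "('u, 'u) cat" and m n F i j k where K: "small_category K" "free_lex_on_mono_cospan K m n" "lex_functor K C F"
   "i \<in> hom C (ob F (Dom K m)) (Dom C a)" "is_iso C i" "j \<in> hom C (ob F (Dom K n)) (Dom C b)" "is_iso C j"
   "k \<in> hom C (ob F (Cod K m)) (Cod C a)" "is_iso C k" "k ** ar F m = a ** i" "k ** ar F n = b ** j"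
   by (rule free_cospan_exists[OF U lex mc])
  interpret K: lpcat K by (rule lpcat_small[OF U K(1)])
  have fK: "finitely_complete K" and mn: "is_mono K m" "is_mono K n" "Cod K n = Cod K m"
   using K(2) by (auto simp: free_lex_on_mono_cospan_def mono_cospan_def)
  note mh = K.mono_hom[OF mn(1)] K.mono_hom[OF mn(2), unfolded mn(3)]
  have GK: "K.gens (Cod K m) {m, n}" using mh K.hom_ob[OF mh(1)] by (simp add: K.gens_def)
  have P: "sv (ob F (Cod K m)) (ar F ` {m, n}) \<in> Phi_l_obs weights_coh C"
   by (rule sieve_colimit[OF K(1) fK sieve_weight_or[OF U K(1,2)] GK _ K(3)]) simp
  have Fh: "ar F m \<in> hom C (ob F (Dom K m)) (ob F (Cod K m))" "ar F n \<in> hom C (ob F (Dom K n)) (ob F (Cod K m))"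
   using K(3) mh by (auto simp: lex_functor_def is_functor_def)
  hence dF: "Dom C (ar F m) = ob F (Dom K m)" "Dom C (ar F n) = ob F (Dom K n)" by (auto simp: hom_def)
  let ?I = "{0, 1 :: nat}" and ?\<sigma> = "\<lambda>s :: nat. if s = 0 then ar F m else ar F n" and ?\<tau> = "\<lambda>s :: nat. if s = 0 then a else b"
  have im: "?\<sigma> ` ?I = ar F ` {m, n}" "?\<tau> ` ?I = T" using 3(1) by auto
  have GF: "gens (ob F (Cod K m)) (?\<sigma> ` ?I)" unfolding im using Fh dF hom_ob[OF Fh(1)] by (simp add: gens_def)
  have GT: "gens y (?\<tau> ` ?I)" unfolding im by (rule G)
  have "\<exists>\<alpha>\<in>phom (sv (ob F (Cod K m)) (?\<sigma> ` ?I)) (sv y (?\<tau> ` ?I)). is_iso (psh C) \<alpha>"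
   by (rule sv_transport[OF GF GT K(8)[unfolded cod(1)] K(9), of "\<lambda>s. if s = 0 then i else j"])
    (use K(4-7,10,11) dF in "auto split: if_splits")
  then obtain \<alpha> where \<alpha>: "\<alpha> \<in> phom (sv (ob F (Cod K m)) (ar F ` {m, n})) (sv y T)" "is_iso (psh C) \<alpha>"
   unfolding im by blast
  show ?thesis by (rule Phi_l_obs_iso[OF P sv_small[OF GF[unfolded im]] small \<alpha>]) simp
 qed
qed

lemma Phi_l_obs_psh: "P \<in> Phi_l_obs \<Phi> C ==> P \<in> Ob (small_psh C)"
proof (induction rule: Phi_l_obs.induct)
 case (repr c)
 thus ?case by (rule fullinD(8)[OF fullin_small])
next
 case (replete P Q)
 then obtain f where "f \<in> hom (small_psh C) P Q" unfolding isomorphic_def by blast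
 thus ?case by (rule fullin_hom(2)[OF fullin_small])
qed (auto simp: is_limit_def is_cone_def is_weighted_colimit_def is_weighted_cocone_def)

lemma fullin_Phi_l: "fullin (Phi_l \<Phi> C)"
 unfolding Phi_l_def by (rule fullin_full_sub[OF fullin_small Phi_l_obs.repr])

lemma Phi_l_ob: "P \<in> Ob (Phi_l \<Phi> C) \<longleftrightarrow> P \<in> Phi_l_obs \<Phi> C"
 using Phi_l_obs_psh by (auto simp: Phi_l_def)

definition orth :: "('o, 'u) presheaf => ('o, 'u) presheaf => ('o, 'u) presheaf_arr => bool" where
 "orth P Q \<alpha> \<longleftrightarrow> (\<forall>Z\<in>Ob C. \<forall>\<beta>\<in>phom P (rep Z). \<exists>!\<gamma>. \<gamma> \<in> phom Q (rep Z) \<and> pcomp \<gamma> \<alpha> = \<beta>)"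

lemma compat_of_map:
 assumes G: "gens c T" and Z: "Z \<in> Ob C" and b: "\<beta> \<in> phom (sv c T) (rep Z)"
 shows "compat T (\<lambda>t. app \<beta> (Dom C t) t) Z"
proof -
 have nat: "app \<beta> z (t ** u) = app \<beta> (Dom C t) t ** u" if t: "t \<in> T" and u: "u \<in> hom C z (Dom C t)" for t u z
 proof -
  have "app \<beta> (Dom C t) t \<in> hom C (Dom C t) Z" using app_in[OF b gensD(3)[OF G t] sv_gen[OF G t]] gensD(3)[OF G t] by simp
  thus ?thesis using app_nat[OF b u sv_gen[OF G t]] sv_act[OF G u sv_gen[OF G t]] rep_act[OF u] by simp
 qed
 show ?thesis
 proof (rule compatI)
  show "Z \<in> Ob C" by (rule Z)
  show "app \<beta> (Dom C t) t \<in> hom C (Dom C t) Z" if "t \<in> T" for t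
   using app_in[OF b gensD(3)[OF G that] sv_gen[OF G that]] gensD(3)[OF G that] by simp
  show "app \<beta> (Dom C t) t ** u = app \<beta> (Dom C t') t' ** u'"
   if "t \<in> T" "t' \<in> T" "u \<in> hom C z (Dom C t)" "u' \<in> hom C z (Dom C t')" "t ** u = t' ** u'" for t t' z u u'
   using nat[OF that(1,3)] nat[OF that(2,4)] that(5) by simp
 qed
qed

lemma yar_sv_incl:
 assumes G: "gens c T" and h: "h \<in> hom C c Z" and t: "t \<in> T"
 shows "app (pcomp (yar h) (sv_incl c T)) (Dom C t) t = h ** t"
 using app_comp[OF yar_hom[OF h] sv_incl_hom[OF G] gensD(3)[OF G t] sv_gen[OF G t]] gensD(3)[OF G t] sv_gen[OF G t]
  yar_app[OF h gensD(3)[OF G t] gensD(2)[OF G t]] by simp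

lemma map_of_compat:
 assumes G: "gens c T" and r: "compat T r Z"
 obtains \<beta> where "\<beta> \<in> phom (sv c T) (rep Z)" "\<And>t. t \<in> T ==> app \<beta> (Dom C t) t = r t"
proof -
 note Z = compatD(1)[OF r]
 have ra: "act (rep Z) u (r t) = r t ** u" if "t \<in> T" "u \<in> hom C z (Dom C t)" for t u z
  by (rule rep_act[OF that(2) compatD(2)[OF r that(1)]])
 have rt: "r t \<in> ob (rep Z) (Dom C t)" if "t \<in> T" for t using compatD(2)[OF r that] gensD(3)[OF G that] by simp
 have cc: "act (rep Z) u (r t) = act (rep Z) u' (r t')"
  if "t \<in> T" "t' \<in> T" "u \<in> hom C z (Dom C t)" "u' \<in> hom C z (Dom C t')" "t ** u = t' ** u'" for t t' z u u'
  using ra[OF that(1,3)] ra[OF that(2,4)] compatD(3)[OF r that] by simp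
 show ?thesis
  by (rule sv_descend[OF G rep_ob[OF Z] rt cc]) (assumption | rule that)+
qed

lemma eff_iff_orth:
 assumes G: "gens c T"
 shows "eff c T \<longleftrightarrow> orth (sv c T) (rep c) (sv_incl c T)"
proof
 note c = gensD(1)[OF G]
 note ih = sv_incl_hom[OF G]
 assume E: "eff c T"
 show "orth (sv c T) (rep c) (sv_incl c T)"
  unfolding orth_def
 proof (intro ballI)
  fix Z \<beta> assume Z: "Z \<in> Ob C" and b: "\<beta> \<in> phom (sv c T) (rep Z)"
  obtain h where h: "h \<in> hom C c Z" "\<And>t. t \<in> T ==> h ** t = app \<beta> (Dom C t) t"
   by (rule eff_ex[OF E compat_of_map[OF G Z b]]) blast
  show "\<exists>!\<gamma>. \<gamma> \<in> phom (rep c) (rep Z) \<and> pcomp \<gamma> (sv_incl c T) = \<beta>"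
  proof (rule ex1I[of _ "yar h"])
   have "pcomp (yar h) (sv_incl c T) = \<beta>"
    by (rule sv_hom_ext[OF G Psh.comp_hom[OF yar_hom[OF h(1)] ih] b]) (use yar_sv_incl[OF G h(1)] h(2) in simp)
   thus "yar h \<in> phom (rep c) (rep Z) \<and> pcomp (yar h) (sv_incl c T) = \<beta>" using yar_hom[OF h(1)] by simp
   fix \<gamma> assume g: "\<gamma> \<in> phom (rep c) (rep Z) \<and> pcomp \<gamma> (sv_incl c T) = \<beta>"
   note k = yar_full[OF conjunct1[OF g] c]
   let ?k = "app \<gamma> c (Id C c)"
   have "?k = h"
   proof (rule eff_ext[OF E k(1) h(1)])
    fix t assume t: "t \<in> T"
    have "?k ** t = app (pcomp (yar ?k) (sv_incl c T)) (Dom C t) t" by (rule yar_sv_incl[OF G k(1) t, symmetric])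
    also have "\<dots> = app \<beta> (Dom C t) t" unfolding k(2)[symmetric] conjunct2[OF g] ..
    finally show "?k ** t = h ** t" using h(2)[OF t] by simp
   qed
   thus "\<gamma> = yar h" using k(2) by simp
  qed
 qed
next
 note c = gensD(1)[OF G]
 note ih = sv_incl_hom[OF G]
 assume O: "orth (sv c T) (rep c) (sv_incl c T)"
 show "eff c T"
 proof (rule effI[OF G])
  fix r Z assume r: "compat T r Z"
  obtain \<beta> where b: "\<beta> \<in> phom (sv c T) (rep Z)" "\<And>t. t \<in> T ==> app \<beta> (Dom C t) t = r t" by (rule map_of_compat[OF G r]) blast
  obtain \<gamma> where g: "\<gamma> \<in> phom (rep c) (rep Z)" "pcomp \<gamma> (sv_incl c T) = \<beta>"
   using O compatD(1)[OF r] b(1) unfolding orth_def by blast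
  note k = yar_full[OF g(1) c]
  have "app \<gamma> c (Id C c) ** t = r t" if t: "t \<in> T" for t
   using yar_sv_incl[OF G k(1) t] unfolding k(2)[symmetric] g(2) b(2)[OF t] by simp
  thus "\<exists>h\<in>hom C c Z. \<forall>t\<in>T. h ** t = r t" using k(1) by blast
 next
  fix h h' Z assume h: "h \<in> hom C c Z" "h' \<in> hom C c Z" and eq: "\<And>t. t \<in> T ==> h ** t = h' ** t"
  have Z: "Z \<in> Ob C" using hom_ob[OF h(1)] by simp
  note yh = Psh.comp_hom[OF yar_hom[OF h(1)] ih] and yh' = Psh.comp_hom[OF yar_hom[OF h(2)] ih]
  have e: "pcomp (yar h) (sv_incl c T) = pcomp (yar h') (sv_incl c T)"
   by (rule sv_hom_ext[OF G yh yh']) (simp add: yar_sv_incl[OF G h(1)] yar_sv_incl[OF G h(2)] eq)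
  have "\<exists>!\<gamma>. \<gamma> \<in> phom (rep c) (rep Z) \<and> pcomp \<gamma> (sv_incl c T) = pcomp (yar h) (sv_incl c T)"
   using O Z yh unfolding orth_def by blast
  hence "yar h = yar h'" using yar_hom[OF h(1)] yar_hom[OF h(2)] e by metis
  thus "h = h'" by (rule yar_faithful[OF h])
 qed
qed

context
 fixes L \<theta>
 assumes adj: "is_adjunction (Phi_l weights_coh C) C L (yoneda C) \<theta>"
  and lexL: "preserves_finite_limits (Phi_l weights_coh C) C L"
begin

private abbreviation "E \<equiv> Phi_l weights_coh C"

private lemma fE: "fullin E" by (rule fullin_Phi_l)

interpretation E: cat E
 by (rule cat.intro) (rule fullinD[OF fE])

private lemma L: "is_functor E C L" using adj by (simp add: is_adjunction_def)

private lemma L_ob: "P \<in> Ob E ==> ob L P \<in> Ob C" using L by (auto simp: is_functor_def)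

private lemma L_hom: "\<alpha> \<in> hom E P Q ==> ar L \<alpha> \<in> hom C (ob L P) (ob L Q)" using L by (auto simp: is_functor_def)

private lemma E_hom: "P \<in> Ob E ==> Q \<in> Ob E ==> hom E P Q = phom P Q" by (rule fullinD(3)[OF fE])

private lemma rep_E: "c \<in> Ob C ==> rep c \<in> Ob E" by (rule fullinD(8)[OF fE])

private definition \<eta> where "\<eta> P = \<theta> P (ob L P) (Id C (ob L P))"

private lemma \<theta>_bij: "P \<in> Ob E ==> Z \<in> Ob C ==> bij_betw (\<theta> P Z) (hom C (ob L P) Z) (hom E P (rep Z))"
 using adj by (simp add: is_adjunction_def yoneda_def)

private lemma \<theta>_nat:
 "f \<in> hom E P' P ==> g \<in> hom C Z Z' ==> h \<in> hom C (ob L P) Z ==>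
  \<theta> P' Z' (g ** (h ** ar L f)) = pcomp (yar g) (pcomp (\<theta> P Z h) f)"
 using adj fullinD(4)[OF fE] unfolding is_adjunction_def by simp

private lemma \<eta>_hom:
 assumes P: "P \<in> Ob E" shows "\<eta> P \<in> hom E P (rep (ob L P))" "\<eta> P \<in> phom P (rep (ob L P))"
proof -
 show "\<eta> P \<in> hom E P (rep (ob L P))"
  unfolding \<eta>_def using \<theta>_bij[OF P L_ob[OF P]] id_hom[OF L_ob[OF P]] by (auto simp: bij_betw_def)
 thus "\<eta> P \<in> phom P (rep (ob L P))" by (rule fullin_hom(3)[OF fE])
qed

private lemma \<theta>_\<eta>:
 assumes P: "P \<in> Ob E" and h: "h \<in> hom C (ob L P) Z"
 shows "\<theta> P Z h = pcomp (yar h) (\<eta> P)"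
proof -
 have "ar L (Id E P) = Id C (ob L P)" using L P by (auto simp: is_functor_def)
 hence "\<theta> P Z (h ** (Id C (ob L P) ** Id C (ob L P))) = pcomp (yar h) (pcomp (\<eta> P) (Id E P))"
  using \<theta>_nat[OF E.id_hom[OF P] h id_hom[OF L_ob[OF P]]] by (simp add: \<eta>_def)
 moreover have "pcomp (\<eta> P) (Id E P) = \<eta> P" using E.id_right[OF \<eta>_hom(1)[OF P]] fullinD(4)[OF fE] by simp
 ultimately show ?thesis using id_right[OF h] id_left[OF id_hom[OF L_ob[OF P]]] by simp
qed

private lemma \<eta>_univ:
 assumes P: "P \<in> Ob E" and Z: "Z \<in> Ob C" and b: "\<beta> \<in> phom P (rep Z)"
 obtains h where "h \<in> hom C (ob L P) Z" "pcomp (yar h) (\<eta> P) = \<beta>"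
proof -
 have "\<beta> \<in> hom E P (rep Z)" using b E_hom[OF P rep_E[OF Z]] by simp
 hence "\<beta> \<in> \<theta> P Z ` hom C (ob L P) Z" using bij_betw_imp_surj_on[OF \<theta>_bij[OF P Z]] by simp
 then obtain h where h: "\<beta> = \<theta> P Z h" "h \<in> hom C (ob L P) Z" by (rule imageE)
 show ?thesis by (rule that[OF h(2)]) (simp add: \<theta>_\<eta>[OF P h(2)] h(1))
qed

private lemma \<eta>_ext:
 assumes P: "P \<in> Ob E" and h: "h \<in> hom C (ob L P) Z" "h' \<in> hom C (ob L P) Z"
  and eq: "pcomp (yar h) (\<eta> P) = pcomp (yar h') (\<eta> P)"
 shows "h = h'"
proof -
 have "Z \<in> Ob C" using hom_ob[OF h(1)] by simp
 hence "inj_on (\<theta> P Z) (hom C (ob L P) Z)" using \<theta>_bij[OF P] by (simp add: bij_betw_def)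
 moreover have "\<theta> P Z h = \<theta> P Z h'" using \<theta>_\<eta>[OF P h(1)] \<theta>_\<eta>[OF P h(2)] eq by simp
 ultimately show ?thesis using h by (simp add: inj_on_eq_iff)
qed

private lemma L_\<eta>:
 assumes a: "\<alpha> \<in> hom E P Q"
 shows "pcomp (yar (ar L \<alpha>)) (\<eta> P) = pcomp (\<eta> Q) \<alpha>"
proof -
 have PQ: "P \<in> Ob E" "Q \<in> Ob E" using E.hom_ob[OF a] by auto
 note i = id_hom[OF L_ob[OF PQ(2)]] and La = L_hom[OF a]
 have "\<theta> P (ob L Q) (Id C (ob L Q) ** (Id C (ob L Q) ** ar L \<alpha>)) = pcomp (yar (Id C (ob L Q))) (pcomp (\<eta> Q) \<alpha>)"
  unfolding \<eta>_def by (rule \<theta>_nat[OF a i i])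
 moreover have "pcomp (\<eta> Q) \<alpha> \<in> phom P (rep (ob L Q))"
  by (rule Psh.comp_hom[OF \<eta>_hom(2)[OF PQ(2)] fullin_hom(3)[OF fE a]])
 ultimately show ?thesis
  using \<theta>_\<eta>[OF PQ(1) La] id_left[OF La] yar_id[OF L_ob[OF PQ(2)]] Psh.id_left by simp
qed

private lemma orth_iff_iso:
 assumes a: "\<alpha> \<in> hom E P Q"
 shows "orth P Q \<alpha> \<longleftrightarrow> is_iso C (ar L \<alpha>)"
proof
 have PQ: "P \<in> Ob E" "Q \<in> Ob E" using E.hom_ob[OF a] by auto
 note La = L_hom[OF a] and ah = fullin_hom(3)[OF fE a] and \<eta>P = \<eta>_hom(2)[OF PQ(1)] and \<eta>Q = \<eta>_hom(2)[OF PQ(2)]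
 note LP = L_ob[OF PQ(1)] and LQ = L_ob[OF PQ(2)]
 have ca: "pcomp (pcomp (yar k) (\<eta> Q)) \<alpha> = pcomp (yar (k ** ar L \<alpha>)) (\<eta> P)"
  if k: "k \<in> hom C (ob L Q) Z" for k Z
  using Psh.assoc[OF yar_hom[OF k] \<eta>Q ah] L_\<eta>[OF a] Psh.assoc[OF yar_hom[OF k] yar_hom[OF La] \<eta>P] yar_comp[OF k La] by simp
 {
  assume O: "orth P Q \<alpha>"
  obtain \<gamma> where g: "\<gamma> \<in> phom Q (rep (ob L P))" "pcomp \<gamma> \<alpha> = \<eta> P"
   using O LP \<eta>P unfolding orth_def by blast
  obtain k where k: "k \<in> hom C (ob L Q) (ob L P)" "pcomp (yar k) (\<eta> Q) = \<gamma>" by (rule \<eta>_univ[OF PQ(2) LP g(1)])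
  have kL: "k ** ar L \<alpha> = Id C (ob L P)"
   by (rule \<eta>_ext[OF PQ(1) comp_hom[OF k(1) La] id_hom[OF LP]])
    (use ca[OF k(1)] k(2) g(2) yar_id[OF LP] Psh.id_left[OF \<eta>P] in simp)
  note Lk = comp_hom[OF La k(1)]
  have "pcomp (pcomp (yar (ar L \<alpha> ** k)) (\<eta> Q)) \<alpha> = pcomp (\<eta> Q) \<alpha>"
   using ca[OF Lk] assoc[OF La k(1) La] kL id_right[OF La] L_\<eta>[OF a] by simp
  moreover have "\<exists>!\<gamma>. \<gamma> \<in> phom Q (rep (ob L Q)) \<and> pcomp \<gamma> \<alpha> = pcomp (\<eta> Q) \<alpha>"
   using O LQ Psh.comp_hom[OF \<eta>Q ah] unfolding orth_def by blast
  ultimately have "pcomp (yar (ar L \<alpha> ** k)) (\<eta> Q) = \<eta> Q"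
   using Psh.comp_hom[OF yar_hom[OF Lk] \<eta>Q] \<eta>Q by blast
  hence "ar L \<alpha> ** k = Id C (ob L Q)"
   using yar_id[OF LQ] Psh.id_left[OF \<eta>Q] by (intro \<eta>_ext[OF PQ(2) Lk id_hom[OF LQ]]) simp
  thus "is_iso C (ar L \<alpha>)" using isoI[OF La k(1) kL] by simp
 }
 assume "is_iso C (ar L \<alpha>)"
 then obtain k where k: "k \<in> hom C (ob L Q) (ob L P)" "k ** ar L \<alpha> = Id C (ob L P)" "ar L \<alpha> ** k = Id C (ob L Q)"
  using isoD[OF _ La] by blast
 show "orth P Q \<alpha>"
  unfolding orth_def
 proof (intro ballI)
  fix Z \<beta> assume Z: "Z \<in> Ob C" and b: "\<beta> \<in> phom P (rep Z)"
  obtain h where h: "h \<in> hom C (ob L P) Z" "pcomp (yar h) (\<eta> P) = \<beta>" by (rule \<eta>_univ[OF PQ(1) Z b])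
  note hk = comp_hom[OF h(1) k(1)]
  show "\<exists>!\<gamma>. \<gamma> \<in> phom Q (rep Z) \<and> pcomp \<gamma> \<alpha> = \<beta>"
  proof (rule ex1I[of _ "pcomp (yar (h ** k)) (\<eta> Q)"])
   have "pcomp (pcomp (yar (h ** k)) (\<eta> Q)) \<alpha> = \<beta>"
    using ca[OF hk] assoc[OF h(1) k(1) La] k(2) id_right[OF h(1)] h(2) by simp
   thus "pcomp (yar (h ** k)) (\<eta> Q) \<in> phom Q (rep Z) \<and> pcomp (pcomp (yar (h ** k)) (\<eta> Q)) \<alpha> = \<beta>"
    using Psh.comp_hom[OF yar_hom[OF hk] \<eta>Q] by simp
   fix \<gamma> assume g: "\<gamma> \<in> phom Q (rep Z) \<and> pcomp \<gamma> \<alpha> = \<beta>"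
   obtain l where l: "l \<in> hom C (ob L Q) Z" "pcomp (yar l) (\<eta> Q) = \<gamma>" by (rule \<eta>_univ[OF PQ(2) Z conjunct1[OF g]])
   have "l ** ar L \<alpha> = h"
    by (rule \<eta>_ext[OF PQ(1) comp_hom[OF l(1) La] h(1)]) (use ca[OF l(1)] l(2) g h(2) in simp)
   hence "h ** k = l" using assoc[OF l(1) La k(1)] k(3) id_right[OF l(1)] by simp
   thus "\<gamma> = pcomp (yar (h ** k)) (\<eta> Q)" using l(2) by simp
  qed
 qed
qed

private lemma sv_E: "gens y T ==> good T ==> sv y T \<in> Ob E"
 using sv_Phi_l_obs by (simp add: Phi_l_ob)

private lemma incl_E: "gens y T ==> good T ==> sv_incl y T \<in> hom E (sv y T) (rep y)"
 using E_hom[OF sv_E rep_E] sv_incl_hom gensD(1) by simp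

lemma exact_stable: stable
 unfolding stable_def
proof (intro allI impI, elim conjE)
 fix x T d f p q
 assume T: "good T" and E: "eff x T" and f: "f \<in> hom C d x" and pb: "\<forall>t\<in>T. is_pullback C f t (p t) (q t)"
 note G = eff_gens[OF E]
 have d: "d \<in> Ob C" using hom_ob[OF f] by simp
 have D: "p t \<in> hom C (Dom C (p t)) d" "q t \<in> hom C (Dom C (p t)) (Dom C t)" "f ** p t = t ** q t" if "t \<in> T" for t
  using pullbackD(1,2,4)[OF bspec[OF pb that] f] by auto
 have G': "gens d (p ` T)" using D(1) d by (simp add: gens_def)
 have T': "good (p ` T)" by (rule good_image[OF T]) (use pullback_mono[OF bspec[OF pb] f] in blast)
 have mem: "g \<in> ob (sv d (p ` T)) z \<longleftrightarrow> f ** g \<in> ob (sv x T) z" if g: "g \<in> hom C z d" for g z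
 proof -
  have z: "z \<in> Ob C" using hom_ob[OF g] by simp
  show ?thesis
  proof
   assume "g \<in> ob (sv d (p ` T)) z"
   then obtain t u where t: "t \<in> T" "u \<in> hom C z (Dom C (p t))" "g = p t ** u" using sv_el[OF G' z] by blast
   have "f ** g = t ** (q t ** u)" unfolding t(3) by (rule square[OF D(3)[OF t(1)] f D(1)[OF t(1)] gensD(2)[OF G t(1)] D(2)[OF t(1)] t(2)])
   thus "f ** g \<in> ob (sv x T) z" using sv_mem[OF G t(1) comp_hom[OF D(2)[OF t(1)] t(2)]] by simp
  next
   assume "f ** g \<in> ob (sv x T) z"
   then obtain t u where t: "t \<in> T" "u \<in> hom C z (Dom C t)" "f ** g = t ** u" using sv_el[OF G z] by blast
   obtain h where h: "h \<in> hom C z (Dom C (p t))" "p t ** h = g"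
    by (rule pullback_univ[OF bspec[OF pb t(1)] f gensD(2)[OF G t(1)] g t(2,3)])
   thus "g \<in> ob (sv d (p ` T)) z" using sv_mem[OF G' imageI[OF t(1)] h(1)] by simp
  qed
 qed
 let ?f = "mk_arr C (sv d (p ` T)) (sv x T) (\<lambda>z g. f ** g)"
 have fh: "?f \<in> phom (sv d (p ` T)) (sv x T)"
 proof (rule mk_arr_homI[OF sv_ob[OF G'] sv_ob[OF G]])
  show "f ** g \<in> ob (sv x T) z" if "z \<in> Ob C" "g \<in> ob (sv d (p ` T)) z" for z g
   using mem[OF sv_sub[OF G' that]] that(2) by simp
  fix w z k g assume k: "k \<in> hom C w z" and g: "g \<in> ob (sv d (p ` T)) z"
  have z: "z \<in> Ob C" using hom_ob[OF k] by simp
  note gh = sv_sub[OF G' z g]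
  show "f ** act (sv d (p ` T)) k g = act (sv x T) k (f ** g)"
   using sv_act[OF G' k g] sv_act[OF G k, of "f ** g"] mem[OF gh] g assoc[OF f gh k] by simp
 qed
 note svE = sv_E[OF G' T'] sv_E[OF G T] and repE = rep_E[OF d] rep_E[OF gensD(1)[OF G]]
 have fE': "?f \<in> hom E (sv d (p ` T)) (sv x T)" using fh E_hom[OF svE] by simp
 have yf: "yar f \<in> hom E (rep d) (rep x)" using yar_hom[OF f] E_hom[OF repE] by simp
 note i = incl_E[OF G T] and i' = incl_E[OF G' T']
 note ih = sv_incl_hom[OF G] and ih' = sv_incl_hom[OF G']
 have "is_pullback E (yar f) (sv_incl x T) (sv_incl d (p ` T)) ?f"
 proof (rule E.pullbackI[OF yf i i' fE'])
  have "pcomp (yar f) (sv_incl d (p ` T)) = pcomp (sv_incl x T) ?f"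
  proof (rule psh_ext[OF Psh.comp_hom[OF yar_hom[OF f] ih'] Psh.comp_hom[OF ih fh]])
   fix z g assume zg: "z \<in> Ob C" "g \<in> ob (sv d (p ` T)) z"
   note gh = sv_sub[OF G' zg]
   show "app (pcomp (yar f) (sv_incl d (p ` T))) z g = app (pcomp (sv_incl x T) ?f) z g"
    using app_comp[OF yar_hom[OF f] ih' zg] app_comp[OF ih fh zg] zg yar_app[OF f zg(1) gh] mem[OF gh] by simp
  qed
  thus "Comp E (yar f) (sv_incl d (p ` T)) = Comp E (sv_incl x T) ?f" using fullinD(4)[OF fE] by simp
 next
  fix W r s assume r: "r \<in> hom E W (rep d)" and s: "s \<in> hom E W (sv x T)" and e: "Comp E (yar f) r = Comp E (sv_incl x T) s"
  have W: "W \<in> Ob E" "W \<in> Ob (psh C)" using E.hom_ob[OF r] fullinD(2)[OF fE] by auto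
  note rh = fullin_hom(3)[OF fE r] and sh = fullin_hom(3)[OF fE s]
  have rin: "app r z w \<in> hom C z d" if "z \<in> Ob C" "w \<in> ob W z" for z w using app_in[OF rh that] that(1) by simp
  have fr: "f ** app r z w = app s z w" if zw: "z \<in> Ob C" "w \<in> ob W z" for z w
   using app_comp[OF yar_hom[OF f] rh zw] app_comp[OF ih sh zw] e fullinD(4)[OF fE] yar_app[OF f zw(1) rin[OF zw]] app_in[OF sh zw] zw(1) by simp
  have rmem: "app r z w \<in> ob (sv d (p ` T)) z" if zw: "z \<in> Ob C" "w \<in> ob W z" for z w
   using mem[OF rin[OF zw]] fr[OF zw] app_in[OF sh zw] by simp
  let ?h = "mk_arr C W (sv d (p ` T)) (app r)"
  have hh: "?h \<in> phom W (sv d (p ` T))"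
  proof (rule mk_arr_homI[OF W(2) sv_ob[OF G'] rmem])
   fix v z k w assume k: "k \<in> hom C v z" and w: "w \<in> ob W z"
   have z: "z \<in> Ob C" using hom_ob[OF k] by simp
   show "app r v (act W k w) = act (sv d (p ` T)) k (app r z w)"
    using app_nat[OF rh k w] rep_act[OF k rin[OF z w]] sv_act[OF G' k rmem[OF z w]] by simp
  qed
  have hE: "?h \<in> hom E W (sv d (p ` T))" using hh E_hom[OF W(1) svE(1)] by simp
  have "pcomp (sv_incl d (p ` T)) ?h = r"
   by (rule psh_ext[OF Psh.comp_hom[OF ih' hh] rh]) (use app_comp[OF ih' hh] rmem in simp)
  moreover have "pcomp ?f ?h = s"
   by (rule psh_ext[OF Psh.comp_hom[OF fh hh] sh]) (use app_comp[OF fh hh] rmem fr in simp)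
  moreover have "k = ?h" if k: "k \<in> phom W (sv d (p ` T))" "pcomp (sv_incl d (p ` T)) k = r" for k
  proof (rule psh_ext[OF k(1) hh])
   fix z w assume zw: "z \<in> Ob C" "w \<in> ob W z"
   show "app k z w = app ?h z w" using app_comp[OF ih' k(1) zw] k(2) app_in[OF k(1) zw] zw by simp
  qed
  ultimately show "\<exists>!h. h \<in> hom E W (sv d (p ` T)) \<and> Comp E (sv_incl d (p ` T)) h = r \<and> Comp E ?f h = s"
   using hE fullin_hom(3)[OF fE] fullinD(4)[OF fE] by (intro ex1I[of _ ?h]) auto
 qed
 from pullback_preserved[OF L lexL this]
 have PB: "is_pullback C (ar L (yar f)) (ar L (sv_incl x T)) (ar L (sv_incl d (p ` T))) (ar L ?f)" .
 have "is_iso C (ar L (sv_incl x T))" using orth_iff_iso[OF i] eff_iff_orth[OF G] E by simp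
 from pullback_iso[OF PB L_hom[OF yf] this] have "orth (sv d (p ` T)) (rep d) (sv_incl d (p ` T))" using orth_iff_iso[OF i'] by simp
 thus "eff d (p ` T)" using eff_iff_orth[OF G'] by simp
qed

lemma exact_factorises: factorises
 unfolding factorises_def
proof (intro allI impI, elim conjE)
 fix x T assume G: "gens x T" and T: "good T"
 let ?S = "sv x T"
 note S = sv_E[OF G T] and x = gensD(1)[OF G] and ih = sv_incl_hom[OF G] and iE = incl_E[OF G T]
 let ?M = "ob L ?S"
 note M = L_ob[OF S] and \<eta>h = \<eta>_hom(2)[OF S]
 define e where "e t = app (\<eta> ?S) (Dom C t) t" for t
 have eh: "e t \<in> hom C (Dom C t) ?M" if t: "t \<in> T" for t
  using app_in[OF \<eta>h gensD(3)[OF G t] sv_gen[OF G t]] gensD(3)[OF G t] by (simp add: e_def)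
 have de: "Dom C (e t) = Dom C t" if "t \<in> T" for t using eh[OF that] by (simp add: hom_def)
 obtain m where m: "m \<in> hom C ?M x" "pcomp (yar m) (\<eta> ?S) = sv_incl x T" by (rule \<eta>_univ[OF S x ih])
 have ya: "app (pcomp (yar h) (\<eta> ?S)) (Dom C t) t = h ** e t" if h: "h \<in> hom C ?M Z" and t: "t \<in> T" for h t Z
  using app_comp[OF yar_hom[OF h] \<eta>h gensD(3)[OF G t] sv_gen[OF G t]] yar_app[OF h gensD(3)[OF G t] eh[OF t]] by (simp add: e_def)
 have me: "m ** e t = t" if t: "t \<in> T" for t
  using ya[OF m(1) t] m(2) gensD(3)[OF G t] sv_gen[OF G t] by simp
 have Ge: "gens ?M (e ` T)" using eh de M by (simp add: gens_def)
 have eu: "app (\<eta> ?S) z (t ** u) = e t ** u" if t: "t \<in> T" and u: "u \<in> hom C z (Dom C t)" for t u z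
  using app_nat[OF \<eta>h u sv_gen[OF G t]] sv_act[OF G u sv_gen[OF G t]] rep_act[OF u eh[OF t]] by (simp add: e_def)
 have "eff ?M (e ` T)"
 proof (rule effI[OF Ge])
  fix r Z assume c: "compat (e ` T) r Z"
  have re: "r (e t) \<in> hom C (Dom C t) Z" if "t \<in> T" for t using compatD(2)[OF c imageI[OF that]] de[OF that] by simp
  have "compat T (\<lambda>t. r (e t)) Z"
  proof (rule compatI[OF compatD(1)[OF c] re])
   fix t t' z u u' assume t: "t \<in> T" "t' \<in> T" and u: "u \<in> hom C z (Dom C t)" "u' \<in> hom C z (Dom C t')" and eq: "t ** u = t' ** u'"
   have "e t ** u = e t' ** u'" using eu[OF t(1) u(1)] eu[OF t(2) u(2)] eq by simp
   thus "r (e t) ** u = r (e t') ** u'"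
    using compatD(3)[OF c imageI[OF t(1)] imageI[OF t(2)], unfolded de[OF t(1)] de[OF t(2)], OF u] by simp
  qed
  then obtain \<beta> where b: "\<beta> \<in> phom ?S (rep Z)" "\<And>t. t \<in> T ==> app \<beta> (Dom C t) t = r (e t)"
   by (rule map_of_compat[OF G]) blast
  obtain h where h: "h \<in> hom C ?M Z" "pcomp (yar h) (\<eta> ?S) = \<beta>" by (rule \<eta>_univ[OF S compatD(1)[OF c] b(1)])
  have "h ** e t = r (e t)" if "t \<in> T" for t using ya[OF h(1) that] h(2) b(2)[OF that] by simp
  thus "\<exists>h\<in>hom C ?M Z. \<forall>t\<in>e ` T. h ** t = r t" using h(1) by blast
 next
  fix h h' Z assume h: "h \<in> hom C ?M Z" "h' \<in> hom C ?M Z" and eq: "\<And>t. t \<in> e ` T ==> h ** t = h' ** t"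
  show "h = h'"
  proof (rule \<eta>_ext[OF S h])
   show "pcomp (yar h) (\<eta> ?S) = pcomp (yar h') (\<eta> ?S)"
    by (rule sv_hom_ext[OF G Psh.comp_hom[OF yar_hom[OF h(1)] \<eta>h] Psh.comp_hom[OF yar_hom[OF h(2)] \<eta>h]])
     (simp add: ya[OF h(1)] ya[OF h(2)] eq)
  qed
 qed
 moreover have "is_mono C m"
 proof -
  have "is_mono E (sv_incl x T)"
  proof (rule E.monoI[OF iE])
   fix W r s assume r: "r \<in> hom E W ?S" "s \<in> hom E W ?S" "Comp E (sv_incl x T) r = Comp E (sv_incl x T) s"
   thus "r = s"
    using Psh.monoD[OF sv_incl_mono[OF G] ih fullin_hom(3)[OF fE r(1)] fullin_hom(3)[OF fE r(2)]] fullinD(4)[OF fE] by simp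
  qed
  from mono_preserved[OF L lexL this] have Lm: "is_mono C (ar L (sv_incl x T))" .
  note rx = rep_E[OF x]
  note Lx = L_ob[OF rx] and \<eta>x = \<eta>_hom(2)[OF rx]
  note j = yar_full[OF \<eta>x x]
  let ?j = "app (\<eta> (rep x)) x (Id C x)"
  have "pcomp (yar (?j ** m)) (\<eta> ?S) = pcomp (yar ?j) (sv_incl x T)"
   using yar_comp[OF j(1) m(1)] Psh.assoc[OF yar_hom[OF j(1)] yar_hom[OF m(1)] \<eta>h] m(2) by simp
  also have "\<dots> = pcomp (yar (ar L (sv_incl x T))) (\<eta> ?S)" using L_\<eta>[OF iE] unfolding j(2)[symmetric] by simp
  finally have "?j ** m = ar L (sv_incl x T)" by (rule \<eta>_ext[OF S comp_hom[OF j(1) m(1)] L_hom[OF iE]])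
  hence jm: "is_mono C (?j ** m)" using Lm by simp
  show ?thesis
  proof (rule monoI[OF m(1)])
   fix w r s assume r: "r \<in> hom C w ?M" "s \<in> hom C w ?M" and eq: "m ** r = m ** s"
   show "r = s"
    by (rule monoD[OF jm comp_hom[OF j(1) m(1)] r]) (use assoc[OF j(1) m(1) r(1)] assoc[OF j(1) m(1) r(2)] eq in simp)
  qed
 qed
 ultimately show "\<exists>M m e. is_mono C m \<and> m \<in> hom C M x \<and> (\<forall>t\<in>T. e t \<in> hom C (Dom C t) M \<and> m ** e t = t) \<and> eff M (e ` T)"
  using m(1) eh me by blast
qed

end

lemma exact_imp_coherent:
 assumes "Phi_exact weights_coh C"
 shows "coherent_category C"
proof -
 obtain L \<theta> where "is_adjunction (Phi_l weights_coh C) C L (yoneda C) \<theta>" "preserves_finite_limits (Phi_l weights_coh C) C L"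
  using assms unfolding Phi_exact_def left_adjoint_def by blast
 from coherentI[OF exact_factorises[OF this] exact_stable[OF this]] show ?thesis .
qed

end

section \<open>Finite covers in a coherent category\<close>

locale coh = lexp C for C :: "('o, 'u) cat" +
 assumes coherent: "coherent_category C"
begin

lemma coherentD:
 shows "is_pullback C f f p q ==> \<exists>e. is_coequaliser C p q e"
  and "is_regular_epi C e ==> is_pullback C f e p q ==> is_regular_epi C p"
  and "x \<in> Ob C ==> finite S ==> (\<And>s. s \<in> S ==> is_subobject C x s) ==> \<exists>m. is_union C x S m"
  and "f \<in> Arr C ==> is_union C (Cod C f) (s ` {..<n}) m ==> (\<And>i. i < n ==> \<exists>t. is_pullback C f (s i) (s' i) t) ==>
   is_pullback C f m m' k ==> is_union C (Dom C f) (s' ` {..<(n :: nat)}) m'"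
proof -
 note c = coherent[unfolded coherent_category_def regular_category_def is_kernel_pair_def]
 note r = conjunct2[OF conjunct1[OF c]] and u = conjunct2[OF c]
 show "is_pullback C f f p q ==> \<exists>e. is_coequaliser C p q e"
  by (rule conjunct1[OF r, rule_format])
 show "is_regular_epi C e ==> is_pullback C f e p q ==> is_regular_epi C p"
  by (rule conjunct2[OF r, rule_format]) (rule conjI)
 show "x \<in> Ob C ==> finite S ==> (\<And>s. s \<in> S ==> is_subobject C x s) ==> \<exists>m. is_union C x S m"
  by (rule bspec[OF conjunct1[OF u], THEN spec, THEN mp]) (assumption, intro conjI ballI)
 show "f \<in> Arr C ==> is_union C (Cod C f) (s ` {..<n}) m ==> (\<And>i. i < n ==> \<exists>t. is_pullback C f (s i) (s' i) t) ==>
   is_pullback C f m m' k ==> is_union C (Dom C f) (s' ` {..<n}) m'"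
  by (rule bspec[OF conjunct2[OF u], THEN spec, THEN spec, THEN spec, THEN spec, THEN spec, THEN mp])
   (assumption, intro conjI allI impI, assumption, simp, rule exI)
qed

lemma regular_epi_lift:
 assumes e: "is_regular_epi C e" "e \<in> hom C x y" and m: "m \<in> hom C y d" and n: "is_mono C n" "n \<in> hom C N d"
  and k: "k \<in> hom C x N" "n ** k = m ** e"
 shows "\<exists>h\<in>hom C y N. n ** h = m"
proof -
 have "eff y {e}" "Dom C e = x" using regular_epi_eff(1)[OF e(1)] e(2) by (auto simp: hom_def)
 from eff_sub_le[OF this(1) m n] show ?thesis using k \<open>Dom C e = x\<close> by auto
qed

lemma regular_epi_epi:
 assumes e: "is_regular_epi C e" "e \<in> hom C x y" and h: "h \<in> hom C y z" "h' \<in> hom C y z" and eq: "h ** e = h' ** e"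
 shows "h = h'"
proof -
 have "eff y {e}" using regular_epi_eff(1)[OF e(1)] e(2) by (auto simp: hom_def)
 from eff_ext[OF this h] show ?thesis using eq by simp
qed

lemma regular_epi_pullback:
 assumes e: "is_regular_epi C e" "e \<in> hom C x y" and f: "f \<in> hom C d y"
 obtains l p q where "p \<in> hom C l d" "q \<in> hom C l x" "f ** p = e ** q" "is_regular_epi C p"
proof -
 obtain l p q where p: "p \<in> hom C l d" "q \<in> hom C l x" "is_pullback C f e p q" by (rule pullback_exists[OF f e(2)])
 have "is_regular_epi C p" by (rule coherentD(2)[OF e(1) p(3)])
 thus ?thesis by (rule that[OF p(1,2) pullbackD(4)[OF p(3) f]])
qed

lemma image:
 assumes f: "f \<in> hom C x y"
 obtains M m e where "m \<in> hom C M y" "is_mono C m" "e \<in> hom C x M" "is_regular_epi C e" "m ** e = f"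
proof -
 obtain l p q where p: "p \<in> hom C l x" "q \<in> hom C l x" and pb: "is_pullback C f f p q" by (rule pullback_exists[OF f f])
 obtain e where ce: "is_coequaliser C p q e" by (rule exE[OF coherentD(1)[OF pb]])
 note c = coequaliserD[OF ce]
 have cx: "Cod C p = x" using p(1) by (simp add: hom_def)
 let ?M = "Cod C e"
 have e: "e \<in> hom C x ?M" using c(1) cx by simp
 have re: "is_regular_epi C e" using ce by (auto simp: is_regular_epi_def)
 obtain m where m: "m \<in> hom C ?M y" "m ** e = f"
  using c(5)[unfolded cx, OF f pullbackD(4)[OF pb f]] by blast
 have "is_mono C m"
 proof (rule monoI[OF m(1)])
  fix w r s assume r: "r \<in> hom C w ?M" and s: "s \<in> hom C w ?M" and eq: "m ** r = m ** s"
  obtain w1 a a' where a: "a \<in> hom C w1 w" "a' \<in> hom C w1 x" "r ** a = e ** a'" "is_regular_epi C a"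
   by (rule regular_epi_pullback[OF re e r])
  note sa = comp_hom[OF s a(1)] and ra = comp_hom[OF r a(1)]
  obtain w2 b b' where b: "b \<in> hom C w2 w1" "b' \<in> hom C w2 x" "(s ** a) ** b = e ** b'" "is_regular_epi C b"
   by (rule regular_epi_pullback[OF re e sa])
  note a'b = comp_hom[OF a(2) b(1)]
  have 1: "(r ** a) ** b = e ** (a' ** b)" unfolding a(3) by (rule assoc[OF e a(2) b(1)])
  have "f ** (a' ** b) = m ** ((r ** a) ** b)" unfolding 1 m(2)[symmetric] by (rule assoc[OF m(1) e a'b])
  also have "\<dots> = (m ** r) ** (a ** b)" using assoc[OF r a(1) b(1)] assoc[OF m(1) r comp_hom[OF a(1) b(1)]] by simp
  also have "\<dots> = m ** ((s ** a) ** b)" unfolding eq using assoc[OF s a(1) b(1)] assoc[OF m(1) s comp_hom[OF a(1) b(1)]] by simp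
  also have "\<dots> = f ** b'" unfolding b(3) m(2)[symmetric] by (rule assoc[OF m(1) e b(2), symmetric])
  finally obtain h where h: "h \<in> hom C w2 (Dom C p)" "p ** h = a' ** b" "q ** h = b'"
   by (rule pullback_univ[OF pb f f a'b b(2)])
  have "Dom C p = l" using p(1) by (simp add: hom_def)
  hence h1: "h \<in> hom C w2 l" using h(1) by simp
  have "e ** (a' ** b) = e ** b'" using square[OF c(2) e p(1) e p(2) h1] h(2,3) by simp
  hence "(r ** a) ** b = (s ** a) ** b" using 1 b(3) by simp
  hence "r ** a = s ** a" by (rule regular_epi_epi[OF b(4,1) ra sa])
  thus "r = s" by (rule regular_epi_epi[OF a(4,1) r s])
 qed
 thus ?thesis by (rule that[OF m(1) _ e re m(2)])
qed

definition cov :: "'o => 'u set => bool" where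
 "cov x T \<longleftrightarrow> gens x T \<and> finite T \<and> (\<forall>n N. is_mono C n --> n \<in> hom C N x -->
  (\<forall>t\<in>T. \<exists>k\<in>hom C (Dom C t) N. n ** k = t) --> is_iso C n)"

lemma covD:
 assumes "cov x T"
 shows "gens x T" "finite T" "x \<in> Ob C" "t \<in> T ==> t \<in> hom C (Dom C t) x"
  "is_mono C n ==> n \<in> hom C N x ==> (\<And>t. t \<in> T ==> \<exists>k\<in>hom C (Dom C t) N. n ** k = t) ==> is_iso C n"
 using assms gensD unfolding cov_def by blast+

lemma covI:
 assumes "gens x T" "finite T"
  "\<And>n N. is_mono C n ==> n \<in> hom C N x ==> (\<And>t. t \<in> T ==> \<exists>k\<in>hom C (Dom C t) N. n ** k = t) ==> is_iso C n"
 shows "cov x T"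
 using assms unfolding cov_def by blast

lemma cov_id: "x \<in> Ob C ==> cov x {Id C x}"
proof (rule covI)
 assume x: "x \<in> Ob C"
 have d: "Dom C (Id C x) = x" using id_hom[OF x] by (simp add: hom_def)
 show "gens x {Id C x}" using x id_hom[OF x] d by (simp add: gens_def)
 fix n N assume n: "is_mono C n" "n \<in> hom C N x" and k: "\<And>t. t \<in> {Id C x} ==> \<exists>k\<in>hom C (Dom C t) N. n ** k = t"
 obtain k where "k \<in> hom C x N" "n ** k = Id C x" using k[of "Id C x"] d by auto
 thus "is_iso C n" by (rule mono_split_iso[OF n])
qed simp

lemma cov_factor:
 assumes G: "gens x T" and fin: "finite T"
 obtains M m e where "is_mono C m" "m \<in> hom C M x" "\<And>t. t \<in> T ==> e t \<in> hom C (Dom C t) M \<and> m ** e t = t" "cov M (e ` T)"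
proof -
 have "\<exists>M m e. m \<in> hom C M x \<and> is_mono C m \<and> e \<in> hom C (Dom C t) M \<and> is_regular_epi C e \<and> m ** e = t" if t: "t \<in> T" for t
  by (rule image[OF gensD(2)[OF G t]]) blast
 then obtain N i r where N: "\<And>t. t \<in> T ==> i t \<in> hom C (N t) x \<and> is_mono C (i t) \<and> r t \<in> hom C (Dom C t) (N t) \<and> is_regular_epi C (r t) \<and> i t ** r t = t"
  by metis
 have "is_subobject C x s" if "s \<in> i ` T" for s using that N subobjectI by blast
 from coherentD(3)[OF gensD(1)[OF G] finite_imageI[OF fin] this] obtain m where m: "is_union C x (i ` T) m" by (rule exE)
 let ?M = "Dom C m"
 note mh = subobject_hom[OF is_unionD(2)[OF m]]
 have "\<exists>k\<in>hom C (N t) ?M. m ** k = i t" if t: "t \<in> T" for t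
  using is_unionD(3)[OF m imageI[OF t]] N[OF t] by (auto simp: sub_le_def hom_def)
 then obtain k where k: "\<And>t. t \<in> T ==> k t \<in> hom C (N t) ?M" "\<And>t. t \<in> T ==> m ** k t = i t" by metis
 define e where "e t = k t ** r t" for t
 have eh: "e t \<in> hom C (Dom C t) ?M \<and> m ** e t = t" if t: "t \<in> T" for t
  using comp_hom[OF k(1)[OF t]] N[OF t] assoc[OF mh(1) k(1)[OF t]] k(2)[OF t] by (auto simp: e_def)
 have de: "Dom C (e t) = Dom C t" if "t \<in> T" for t using eh[OF that] by (simp add: hom_def)
 have "cov ?M (e ` T)"
 proof (rule covI)
  show "gens ?M (e ` T)" using eh de hom_ob[OF mh(1)] by (simp add: gens_def)
  show "finite (e ` T)" using fin by simp
  fix n L assume n: "is_mono C n" "n \<in> hom C L ?M" and f: "\<And>t. t \<in> e ` T ==> \<exists>k\<in>hom C (Dom C t) L. n ** k = t"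
  note mn = comp_mono[OF mh(2,1) n] comp_hom[OF mh(1) n(2)]
  have dmn: "Dom C (m ** n) = L" using mn(2) by (simp add: hom_def)
  have "sub_le C m (m ** n)"
  proof (rule is_unionD(4)[OF m subobjectI[OF mn]])
   fix s assume "s \<in> i ` T"
   then obtain t where t: "t \<in> T" "s = i t" by blast
   note Nt = N[OF t(1)]
   have i: "i t \<in> hom C (N t) x" and r: "r t \<in> hom C (Dom C t) (N t)" "is_regular_epi C (r t)" and ir: "i t ** r t = t" using Nt by auto
   obtain l where l: "l \<in> hom C (Dom C t) L" "n ** l = e t" using f[OF imageI[OF t(1)]] de[OF t(1)] by auto
   have "(m ** n) ** l = i t ** r t" using assoc[OF mh(1) n(2) l(1)] l(2) eh[OF t(1)] ir by simp
   from regular_epi_lift[OF r(2,1) i mn l(1) this] obtain h where h: "h \<in> hom C (N t) L" "(m ** n) ** h = i t" by blast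
   show "sub_le C s (m ** n)" using sub_leI[OF h(1) _ dmn] h(2) t(2) i by (simp add: hom_def)
  qed
  then obtain h where h: "h \<in> hom C ?M L" "(m ** n) ** h = m" using dmn by (auto simp: sub_le_def)
  have "m ** (n ** h) = m ** Id C ?M" using assoc[OF mh(1) n(2) h(1)] h(2) id_right[OF mh(1)] by simp
  hence "n ** h = Id C ?M"
   by (rule monoD[OF mh(2,1) comp_hom[OF n(2) h(1)] id_hom[OF conjunct1[OF hom_ob[OF mh(1)]]]])
  thus "is_iso C n" by (rule mono_split_iso[OF n h(1)])
 qed
 thus ?thesis using that[OF mh(2,1), of e] eh by blast
qed

lemma cov_pullback:
 assumes T: "cov x T" and f: "f \<in> hom C d x"
 obtains T' where "cov d T'" "\<And>s. s \<in> T' ==> \<exists>t\<in>T. \<exists>u\<in>hom C (Dom C s) (Dom C t). f ** s = t ** u"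
proof -
 have "\<exists>M m e. m \<in> hom C M x \<and> is_mono C m \<and> e \<in> hom C (Dom C t) M \<and> is_regular_epi C e \<and> m ** e = t" if t: "t \<in> T" for t
  by (rule image[OF covD(4)[OF T t]]) blast
 then obtain N i r where N: "\<And>t. t \<in> T ==> i t \<in> hom C (N t) x" "\<And>t. t \<in> T ==> is_mono C (i t)"
  "\<And>t. t \<in> T ==> r t \<in> hom C (Dom C t) (N t)" "\<And>t. t \<in> T ==> is_regular_epi C (r t)" "\<And>t. t \<in> T ==> i t ** r t = t"
  by metis
 note Tfin = covD(2)[OF T]
 have un: "is_union C x (i ` T) (Id C x)"
 proof (rule is_unionI)
  note ix = id_hom[OF covD(3)[OF T]]
  show "is_subobject C x s" if "s \<in> i ` T" for s using that N subobjectI by blast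
  show "is_subobject C x (Id C x)" by (rule subobjectI[OF mono_Id[OF covD(3)[OF T]] ix])
  show "sub_le C s (Id C x)" if s: "s \<in> i ` T" for s
  proof -
   obtain t where t: "t \<in> T" "s = i t" using s by blast
   show ?thesis unfolding t(2) by (rule sub_leI[OF N(1)[OF t(1)]]) (use N(1)[OF t(1)] ix id_left[OF N(1)[OF t(1)]] in "auto simp: hom_def")
  qed
  fix n assume n: "is_subobject C x n" and le: "\<And>s. s \<in> i ` T ==> sub_le C s n"
  note nh = subobject_hom[OF n]
  have "is_iso C n"
  proof (rule covD(5)[OF T nh(2,1)])
   fix t assume t: "t \<in> T"
   obtain k where k: "k \<in> hom C (N t) (Dom C n)" "n ** k = i t" using le[OF imageI[OF t]] N(1)[OF t] by (auto simp: sub_le_def hom_def)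
   show "\<exists>k\<in>hom C (Dom C t) (Dom C n). n ** k = t"
    by (rule bexI[OF _ comp_hom[OF k(1) N(3)[OF t]]]) (simp add: assoc[OF nh(1) k(1) N(3)[OF t], symmetric] k(2) N(5)[OF t])
  qed
  from isoD[OF this nh(1)] obtain g where g: "g \<in> hom C x (Dom C n)" "n ** g = Id C x" by blast
  show "sub_le C (Id C x) n" by (rule sub_leI[OF g(1) _ _ g(2)]) (use ix in "auto simp: hom_def")
 qed
 have "\<exists>l p q. p \<in> hom C l d \<and> q \<in> hom C l (N t) \<and> is_pullback C f (i t) p q" if t: "t \<in> T" for t
  by (rule pullback_exists[OF f N(1)[OF t]]) blast
 then obtain A p q where p: "\<And>t. t \<in> T ==> p t \<in> hom C (A t) d" "\<And>t. t \<in> T ==> q t \<in> hom C (A t) (N t)"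
  "\<And>t. t \<in> T ==> is_pullback C f (i t) (p t) (q t)" by metis
 have d: "d \<in> Ob C" using hom_ob[OF f] by simp
 have un': "is_union C d (p ` T) (Id C d)"
 proof -
  obtain \<tau> and n :: nat where \<tau>: "T = \<tau> ` {..<n}" using Tfin finite_imp_nat_seg_image_inj_on[OF Tfin] lessThan_def by metis
  have pbI: "is_pullback C f (Id C x) (Id C d) f"
  proof (rule pullbackI[OF f id_hom[OF covD(3)[OF T]] id_hom[OF d] f])
   show "f ** Id C d = Id C x ** f" using id_left[OF f] id_right[OF f] by simp
   fix w r s assume r: "r \<in> hom C w d" "s \<in> hom C w x" "f ** r = Id C x ** s"
   show "\<exists>!h. h \<in> hom C w d \<and> Id C d ** h = r \<and> f ** h = s"
   proof (rule ex1I[of _ r])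
    show "r \<in> hom C w d \<and> Id C d ** r = r \<and> f ** r = s" using r id_left[OF r(1)] id_left[OF r(2)] by simp
    show "h = r" if h: "h \<in> hom C w d \<and> Id C d ** h = r \<and> f ** h = s" for h using id_left[OF conjunct1[OF h]] h by simp
   qed
  qed
  have pb: "\<exists>t. is_pullback C f ((i \<circ> \<tau>) j) ((p \<circ> \<tau>) j) t" if "j < n" for j using p(3)[of "\<tau> j"] \<tau> that by auto
  have im: "(i \<circ> \<tau>) ` {..<n} = i ` T" "(p \<circ> \<tau>) ` {..<n} = p ` T" by (auto simp: \<tau> image_comp)
  have fA: "f \<in> Arr C" "Cod C f = x" "Dom C f = d" using f by (auto simp: hom_def)
  from coherentD(4)[OF fA(1), of "i \<circ> \<tau>" n "Id C x" "p \<circ> \<tau>" "Id C d" f, unfolded im fA(2,3)]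
  show ?thesis using un pb pbI by simp
 qed
 have "\<exists>l e u. e \<in> hom C l (A t) \<and> u \<in> hom C l (Dom C t) \<and> q t ** e = r t ** u \<and> is_regular_epi C e" if t: "t \<in> T" for t
  by (rule regular_epi_pullback[OF N(4)[OF t] N(3)[OF t] p(2)[OF t]]) blast
 then obtain B e u where e: "\<And>t. t \<in> T ==> e t \<in> hom C (B t) (A t)" "\<And>t. t \<in> T ==> u t \<in> hom C (B t) (Dom C t)"
  "\<And>t. t \<in> T ==> q t ** e t = r t ** u t" "\<And>t. t \<in> T ==> is_regular_epi C (e t)" by metis
 define s where "s t = p t ** e t" for t
 have sh: "s t \<in> hom C (B t) d" if t: "t \<in> T" for t unfolding s_def by (rule comp_hom[OF p(1)[OF t] e(1)[OF t]])
 have ds: "Dom C (s t) = B t" if "t \<in> T" for t using sh[OF that] by (simp add: hom_def)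
 have "cov d (s ` T)"
 proof (rule covI)
  show "gens d (s ` T)" using d sh ds by (simp add: gens_def)
  show "finite (s ` T)" using Tfin by simp
  fix n L assume n: "is_mono C n" "n \<in> hom C L d" and fa: "\<And>t. t \<in> s ` T ==> \<exists>k\<in>hom C (Dom C t) L. n ** k = t"
  have dn: "Dom C n = L" using n(2) by (simp add: hom_def)
  have "sub_le C (Id C d) n"
  proof (rule is_unionD(4)[OF un' subobjectI[OF n]])
   fix a assume "a \<in> p ` T"
   then obtain t where t: "t \<in> T" "a = p t" by blast
   obtain k where k: "k \<in> hom C (B t) L" "n ** k = s t" using fa[OF imageI[OF t(1)]] ds[OF t(1)] by auto
   have "n ** k = p t ** e t" using k(2) by (simp add: s_def)
   from regular_epi_lift[OF e(4)[OF t(1)] e(1)[OF t(1)] p(1)[OF t(1)] n k(1) this]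
   obtain h where h: "h \<in> hom C (A t) L" "n ** h = p t" by blast
   show "sub_le C a n" using sub_leI[OF h(1) _ dn] h(2) t(2) p(1)[OF t(1)] by (simp add: hom_def)
  qed
  then obtain h where h: "h \<in> hom C d L" "n ** h = Id C d" using dn id_hom[OF d] by (auto simp: sub_le_def hom_def)
  thus "is_iso C n" by (rule mono_split_iso[OF n])
 qed
 moreover have "\<exists>t\<in>T. \<exists>u\<in>hom C (Dom C a) (Dom C t). f ** a = t ** u" if "a \<in> s ` T" for a
 proof -
  obtain t where t: "t \<in> T" "a = s t" using \<open>a \<in> s ` T\<close> by blast
  have "f ** s t = i t ** (q t ** e t)" unfolding s_def
   by (rule square[OF pullbackD(4)[OF p(3)[OF t(1)] f] f p(1)[OF t(1)] N(1)[OF t(1)] p(2)[OF t(1)] e(1)[OF t(1)]])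
  also have "\<dots> = t ** u t" unfolding e(3)[OF t(1)] using assoc[OF N(1)[OF t(1)] N(3)[OF t(1)] e(2)[OF t(1)]] N(5)[OF t(1)] by simp
  finally show ?thesis using t e(2)[OF t(1)] ds[OF t(1)] by auto
 qed
 ultimately show ?thesis by (rule that)
qed

lemma cov_trans:
 assumes T: "cov z T" and S: "\<And>t. t \<in> T ==> cov (Dom C t) (S t)"
 shows "cov z (\<Union>t\<in>T. (\<lambda>s. t ** s) ` S t)"
proof (rule covI)
 have h: "t ** s \<in> hom C (Dom C s) z" if "t \<in> T" "s \<in> S t" for t s
  by (rule comp_hom[OF covD(4)[OF T that(1)] covD(4)[OF S[OF that(1)] that(2)]])
 have d: "Dom C (t ** s) = Dom C s" if "t \<in> T" "s \<in> S t" for t s using h[OF that] by (simp add: hom_def)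
 show "gens z (\<Union>t\<in>T. (\<lambda>s. t ** s) ` S t)" using h d covD(3)[OF T] by (auto simp: gens_def)
 show "finite (\<Union>t\<in>T. (\<lambda>s. t ** s) ` S t)" using covD(2)[OF T] covD(2)[OF S] by simp
 fix n N assume n: "is_mono C n" "n \<in> hom C N z"
  and f: "\<And>t. t \<in> (\<Union>t\<in>T. (\<lambda>s. t ** s) ` S t) ==> \<exists>k\<in>hom C (Dom C t) N. n ** k = t"
 show "is_iso C n"
 proof (rule covD(5)[OF T n])
  fix t assume t: "t \<in> T"
  note th = covD(4)[OF T t]
  obtain l p q where p: "p \<in> hom C l (Dom C t)" "q \<in> hom C l N" and pb: "is_pullback C t n p q" by (rule pullback_exists[OF th n(2)])
  have dp: "Dom C p = l" using p(1) by (simp add: hom_def)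
  have "is_iso C p"
  proof (rule covD(5)[OF S[OF t] pullback_mono[OF pb th n(1)] p(1)])
   fix s assume s: "s \<in> S t"
   obtain k where k: "k \<in> hom C (Dom C s) N" "n ** k = t ** s" using f[of "t ** s"] t s d[OF t s] by auto
   obtain h where h: "h \<in> hom C (Dom C s) (Dom C p)" "p ** h = s"
    by (rule pullback_univ[OF pb th n(2) covD(4)[OF S[OF t] s] k(1) k(2)[symmetric]])
   thus "\<exists>k\<in>hom C (Dom C s) l. p ** k = s" using dp by auto
  qed
  from isoD[OF this p(1)] obtain g where g: "g \<in> hom C (Dom C t) l" "p ** g = Id C (Dom C t)" by blast
  have "t ** (p ** g) = n ** (q ** g)" by (rule square[OF pullbackD(4)[OF pb th] th p(1) n(2) p(2) g(1)])
  hence "n ** (q ** g) = t" using g(2) id_right[OF th] by simp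
  thus "\<exists>k\<in>hom C (Dom C t) N. n ** k = t" using comp_hom[OF p(2) g(1)] by blast
 qed
qed

lemma cov_ext:
 assumes T: "cov z T" and h: "h \<in> hom C z Z" "h' \<in> hom C z Z" and eq: "\<And>t. t \<in> T ==> h ** t = h' ** t"
 shows "h = h'"
proof -
 obtain l e where e: "e \<in> hom C l z" "is_mono C e" "h ** e = h' ** e"
  "\<And>w r. r \<in> hom C w z ==> h ** r = h' ** r ==> \<exists>k \<in> hom C w l. e ** k = r" by (rule equaliser_exists[OF h]) blast
 have "is_iso C e" by (rule covD(5)[OF T e(2,1)]) (rule e(4)[OF covD(4)[OF T] eq])
 from isoD[OF this e(1)] obtain g where g: "g \<in> hom C z l" "e ** g = Id C z" by blast
 have "h ** (e ** g) = h' ** (e ** g)" by (rule square[OF e(3) h(1) e(1) h(2) e(1) g(1)])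
 thus ?thesis unfolding g(2) id_right[OF h(1)] id_right[OF h(2)] .
qed

definition loc :: "'o => ('u => bool) => bool" where
 "loc z \<Phi> \<longleftrightarrow> (\<exists>T. cov z T \<and> (\<forall>t\<in>T. \<Phi> t))"

definition closed :: "'o => ('u => bool) => bool" where
 "closed z \<Phi> \<longleftrightarrow> (\<forall>x y t u. t \<in> hom C y z --> u \<in> hom C x y --> \<Phi> t --> \<Phi> (t ** u))"

lemma closedI:
 "(\<And>x y t u. t \<in> hom C y z ==> u \<in> hom C x y ==> \<Phi> t ==> \<Phi> (t ** u)) ==> closed z \<Phi>"
 unfolding closed_def by blast

lemma closed_comp:
 assumes c: "closed c \<Phi>" and g: "g \<in> hom C z c"
 shows "closed z (\<lambda>t. \<Phi> (g ** t))"
proof (rule closedI)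
 fix x y t u assume t: "t \<in> hom C y z" and u: "u \<in> hom C x y" and "\<Phi> (g ** t)"
 hence "\<Phi> ((g ** t) ** u)" using c comp_hom[OF g t] unfolding closed_def by blast
 thus "\<Phi> (g ** (t ** u))" unfolding assoc[OF g t u] .
qed

lemma loc_ob: "loc z \<Phi> ==> z \<in> Ob C"
 using covD(3) unfolding loc_def by blast

lemma loc_triv: "z \<in> Ob C ==> \<Phi> (Id C z) ==> loc z \<Phi>"
 using cov_id unfolding loc_def by blast

lemma loc_trans:
 assumes L: "loc z \<Psi>" and s: "\<And>t. t \<in> hom C (Dom C t) z ==> \<Psi> t ==> loc (Dom C t) (\<lambda>s. s \<in> hom C (Dom C s) (Dom C t) --> \<Phi> (t ** s))"
 shows "loc z \<Phi>"
proof -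
 obtain T where T: "cov z T" "\<And>t. t \<in> T ==> \<Psi> t" using L unfolding loc_def by blast
 have "\<exists>S. cov (Dom C t) S \<and> (\<forall>s\<in>S. s \<in> hom C (Dom C s) (Dom C t) --> \<Phi> (t ** s))" if "t \<in> T" for t
  using s[OF covD(4)[OF T(1) that] T(2)[OF that]] unfolding loc_def .
 then obtain S where S: "\<And>t. t \<in> T ==> cov (Dom C t) (S t)" "\<And>t s. t \<in> T ==> s \<in> S t ==> s \<in> hom C (Dom C s) (Dom C t) --> \<Phi> (t ** s)" by metis
 have "cov z (\<Union>t\<in>T. (\<lambda>s. t ** s) ` S t)" by (rule cov_trans[OF T(1) S(1)])
 moreover have "\<Phi> a" if "a \<in> (\<Union>t\<in>T. (\<lambda>s. t ** s) ` S t)" for a using that S(2) covD(4)[OF S(1)] by blast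
 ultimately show ?thesis unfolding loc_def by blast
qed

lemma loc_mono:
 assumes L: "loc z \<Psi>" and s: "\<And>t. t \<in> hom C (Dom C t) z ==> \<Psi> t ==> \<Phi> t"
 shows "loc z \<Phi>"
 using assms covD(4) unfolding loc_def by blast

lemma loc_pull:
 assumes L: "loc x \<Phi>" and f: "f \<in> hom C d x" and c: "closed x \<Phi>"
 shows "loc d (\<lambda>s. \<Phi> (f ** s))"
proof -
 obtain T where T: "cov x T" "\<And>t. t \<in> T ==> \<Phi> t" using L unfolding loc_def by blast
 obtain T' where T': "cov d T'" "\<And>s. s \<in> T' ==> \<exists>t\<in>T. \<exists>u\<in>hom C (Dom C s) (Dom C t). f ** s = t ** u" by (rule cov_pullback[OF T(1) f]) blast
 have "\<Phi> (f ** s)" if s: "s \<in> T'" for s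
 proof -
  obtain t u where t: "t \<in> T" "u \<in> hom C (Dom C s) (Dom C t)" "f ** s = t ** u" using T'(2)[OF s] by blast
  show ?thesis unfolding t(3) using c covD(4)[OF T(1) t(1)] t(2) T(2)[OF t(1)] unfolding closed_def by blast
 qed
 thus ?thesis using T'(1) unfolding loc_def by blast
qed

lemma loc_eq:
 assumes "h \<in> hom C z Z" "h' \<in> hom C z Z" "loc z (\<lambda>t. h ** t = h' ** t)"
 shows "h = h'"
 using assms cov_ext unfolding loc_def by blast

lemma loc_all:
 assumes "finite J" "z \<in> Ob C" "\<And>j. j \<in> J ==> loc z (\<Phi> j)" "\<And>j. j \<in> J ==> closed z (\<Phi> j)"
 shows "loc z (\<lambda>t. \<forall>j\<in>J. \<Phi> j t)"
 using assms(1,3,4)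
proof (induction J)
 case empty
 show ?case using loc_triv[OF assms(2)] by simp
next
 case (insert j J)
 have cj: "closed z (\<Phi> j)" and lj: "loc z (\<Phi> j)" using insert.prems by auto
 have "loc z (\<lambda>t. \<forall>j\<in>J. \<Phi> j t)" using insert.IH insert.prems by blast
 thus ?case
 proof (rule loc_trans)
  fix t assume t: "t \<in> hom C (Dom C t) z" "\<forall>j\<in>J. \<Phi> j t"
  show "loc (Dom C t) (\<lambda>s. s \<in> hom C (Dom C s) (Dom C t) --> (\<forall>i\<in>insert j J. \<Phi> i (t ** s)))"
  proof (rule loc_mono[OF loc_pull[OF lj t(1) cj]])
   fix s assume s: "\<Phi> j (t ** s)"
   have "\<Phi> i (t ** s)" if "i \<in> J" "s \<in> hom C (Dom C s) (Dom C t)" for i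
    using insert.prems(2)[of i] that t unfolding closed_def by blast
   thus "s \<in> hom C (Dom C s) (Dom C t) --> (\<forall>i\<in>insert j J. \<Phi> i (t ** s))" using s by blast
  qed
 qed
qed

text \<open>The glued arrow is the one whose graph is the image of the pairs \<open>\<langle>t, r t\<rangle>\<close> in \<open>z \<times> Z\<close>: this image
  projects monomorphically to \<open>z\<close>, and \<open>T\<close> factors through it.\<close>

lemma cov_glue:
 assumes T: "cov z T" and r: "compat T r Z"
 obtains h where "h \<in> hom C z Z" "\<And>t. t \<in> T ==> h ** t = r t"
proof -
 note Z = compatD(1)[OF r] and rh = compatD(2)[OF r]
 obtain l p q where p: "p \<in> hom C l z" "q \<in> hom C l Z"
  "\<And>w r s. r \<in> hom C w z ==> s \<in> hom C w Z ==> \<exists>!h. h \<in> hom C w l \<and> p ** h = r \<and> q ** h = s"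
  by (rule product_exists[OF covD(3)[OF T] Z]) blast
 have "\<exists>g. g \<in> hom C (Dom C t) l \<and> p ** g = t \<and> q ** g = r t" if t: "t \<in> T" for t
  by (rule ex1_implies_ex[OF p(3)[OF covD(4)[OF T t] rh[OF t]]])
 then obtain g where g: "\<And>t. t \<in> T ==> g t \<in> hom C (Dom C t) l" "\<And>t. t \<in> T ==> p ** g t = t" "\<And>t. t \<in> T ==> q ** g t = r t" by metis
 have dg: "Dom C (g t) = Dom C t" if "t \<in> T" for t using g(1)[OF that] by (simp add: hom_def)
 have Gg: "gens l (g ` T)" using g(1) dg hom_ob[OF p(1)] by (simp add: gens_def)
 obtain R m e0 where m: "is_mono C m" "m \<in> hom C R l" and e0: "\<And>t. t \<in> g ` T ==> e0 t \<in> hom C (Dom C t) R \<and> m ** e0 t = t"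
  and cR: "cov R (e0 ` g ` T)" by (rule cov_factor[OF Gg]) (use covD(2)[OF T] in blast)+
 define e where "e t = e0 (g t)" for t
 have e: "e t \<in> hom C (Dom C t) R" "m ** e t = g t" if "t \<in> T" for t using e0[OF imageI[OF that]] dg[OF that] by (auto simp: e_def)
 have ce: "cov R (e ` T)" using cR by (simp add: e_def image_image)
 have de: "Dom C (e t) = Dom C t" if "t \<in> T" for t using e(1)[OF that] by (simp add: hom_def)
 let ?a = "p ** m" and ?b = "q ** m"
 note a = comp_hom[OF p(1) m(2)] and b = comp_hom[OF p(2) m(2)]
 have ae: "?a ** e t = t" "?b ** e t = r t" if t: "t \<in> T" for t
  using assoc[OF p(1) m(2) e(1)[OF t]] assoc[OF p(2) m(2) e(1)[OF t]] e(2)[OF t] g(2,3)[OF t] by auto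
 have aeu: "?a ** (e t ** u) = t ** u" "?b ** (e t ** u) = r t ** u" if t: "t \<in> T" and u: "u \<in> hom C w (Dom C t)" for t u w
  using assoc[OF a e(1)[OF t] u] assoc[OF b e(1)[OF t] u] ae[OF t] by auto
 let ?\<Phi> = "\<lambda>f. \<exists>t\<in>T. \<exists>k\<in>hom C (Dom C f) (Dom C t). f = e t ** k"
 have cl: "closed R ?\<Phi>"
 proof (rule closedI)
  fix x y f u assume f: "f \<in> hom C y R" and u: "u \<in> hom C x y" and "?\<Phi> f"
  then obtain t k where t: "t \<in> T" "k \<in> hom C y (Dom C t)" "f = e t ** k" by (auto simp: hom_def)
  have "Dom C (f ** u) = x" using comp_hom[OF f u] by (simp add: hom_def)
  moreover have "f ** u = e t ** (k ** u)" unfolding t(3) by (rule assoc[OF e(1)[OF t(1)] t(2) u])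
  ultimately show "?\<Phi> (f ** u)" using t(1) comp_hom[OF t(2) u] by blast
 qed
 have "?\<Phi> (e t)" if t: "t \<in> T" for t
 proof -
  have "Dom C t \<in> Ob C" using hom_ob[OF e(1)[OF t]] by simp
  thus ?thesis using t id_right[OF e(1)[OF t]] id_hom de[OF t] by (intro bexI[of _ t] bexI[of _ "Id C (Dom C t)"]) auto
 qed
 hence LR: "loc R ?\<Phi>" using ce unfolding loc_def by blast
 have am: "is_mono C ?a"
 proof (rule monoI[OF a])
  fix w u v assume u: "u \<in> hom C w R" and v: "v \<in> hom C w R" and eq: "?a ** u = ?a ** v"
  have "loc w (\<lambda>s. (?b ** u) ** s = (?b ** v) ** s)"
  proof (rule loc_trans[OF loc_pull[OF LR u cl]])
   fix s assume s: "s \<in> hom C (Dom C s) w" and fs: "?\<Phi> (u ** s)"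
   note us = comp_hom[OF u s] and vs = comp_hom[OF v s]
   have "Dom C (u ** s) = Dom C s" using us by (simp add: hom_def)
   then obtain t k where t: "t \<in> T" "k \<in> hom C (Dom C s) (Dom C t)" "u ** s = e t ** k" using fs by auto
   show "loc (Dom C s) (\<lambda>s'. s' \<in> hom C (Dom C s') (Dom C s) --> (?b ** u) ** (s ** s') = (?b ** v) ** (s ** s'))"
   proof (rule loc_mono[OF loc_pull[OF LR vs cl]], rule impI)
    fix s' assume fs': "?\<Phi> ((v ** s) ** s')" and s': "s' \<in> hom C (Dom C s') (Dom C s)"
    have "Dom C ((v ** s) ** s') = Dom C s'" using comp_hom[OF vs s'] by (simp add: hom_def)
    then obtain t' k' where t': "t' \<in> T" "k' \<in> hom C (Dom C s') (Dom C t')" "(v ** s) ** s' = e t' ** k'" using fs' by auto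
    note ss = comp_hom[OF s s'] and ks = comp_hom[OF t(2) s']
    have 1: "u ** (s ** s') = e t ** (k ** s')" using assoc[OF u s s'] t(3) assoc[OF e(1)[OF t(1)] t(2) s'] by simp
    have 2: "v ** (s ** s') = e t' ** k'" using assoc[OF v s s'] t'(3) by simp
    have "?a ** (u ** (s ** s')) = ?a ** (v ** (s ** s'))" by (rule square[OF eq a u a v ss])
    hence "t ** (k ** s') = t' ** k'" unfolding 1 2 aeu(1)[OF t(1) ks] aeu(1)[OF t'(1,2)] .
    hence "r t ** (k ** s') = r t' ** k'" by (rule compatD(3)[OF r t(1) t'(1) ks t'(2)])
    hence "?b ** (u ** (s ** s')) = ?b ** (v ** (s ** s'))" unfolding 1 2 aeu(2)[OF t(1) ks] aeu(2)[OF t'(1,2)] .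
    thus "(?b ** u) ** (s ** s') = (?b ** v) ** (s ** s')" using assoc[OF b u ss] assoc[OF b v ss] by simp
   qed
  qed
  hence beq: "?b ** u = ?b ** v" by (rule loc_eq[OF comp_hom[OF b u] comp_hom[OF b v]])
  note mu = comp_hom[OF m(2) u] and mv = comp_hom[OF m(2) v]
  have "p ** (m ** u) = p ** (m ** v)" "q ** (m ** u) = q ** (m ** v)"
   using eq beq assoc[OF p(1) m(2) u] assoc[OF p(1) m(2) v] assoc[OF p(2) m(2) u] assoc[OF p(2) m(2) v] by auto
  hence "m ** u = m ** v" using ex1_implies_ex p(3)[OF comp_hom[OF p(1) mu] comp_hom[OF p(2) mu]] mu mv by metis
  thus "u = v" by (rule monoD[OF m u v])
 qed
 have "is_iso C ?a" by (rule covD(5)[OF T am a]) (use e(1) ae(1) in blast)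
 from isoD[OF this a] obtain c where c: "c \<in> hom C z R" "c ** ?a = Id C R" by blast
 have "(?b ** c) ** t = r t" if t: "t \<in> T" for t
 proof -
  have "c ** t = c ** (?a ** e t)" using ae(1)[OF t] by simp
  also have "\<dots> = e t" using assoc[OF c(1) a e(1)[OF t]] c(2) id_left[OF e(1)[OF t]] by simp
  finally show ?thesis using assoc[OF b c(1) covD(4)[OF T t]] ae(2)[OF t] by simp
 qed
 thus ?thesis by (rule that[OF comp_hom[OF b c(1)]])
qed

end

section \<open>Presheaves locally isomorphic to a representable\<close>

lemma ex1_unique: "\<exists>!x. Q x ==> Q a ==> Q b ==> a = b"
 by blast

context coh
begin

definition hits :: "('o, 'u) presheaf => ('o, 'u) presheaf_arr => 'u => bool" where
 "hits P \<epsilon> f \<longleftrightarrow> (\<exists>x\<in>ob P (Dom C f). app \<epsilon> (Dom C f) x = f)"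

definition agree :: "('o, 'u) presheaf => 'u => 'u => 'u => bool" where
 "agree P x x' f \<longleftrightarrow> act P f x = act P f x'"

definition liso :: "('o, 'u) presheaf => 'o => ('o, 'u) presheaf_arr => bool" where
 "liso P c \<epsilon> \<longleftrightarrow> \<epsilon> \<in> phom P (rep c) \<and> loc c (hits P \<epsilon>) \<and>
  (\<forall>z\<in>Ob C. \<forall>x\<in>ob P z. \<forall>x'\<in>ob P z. app \<epsilon> z x = app \<epsilon> z x' --> loc z (agree P x x'))"

lemma lisoD:
 assumes "liso P c \<epsilon>"
 shows "\<epsilon> \<in> phom P (rep c)" "loc c (hits P \<epsilon>)" "c \<in> Ob C" "P \<in> Ob (psh C)" "is_psh P"
  "z \<in> Ob C ==> x \<in> ob P z ==> x' \<in> ob P z ==> app \<epsilon> z x = app \<epsilon> z x' ==> loc z (agree P x x')"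
proof -
 show e: "\<epsilon> \<in> phom P (rep c)" and l: "loc c (hits P \<epsilon>)" using assms by (auto simp: liso_def)
 show "c \<in> Ob C" by (rule loc_ob[OF l])
 show P: "P \<in> Ob (psh C)" by (rule psh_hom(1)[OF e])
 show "is_psh P" by (rule ob_psh[OF P])
 show "z \<in> Ob C ==> x \<in> ob P z ==> x' \<in> ob P z ==> app \<epsilon> z x = app \<epsilon> z x' ==> loc z (agree P x x')"
  using assms unfolding liso_def by blast
qed

lemma hom_app:
 "\<epsilon> \<in> phom P (rep c) ==> z \<in> Ob C ==> x \<in> ob P z ==> app \<epsilon> z x \<in> hom C z c"
 using app_in by fastforce

lemma app_act:
 assumes e: "\<epsilon> \<in> phom P (rep c)" and f: "f \<in> hom C w z" and x: "x \<in> ob P z"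
 shows "app \<epsilon> w (act P f x) = app \<epsilon> z x ** f"
proof -
 have "z \<in> Ob C" using hom_ob[OF f] by simp
 thus ?thesis using app_nat[OF e f x] rep_act[OF f hom_app[OF e _ x]] by simp
qed

lemma app_yar_comp:
 assumes h: "h \<in> hom C c Z" and e: "\<epsilon> \<in> phom P (rep c)" and z: "z \<in> Ob C" "x \<in> ob P z"
 shows "app (pcomp (yar h) \<epsilon>) z x = h ** app \<epsilon> z x"
 using app_comp[OF yar_hom[OF h] e z] yar_app[OF h z(1) hom_app[OF e z]] by simp

lemma closed_hits: assumes e: "\<epsilon> \<in> phom P (rep c)" shows "closed c (hits P \<epsilon>)"
proof (rule closedI)
 fix x y t u assume t: "t \<in> hom C y c" and u: "u \<in> hom C x y" and "hits P \<epsilon> t"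
 then obtain a where a: "a \<in> ob P y" "app \<epsilon> y a = t" by (auto simp: hits_def hom_def)
 have "Dom C (t ** u) = x" using comp_hom[OF t u] by (simp add: hom_def)
 thus "hits P \<epsilon> (t ** u)"
  unfolding hits_def using app_act[OF e u a(1)] a(2) act_in[OF ob_psh[OF psh_hom(1)[OF e]] u a(1)] by auto
qed

lemma closed_agree:
 assumes P: "is_psh P" and x: "x \<in> ob P z" "x' \<in> ob P z"
 shows "closed z (agree P x x')"
proof (rule closedI)
 fix w y t u assume t: "t \<in> hom C y z" and u: "u \<in> hom C w y" and "agree P x x' t"
 thus "agree P x x' (t ** u)" using act_comp[OF P t u x(1)] act_comp[OF P t u x(2)] by (simp add: agree_def)
qed

lemma agree_map:
 assumes b: "\<beta> \<in> phom P (rep Z)" and z: "z \<in> Ob C" and y: "y \<in> ob P z" "y' \<in> ob P z" and l: "loc z (agree P y y')"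
 shows "app \<beta> z y = app \<beta> z y'"
proof (rule loc_eq[OF hom_app[OF b z y(1)] hom_app[OF b z y(2)]], rule loc_mono[OF l])
 fix s assume s: "s \<in> hom C (Dom C s) z" and "agree P y y' s"
 thus "app \<beta> z y ** s = app \<beta> z y' ** s" using app_act[OF b s y(1)] app_act[OF b s y(2)] by (simp add: agree_def)
qed

lemma liso_ext:
 assumes l: "liso P c \<epsilon>" and h: "h \<in> hom C c Z" "h' \<in> hom C c Z"
  and eq: "pcomp (yar h) \<epsilon> = pcomp (yar h') \<epsilon>"
 shows "h = h'"
proof (rule loc_eq[OF h], rule loc_mono[OF lisoD(2)[OF l]])
 note e = lisoD(1)[OF l]
 fix t assume t: "t \<in> hom C (Dom C t) c" and "hits P \<epsilon> t"
 then obtain x where x: "x \<in> ob P (Dom C t)" "app \<epsilon> (Dom C t) x = t" by (auto simp: hits_def)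
 have z: "Dom C t \<in> Ob C" using hom_ob[OF t] by simp
 have "h ** app \<epsilon> (Dom C t) x = h' ** app \<epsilon> (Dom C t) x"
  using app_yar_comp[OF h(1) e z x(1)] app_yar_comp[OF h(2) e z x(1)] eq by simp
 thus "h ** t = h' ** t" unfolding x(2) .
qed

lemma liso_univ:
 assumes l: "liso P c \<epsilon>" and b: "\<beta> \<in> phom P (rep Z)" and Z: "Z \<in> Ob C"
 obtains h where "h \<in> hom C c Z" "pcomp (yar h) \<epsilon> = \<beta>"
proof -
 note e = lisoD(1)[OF l] and P = lisoD(5)[OF l]
 obtain T where T: "cov c T" "\<forall>t\<in>T. hits P \<epsilon> t" using lisoD(2)[OF l] unfolding loc_def by blast
 then obtain x where x: "\<And>t. t \<in> T ==> x t \<in> ob P (Dom C t)" "\<And>t. t \<in> T ==> app \<epsilon> (Dom C t) (x t) = t"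
  unfolding hits_def by metis
 note th = covD(4)[OF T(1)]
 define r where "r t = app \<beta> (Dom C t) (x t)" for t
 have dob: "Dom C t \<in> Ob C" if "t \<in> T" for t using hom_ob[OF th[OF that]] by simp
 have rh: "r t \<in> hom C (Dom C t) Z" if t: "t \<in> T" for t unfolding r_def by (rule hom_app[OF b dob[OF t] x(1)[OF t]])
 have c: "compat T r Z"
 proof (rule compatI[OF Z rh])
  fix t t' z u u' assume t: "t \<in> T" "t' \<in> T" and u: "u \<in> hom C z (Dom C t)" "u' \<in> hom C z (Dom C t')" and eq: "t ** u = t' ** u'"
  have z: "z \<in> Ob C" using hom_ob[OF u(1)] by simp
  note y = act_in[OF P u(1) x(1)[OF t(1)]] act_in[OF P u(2) x(1)[OF t(2)]]
  have "app \<epsilon> z (act P u (x t)) = app \<epsilon> z (act P u' (x t'))"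
   using app_act[OF e u(1) x(1)[OF t(1)]] app_act[OF e u(2) x(1)[OF t(2)]] x(2)[OF t(1)] x(2)[OF t(2)] eq by simp
  from agree_map[OF b z y lisoD(6)[OF l z y this]] show "r t ** u = r t' ** u'"
   unfolding r_def using app_act[OF b u(1) x(1)[OF t(1)]] app_act[OF b u(2) x(1)[OF t(2)]] by simp
 qed
 obtain h where h: "h \<in> hom C c Z" "\<And>t. t \<in> T ==> h ** t = r t" by (rule cov_glue[OF T(1) c]) blast
 let ?\<Psi> = "\<lambda>f. \<exists>y\<in>ob P (Dom C f). app \<epsilon> (Dom C f) y = f \<and> app \<beta> (Dom C f) y = h ** f"
 have "?\<Psi> t" if t: "t \<in> T" for t
  by (rule bexI[OF _ x(1)[OF t]]) (simp only: h(2)[OF t] r_def x(2)[OF t] simp_thms)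
 hence L: "loc c ?\<Psi>" using T(1) unfolding loc_def by blast
 have cl: "closed c ?\<Psi>"
 proof (rule closedI)
  fix w z t u assume t: "t \<in> hom C z c" and u: "u \<in> hom C w z" and "?\<Psi> t"
  then obtain y where y: "y \<in> ob P z" "app \<epsilon> z y = t" "app \<beta> z y = h ** t" by (auto simp: hom_def)
  have d: "Dom C (t ** u) = w" using comp_hom[OF t u] by (simp add: hom_def)
  show "?\<Psi> (t ** u)"
   unfolding d using app_act[OF e u y(1)] app_act[OF b u y(1)] y(2,3) assoc[OF h(1) t u] act_in[OF P u y(1)] by auto
 qed
 have "pcomp (yar h) \<epsilon> = \<beta>"
 proof (rule psh_ext[OF Psh.comp_hom[OF yar_hom[OF h(1)] e] b])
  fix z a assume z: "z \<in> Ob C" "a \<in> ob P z"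
  note ea = hom_app[OF e z] and ba = hom_app[OF b z]
  have "h ** app \<epsilon> z a = app \<beta> z a"
  proof (rule loc_eq[OF comp_hom[OF h(1) ea] ba], rule loc_mono[OF loc_pull[OF L ea cl]])
   fix s assume s: "s \<in> hom C (Dom C s) z" and ps: "?\<Psi> (app \<epsilon> z a ** s)"
   have d: "Dom C (app \<epsilon> z a ** s) = Dom C s" using comp_hom[OF ea s] by (simp add: hom_def)
   have w: "Dom C s \<in> Ob C" using hom_ob[OF s] by simp
   obtain y where y: "y \<in> ob P (Dom C s)" "app \<epsilon> (Dom C s) y = app \<epsilon> z a ** s" "app \<beta> (Dom C s) y = h ** (app \<epsilon> z a ** s)"
    using ps unfolding d by blast
   have "app \<epsilon> (Dom C s) y = app \<epsilon> (Dom C s) (act P s a)" using y(2) app_act[OF e s z(2)] by simp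
   from agree_map[OF b w y(1) act_in[OF P s z(2)] lisoD(6)[OF l w y(1) act_in[OF P s z(2)] this]]
   show "(h ** app \<epsilon> z a) ** s = app \<beta> z a ** s"
    using y(3) app_act[OF b s z(2)] assoc[OF h(1) ea s] by simp
  qed
  thus "app (pcomp (yar h) \<epsilon>) z a = app \<beta> z a" using app_yar_comp[OF h(1) e z] by simp
 qed
 thus ?thesis by (rule that[OF h(1)])
qed

lemma liso_rep:
 assumes c: "c \<in> Ob C" shows "liso (rep c) c (Id (psh C) (rep c))"
 unfolding liso_def
proof (intro conjI ballI impI)
 show "Id (psh C) (rep c) \<in> phom (rep c) (rep c)" by (rule Psh.id_hom[OF rep_ob[OF c]])
 have "Dom C (Id C c) = c" "Id C c \<in> ob (rep c) c" using id_hom[OF c] c by (auto simp: hom_def)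
 hence "hits (rep c) (Id (psh C) (rep c)) (Id C c)" unfolding hits_def using c app_Id by metis
 thus "loc c (hits (rep c) (Id (psh C) (rep c)))" by (rule loc_triv[OF c])
 fix z x x' assume "z \<in> Ob C" "x \<in> ob (rep c) z" "x' \<in> ob (rep c) z"
  "app (Id (psh C) (rep c)) z x = app (Id (psh C) (rep c)) z x'"
 thus "loc z (agree (rep c) x x')" by (intro loc_triv) (auto simp: agree_def)
qed

lemma liso_iso:
 assumes l: "liso P c \<epsilon>" and k: "k \<in> phom Q P" "is_iso (psh C) k"
 shows "liso Q c (pcomp \<epsilon> k)"
proof -
 note e = lisoD(1)[OF l]
 obtain k' where k': "k' \<in> phom P Q" "pcomp k' k = Id (psh C) Q" "pcomp k k' = Id (psh C) P"
  using Psh.isoD[OF k(2,1)] by blast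
 have kk: "app k z (app k' z x) = x" if "z \<in> Ob C" "x \<in> ob P z" for z x
  using app_comp[OF k(1) k'(1) that] k'(3) app_Id[OF that] by simp
 have kk': "app k' z (app k z x) = x" if "z \<in> Ob C" "x \<in> ob Q z" for z x
  using app_comp[OF k'(1) k(1) that] k'(2) app_Id[OF that] by simp
 note ek = app_comp[OF e k(1)]
 show ?thesis
  unfolding liso_def
 proof (intro conjI ballI impI)
  show "pcomp \<epsilon> k \<in> phom Q (rep c)" by (rule Psh.comp_hom[OF e k(1)])
  show "loc c (hits Q (pcomp \<epsilon> k))"
  proof (rule loc_mono[OF lisoD(2)[OF l]])
   fix t assume t: "t \<in> hom C (Dom C t) c" and "hits P \<epsilon> t"
   then obtain x where x: "x \<in> ob P (Dom C t)" "app \<epsilon> (Dom C t) x = t" by (auto simp: hits_def)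
   have z: "Dom C t \<in> Ob C" using hom_ob[OF t] by simp
   note y = app_in[OF k'(1) z x(1)]
   have "app (pcomp \<epsilon> k) (Dom C t) (app k' (Dom C t) x) = t" using ek[OF z y] kk[OF z x(1)] x(2) by simp
   thus "hits Q (pcomp \<epsilon> k) t" unfolding hits_def using y by blast
  qed
  fix z x x' assume z: "z \<in> Ob C" and x: "x \<in> ob Q z" "x' \<in> ob Q z" and eq: "app (pcomp \<epsilon> k) z x = app (pcomp \<epsilon> k) z x'"
  have "app \<epsilon> z (app k z x) = app \<epsilon> z (app k z x')" using eq ek[OF z x(1)] ek[OF z x(2)] by simp
  from lisoD(6)[OF l z app_in[OF k(1) z x(1)] app_in[OF k(1) z x(2)] this]
  show "loc z (agree Q x x')"
  proof (rule loc_mono)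
   fix s assume s: "s \<in> hom C (Dom C s) z" and a: "agree P (app k z x) (app k z x') s"
   have w: "Dom C s \<in> Ob C" using hom_ob[OF s] by simp
   have Q: "is_psh Q" by (rule ob_psh[OF psh_hom(1)[OF k(1)]])
   have "app k (Dom C s) (act Q s x) = app k (Dom C s) (act Q s x')"
    using a app_nat[OF k(1) s x(1)] app_nat[OF k(1) s x(2)] by (simp add: agree_def)
   hence "app k' (Dom C s) (app k (Dom C s) (act Q s x)) = app k' (Dom C s) (app k (Dom C s) (act Q s x'))" by (rule arg_cong)
   thus "agree Q x x' s" unfolding agree_def using kk'[OF w act_in[OF Q s x(1)]] kk'[OF w act_in[OF Q s x(2)]] by simp
  qed
 qed
qed

lemma limit_ext:
 assumes F: "is_functor J C F" and L: "is_limit J C F l \<kappa>" and k: "k \<in> hom C z l" "k' \<in> hom C z l"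
  and eq: "\<And>j. j \<in> Ob J ==> \<kappa> j ** k = \<kappa> j ** k'"
 shows "k = k'"
proof -
 interpret J: cat J using F by (auto simp: is_functor_def cat_def)
 have lh: "\<And>j. j \<in> Ob J ==> \<kappa> j \<in> hom C l (ob F j)" and lc: "\<And>j i u. u \<in> hom J j i ==> ar F u ** \<kappa> j = \<kappa> i"
  using L by (auto simp: is_limit_def is_cone_def)
 have "is_cone J C F z (\<lambda>j. \<kappa> j ** k)"
  unfolding is_cone_def
 proof (intro conjI ballI allI)
  show "z \<in> Ob C" using hom_ob[OF k(1)] by simp
  show "\<kappa> j ** k \<in> hom C z (ob F j)" if "j \<in> Ob J" for j by (rule comp_hom[OF lh[OF that] k(1)])
  fix j i u assume u: "u \<in> hom J j i"
  have "j \<in> Ob J" "ar F u \<in> hom C (ob F j) (ob F i)" using J.hom_ob[OF u] F u by (auto simp: is_functor_def)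
  thus "ar F u ** (\<kappa> j ** k) = \<kappa> i ** k" using assoc[OF _ lh k(1)] lc[OF u] by metis
 qed
 hence "\<exists>!h. h \<in> hom C z l \<and> (\<forall>j\<in>Ob J. \<kappa> j ** h = \<kappa> j ** k)" using L unfolding is_limit_def by blast
 moreover have "k \<in> hom C z l \<and> (\<forall>j\<in>Ob J. \<kappa> j ** k = \<kappa> j ** k)" using k(1) by simp
 moreover have "k' \<in> hom C z l \<and> (\<forall>j\<in>Ob J. \<kappa> j ** k' = \<kappa> j ** k)" using k(2) eq by simp
 ultimately show ?thesis by (rule ex1_unique)
qed

lemma liso_limit:
 assumes E: "fullin E" and J: "finite_category J" and D: "is_functor J E D" and L: "is_limit J E D P \<pi>"
  and l: "\<And>j. j \<in> Ob J ==> liso (ob D j) (ob F j) (\<epsilon> j)" and F: "is_functor J C F"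
  and nat: "\<And>u j k. u \<in> hom J j k ==> pcomp (yar (ar F u)) (\<epsilon> j) = pcomp (\<epsilon> k) (ar D u)"
  and CL: "is_limit J C F m \<kappa>"
 obtains \<eta> where "liso P m \<eta>" "\<And>j. j \<in> Ob J ==> pcomp (yar (\<kappa> j)) \<eta> = pcomp (\<epsilon> j) (\<pi> j)"
proof -
 interpret J: cat J using F by (auto simp: is_functor_def cat_def)
 have fJ: "finite (Ob J)" "finite (Arr J)" using J by (auto simp: finite_category_def)
 note Fu = functorD(4)[OF F]
 note Du = fullin_hom(3)[OF E functorD(4)[OF D]]
 have pE: "\<And>j. j \<in> Ob J ==> \<pi> j \<in> hom E P (ob D j)" and pc: "\<And>j k u. u \<in> hom J j k ==> pcomp (ar D u) (\<pi> j) = \<pi> k"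
  and PE: "P \<in> Ob E"
  using L fullinD(4)[OF E] by (auto simp: is_limit_def is_cone_def)
 note ph = fullin_hom(3)[OF E pE]
 have Pob: "P \<in> Ob (psh C)" by (rule fullinD(2)[OF E PE])
 note Pp = ob_psh[OF Pob]
 note e = lisoD(1)[OF l] and Dp = lisoD(5)[OF l]
 have mh: "m \<in> Ob C" and lh: "\<And>j. j \<in> Ob J ==> \<kappa> j \<in> hom C m (ob F j)" and lc: "\<And>j k u. u \<in> hom J j k ==> ar F u ** \<kappa> j = \<kappa> k"
  using CL by (auto simp: is_limit_def is_cone_def)
 have enat: "ar F u ** app (\<epsilon> j) z x = app (\<epsilon> k) z (app (ar D u) z x)"
  if u: "u \<in> hom J j k" and z: "z \<in> Ob C" "x \<in> ob (ob D j) z" for u j k z x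
 proof -
  have jk: "j \<in> Ob J" "k \<in> Ob J" using J.hom_ob[OF u] by auto
  show ?thesis using app_yar_comp[OF Fu[OF u] e[OF jk(1)] z] app_comp[OF e[OF jk(2)] Du[OF u] z] nat[OF u] by simp
 qed
 have pnat: "app (ar D u) z (app (\<pi> j) z x) = app (\<pi> k) z x"
  if u: "u \<in> hom J j k" and z: "z \<in> Ob C" "x \<in> ob P z" for u j k z x
  using app_comp[OF Du[OF u] ph z] pc[OF u] J.hom_ob[OF u] by simp
 have ep: "app (\<epsilon> j) z (app (\<pi> j) z x) \<in> hom C z (ob F j)" if "j \<in> Ob J" "z \<in> Ob C" "x \<in> ob P z" for j z x
  by (rule hom_app[OF e[OF that(1)] that(2) app_in[OF ph[OF that(1)] that(2,3)]])
 have "\<exists>k. k \<in> hom C z m \<and> (\<forall>j\<in>Ob J. \<kappa> j ** k = app (\<epsilon> j) z (app (\<pi> j) z x))" if z: "z \<in> Ob C" "x \<in> ob P z" for z x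
 proof -
  have "is_cone J C F z (\<lambda>j. app (\<epsilon> j) z (app (\<pi> j) z x))"
   unfolding is_cone_def
  proof (intro conjI ballI allI)
   show "z \<in> Ob C" by (rule z(1))
   show "app (\<epsilon> j) z (app (\<pi> j) z x) \<in> hom C z (ob F j)" if "j \<in> Ob J" for j by (rule ep[OF that z])
   fix j k u assume u: "u \<in> hom J j k"
   hence "j \<in> Ob J" using J.hom_ob by blast
   from enat[OF u z(1) app_in[OF ph[OF this] z]]
   show "ar F u ** app (\<epsilon> j) z (app (\<pi> j) z x) = app (\<epsilon> k) z (app (\<pi> k) z x)" unfolding pnat[OF u z] .
  qed
  thus ?thesis using CL unfolding is_limit_def by blast
 qed
 then obtain h where h: "\<And>z x. z \<in> Ob C ==> x \<in> ob P z ==> h z x \<in> hom C z m"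
  "\<And>z x j. z \<in> Ob C ==> x \<in> ob P z ==> j \<in> Ob J ==> \<kappa> j ** h z x = app (\<epsilon> j) z (app (\<pi> j) z x)" by metis
 let ?\<eta> = "mk_arr C P (rep m) h"
 have hh: "?\<eta> \<in> phom P (rep m)"
 proof (rule mk_arr_homI[OF Pob rep_ob[OF mh]])
  show "h z x \<in> ob (rep m) z" if "z \<in> Ob C" "x \<in> ob P z" for z x using h(1)[OF that] that(1) by simp
  fix w z f x assume f: "f \<in> hom C w z" and x: "x \<in> ob P z"
  have wz: "w \<in> Ob C" "z \<in> Ob C" using hom_ob[OF f] by auto
  note xf = act_in[OF Pp f x]
  have "h w (act P f x) = h z x ** f"
  proof (rule limit_ext[OF F CL h(1)[OF wz(1) xf] comp_hom[OF h(1)[OF wz(2) x] f]])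
   fix j assume j: "j \<in> Ob J"
   show "\<kappa> j ** h w (act P f x) = \<kappa> j ** (h z x ** f)"
    using h(2)[OF wz(1) xf j] h(2)[OF wz(2) x j] assoc[OF lh[OF j] h(1)[OF wz(2) x] f]
     app_nat[OF ph[OF j] f x] app_act[OF e[OF j] f app_in[OF ph[OF j] wz(2) x]] by simp
  qed
  thus "h w (act P f x) = act (rep m) f (h z x)" using rep_act[OF f h(1)[OF wz(2) x]] by simp
 qed
 have "liso P m ?\<eta>"
  unfolding liso_def
 proof (intro conjI ballI impI)
  show "?\<eta> \<in> phom P (rep m)" by (rule hh)
  have "loc m (\<lambda>f. \<forall>j\<in>Ob J. hits (ob D j) (\<epsilon> j) (\<kappa> j ** f))"
   by (rule loc_all[OF fJ(1) mh]) (rule loc_pull[OF lisoD(2)[OF l] lh closed_hits[OF e]] closed_comp[OF closed_hits[OF e] lh], assumption+)+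
  thus "loc m (hits P ?\<eta>)"
  proof (rule loc_trans)
   fix f assume f: "f \<in> hom C (Dom C f) m" and hf: "\<forall>j\<in>Ob J. hits (ob D j) (\<epsilon> j) (\<kappa> j ** f)"
   let ?w = "Dom C f"
   have w: "?w \<in> Ob C" using hom_ob[OF f] by simp
   have "Dom C (\<kappa> j ** f) = ?w" if "j \<in> Ob J" for j using comp_hom[OF lh[OF that] f] by (simp add: hom_def)
   hence "\<forall>j\<in>Ob J. \<exists>x\<in>ob (ob D j) ?w. app (\<epsilon> j) ?w x = \<kappa> j ** f" using hf unfolding hits_def by simp
   then obtain x where x: "\<And>j. j \<in> Ob J ==> x j \<in> ob (ob D j) ?w" "\<And>j. j \<in> Ob J ==> app (\<epsilon> j) ?w (x j) = \<kappa> j ** f" by metis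
   have ua: "app (ar D u) ?w (x (Dom J u)) \<in> ob (ob D (Cod J u)) ?w \<and> Cod J u \<in> Ob J \<and>
     loc ?w (agree (ob D (Cod J u)) (app (ar D u) ?w (x (Dom J u))) (x (Cod J u)))" if "u \<in> Arr J" for u
   proof -
    have u: "u \<in> hom J (Dom J u) (Cod J u)" by (rule J.hom_arr[OF that])
    have jk: "Dom J u \<in> Ob J" "Cod J u \<in> Ob J" using J.hom_ob[OF u] by auto
    note ux = app_in[OF Du[OF u] w x(1)[OF jk(1)]]
    have "app (\<epsilon> (Cod J u)) ?w (app (ar D u) ?w (x (Dom J u))) = ar F u ** (\<kappa> (Dom J u) ** f)"
     using enat[OF u w x(1)[OF jk(1)]] x(2)[OF jk(1)] by simp
    also have "\<dots> = app (\<epsilon> (Cod J u)) ?w (x (Cod J u))"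
     using assoc[OF Fu[OF u] lh[OF jk(1)] f] lc[OF u] x(2)[OF jk(2)] by simp
    finally show ?thesis using lisoD(6)[OF l[OF jk(2)] w ux x(1)[OF jk(2)]] ux jk(2) by blast
   qed
   have "loc ?w (\<lambda>s. \<forall>u\<in>Arr J. agree (ob D (Cod J u)) (app (ar D u) ?w (x (Dom J u))) (x (Cod J u)) s)"
   proof (rule loc_all[OF fJ(2) w])
    fix u assume u: "u \<in> Arr J"
    note a = ua[OF u]
    show "loc ?w (agree (ob D (Cod J u)) (app (ar D u) ?w (x (Dom J u))) (x (Cod J u)))" using a by blast
    have k: "Cod J u \<in> Ob J" using a by blast
    show "closed ?w (agree (ob D (Cod J u)) (app (ar D u) ?w (x (Dom J u))) (x (Cod J u)))"
     by (rule closed_agree[OF Dp[OF k] conjunct1[OF a] x(1)[OF k]])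
   qed
   thus "loc ?w (\<lambda>s. s \<in> hom C (Dom C s) ?w --> hits P ?\<eta> (f ** s))"
   proof (rule loc_mono, intro impI)
    fix s assume s: "s \<in> hom C (Dom C s) ?w"
     and a: "\<forall>u\<in>Arr J. agree (ob D (Cod J u)) (app (ar D u) ?w (x (Dom J u))) (x (Cod J u)) s"
    let ?v = "Dom C s"
    have v: "?v \<in> Ob C" using hom_ob[OF s] by simp
    note fs = comp_hom[OF f s]
    have xs: "act (ob D j) s (x j) \<in> ob (ob D j) ?v" if "j \<in> Ob J" for j by (rule act_in[OF Dp[OF that] s x(1)[OF that]])
    have cp: "app (ar D u) ?v (act (ob D j) s (x j)) = act (ob D k) s (x k)" if u: "u \<in> hom J j k" for j k u
    proof -
     have "u \<in> Arr J" "Dom J u = j" "Cod J u = k" using u by (auto simp: hom_def)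
     hence "act (ob D k) s (app (ar D u) ?w (x j)) = act (ob D k) s (x k)" using a by (auto simp: agree_def)
     moreover have "j \<in> Ob J" using J.hom_ob[OF u] by simp
     ultimately show ?thesis using app_nat[OF Du[OF u] s x(1)] by simp
    qed
    have "\<exists>y. y \<in> ob P ?v \<and> (\<forall>j\<in>Ob J. app (\<pi> j) ?v y = act (ob D j) s (x j))"
     by (rule ex1_implies_ex[OF limit_pointwise[OF E D L v xs cp]])
    then obtain y where y: "y \<in> ob P ?v" "\<And>j. j \<in> Ob J ==> app (\<pi> j) ?v y = act (ob D j) s (x j)" by blast
    have "h ?v y = f ** s"
    proof (rule limit_ext[OF F CL h(1)[OF v y(1)] fs])
     fix j assume j: "j \<in> Ob J"
     show "\<kappa> j ** h ?v y = \<kappa> j ** (f ** s)"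
      using h(2)[OF v y(1) j] y(2)[OF j] app_act[OF e[OF j] s x(1)[OF j]] x(2)[OF j] assoc[OF lh[OF j] f s] by simp
    qed
    hence "app ?\<eta> ?v y = f ** s" using app_mk_arr[OF v y(1)] by simp
    moreover have "Dom C (f ** s) = ?v" using fs by (simp add: hom_def)
    ultimately show "hits P ?\<eta> (f ** s)" unfolding hits_def using y(1) by auto
   qed
  qed
  fix z x x' assume z: "z \<in> Ob C" and x: "x \<in> ob P z" "x' \<in> ob P z" and eq: "app ?\<eta> z x = app ?\<eta> z x'"
  have hx: "h z x = h z x'" using eq app_mk_arr[OF z x(1)] app_mk_arr[OF z x(2)] by simp
  have "loc z (\<lambda>s. \<forall>j\<in>Ob J. agree (ob D j) (app (\<pi> j) z x) (app (\<pi> j) z x') s)"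
  proof (rule loc_all[OF fJ(1) z])
   fix j assume j: "j \<in> Ob J"
   note y = app_in[OF ph[OF j] z x(1)] app_in[OF ph[OF j] z x(2)]
   show "closed z (agree (ob D j) (app (\<pi> j) z x) (app (\<pi> j) z x'))" by (rule closed_agree[OF Dp[OF j] y])
   have "app (\<epsilon> j) z (app (\<pi> j) z x) = app (\<epsilon> j) z (app (\<pi> j) z x')" using h(2)[OF z x(1) j] h(2)[OF z x(2) j] hx by simp
   thus "loc z (agree (ob D j) (app (\<pi> j) z x) (app (\<pi> j) z x'))" by (rule lisoD(6)[OF l[OF j] z y])
  qed
  thus "loc z (agree P x x')"
  proof (rule loc_mono)
   fix s assume s: "s \<in> hom C (Dom C s) z" and a: "\<forall>j\<in>Ob J. agree (ob D j) (app (\<pi> j) z x) (app (\<pi> j) z x') s"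
   let ?v = "Dom C s"
   have v: "?v \<in> Ob C" using hom_ob[OF s] by simp
   note xs = act_in[OF Pp s x(1)] and xs' = act_in[OF Pp s x(2)]
   have "\<exists>!y. y \<in> ob P ?v \<and> (\<forall>j\<in>Ob J. app (\<pi> j) ?v y = app (\<pi> j) ?v (act P s x))"
    by (rule limit_pointwise[OF E D L v]) (rule app_in[OF ph v xs] pnat[OF _ v xs], assumption)+
   moreover have "app (\<pi> j) ?v (act P s x') = app (\<pi> j) ?v (act P s x)" if j: "j \<in> Ob J" for j
    using a j app_nat[OF ph[OF j] s x(1)] app_nat[OF ph[OF j] s x(2)] by (simp add: agree_def)
   ultimately show "agree P x x' s" unfolding agree_def using xs xs' by blast
  qed
 qed
 moreover have "pcomp (yar (\<kappa> j)) ?\<eta> = pcomp (\<epsilon> j) (\<pi> j)" if j: "j \<in> Ob J" for j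
  by (rule psh_ext[OF Psh.comp_hom[OF yar_hom[OF lh[OF j]] hh] Psh.comp_hom[OF e[OF j] ph[OF j]]])
   (simp add: app_yar_comp[OF lh[OF j] hh] app_comp[OF e[OF j] ph[OF j]] h(2) j)
 ultimately show ?thesis by (rule that)
qed

lemma liso_img:
 assumes A: "into B A" "finite A" and lB: "liso B b \<epsilon>" and lA: "\<And>\<alpha>. \<alpha> \<in> A ==> liso (Dom (psh C) \<alpha>) (c \<alpha>) (\<delta> \<alpha>)"
 shows "\<exists>M \<eta>. liso (img B A) M \<eta>"
proof -
 note e = lisoD(1)[OF lB] and d = lisoD(1)[OF lA] and Bp = lisoD(5)[OF lB]
 have a: "\<alpha> \<in> phom (Dom (psh C) \<alpha>) B" if "\<alpha> \<in> A" for \<alpha> using A(1) that by (auto simp: into_def)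
 have "\<exists>h. h \<in> hom C (c \<alpha>) b \<and> pcomp (yar h) (\<delta> \<alpha>) = pcomp \<epsilon> \<alpha>" if al: "\<alpha> \<in> A" for \<alpha>
  by (rule liso_univ[OF lA[OF al] Psh.comp_hom[OF e a[OF al]] lisoD(3)[OF lB]]) blast
 then obtain f where f: "\<And>\<alpha>. \<alpha> \<in> A ==> f \<alpha> \<in> hom C (c \<alpha>) b" "\<And>\<alpha>. \<alpha> \<in> A ==> pcomp (yar (f \<alpha>)) (\<delta> \<alpha>) = pcomp \<epsilon> \<alpha>" by metis
 have df: "Dom C (f \<alpha>) = c \<alpha>" if "\<alpha> \<in> A" for \<alpha> using f(1)[OF that] by (simp add: hom_def)
 have fe: "f \<alpha> ** app (\<delta> \<alpha>) z y = app \<epsilon> z (app \<alpha> z y)" if al: "\<alpha> \<in> A" and z: "z \<in> Ob C" "y \<in> ob (Dom (psh C) \<alpha>) z" for \<alpha> z y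
  using app_yar_comp[OF f(1)[OF al] d[OF al] z] app_comp[OF e a[OF al] z] f(2)[OF al] by simp
 have G: "gens b (f ` A)" using f(1) df lisoD(3)[OF lB] by (simp add: gens_def)
 obtain M m k where m: "is_mono C m" "m \<in> hom C M b" and k: "\<And>t. t \<in> f ` A ==> k t \<in> hom C (Dom C t) M \<and> m ** k t = t" and cM: "cov M (k ` f ` A)"
  by (rule cov_factor[OF G]) (use A(2) in blast)+
 define q where "q \<alpha> = k (f \<alpha>)" for \<alpha>
 have q: "q \<alpha> \<in> hom C (c \<alpha>) M" "m ** q \<alpha> = f \<alpha>" if "\<alpha> \<in> A" for \<alpha> using k[OF imageI[OF that]] df[OF that] by (auto simp: q_def)
 have cq: "cov M (q ` A)" using cM by (simp add: q_def image_image)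
 have Mob: "M \<in> Ob C" by (rule covD(3)[OF cq])
 have inB: "x \<in> ob B z" if "z \<in> Ob C" "x \<in> ob (img B A) z" for z x using that img_el by simp
 have mq: "m ** (q \<alpha> ** app (\<delta> \<alpha>) z y) = app \<epsilon> z (app \<alpha> z y)" if al: "\<alpha> \<in> A" and z: "z \<in> Ob C" "y \<in> ob (Dom (psh C) \<alpha>) z" for \<alpha> z y
  using assoc[OF m(2) q(1)[OF al] hom_app[OF d[OF al] z]] q(2)[OF al] fe[OF al z] by simp
 have "\<exists>g. g \<in> hom C z M \<and> m ** g = app \<epsilon> z x" if z: "z \<in> Ob C" "x \<in> ob (img B A) z" for z x
 proof -
  obtain \<alpha> y where y: "\<alpha> \<in> A" "y \<in> ob (Dom (psh C) \<alpha>) z" "x = app \<alpha> z y" using z(2) unfolding img_el[OF z(1)] by blast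
  show ?thesis using mq[OF y(1) z(1) y(2)] comp_hom[OF q(1)[OF y(1)] hom_app[OF d[OF y(1)] z(1) y(2)]] unfolding y(3) by blast
 qed
 then obtain g where g: "\<And>z x. z \<in> Ob C ==> x \<in> ob (img B A) z ==> g z x \<in> hom C z M"
  "\<And>z x. z \<in> Ob C ==> x \<in> ob (img B A) z ==> m ** g z x = app \<epsilon> z x" by metis
 note Iob = img_ob[OF A(1)]
 note Ip = ob_psh[OF Iob]
 let ?\<eta> = "mk_arr C (img B A) (rep M) g"
 have hh: "?\<eta> \<in> phom (img B A) (rep M)"
 proof (rule mk_arr_homI[OF Iob rep_ob[OF Mob]])
  show "g z x \<in> ob (rep M) z" if "z \<in> Ob C" "x \<in> ob (img B A) z" for z x using g(1)[OF that] that(1) by simp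
  fix w z u x assume u: "u \<in> hom C w z" and x: "x \<in> ob (img B A) z"
  have wz: "w \<in> Ob C" "z \<in> Ob C" using hom_ob[OF u] by auto
  note xu = act_in[OF Ip u x]
  have "m ** g w (act (img B A) u x) = m ** (g z x ** u)"
   using g(2)[OF wz(1) xu] img_act[OF u x] app_act[OF e u inB[OF wz(2) x]] g(2)[OF wz(2) x] assoc[OF m(2) g(1)[OF wz(2) x] u] by simp
  hence "g w (act (img B A) u x) = g z x ** u" by (rule monoD[OF m g(1)[OF wz(1) xu] comp_hom[OF g(1)[OF wz(2) x] u]])
  thus "g w (act (img B A) u x) = act (rep M) u (g z x)" using rep_act[OF u g(1)[OF wz(2) x]] by simp
 qed
 have "liso (img B A) M ?\<eta>"
  unfolding liso_def
 proof (intro conjI ballI impI)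
  show "?\<eta> \<in> phom (img B A) (rep M)" by (rule hh)
  have "loc M (\<lambda>t. \<exists>\<alpha>\<in>A. t = q \<alpha>)" unfolding loc_def using cq by blast
  thus "loc M (hits (img B A) ?\<eta>)"
  proof (rule loc_trans)
   fix t assume t: "t \<in> hom C (Dom C t) M" and "\<exists>\<alpha>\<in>A. t = q \<alpha>"
   then obtain \<alpha> where al: "\<alpha> \<in> A" "t = q \<alpha>" by blast
   have dt: "Dom C t = c \<alpha>" using q(1)[OF al(1)] al(2) by (simp add: hom_def)
   show "loc (Dom C t) (\<lambda>s. s \<in> hom C (Dom C s) (Dom C t) --> hits (img B A) ?\<eta> (t ** s))"
    unfolding dt
   proof (rule loc_mono[OF lisoD(2)[OF lA[OF al(1)]]], intro impI)
    fix s assume s: "s \<in> hom C (Dom C s) (c \<alpha>)" and "hits (Dom (psh C) \<alpha>) (\<delta> \<alpha>) s"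
    then obtain y where y: "y \<in> ob (Dom (psh C) \<alpha>) (Dom C s)" "app (\<delta> \<alpha>) (Dom C s) y = s" by (auto simp: hits_def)
    have z: "Dom C s \<in> Ob C" using hom_ob[OF s] by simp
    note qs = comp_hom[OF q(1)[OF al(1)] s]
    note x = app_img[OF A(1) al(1) z y(1)]
    have "m ** g (Dom C s) (app \<alpha> (Dom C s) y) = m ** (q \<alpha> ** s)" using g(2)[OF z x] mq[OF al(1) z y(1)] y(2) by simp
    hence "g (Dom C s) (app \<alpha> (Dom C s) y) = q \<alpha> ** s" by (rule monoD[OF m g(1)[OF z x] qs])
    hence "app ?\<eta> (Dom C s) (app \<alpha> (Dom C s) y) = t ** s" using app_mk_arr[OF z x] al(2) by simp
    moreover have "Dom C (t ** s) = Dom C s" using qs al(2) by (simp add: hom_def)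
    ultimately show "hits (img B A) ?\<eta> (t ** s)" unfolding hits_def using x by auto
   qed
  qed
  fix z x x' assume z: "z \<in> Ob C" and x: "x \<in> ob (img B A) z" "x' \<in> ob (img B A) z" and eq: "app ?\<eta> z x = app ?\<eta> z x'"
  have "g z x = g z x'" using eq app_mk_arr[OF z x(1)] app_mk_arr[OF z x(2)] by simp
  hence "app \<epsilon> z x = app \<epsilon> z x'" using g(2)[OF z x(1)] g(2)[OF z x(2)] by simp
  from lisoD(6)[OF lB z inB[OF z x(1)] inB[OF z x(2)] this]
  show "loc z (agree (img B A) x x')"
  proof (rule loc_mono)
   fix s assume "s \<in> hom C (Dom C s) z" "agree B x x' s"
   thus "agree (img B A) x x' s" using img_act x by (simp add: agree_def)
  qed
 qed
 thus ?thesis by blast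
qed

end

section \<open>The reflection\<close>

context coh
begin

definition reflective :: "('o, 'u) presheaf => bool" where
 "reflective P \<longleftrightarrow> (\<exists>c \<epsilon>. liso P c \<epsilon>)"

definition refl_ob :: "('o, 'u) presheaf => 'o" where
 "refl_ob P = (SOME c. \<exists>\<epsilon>. liso P c \<epsilon>)"

definition refl_unit :: "('o, 'u) presheaf => ('o, 'u) presheaf_arr" where
 "refl_unit P = (SOME \<epsilon>. liso P (refl_ob P) \<epsilon>)"

definition refl_arr :: "('o, 'u) presheaf_arr => 'u" where
 "refl_arr f = (SOME h. h \<in> hom C (refl_ob (Dom (psh C) f)) (refl_ob (Cod (psh C) f)) \<and>
  pcomp (yar h) (refl_unit (Dom (psh C) f)) = pcomp (refl_unit (Cod (psh C) f)) f)"

definition reflector :: "(('o, 'u) presheaf, ('o, 'u) presheaf_arr, 'o, 'u) func" where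
 "reflector = \<lparr>ob_map = refl_ob, ar_map = refl_arr\<rparr>"

lemma refl_unit: assumes "reflective P" shows "liso P (refl_ob P) (refl_unit P)"
proof -
 have "\<exists>\<epsilon>. liso P (refl_ob P) \<epsilon>" using assms unfolding reflective_def refl_ob_def by (rule someI_ex)
 thus ?thesis unfolding refl_unit_def by (rule someI_ex)
qed

lemma refl_arr:
 assumes f: "f \<in> phom P Q" and P: "reflective P" and Q: "reflective Q"
 shows "refl_arr f \<in> hom C (refl_ob P) (refl_ob Q)"
  and "pcomp (yar (refl_arr f)) (refl_unit P) = pcomp (refl_unit Q) f"
proof -
 note lP = refl_unit[OF P] and lQ = refl_unit[OF Q]
 have "\<exists>h. h \<in> hom C (refl_ob P) (refl_ob Q) \<and> pcomp (yar h) (refl_unit P) = pcomp (refl_unit Q) f"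
  by (rule liso_univ[OF lP Psh.comp_hom[OF lisoD(1)[OF lQ] f] lisoD(3)[OF lQ]]) blast
 hence "refl_arr f \<in> hom C (refl_ob P) (refl_ob Q) \<and> pcomp (yar (refl_arr f)) (refl_unit P) = pcomp (refl_unit Q) f"
  unfolding refl_arr_def psh_hom(3,4)[OF f] by (rule someI_ex)
 thus "refl_arr f \<in> hom C (refl_ob P) (refl_ob Q)" "pcomp (yar (refl_arr f)) (refl_unit P) = pcomp (refl_unit Q) f" by auto
qed

lemma refl_arr_eq:
 assumes f: "f \<in> phom P Q" and P: "reflective P" and Q: "reflective Q"
  and h: "h \<in> hom C (refl_ob P) (refl_ob Q)" "pcomp (yar h) (refl_unit P) = pcomp (refl_unit Q) f"
 shows "refl_arr f = h"
 by (rule liso_ext[OF refl_unit[OF P] refl_arr(1)[OF f P Q] h(1)]) (simp add: refl_arr(2)[OF f P Q] h(2))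

lemma reflector_functor:
 assumes E: "fullin E" and D: "is_functor J E D" and R: "\<And>j. j \<in> Ob J ==> reflective (ob D j)"
 shows "is_functor J C (comp_func reflector D)"
proof -
 interpret J: cat J using D by (auto simp: is_functor_def cat_def)
 note Dh = fullin_hom(3)[OF E functorD(4)[OF D]]
 have jk: "reflective (ob D j)" "reflective (ob D k)" if "u \<in> hom J j k" for u j k using R J.hom_ob[OF that] by auto
 note e = lisoD(1)[OF refl_unit]
 have i: "refl_arr (ar D (Id J j)) = Id C (refl_ob (ob D j))" if j: "j \<in> Ob J" for j
 proof (rule refl_arr_eq[OF Dh[OF J.id_hom[OF j]] R[OF j] R[OF j]])
  note c = lisoD(3)[OF refl_unit[OF R[OF j]]]
  show "Id C (refl_ob (ob D j)) \<in> hom C (refl_ob (ob D j)) (refl_ob (ob D j))" by (rule id_hom[OF c])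
  have "ar D (Id J j) = Id (psh C) (ob D j)" using D j fullinD(5)[OF E] by (simp add: is_functor_def)
  thus "pcomp (yar (Id C (refl_ob (ob D j)))) (refl_unit (ob D j)) = pcomp (refl_unit (ob D j)) (ar D (Id J j))"
   using yar_id[OF c] Psh.id_left[OF e[OF R[OF j]]] Psh.id_right[OF e[OF R[OF j]]] by simp
 qed
 have co: "refl_arr (ar D (Comp J v u)) = refl_arr (ar D v) ** refl_arr (ar D u)" if u: "u \<in> hom J j k" and v: "v \<in> hom J k l" for u v j k l
 proof (rule refl_arr_eq[OF Dh[OF J.comp_hom[OF v u]] jk(1)[OF u] jk(2)[OF v]])
  note hu = refl_arr[OF Dh[OF u] jk[OF u]] and hv = refl_arr[OF Dh[OF v] jk[OF v]]
  note ej = e[OF jk(1)[OF u]] and ek = e[OF jk(1)[OF v]] and el = e[OF jk(2)[OF v]]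
  show "refl_arr (ar D v) ** refl_arr (ar D u) \<in> hom C (refl_ob (ob D j)) (refl_ob (ob D l))" by (rule comp_hom[OF hv(1) hu(1)])
  have "ar D (Comp J v u) = pcomp (ar D v) (ar D u)" using D u v fullinD(4)[OF E] unfolding is_functor_def by metis
  thus "pcomp (yar (refl_arr (ar D v) ** refl_arr (ar D u))) (refl_unit (ob D j)) =
    pcomp (refl_unit (ob D l)) (ar D (Comp J v u))"
   using yar_comp[OF hv(1) hu(1)] Psh.assoc[OF yar_hom[OF hv(1)] yar_hom[OF hu(1)] ej] hu(2)
    Psh.assoc[OF yar_hom[OF hv(1)] ek Dh[OF u]] hv(2) Psh.assoc[OF el Dh[OF v] Dh[OF u]] by simp
 qed
 show ?thesis
  unfolding is_functor_def
 proof (intro conjI ballI allI)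
  show "category J" "category C" by (rule J.category, rule category)
  show "ob (comp_func reflector D) j \<in> Ob C" if "j \<in> Ob J" for j
   using lisoD(3)[OF refl_unit[OF R[OF that]]] by (simp add: comp_func_def reflector_def)
  show "ar (comp_func reflector D) (Id J j) = Id C (ob (comp_func reflector D) j)" if "j \<in> Ob J" for j
   using i[OF that] by (simp add: comp_func_def reflector_def)
  show "ar (comp_func reflector D) u \<in> hom C (ob (comp_func reflector D) j) (ob (comp_func reflector D) k)"
   if "u \<in> hom J j k" for j k u using refl_arr(1)[OF Dh[OF that] jk[OF that]] by (simp add: comp_func_def reflector_def)
  show "ar (comp_func reflector D) (Comp J v u) = ar (comp_func reflector D) v ** ar (comp_func reflector D) u"
   if "u \<in> hom J j k" "v \<in> hom J k l" for j k l u v using co[OF that] by (simp add: comp_func_def reflector_def)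
 qed
qed

lemma reflector_limit:
 assumes E: "fullin E" and J: "finite_category J" and D: "is_functor J E D" and L: "is_limit J E D P \<pi>"
  and R: "\<And>j. j \<in> Ob J ==> reflective (ob D j)"
 obtains m \<kappa> \<eta> where "is_limit J C (comp_func reflector D) m \<kappa>" "liso P m \<eta>"
  "\<And>j. j \<in> Ob J ==> pcomp (yar (\<kappa> j)) \<eta> = pcomp (refl_unit (ob D j)) (\<pi> j)"
proof -
 interpret J: cat J using D by (auto simp: is_functor_def cat_def)
 note F = reflector_functor[OF E D R]
 obtain m \<kappa> where CL: "is_limit J C (comp_func reflector D) m \<kappa>" using lex J F unfolding finitely_complete_def by blast
 have "liso (ob D j) (ob (comp_func reflector D) j) (refl_unit (ob D j))" if "j \<in> Ob J" for j
  using refl_unit[OF R[OF that]] by (simp add: comp_func_def reflector_def)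
 moreover have "pcomp (yar (ar (comp_func reflector D) u)) (refl_unit (ob D j)) = pcomp (refl_unit (ob D k)) (ar D u)"
  if u: "u \<in> hom J j k" for u j k
 proof -
  have "ar D u \<in> phom (ob D j) (ob D k)" using fullin_hom(3)[OF E] D u by (auto simp: is_functor_def)
  moreover have "reflective (ob D j)" "reflective (ob D k)" using R J.hom_ob[OF u] by auto
  ultimately show ?thesis using refl_arr(2) by (simp add: comp_func_def reflector_def)
 qed
 ultimately obtain \<eta> where "liso P m \<eta>" "\<And>j. j \<in> Ob J ==> pcomp (yar (\<kappa> j)) \<eta> = pcomp (refl_unit (ob D j)) (\<pi> j)"
  using liso_limit[OF E J D L _ F _ CL, of "\<lambda>j. refl_unit (ob D j)"] by blast
 thus ?thesis by (rule that[OF CL])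
qed

lemma reflective_iso:
 assumes i: "isomorphic (small_psh C) P Q"
 shows "reflective P \<longleftrightarrow> reflective Q"
proof -
 obtain f where f: "f \<in> hom (small_psh C) P Q" "is_iso (small_psh C) f" using i by (auto simp: isomorphic_def)
 note fh = fullin_hom[OF fullin_small f(1)]
 have fi: "is_iso (psh C) f" using fullin_iso[OF fullin_small fh(1,2,3)] f(2) by simp
 obtain g where g: "g \<in> phom Q P" "pcomp g f = Id (psh C) P" "pcomp f g = Id (psh C) Q"
  using Psh.isoD[OF fi fh(3)] by blast
 have gi: "is_iso (psh C) g" by (rule Psh.isoI[OF g(1) fh(3) g(3,2)])
 show ?thesis using liso_iso[OF _ fh(3) fi] liso_iso[OF _ g(1) gi] unfolding reflective_def by blast
qed

lemma Phi_l_reflective: "P \<in> Phi_l_obs weights_coh C ==> reflective P"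
proof (induction rule: Phi_l_obs.induct)
 case (repr c)
 thus ?case using liso_rep unfolding reflective_def by blast
next
 case (replete P Q)
 thus ?case using reflective_iso by blast
next
 case (finite_limit J D P \<pi>)
 obtain m \<kappa> \<eta> where "liso P m \<eta>"
  by (rule reflector_limit[OF fullin_small finite_limit.hyps(1,2,4) finite_limit.IH])
 thus ?case unfolding reflective_def by blast
next
 case (lex_colimit K \<phi> D P \<gamma>)
 note lw = weights_coh_lex[OF U lex_colimit.hyps(1)]
 have K: "small_category K" "finitely_complete K" "\<phi> \<in> Ob (psh K)" using lw by (auto simp: lex_weight_def)
 obtain y T x where G: "gen_by K \<phi> y T x" using weights_coh_gen_by[OF U lex_colimit.hyps(1)] by blast
 have D: "is_functor K (small_psh C) D" "preserves_finite_limits K (small_psh C) D" using lex_colimit.hyps(2) by (auto simp: lex_functor_def)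
 have Kc: "category K" using K(1) by (simp add: small_category_def)
 interpret K: cat K by (rule cat.intro) (rule Kc)
 let ?I = "img (ob D y) (ar D ` T)"
 obtain \<delta> where wc: "is_weighted_colimit K \<phi> (small_psh C) D ?I \<delta>"
  using img_weighted_colimit[OF K(2,3) G D] by blast
 have i: "isomorphic (small_psh C) P ?I"
  by (rule weighted_colimit_unique[OF fullinD(1)[OF fullin_small] lex_colimit.hyps(4) wc Kc D(1)])
 have th: "ar D t \<in> phom (ob D (Dom K t)) (ob D y)" "Dom K t \<in> Ob K" if "t \<in> T" for t
  using fullin_hom(3)[OF fullin_small] D(1) gen_byD(3)[OF G that] K.hom_ob[OF gen_byD(3)[OF G that]] by (auto simp: is_functor_def)
 have dom: "Dom (psh C) (ar D t) = ob D (Dom K t)" if "t \<in> T" for t by (rule psh_hom(3)[OF th(1)[OF that]])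
 note y = gen_byD(2)[OF G]
 note ly = refl_unit[OF lex_colimit.IH[OF y]]
 have into: "into (ob D y) (ar D ` T)" unfolding into_def using th(1) dom lisoD(4)[OF ly] by simp
 have "\<exists>M \<eta>. liso ?I M \<eta>"
 proof (rule liso_img[OF into finite_imageI[OF gen_byD(1)[OF G]] ly])
  fix \<alpha> assume "\<alpha> \<in> ar D ` T"
  then obtain t where t: "t \<in> T" "\<alpha> = ar D t" by blast
  show "liso (Dom (psh C) \<alpha>) (refl_ob (Dom (psh C) \<alpha>)) (refl_unit (Dom (psh C) \<alpha>))"
   unfolding t(2) dom[OF t(1)] by (rule refl_unit[OF lex_colimit.IH[OF th(2)[OF t(1)]]])
 qed
 thus ?case using reflective_iso[OF i] unfolding reflective_def by blast
qed

lemma reflector_preserves: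
 assumes E: "fullin E" and R: "\<And>P. P \<in> Ob E ==> reflective P"
 shows "preserves_finite_limits E C reflector"
 unfolding preserves_finite_limits_def
proof (intro allI impI, elim conjE)
 fix J :: "(nat, nat) cat" and D P \<pi>
 assume J: "finite_category J" and D: "is_functor J E D" and L: "is_limit J E D P \<pi>"
 interpret J: cat J using D by (auto simp: is_functor_def cat_def)
 have RD: "reflective (ob D j)" if "j \<in> Ob J" for j using R D that by (auto simp: is_functor_def)
 have RP: "reflective P" using R L by (auto simp: is_limit_def is_cone_def)
 have pE: "\<And>j. j \<in> Ob J ==> \<pi> j \<in> hom E P (ob D j)" using L by (auto simp: is_limit_def is_cone_def)
 note ph = fullin_hom(3)[OF E pE]
 let ?F = "comp_func reflector D"
 note F = reflector_functor[OF E D RD]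
 obtain m \<kappa> \<eta> where CL: "is_limit J C ?F m \<kappa>" and l: "liso P m \<eta>"
  and \<eta>: "\<And>j. j \<in> Ob J ==> pcomp (yar (\<kappa> j)) \<eta> = pcomp (refl_unit (ob D j)) (\<pi> j)"
  by (rule reflector_limit[OF E J D L RD]) blast+
 note lP = refl_unit[OF RP]
 let ?l = "refl_ob P"
 obtain k where k: "k \<in> hom C ?l m" "pcomp (yar k) (refl_unit P) = \<eta>" by (rule liso_univ[OF lP lisoD(1)[OF l] lisoD(3)[OF l]])
 obtain k' where k': "k' \<in> hom C m ?l" "pcomp (yar k') \<eta> = refl_unit P" by (rule liso_univ[OF l lisoD(1)[OF lP] lisoD(3)[OF lP]])
 have kk': "k ** k' = Id C m"
  by (rule liso_ext[OF l comp_hom[OF k(1) k'(1)] id_hom[OF lisoD(3)[OF l]]])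
   (simp add: yar_comp[OF k(1) k'(1)] Psh.assoc[OF yar_hom[OF k(1)] yar_hom[OF k'(1)] lisoD(1)[OF l]] k(2) k'(2) yar_id[OF lisoD(3)[OF l]] Psh.id_left[OF lisoD(1)[OF l]])
 have k'k: "k' ** k = Id C ?l"
  by (rule liso_ext[OF lP comp_hom[OF k'(1) k(1)] id_hom[OF lisoD(3)[OF lP]]])
   (simp add: yar_comp[OF k'(1) k(1)] Psh.assoc[OF yar_hom[OF k'(1)] yar_hom[OF k(1)] lisoD(1)[OF lP]] k(2) k'(2) yar_id[OF lisoD(3)[OF lP]] Psh.id_left[OF lisoD(1)[OF lP]])
 have mh: "\<And>j. j \<in> Ob J ==> \<kappa> j \<in> hom C m (ob ?F j)" and mc: "\<And>j k u. u \<in> hom J j k ==> ar ?F u ** \<kappa> j = \<kappa> k"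
  using CL by (auto simp: is_limit_def is_cone_def)
 have pk: "refl_arr (\<pi> j) = \<kappa> j ** k" if j: "j \<in> Ob J" for j
 proof (rule refl_arr_eq[OF ph[OF j] RP RD[OF j]])
  have \<kappa>h: "\<kappa> j \<in> hom C m (refl_ob (ob D j))" using mh[OF j] by (simp add: comp_func_def reflector_def)
  show "\<kappa> j ** k \<in> hom C ?l (refl_ob (ob D j))" by (rule comp_hom[OF \<kappa>h k(1)])
  show "pcomp (yar (\<kappa> j ** k)) (refl_unit P) = pcomp (refl_unit (ob D j)) (\<pi> j)"
   using yar_comp[OF \<kappa>h k(1)] Psh.assoc[OF yar_hom[OF \<kappa>h] yar_hom[OF k(1)] lisoD(1)[OF lP]] k(2) \<eta>[OF j] by simp
 qed
 have Fu: "ar ?F u \<in> hom C (ob ?F i) (ob ?F j)" if "u \<in> hom J i j" for u i j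
  using F that unfolding is_functor_def by blast
 have "is_limit J C ?F ?l (\<lambda>j. refl_arr (\<pi> j))"
  unfolding is_limit_def
 proof (intro conjI allI impI)
  show "is_cone J C ?F ?l (\<lambda>j. refl_arr (\<pi> j))"
   unfolding is_cone_def
  proof (intro conjI ballI allI)
   show "?l \<in> Ob C" by (rule lisoD(3)[OF lP])
   show "refl_arr (\<pi> j) \<in> hom C ?l (ob ?F j)" if "j \<in> Ob J" for j unfolding pk[OF that] by (rule comp_hom[OF mh[OF that] k(1)])
   fix i j u assume u: "u \<in> hom J i j"
   have ij: "i \<in> Ob J" "j \<in> Ob J" using J.hom_ob[OF u] by auto
   show "ar ?F u ** refl_arr (\<pi> i) = refl_arr (\<pi> j)"
    unfolding pk[OF ij(1)] pk[OF ij(2)] using assoc[OF Fu[OF u] mh[OF ij(1)] k(1)] mc[OF u] by simp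
  qed
  fix n \<rho> assume c: "is_cone J C ?F n \<rho>"
  obtain h where h: "h \<in> hom C n m" "\<forall>j\<in>Ob J. \<kappa> j ** h = \<rho> j" using CL c unfolding is_limit_def by blast
  show "\<exists>!h. h \<in> hom C n ?l \<and> (\<forall>j\<in>Ob J. refl_arr (\<pi> j) ** h = \<rho> j)"
  proof (rule ex1I[of _ "k' ** h"], intro conjI ballI)
   note kh = comp_hom[OF k'(1) h(1)]
   show "k' ** h \<in> hom C n ?l" by (rule kh)
   have kkh: "k ** (k' ** h) = h" using assoc[OF k(1) k'(1) h(1)] kk' id_left[OF h(1)] by simp
   show "refl_arr (\<pi> j) ** (k' ** h) = \<rho> j" if j: "j \<in> Ob J" for j
    unfolding pk[OF j] using assoc[OF mh[OF j] k(1) kh] kkh h(2) j by simp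
   fix g assume g: "g \<in> hom C n ?l \<and> (\<forall>j\<in>Ob J. refl_arr (\<pi> j) ** g = \<rho> j)"
   note gh = conjunct1[OF g]
   have "k ** g = h"
   proof (rule limit_ext[OF F CL comp_hom[OF k(1) gh] h(1)])
    fix j assume j: "j \<in> Ob J"
    have "\<kappa> j ** (k ** g) = refl_arr (\<pi> j) ** g" unfolding pk[OF j] by (rule assoc[OF mh[OF j] k(1) gh, symmetric])
    thus "\<kappa> j ** (k ** g) = \<kappa> j ** h" using g h(2) j by simp
   qed
   thus "g = k' ** h" using assoc[OF k'(1) k(1) gh] k'k id_left[OF gh] by simp
  qed
 qed
 thus "is_limit J C ?F (ob reflector P) (\<lambda>j. ar reflector (\<pi> j))" by (simp add: reflector_def)
qed

lemma reflector_adjoint: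
 assumes E: "fullin E" and R: "\<And>P. P \<in> Ob E ==> reflective P"
 shows "left_adjoint E C reflector (yoneda C)"
proof -
 interpret E: cat E by (rule cat.intro) (rule fullinD[OF E])
 let ?\<theta> = "\<lambda>P (Z :: 'o) h. pcomp (yar h) (refl_unit P)"
 have idf: "is_functor E E id_func" using E.category E.id_hom E.id_left E.id_right by (auto simp: is_functor_def id_func_def)
 have "is_functor E C (comp_func reflector id_func)" by (rule reflector_functor[OF E idf]) (simp add: id_func_def R)
 hence LF: "is_functor E C reflector" by (simp add: comp_func_def id_func_def reflector_def)
 have bij: "bij_betw (?\<theta> P Z) (hom C (refl_ob P) Z) (hom E P (rep Z))" if P: "P \<in> Ob E" and Z: "Z \<in> Ob C" for P Z
 proof -
  note l = refl_unit[OF R[OF P]]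
  have hE: "hom E P (rep Z) = phom P (rep Z)" by (rule fullinD(3)[OF E P fullinD(8)[OF E Z]])
  show ?thesis
   unfolding bij_betw_def hE
  proof (intro conjI)
   show "inj_on (?\<theta> P Z) (hom C (refl_ob P) Z)" by (rule inj_onI) (rule liso_ext[OF l])
   show "?\<theta> P Z ` hom C (refl_ob P) Z = phom P (rep Z)"
   proof (intro equalityI subsetI)
    fix b assume "b \<in> ?\<theta> P Z ` hom C (refl_ob P) Z"
    then obtain h where h: "b = ?\<theta> P Z h" "h \<in> hom C (refl_ob P) Z" by (rule imageE)
    show "b \<in> phom P (rep Z)" unfolding h(1) by (rule Psh.comp_hom[OF yar_hom[OF h(2)] lisoD(1)[OF l]])
   next
    fix b assume b: "b \<in> phom P (rep Z)"
    obtain h where h: "h \<in> hom C (refl_ob P) Z" "?\<theta> P Z h = b" by (rule liso_univ[OF l b Z])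
    show "b \<in> ?\<theta> P Z ` hom C (refl_ob P) Z" unfolding h(2)[symmetric] by (rule imageI[OF h(1)])
   qed
  qed
 qed
 have nat: "?\<theta> P' Z' (g ** (h ** refl_arr f)) = pcomp (yar g) (pcomp (?\<theta> P Z h) f)"
  if f: "f \<in> hom E P' P" and g: "g \<in> hom C Z Z'" and h: "h \<in> hom C (refl_ob P) Z" for P P' Z Z' f g h
 proof -
  note PP = fullin_hom[OF E f]
  note r = refl_arr[OF PP(3) R[OF PP(1)] R[OF PP(2)]] and e' = lisoD(1)[OF refl_unit[OF R[OF PP(1)]]] and e = lisoD(1)[OF refl_unit[OF R[OF PP(2)]]]
  note hr = comp_hom[OF h r(1)]
  show ?thesis
   using yar_comp[OF g hr] yar_comp[OF h r(1)] Psh.assoc[OF yar_hom[OF g] yar_hom[OF hr] e'] Psh.assoc[OF yar_hom[OF h] yar_hom[OF r(1)] e']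
    r(2) Psh.assoc[OF yar_hom[OF h] e PP(3)] by simp
 qed
 have "is_adjunction E C reflector (yoneda C) ?\<theta>"
  unfolding is_adjunction_def
 proof (intro conjI ballI allI)
  show "is_functor E C reflector" by (rule LF)
  show "is_functor C E (yoneda C)" by (rule yoneda_functor_in[OF E])
  show "bij_betw (?\<theta> P Z) (hom C (ob reflector P) Z) (hom E P (ob (yoneda C) Z))" if "P \<in> Ob E" "Z \<in> Ob C" for P Z
   using bij[OF that] by (simp add: reflector_def yoneda_def)
  show "?\<theta> P' Z' (g ** (h ** ar reflector f)) = Comp E (yar g) (Comp E (?\<theta> P Z h) f)"
   if "f \<in> hom E P' P" "g \<in> hom C Z Z'" "h \<in> hom C (ob reflector P) Z" for P P' Z Z' f g h
   using nat[OF that(1,2)] that(3) fullinD(4)[OF E] by (simp add: reflector_def)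
 qed
 thus ?thesis unfolding left_adjoint_def by blast
qed

lemma coherent_imp_exact: "Phi_exact weights_coh C"
proof -
 have R: "reflective P" if "P \<in> Ob (Phi_l weights_coh C)" for P using Phi_l_reflective that Phi_l_ob by blast
 show ?thesis
  unfolding Phi_exact_def using lex reflector_adjoint[OF fullin_Phi_l R] reflector_preserves[OF fullin_Phi_l R] by blast
qed

end

theorem mainTheorem8:
  fixes C :: "('o, 'u) cat"
  assumes "universe TYPE('u)"
    and "category C" and "locally_small C" and "finitely_complete C"
  shows "Phi_exact weights_coh C \<longleftrightarrow> coherent_category C"
proof -
 interpret lexp C using assms by unfold_locales
 show ?thesis
 proof
  show "coherent_category C" if "Phi_exact weights_coh C" by (rule exact_imp_coherent[OF that])
  assume "coherent_category C"
  then interpret coh C by unfold_locales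
  show "Phi_exact weights_coh C" by (rule coherent_imp_exact)
 qed
qed

end
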